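(* There exists a constant $c_s>0$, independent of $h$, such that for every triangulation $\mathcal{T}_h$ of the family and every $v_h\in V_h^k$, $$c_s\,\|v_h\|_{1,h}\le \sup_{w_h\in V_h^k\setminus\{0\}}\frac{a_h(v_h,w_h)}{\|w_h\|_{1,h}}.$$
   Context: $\Omega\subset\mathbb{R}^2$ is a bounded domain with polygonal boundary $\partial\Omega=\cup_i\Gamma_i$, where the $\Gamma_i$ are the faces (sides) of the polygon; $n$ is the outward unit normal. $\{\mathcal{T}_h\}$ is a family of quasi-uniform, shape regular triangulations fitted to $\Omega$, with $h_K=\mathrm{diam}(K)$ for a triangle $K\in\mathcal{T}_h$, $h=\max_{K}h_K$, and $h_K/\rho_K\le c_\rho$ for all $K\in\mathcal{T}_h$ with $c_\rho$ fixed for the family ($\rho_K$ is the radius of the largest ball inscribed in $K$). For all $i$, $\Gamma_i$ contains no fewer than five element faces. $k\ge 1$ is a fixed integer, and $V_h^k=\{v_h\in H^1(\Omega): v_h|_K\in\mathbb{P}_k(K)\ \forall K\in\mathcal{T}_h\}$, with $\mathbb{P}_k(K)$ the polynomials of degree at most $k$ on $K$. $(\cdot,\cdot)_\Omega$ and $\langle\cdot,\cdot\rangle_{\partial\Omega}$ are the $L^2$ scalar products over $\Omega$ and $\partial\Omega$, and $\|\cdot\|=\|\cdot\|_{L^2(\Omega)}$. The (penalty free non-symmetric Nitsche) bilinear form is $$a_h(u,v)=(\nabla u,\nabla v)_\Omega-\langle\nabla u\cdot n,v\rangle_{\partial\Omega}+\langle u,\nabla v\cdot n\rangle_{\partial\Omega}.$$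 The norm is $\|v\|_{1,h}^2=\|\nabla v\|^2+\|v\|_{\frac12,h,\partial\Omega}^2$, where $\|v\|_{\frac12,h,\partial\Omega}^2=\sum_{K}h_K^{-1}\|v\|_{L^2(\partial\Omega\cap\partial K)}^2$. *)

theory Defs
  imports "HOL-Analysis.Analysis"
begin

type_synonym point = "real^2"

definition side :: "point list \<Rightarrow> nat \<Rightarrow> point set" where
  "side vs i = closed_segment (vs ! i) (vs ! (Suc i mod length vs))"

definition side_ends :: "point list \<Rightarrow> nat \<Rightarrow> point set" where
  "side_ends vs i = {vs ! i, vs ! (Suc i mod length vs)}"

text \<open>A polygon is a simple closed polygonal curve, given by the cyclic list of its vertices:
  distinct sides meet at most in a common end point.  Vertices with a straight angle are
  tolerated.\<close>

definition simple_polygon :: "point list \<Rightarrow> bool" where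
  "simple_polygon vs \<longleftrightarrow>
     length vs \<ge> 3 \<and> distinct vs \<and>
     (\<forall>i<length vs. \<forall>j<length vs. i \<noteq> j \<longrightarrow>
        side vs i \<inter> side vs j \<subseteq> side_ends vs i \<inter> side_ends vs j)"

definition polygonal_domain :: "point list \<Rightarrow> point set \<Rightarrow> bool" where
  "polygonal_domain vs \<Omega> \<longleftrightarrow>
     simple_polygon vs \<and> open \<Omega> \<and> connected \<Omega> \<and> bounded \<Omega> \<and>
     frontier \<Omega> = (\<Union>i<length vs. side vs i)"

text \<open>The outward unit normal is the unit vector \<open>\<nu>\<close> such that, near \<open>x\<close>, \<open>\<Omega>\<close> is the half plane
  through \<open>x\<close> with outer direction \<open>\<nu>\<close>.  It exists and is unique at every boundary point except
  the (finitely many) corners, where the value is irrelevant.\<close>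

definition outer_normal :: "point set \<Rightarrow> point \<Rightarrow> point" where
  "outer_normal \<Omega> x = (THE \<nu>. norm \<nu> = 1 \<and>
     (\<exists>\<epsilon>>0. \<forall>y\<in>ball x \<epsilon>. y \<in> \<Omega> \<longleftrightarrow> (y - x) \<bullet> \<nu> < 0))"

text \<open>Integral over the closed polygonal curve with respect to arc length.\<close>

definition boundary_integral :: "point list \<Rightarrow> (point \<Rightarrow> real) \<Rightarrow> real" where
  "boundary_integral vs f = (\<Sum>i<length vs.
     let a = vs ! i; b = vs ! (Suc i mod length vs)
     in dist a b * (LINT t:{0..1}|lborel. f (linepath a b t)))"

definition fitted_triangulation :: "point set \<Rightarrow> point set set \<Rightarrow> bool" where
  "fitted_triangulation \<Omega> \<T> \<longleftrightarrow>
     triangulation \<T> \<and> (\<forall>K\<in>\<T>. 2 simplex K) \<and> \<Union>\<T> = closure \<Omega>"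

definition inradius :: "point set \<Rightarrow> real" where
  "inradius K = Sup {r. r > 0 \<and> (\<exists>x. ball x r \<subseteq> K)}"

definition mesh_size :: "point set set \<Rightarrow> real" where
  "mesh_size \<T> = Max (diameter ` \<T>)"

definition shape_regular :: "real \<Rightarrow> point set set \<Rightarrow> bool" where
  "shape_regular c \<T> \<longleftrightarrow> (\<forall>K\<in>\<T>. diameter K / inradius K \<le> c)"

definition quasi_uniform :: "real \<Rightarrow> point set set \<Rightarrow> bool" where
  "quasi_uniform c \<T> \<longleftrightarrow> (\<forall>K\<in>\<T>. mesh_size \<T> \<le> c * diameter K)"

definition element_faces_in :: "point set set \<Rightarrow> point set \<Rightarrow> point set set" where
  "element_faces_in \<T> \<Gamma> = {F. F \<subseteq> \<Gamma> \<and> (\<exists>K\<in>\<T>. F facet_of K)}"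

text \<open>Elements of \<open>L\<^sup>2(\<Omega>)\<close> and \<open>H\<^sup>1(\<Omega>)\<close> are represented by functions on the plane; two functions
  that agree almost everywhere on \<open>\<Omega>\<close> represent the same element.\<close>

definition L2 :: "point set \<Rightarrow> (point \<Rightarrow> 'a::euclidean_space) set" where
  "L2 \<Omega> = {f. f \<in> borel_measurable (lebesgue_on \<Omega>) \<and>
              integrable (lebesgue_on \<Omega>) (\<lambda>x. (norm (f x))\<^sup>2)}"

definition L2_inner ::
    "point set \<Rightarrow> (point \<Rightarrow> 'a::euclidean_space) \<Rightarrow> (point \<Rightarrow> 'a) \<Rightarrow> real" where
  "L2_inner \<Omega> f g = (LINT x|lebesgue_on \<Omega>. f x \<bullet> g x)"

text \<open>\<open>\<phi> \<in> C\<^sub>c\<^sup>1(\<Omega>)\<close> with gradient \<open>D\<phi>\<close>.\<close>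

definition test_function :: "point set \<Rightarrow> (point \<Rightarrow> real) \<Rightarrow> (point \<Rightarrow> point) \<Rightarrow> bool" where
  "test_function \<Omega> \<phi> D\<phi> \<longleftrightarrow>
     (\<forall>x. GDERIV \<phi> x :> D\<phi> x) \<and> continuous_on UNIV D\<phi> \<and>
     compact (closure {x. \<phi> x \<noteq> 0}) \<and> closure {x. \<phi> x \<noteq> 0} \<subseteq> \<Omega>"

definition weak_gradient :: "point set \<Rightarrow> (point \<Rightarrow> real) \<Rightarrow> (point \<Rightarrow> point) \<Rightarrow> bool" where
  "weak_gradient \<Omega> v g \<longleftrightarrow> (\<forall>\<phi> D\<phi>. test_function \<Omega> \<phi> D\<phi> \<longrightarrow>
     (LINT x|lebesgue_on \<Omega>. v x *\<^sub>R D\<phi> x) = - (LINT x|lebesgue_on \<Omega>. \<phi> x *\<^sub>R g x))"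

definition H1 :: "point set \<Rightarrow> (point \<Rightarrow> real) set" where
  "H1 \<Omega> = {v. v \<in> L2 \<Omega> \<and> (\<exists>g. g \<in> L2 \<Omega> \<and> weak_gradient \<Omega> v g)}"

text \<open>A representative of the weak gradient, which is unique up to null sets.\<close>

definition grad :: "point set \<Rightarrow> (point \<Rightarrow> real) \<Rightarrow> point \<Rightarrow> point" where
  "grad \<Omega> v = (SOME g. g \<in> L2 \<Omega> \<and> weak_gradient \<Omega> v g)"

definition polys :: "nat \<Rightarrow> (point \<Rightarrow> real) set" where
  "polys k = {p. \<exists>c :: nat \<Rightarrow> nat \<Rightarrow> real.
     \<forall>x. p x = (\<Sum>i\<le>k. \<Sum>j\<le>k - i. c i j * (x $ 1) ^ i * (x $ 2) ^ j)}"

definition fe_space :: "point set \<Rightarrow> point set set \<Rightarrow> nat \<Rightarrow> (point \<Rightarrow> real) set" where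
  "fe_space \<Omega> \<T> k =
     {v \<in> H1 \<Omega>. \<forall>K\<in>\<T>. \<exists>p\<in>polys k. AE x in lebesgue_on K. v x = p x}"

definition nonzero_on :: "point set \<Rightarrow> (point \<Rightarrow> real) \<Rightarrow> bool" where
  "nonzero_on \<Omega> v \<longleftrightarrow> \<not> (AE x in lebesgue_on \<Omega>. v x = 0)"

text \<open>Functions in the finite element space are only given almost everywhere, so their boundary
  values and those of their gradients are taken from the polynomial that represents the function on
  the adjacent triangle (it is unique, because a triangle has nonempty interior).  The triangle
  containing a boundary point is unique except at the finitely many boundary nodes, which do not
  affect boundary integrals.\<close>

definition elem_poly :: "(point \<Rightarrow> real) \<Rightarrow> point set \<Rightarrow> point \<Rightarrow> real" where
  "elem_poly v K = (SOME p. (\<exists>k. p \<in> polys k) \<and> (AE x in lebesgue_on K. v x = p x))"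

definition elem_at :: "point set set \<Rightarrow> point \<Rightarrow> point set" where
  "elem_at \<T> x = (SOME K. K \<in> \<T> \<and> x \<in> K)"

definition fe_trace :: "point set set \<Rightarrow> (point \<Rightarrow> real) \<Rightarrow> point \<Rightarrow> real" where
  "fe_trace \<T> v x = elem_poly v (elem_at \<T> x) x"

definition fe_grad_trace :: "point set set \<Rightarrow> (point \<Rightarrow> real) \<Rightarrow> point \<Rightarrow> point" where
  "fe_grad_trace \<T> v x = (THE D. GDERIV (elem_poly v (elem_at \<T> x)) x :> D)"

definition nitsche_form ::
    "point list \<Rightarrow> point set \<Rightarrow> point set set \<Rightarrow> (point \<Rightarrow> real) \<Rightarrow> (point \<Rightarrow> real) \<Rightarrow> real" where
  "nitsche_form vs \<Omega> \<T> u v =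
     L2_inner \<Omega> (grad \<Omega> u) (grad \<Omega> v)
     - boundary_integral vs (\<lambda>x. (fe_grad_trace \<T> u x \<bullet> outer_normal \<Omega> x) * fe_trace \<T> v x)
     + boundary_integral vs (\<lambda>x. fe_trace \<T> u x * (fe_grad_trace \<T> v x \<bullet> outer_normal \<Omega> x))"

definition half_norm_sq :: "point list \<Rightarrow> point set set \<Rightarrow> (point \<Rightarrow> real) \<Rightarrow> real" where
  "half_norm_sq vs \<T> v = (\<Sum>K\<in>\<T>.
     inverse (diameter K) * boundary_integral vs (\<lambda>x. indicator (frontier K) x * (fe_trace \<T> v x)\<^sup>2))"

definition norm_1h ::
    "point list \<Rightarrow> point set \<Rightarrow> point set set \<Rightarrow> (point \<Rightarrow> real) \<Rightarrow> real" where
  "norm_1h vs \<Omega> \<T> v = sqrt (L2_inner \<Omega> (grad \<Omega> v) (grad \<Omega> v) + half_norm_sq vs \<T> v)"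

end

theory Submission
  imports Defs
begin

text \<open>Testing with \<open>v\<close> itself gives \<open>a(v, v) = \<parallel>\<nabla>v\<parallel>\<^sup>2\<close>, because the boundary terms cancel; it remains to
  control the trace. If a boundary edge has an interior opposite vertex \<open>z\<close>, the piecewise linear \<open>w\<close>
  with \<open>w(z) = - v(z)\<close> vanishes on the boundary, and the term \<open>\<langle>v, \<nabla>w \<bullet> n\<rangle>\<close> produces
  \<open>v(z)\<^sup>2\<close> up to multiples of \<open>\<parallel>\<nabla>v\<parallel>\<^sup>2\<close>. Along a chain of a bounded number of neighbouring triangles the
  oscillation of \<open>v\<close> is bounded by \<open>\<parallel>\<nabla>v\<parallel>\<close> through an inverse estimate, which transfers the control to
  the boundedly many boundary edges near corners whose opposite vertex lies on the boundary.

  On fine meshes such a chain exists by the geometry of the corners. On coarse meshes the number of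
  triangles is bounded, and a single good edge controls all others. If there is none at all, a minimal
  chord of the domain cuts off an ear, that is, a triangle with two boundary edges whose common vertex
  belongs to no other triangle; the hat function of that vertex then does the job, since its total
  flux through the two edges has a sign.\<close>

section \<open>Polynomials and the inverse estimate\<close>

text \<open>\<open>fe_space\<close> only speaks of weak derivatives. Before values can be passed
  from one triangle to the next, continuity across edges and at vertices has to be recovered from
  the existence of a weak gradient. The constant does not depend on h because every good edge is
  paid for by its own opposite vertex. Only the other edges borrow from elsewhere; area counting
  (\<open>elements_in_ball\<close>) bounds their number and the number of triangles through which
  they borrow. The inverse estimate comes from a vanishing finite difference along segments, not
  from a reference triangle; it has one explicit constant for all compact convex sets. The five
  faces per side exclude a mesh of a single triangle, all of whose edges would lie on the
  boundary.\<close>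

lemma alternating_binomial_poly_zero:
  fixes P :: "real poly"
  assumes "degree P < n"
  shows "(\<Sum>j\<le>n. (-1)^j * real (n choose j) * poly P (x + real j)) = 0"
  using assms
proof (induction n arbitrary: P x)
  case 0 then show ?case by simp
next
  case (Suc n)
  \<comment> \<open>Pascal's rule turns the sum of order n + 1 for P into minus the sum of order n
    for -Q, and the forward difference Q has smaller degree than P.\<close>
  define Q where "Q = P \<circ>\<^sub>p [:1,1:] - P"
  have Q: "poly Q y = poly P (y + 1) - poly P y" for y
    by (simp add: Q_def poly_pcompose add.commute)
  have split: "(\<Sum>j\<le>Suc n. (-1)^j * real (Suc n choose j) * poly P (x + real j))
      = (\<Sum>j\<le>n. (-1)^j * real (n choose j) * poly P (x + real j))
      - (\<Sum>j\<le>n. (-1)^j * real (n choose j) * poly P (x + 1 + real j))"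
  proof -
    have a: "(\<Sum>j\<le>Suc n. (-1)^j * real (Suc n choose j) * poly P (x + real j))
      = poly P x + (\<Sum>j\<le>n. (-1)^(Suc j) * real (Suc n choose Suc j) * poly P (x + real (Suc j)))"
      by (subst sum.atMost_Suc_shift) simp
    have b: "(\<Sum>j\<le>n. (-1)^(Suc j) * real (Suc n choose Suc j) * poly P (x + real (Suc j)))
      = (\<Sum>j\<le>n. (-1)^(Suc j) * real (n choose Suc j) * poly P (x + real (Suc j)))
       + (\<Sum>j\<le>n. (-1)^(Suc j) * real (n choose j) * poly P (x + real (Suc j)))"
      by (simp add: sum.distrib[symmetric] algebra_simps)
    have c: "poly P x + (\<Sum>j\<le>n. (-1)^(Suc j) * real (n choose Suc j) * poly P (x + real (Suc j)))
      = (\<Sum>j\<le>Suc n. (-1)^j * real (n choose j) * poly P (x + real j))"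
      by (subst sum.atMost_Suc_shift) simp
    have d: "(\<Sum>j\<le>n. (-1)^(Suc j) * real (n choose j) * poly P (x + real (Suc j)))
       = - (\<Sum>j\<le>n. (-1)^j * real (n choose j) * poly P (x + 1 + real j))"
      by (simp add: sum_negf[symmetric] algebra_simps)
    have e: "(\<Sum>j\<le>Suc n. (-1)^j * real (n choose j) * poly P (x + real j))
       = (\<Sum>j\<le>n. (-1)^j * real (n choose j) * poly P (x + real j))" by simp
    show ?thesis using a b c d e by linarith
  qed
  also have "\<dots> = - (\<Sum>j\<le>n. (-1)^j * real (n choose j) * poly Q (x + real j))"
    by (simp add: Q algebra_simps sum_subtractf)
  also have "\<dots> = 0"
  \<comment> \<open>A constant P is treated apart: its difference is 0, whose degree is again 0 and
    does not drop.\<close>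
  proof (cases "degree P = 0")
    case True
    then obtain c where "P = [:c:]" by (metis degree_eq_zeroE)
    then have "poly Q y = 0" for y by (simp add: Q)
    then show ?thesis by simp
  next
    case False
    have "degree Q < degree P"
    proof -
      have dd: "degree (P \<circ>\<^sub>p [:1,1:]) = degree P" by (simp add: degree_pcompose)
      have lc: "lead_coeff (P \<circ>\<^sub>p [:1,1:]) = lead_coeff P" by (simp add: lead_coeff_comp)
      have "coeff Q (degree P) = 0" using dd lc by (simp add: Q_def)
      moreover have "degree Q \<le> degree P" unfolding Q_def
        by (rule degree_diff_le) (simp_all add: dd)
      ultimately show ?thesis using False
        by (metis degree_0 leading_coeff_0_iff le_neq_implies_less neq0_conv)
    qed
    then have "degree Q < n" using Suc.prems by simp
    then show ?thesis using Suc.IH by simp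
  qed
  finally show ?case .
qed

lemma sum_in_polys:
  assumes "\<And>i. i \<in> I \<Longrightarrow> f i \<in> polys k" shows "(\<lambda>x. \<Sum>i\<in>I. f i x) \<in> polys k"
proof -
  have "\<forall>i\<in>I. \<exists>c. \<forall>x. f i x = (\<Sum>a\<le>k. \<Sum>b\<le>k - a. c a b * (x $ 1) ^ a * (x $ 2) ^ b)"
    using assms unfolding polys_def by fastforce
  from bchoice[OF this] obtain c where
    c: "\<And>i x. i \<in> I \<Longrightarrow> f i x = (\<Sum>a\<le>k. \<Sum>b\<le>k - a. c i a b * (x $ 1) ^ a * (x $ 2) ^ b)"
    by blast
  have "(\<Sum>i\<in>I. f i x) = (\<Sum>a\<le>k. \<Sum>b\<le>k - a. (\<Sum>i\<in>I. c i a b) * (x $ 1) ^ a * (x $ 2) ^ b)" for x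
  proof -
    have "(\<Sum>i\<in>I. f i x) = (\<Sum>i\<in>I. \<Sum>a\<le>k. \<Sum>b\<le>k - a. c i a b * (x $ 1) ^ a * (x $ 2) ^ b)"
      using c by (intro sum.cong) auto
    also have "\<dots> = (\<Sum>a\<le>k. \<Sum>i\<in>I. \<Sum>b\<le>k - a. c i a b * (x $ 1) ^ a * (x $ 2) ^ b)" by (rule sum.swap)
    also have "\<dots> = (\<Sum>a\<le>k. \<Sum>b\<le>k - a. \<Sum>i\<in>I. c i a b * (x $ 1) ^ a * (x $ 2) ^ b)"
      by (intro sum.cong refl sum.swap)
    finally show ?thesis by (simp add: sum_distrib_right)
  qed
  then show ?thesis unfolding polys_def by (intro CollectI exI[of _ "\<lambda>a b. \<Sum>i\<in>I. c i a b"]) auto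
qed

lemma scale_in_polys: "p \<in> polys k \<Longrightarrow> (\<lambda>x. r * p x) \<in> polys k"
proof -
  assume "p \<in> polys k"
  then obtain c where "\<And>x. p x = (\<Sum>a\<le>k. \<Sum>b\<le>k - a. c a b * (x $ 1) ^ a * (x $ 2) ^ b)" by (auto simp: polys_def)
  then show ?thesis unfolding polys_def
    by (intro CollectI exI[of _ "\<lambda>a b. r * c a b"]) (simp add: sum_distrib_left mult.assoc)
qed

lemma add_in_polys: "p \<in> polys k \<Longrightarrow> q \<in> polys k \<Longrightarrow> (\<lambda>x. p x + q x) \<in> polys k"
  using sum_in_polys[of "{0::nat,1}" "\<lambda>b. if b = 0 then p else q" k] by simp

lemma monom_in_polys:
  assumes "i + j \<le> k" shows "(\<lambda>x::point. (x $ 1) ^ i * (x $ 2) ^ j) \<in> polys k"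
proof -
  have "(\<Sum>a\<le>k. \<Sum>b\<le>k - a. (if a = i \<and> b = j then 1 else 0) * (x $ 1) ^ a * (x $ 2) ^ b) = (x $ 1) ^ i * (x $ 2) ^ j" for x :: point
  proof -
    have "(\<Sum>b\<le>k - a. (if a = i \<and> b = j then 1 else 0) * (x $ 1) ^ a * (x $ 2) ^ b)
       = (if a = i then (\<Sum>b\<le>k - a. if b = j then (x $ 1) ^ a * (x $ 2) ^ b else 0) else 0)" for a
    proof (cases "a = i")
      case True
      show ?thesis unfolding if_P[OF True] by (rule sum.cong[OF refl]) (simp add: True)
    qed simp
    then have "(\<Sum>a\<le>k. \<Sum>b\<le>k - a. (if a = i \<and> b = j then 1 else 0) * (x $ 1) ^ a * (x $ 2) ^ b)
       = (\<Sum>a\<le>k. if a = i then (\<Sum>b\<le>k - a. if b = j then (x $ 1) ^ a * (x $ 2) ^ b else 0) else 0)"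
      by simp
    also have "\<dots> = (\<Sum>b\<le>k - i. if b = j then (x $ 1) ^ i * (x $ 2) ^ b else 0)" using assms by simp
    also have "\<dots> = (x $ 1) ^ i * (x $ 2) ^ j" using assms by simp
    finally show ?thesis .
  qed
  then show ?thesis unfolding polys_def by (intro CollectI exI[of _ "\<lambda>a b. if a = i \<and> b = j then 1 else 0"]) simp
qed

lemma polys_mono:
  assumes "p \<in> polys k" "k \<le> m" shows "p \<in> polys m"
proof -
  obtain c where c: "p = (\<lambda>x. \<Sum>a\<le>k. \<Sum>b\<le>k - a. c a b * ((x $ 1) ^ a * (x $ 2) ^ b))"
    using assms by (auto simp: polys_def mult.assoc)
  show ?thesis unfolding c using assms(2)
    by (intro sum_in_polys scale_in_polys monom_in_polys) auto
qed

lemma const_in_polys: "(\<lambda>x. c) \<in> polys k"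
  using scale_in_polys[OF monom_in_polys[of 0 0 k], of c] by simp

lemma affine_in_polys:
  fixes g :: point assumes "k \<ge> 1" shows "(\<lambda>x. g \<bullet> x + c) \<in> polys k"
proof -
  have "(\<lambda>x. g$1 * ((x$1)^1*(x$2)^0) + g$2 * ((x$1)^0*(x$2)^1) + c) \<in> polys k"
    using assms by (intro add_in_polys scale_in_polys monom_in_polys const_in_polys) auto
  then show ?thesis by (simp add: inner_vec_def sum_2)
qed

lemma polys_on_line:
  assumes "p \<in> polys k"
  obtains P :: "real poly" where "degree P \<le> k" "\<And>t. p (x + t *\<^sub>R d) = poly P t"
proof -
  obtain c where c: "\<And>x. p x = (\<Sum>a\<le>k. \<Sum>b\<le>k - a. c a b * (x $ 1) ^ a * (x $ 2) ^ b)"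
    using assms by (auto simp: polys_def)
  define P where "P = (\<Sum>a\<le>k. \<Sum>b\<le>k - a. Polynomial.smult (c a b) ([:x$1, d$1:]^a * [:x$2, d$2:]^b))"
  have "degree P \<le> k" unfolding P_def
  proof (intro degree_sum_le finite_atMost)
    fix a b assume "a \<in> {..k}" "b \<in> {..k - a}"
    have "degree ([:x$1, d$1:]^a) \<le> a" "degree ([:x$2, d$2:]^b) \<le> b"
      using degree_power_le[of "[:x$1, d$1:]" a] degree_power_le[of "[:x$2, d$2:]" b]
      by (auto split: if_splits)
    then have "degree ([:x$1, d$1:]^a * [:x$2, d$2:]^b) \<le> a + b"
      by (meson add_mono degree_mult_le order_trans)
    then show "degree (Polynomial.smult (c a b) ([:x$1, d$1:]^a * [:x$2, d$2:]^b)) \<le> k"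
      using \<open>a \<in> {..k}\<close> \<open>b \<in> {..k - a}\<close> degree_smult_le[of "c a b" "[:x$1, d$1:]^a * [:x$2, d$2:]^b"] by auto
  qed
  moreover have "p (x + t *\<^sub>R d) = poly P t" for t
    by (simp add: c P_def poly_sum poly_mult poly_power mult.assoc algebra_simps)
  ultimately show ?thesis using that by blast
qed

text \<open>On the segment from x to z the difference of order k + 1 vanishes and gives the value at
  x from the values at k + 1 equidistant points. The power of 4 is the squared bound of the
  binomials, the factor k + 1 comes from Cauchy-Schwarz. Since x itself is no node, every node moves
  with z and can be averaged over z.\<close>

lemma polys_extrapolate:
  fixes x z :: point
  assumes "p \<in> polys k"
  shows "(p x)\<^sup>2 \<le> (real k + 1) * 4 ^ (k + 1) * (\<Sum>j=1..k+1. (p (x + (real j / (real k + 1)) *\<^sub>R (z - x)))\<^sup>2)"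
proof -
  define n where "n = k + 1"
  obtain P :: "real poly" where P: "degree P \<le> k" "\<And>t. p (x + t *\<^sub>R (z - x)) = poly P t"
    using polys_on_line[OF assms] by blast
  \<comment> \<open>Rescaling the line puts the nodes at the integers 0, ..., n.\<close>
  define Q where "Q = P \<circ>\<^sub>p [:0, 1 / real n:]"
  have Q: "poly Q t = p (x + (t / real n) *\<^sub>R (z - x))" for t
    by (simp add: Q_def poly_pcompose P(2))
  have "degree Q \<le> degree P" unfolding Q_def by (simp add: degree_pcompose)
  then have "degree Q < n" using P(1) n_def by simp
  from alternating_binomial_poly_zero[OF this, of 0]
  have "0 = (\<Sum>j\<le>n. (-1)^j * real (n choose j) * poly Q (real j))" by simp
  also have "\<dots> = poly Q 0 + (\<Sum>j=1..n. (-1)^j * real (n choose j) * poly Q (real j))"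
    by (simp add: atMost_atLeast0 sum.atLeast_Suc_atMost[of 0 n])
  finally have "p x = - (\<Sum>j=1..n. (-1)^j * real (n choose j) * poly Q (real j))" by (simp add: Q)
  then have "\<bar>p x\<bar> \<le> (\<Sum>j=1..n. \<bar>(-1)^j * real (n choose j) * poly Q (real j)\<bar>)" by simp
  also have "\<dots> \<le> (\<Sum>j=1..n. 2 ^ n * \<bar>poly Q (real j)\<bar>)"
  proof (intro sum_mono)
    fix j
    have "real (n choose j) \<le> 2 ^ n" by (metis binomial_le_pow2 of_nat_le_iff of_nat_numeral of_nat_power)
    then show "\<bar>(-1)^j * real (n choose j) * poly Q (real j)\<bar> \<le> 2 ^ n * \<bar>poly Q (real j)\<bar>"
      by (simp add: abs_mult mult_right_mono)
  qed
  finally have "\<bar>p x\<bar> \<le> 2 ^ n * (\<Sum>j=1..n. \<bar>poly Q (real j)\<bar>)" by (simp add: sum_distrib_left)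
  then have "(p x)\<^sup>2 \<le> (2 ^ n * (\<Sum>j=1..n. \<bar>poly Q (real j)\<bar>))\<^sup>2" by (metis abs_ge_zero power2_abs power_mono)
  also have "\<dots> = 4 ^ n * (\<Sum>j=1..n. 1 * \<bar>poly Q (real j)\<bar>)\<^sup>2"
  proof -
    have "((2::real) ^ n)\<^sup>2 = 4 ^ n" using power_mult[of "2::real" n 2] power_mult[of "2::real" 2 n] by (simp add: mult.commute)
    then show ?thesis by (simp add: power_mult_distrib)
  qed
  also have "\<dots> \<le> 4 ^ n * ((\<Sum>j=1..n. 1\<^sup>2) * (\<Sum>j=1..n. \<bar>poly Q (real j)\<bar>\<^sup>2))"
    by (intro mult_left_mono Cauchy_Schwarz_ineq_sum) simp
  finally show ?thesis by (simp add: n_def Q mult.assoc mult.left_commute add.commute)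
qed

lemma gderiv_component:
  fixes p :: "point \<Rightarrow> real"
  assumes "\<And>x. (p has_derivative (\<lambda>h. D x \<bullet> h)) (at x)"
  shows "GDERIV p x :> D x"
  using assms unfolding gderiv_def by (simp add: inner_commute)

lemma polys_gderiv:
  assumes "p \<in> polys k"
  obtains D where "\<And>x. GDERIV p x :> D x" "(\<lambda>x. D x $ 1) \<in> polys k" "(\<lambda>x. D x $ 2) \<in> polys k"
proof -
  obtain c where c: "p = (\<lambda>x. \<Sum>a\<le>k. \<Sum>b\<le>k - a. c a b * ((x $ 1) ^ a * (x $ 2) ^ b))"
    using assms by (auto simp: polys_def mult.assoc)
  define D1 :: "point \<Rightarrow> real" where "D1 x = (\<Sum>a\<le>k. \<Sum>b\<le>k - a. (c a b * real a) * ((x $ 1) ^ (a - 1) * (x $ 2) ^ b))" for x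
  define D2 :: "point \<Rightarrow> real" where "D2 x = (\<Sum>a\<le>k. \<Sum>b\<le>k - a. (c a b * real b) * ((x $ 1) ^ a * (x $ 2) ^ (b - 1)))" for x
  define D :: "point \<Rightarrow> point" where "D x = vector [D1 x, D2 x]" for x
  have "(p has_derivative (\<lambda>h. D x \<bullet> h)) (at x)" for x
    unfolding c
    by (auto intro!: derivative_eq_intros bounded_linear.has_derivative[OF bounded_linear_vec_nth] simp: fun_eq_iff D_def D1_def D2_def inner_vec_def sum_2 vector_2
        sum_distrib_right sum_distrib_left sum.distrib[symmetric] algebra_simps)
  moreover have "(\<lambda>x. D x $ 1) \<in> polys k"
    unfolding D_def vector_2 D1_def by (intro sum_in_polys scale_in_polys monom_in_polys) auto
  moreover have "(\<lambda>x. D x $ 2) \<in> polys k"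
    unfolding D_def vector_2 D2_def by (intro sum_in_polys scale_in_polys monom_in_polys) auto
  ultimately show ?thesis using that gderiv_component by blast
qed

lemma polys_continuous: "p \<in> polys k \<Longrightarrow> continuous_on A p"
  by (auto simp: polys_def fun_eq_iff[symmetric] intro!: continuous_intros)

text \<open>Seen from a point of U, the restriction of p to the line towards x has infinitely many
  roots, so it vanishes on the whole line.\<close>

lemma polys_zero:
  assumes "p \<in> polys k" "open U" "U \<noteq> {}" "\<And>x. x \<in> U \<Longrightarrow> p x = 0"
  shows "p x = 0"
proof -
  obtain y where y: "y \<in> U" using assms by auto
  obtain e where e: "e > 0" "ball y e \<subseteq> U" using assms y openE by metis
  obtain P :: "real poly" where P: "\<And>t. p (y + t *\<^sub>R (x - y)) = poly P t"
    using polys_on_line[OF assms(1)] by metis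
  \<comment> \<open>The summand 1 avoids a division by zero when x is y itself.\<close>
  define d where "d = e / (norm (x - y) + 1)"
  have d: "d > 0" unfolding d_def using e by (simp add: add_nonneg_pos)
  have "poly P t = 0" if "t \<in> {0<..<d}" for t
  proof -
    have "norm (t *\<^sub>R (x - y)) < e"
    proof -
      have "norm (t *\<^sub>R (x - y)) = t * norm (x - y)" using that by simp
      also have "\<dots> \<le> t * (norm (x - y) + 1)" using that by simp
      also have "\<dots> < d * (norm (x - y) + 1)" using that by (intro mult_strict_right_mono) (auto simp: add_nonneg_pos)
      also have "\<dots> = e" unfolding d_def using add_nonneg_pos[OF norm_ge_zero[of "x - y"] zero_less_one] by simp
      finally show ?thesis .
    qed
    then have "y + t *\<^sub>R (x - y) \<in> ball y e" by (simp add: dist_norm)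
    then show ?thesis using e assms(4) P by (metis subsetD)
  qed
  then have "{0<..<d} \<subseteq> {t. poly P t = 0}" by auto
  moreover have "infinite {0<..<d}" using d by (simp add: infinite_Ioo)
  ultimately have "P = 0" using poly_roots_finite finite_subset by blast
  then show ?thesis using P[of 1] by simp
qed

section \<open>Averaging over a convex set: the inverse estimate\<close>

lemma integrable_on_compact:
  fixes f :: "'a::euclidean_space \<Rightarrow> 'b::euclidean_space"
  assumes "compact K" "continuous_on K f"
  shows "integrable (lebesgue_on K) f"
proof -
  have i: "integrable lborel (\<lambda>x. indicator K x *\<^sub>R f x)"
    by (rule borel_integrable_compact[OF assms])
  then have "integrable lebesgue (\<lambda>x. indicator K x *\<^sub>R f x)"
    by (subst integrable_completion) auto
  moreover have "K \<in> sets lebesgue" using assms by (simp add: lmeasurable_compact fmeasurableD)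
  ultimately show ?thesis by (simp add: integrable_restrict_space)
qed

text \<open>The homothety with centre x and ratio t maps the convex set K into itself with Jacobian
  t^2; since f is nonnegative, its integral over the image is at most the one over K.\<close>

lemma scaled_integral_le:
  fixes f :: "point \<Rightarrow> real"
  assumes K: "convex K" "compact K" and f: "continuous_on UNIV f" "\<And>x. 0 \<le> f x" and x: "x \<in> K" and t: "0 < t" "t \<le> 1"
  shows "(LINT z|lebesgue_on K. f (x + t *\<^sub>R (z - x))) \<le> (1 / t\<^sup>2) * (LINT z|lebesgue_on K. f z)"
proof -
  have Km: "K \<in> sets borel" using K by (simp add: compact_imp_closed)
  have Kl: "K \<in> sets lebesgue" using Km by simp
  define F where "F z = indicator K z * f z" for z
  have Fm: "F \<in> borel_measurable borel" unfolding F_def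
    using Km f(1) by (intro borel_measurable_times borel_measurable_indicator) (auto intro: borel_measurable_continuous_onI)
  have Fi: "integrable lborel F"
    unfolding F_def using borel_integrable_compact[OF K(2), of f] continuous_on_subset[OF f(1)]
    by (simp add: set_integrable_def indicator_def mult.commute)
  define G where "G z = F ((x - t *\<^sub>R x) + t *\<^sub>R z)" for z
  have Gi: "integrable lborel G"
  proof -
    have "integrable (density (distr lborel borel (\<lambda>z. (x - t *\<^sub>R x) + t *\<^sub>R z)) (\<lambda>_. \<bar>t\<bar>^DIM(point))) F"
      using Fi lborel_affine[of t "x - t *\<^sub>R x"] t by simp
    then have "integrable (distr lborel borel (\<lambda>z. (x - t *\<^sub>R x) + t *\<^sub>R z)) (\<lambda>z. t\<^sup>2 * F z)"
      using t Fm by (subst (asm) integrable_density) auto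
    then have "integrable lborel (\<lambda>z. t\<^sup>2 * F ((x - t *\<^sub>R x) + t *\<^sub>R z))"
      using integrable_distr[of "\<lambda>z. (x - t *\<^sub>R x) + t *\<^sub>R z" lborel borel "\<lambda>z. t\<^sup>2 * F z"] by simp
    then show ?thesis using t unfolding G_def by simp
  qed
  have Gint: "(LINT z|lborel. G z) = (1 / t\<^sup>2) * (LINT z|lborel. F z)"
  proof -
    have "(LINT z|lborel. F z) = (LINT z|density (distr lborel borel (\<lambda>z. (x - t *\<^sub>R x) + t *\<^sub>R z)) (\<lambda>_. \<bar>t\<bar>^DIM(point)). F z)"
      using lborel_affine[of t "x - t *\<^sub>R x"] t by simp
    also have "\<dots> = (LINT z|distr lborel borel (\<lambda>z. (x - t *\<^sub>R x) + t *\<^sub>R z). t\<^sup>2 * F z)"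
      using t Fm by (subst integral_density) auto
    also have "\<dots> = (LINT z|lborel. t\<^sup>2 * G z)" unfolding G_def
      using Fm by (subst integral_distr) auto
    finally show ?thesis using t by simp
  qed
  have eq: "(LINT z|lebesgue_on K. h z) = (LINT z|lborel. indicator K z * h z)" if "continuous_on UNIV h" for h :: "point \<Rightarrow> real"
  proof -
    have m: "(\<lambda>z. indicator K z * h z) \<in> borel_measurable lborel"
      using Km borel_measurable_continuous_onI[OF that] by simp
    have "(LINT z|lebesgue_on K. h z) = (LINT z|lebesgue. indicator K z *\<^sub>R h z)"
      by (rule integral_restrict_space) (use Kl in auto)
    also have "\<dots> = (LINT z|lborel. indicator K z * h z)" using m by (simp add: integral_completion)
    finally show ?thesis .
  qed
  have cont: "continuous_on UNIV (\<lambda>z. f (x + t *\<^sub>R (z - x)))"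
    by (intro continuous_on_compose2[OF f(1)] continuous_intros) auto
  have le: "indicator K z * f (x + t *\<^sub>R (z - x)) \<le> G z" for z
  proof (cases "z \<in> K")
    case True
    have e: "x + t *\<^sub>R (z - x) = (1 - t) *\<^sub>R x + t *\<^sub>R z" "(x - t *\<^sub>R x) + t *\<^sub>R z = (1 - t) *\<^sub>R x + t *\<^sub>R z" by (simp_all add: algebra_simps)
    have "(1 - t) *\<^sub>R x + t *\<^sub>R z \<in> K" using K(1) x True t by (intro convexD) auto
    then show ?thesis unfolding G_def F_def e using True by simp
  qed (simp add: G_def F_def f)
  have "(LINT z|lebesgue_on K. f (x + t *\<^sub>R (z - x))) = (LINT z|lborel. indicator K z * f (x + t *\<^sub>R (z - x)))"
    by (rule eq[OF cont])
  also have "\<dots> \<le> (LINT z|lborel. G z)"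
  proof (intro integral_mono_AE' Gi)
    have "0 \<le> G z" for z unfolding G_def F_def using f by simp
    then show "AE z in lborel. 0 \<le> G z" by simp
  qed (simp add: le)
  also have "\<dots> = (1 / t\<^sup>2) * (LINT z|lebesgue_on K. f z)"
    unfolding Gint eq[OF f(1)] F_def ..
  finally show ?thesis .
qed

text \<open>One factor k + 1 and the power of 4 come from \<open>polys_extrapolate\<close>, another
  k + 1 from the number of nodes, and (k + 1)^2 from the worst Jacobian, at t = 1 / (k + 1).\<close>

definition inv_const :: "nat \<Rightarrow> real" where
  "inv_const k = (real k + 1) ^ 4 * 4 ^ (k + 1)"

lemma inv_const_pos: "inv_const k > 0" unfolding inv_const_def by (simp add: add_nonneg_pos)

text \<open>The extrapolation towards x is integrated over the far end z, and each node integral is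
  bounded by \<open>scaled_integral_le\<close>. The shape of K does not enter, so the constant is
  the same for all triangles.\<close>

lemma inverse_estimate:
  assumes p: "p \<in> polys k" and K: "convex K" "compact K" and x: "x \<in> K"
  shows "measure lebesgue K * (p x)\<^sup>2 \<le> inv_const k * (LINT z|lebesgue_on K. (p z)\<^sup>2)"
proof -
  have cp: "continuous_on UNIV (\<lambda>z. (p z)\<^sup>2)" using polys_continuous[OF p] by (intro continuous_intros)
  have Kl: "K \<in> lmeasurable" using K by (simp add: lmeasurable_compact)
  have int: "integrable (lebesgue_on K) h" if "continuous_on UNIV h" for h :: "point \<Rightarrow> real"
    using integrable_on_compact[OF K(2) continuous_on_subset[OF that]] by simp
  define I where "I = (LINT z|lebesgue_on K. (p z)\<^sup>2)"
  have I0: "I \<ge> 0" unfolding I_def by simp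
  define t where "t j = real j / (real k + 1)" for j :: nat
  have "measure lebesgue K * (p x)\<^sup>2 = (LINT z|lebesgue_on K. (p x)\<^sup>2)"
    using Kl by (simp add: fmeasurableD measure_restrict_space)
  also have "\<dots> \<le> (LINT z|lebesgue_on K. (real k + 1) * 4 ^ (k + 1) * (\<Sum>j=1..k+1. (p (x + t j *\<^sub>R (z - x)))\<^sup>2))"
    using polys_extrapolate[OF p, of x] unfolding t_def
    by (intro integral_mono int) (auto intro!: continuous_intros continuous_on_compose2[OF polys_continuous[OF p, of UNIV]])
  also have "\<dots> = (real k + 1) * 4 ^ (k + 1) * (\<Sum>j=1..k+1. (LINT z|lebesgue_on K. (p (x + t j *\<^sub>R (z - x)))\<^sup>2))"
  proof -
    have "(LINT z|lebesgue_on K. (\<Sum>j=1..k+1. (p (x + t j *\<^sub>R (z - x)))\<^sup>2))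
       = (\<Sum>j=1..k+1. (LINT z|lebesgue_on K. (p (x + t j *\<^sub>R (z - x)))\<^sup>2))"
      by (rule Bochner_Integration.integral_sum, rule int)
         (auto intro!: continuous_intros continuous_on_compose2[OF polys_continuous[OF p, of UNIV]])
    then show ?thesis by simp
  qed
  also have "\<dots> \<le> (real k + 1) * 4 ^ (k + 1) * (\<Sum>j=1..k+1. (real k + 1)\<^sup>2 * I)"
  proof (intro mult_left_mono sum_mono)
    fix j assume j: "j \<in> {1..k+1}"
    have t: "0 < t j" "t j \<le> 1" "1 / (t j)\<^sup>2 \<le> (real k + 1)\<^sup>2"
    proof -
      show "0 < t j" "t j \<le> 1" using j unfolding t_def by auto
      have "1 / t j = (real k + 1) / real j" unfolding t_def by simp
      also have "\<dots> \<le> real k + 1" using j by (simp add: divide_le_eq mult_le_cancel_left1)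
      finally have "(1 / t j)\<^sup>2 \<le> (real k + 1)\<^sup>2" using \<open>0 < t j\<close> by (intro power_mono) auto
      then show "1 / (t j)\<^sup>2 \<le> (real k + 1)\<^sup>2" by (simp add: power_divide)
    qed
    have "(LINT z|lebesgue_on K. (p (x + t j *\<^sub>R (z - x)))\<^sup>2) \<le> 1 / (t j)\<^sup>2 * I"
      unfolding I_def by (rule scaled_integral_le[OF K cp _ x t(1,2)]) simp
    also have "\<dots> \<le> (real k + 1)\<^sup>2 * I" using t I0 by (intro mult_right_mono)
    finally show "(LINT z|lebesgue_on K. (p (x + t j *\<^sub>R (z - x)))\<^sup>2) \<le> (real k + 1)\<^sup>2 * I" .
  qed (auto simp: add_nonneg_pos)
  also have "\<dots> = inv_const k * I" by (simp add: inv_const_def power2_eq_square power4_eq_xxxx algebra_simps)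
  finally show ?thesis unfolding I_def .
qed

section \<open>Triangles and barycentric coordinates\<close>

text \<open>The determinant of two plane vectors; \<open>cr (a - b) (c - b)\<close> is, up to sign,
  twice the area of the triangle a b c.\<close>

definition cr :: "point \<Rightarrow> point \<Rightarrow> real" where
  "cr u v = u $ 1 * v $ 2 - u $ 2 * v $ 1"

definition nondeg :: "point \<Rightarrow> point \<Rightarrow> point \<Rightarrow> bool" where
  "nondeg a b c \<longleftrightarrow> cr (a - b) (c - b) \<noteq> 0"

text \<open>The barycentric coordinate of the first argument, as an affine function on the whole
  plane; cyclic shifts of the arguments give the other two. It turns statements on triangles into
  sign conditions.\<close>

definition lam :: "point \<Rightarrow> point \<Rightarrow> point \<Rightarrow> point \<Rightarrow> real" where
  "lam a b c y = cr (y - b) (c - b) / cr (a - b) (c - b)"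

text \<open>The gradient of \<open>lam a b c\<close>: orthogonal to the edge [b, c], its length is
  the reciprocal of the height over that edge.\<close>

definition glam :: "point \<Rightarrow> point \<Rightarrow> point \<Rightarrow> point" where
  "glam a b c = vector [(c - b) $ 2 / cr (a - b) (c - b), - ((c - b) $ 1 / cr (a - b) (c - b))]"

lemma cr_cyc: "cr (b - c) (a - c) = cr (a - b) (c - b)"
  and cr_swap: "cr (a - c) (b - c) = - cr (a - b) (c - b)"
  by (simp_all add: cr_def algebra_simps)

lemma nondeg_cyc: "nondeg b c a \<longleftrightarrow> nondeg a b c"
  and nondeg_cyc2: "nondeg c a b \<longleftrightarrow> nondeg a b c"
  and nondeg_swap: "nondeg a c b \<longleftrightarrow> nondeg a b c"
  unfolding nondeg_def using cr_cyc[of b c a] cr_cyc[of a b c] cr_cyc[of c a b] cr_swap[of a c b] by simp_all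

lemma cr_self [simp]: "cr u u = 0" by (simp add: cr_def)

text \<open>Lagrange's identity: the squares of the determinant and of the inner product add up to
  the squared product of the norms.\<close>

lemma abs_cr_le: "\<bar>cr u v\<bar> \<le> norm u * norm v"
proof -
  have "(cr u v)\<^sup>2 + (u \<bullet> v)\<^sup>2 = (norm u * norm v)\<^sup>2"
    by (simp add: power_mult_distrib power2_norm_eq_inner inner_vec_def sum_2 cr_def) algebra
  then have "(cr u v)\<^sup>2 \<le> (norm u * norm v)\<^sup>2" by (metis le_add_same_cancel1 zero_le_power2)
  then show ?thesis by (simp add: abs_le_square_iff[symmetric])
qed

lemma glam_inner: "glam a b c \<bullet> h = cr h (c - b) / cr (a - b) (c - b)"
proof -
  have "(vector [v $ 2 / D, - (v $ 1 / D)] :: point) \<bullet> h = cr h v / D" for v D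
    by (simp add: inner_vec_def sum_2 vector_2 cr_def diff_divide_distrib algebra_simps)
  then show ?thesis unfolding glam_def .
qed

lemma lam_eq: "lam a b c y = glam a b c \<bullet> (y - b)"
  by (simp add: glam_inner lam_def)

lemma lam_diff: "lam a b c y = lam a b c x + glam a b c \<bullet> (y - x)"
  by (simp add: lam_eq inner_diff_right)

lemma lam_swap: "lam a c b y = lam a b c y"
proof -
  show ?thesis unfolding lam_def cr_swap[of a c b] cr_swap[of y c b] by simp
qed

lemma norm_glam: "norm (glam a b c) = norm (c - b) / \<bar>cr (a - b) (c - b)\<bar>"
proof -
  have "(norm (glam a b c))\<^sup>2 = (norm (c - b) / \<bar>cr (a - b) (c - b)\<bar>)\<^sup>2"
    by (simp add: power_divide power2_norm_eq_inner inner_vec_def sum_2 glam_def vector_2 add_divide_distrib flip: power2_eq_square)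
  then show ?thesis by simp
qed

lemma lam_vertex:
  assumes "nondeg a b c"
  shows "lam a b c a = 1" "lam a b c b = 0" "lam a b c c = 0"
  using assms by (simp_all add: lam_def nondeg_def) (simp add: cr_def)

lemma lam_sum:
  assumes "nondeg a b c"
  shows "lam a b c y + lam b c a y + lam c a b y = 1"
proof -
  let ?D = "cr (a - b) (c - b)"
  have "cr (y - b) (c - b) + cr (y - c) (a - c) + cr (y - a) (b - a) = ?D"
    by (simp add: cr_def algebra_simps)
  moreover have "cr (b - c) (a - c) = ?D" "cr (c - a) (b - a) = ?D" by (simp_all add: cr_def algebra_simps)
  ultimately show ?thesis using assms unfolding lam_def nondeg_def by (simp add: add_divide_distrib[symmetric])
qed

text \<open>Differentiates the partition of unity \<open>lam_sum\<close>. In the ear test it says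
  that the edge normals of a triangle, weighted by length, cancel.\<close>

lemma glam_sum:
  assumes "nondeg a b c"
  shows "glam a b c + glam b c a + glam c a b = 0"
proof -
  have "(glam a b c + glam b c a + glam c a b) \<bullet> h = 0" for h
    using lam_sum[OF assms, of h] lam_sum[OF assms, of 0]
      lam_diff[of a b c h 0] lam_diff[of b c a h 0] lam_diff[of c a b h 0]
    by (simp add: inner_add_left)
  then show ?thesis using inner_eq_zero_iff by blast
qed

lemma lam_repr:
  assumes "nondeg a b c"
  shows "y = lam a b c y *\<^sub>R a + lam b c a y *\<^sub>R b + lam c a b y *\<^sub>R c"
proof -
  let ?D = "cr (a - b) (c - b)"
  have D: "?D \<noteq> 0" "cr (b - c) (a - c) = ?D" "cr (c - a) (b - a) = ?D"
    using assms by (simp_all add: nondeg_def) (simp_all add: cr_def algebra_simps)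
  have "?D * y $ i = cr (y - b) (c - b) * a $ i + cr (y - c) (a - c) * b $ i + cr (y - a) (b - a) * c $ i" for i
    using exhaust_2[of i] by (auto simp: cr_def algebra_simps)
  then have "y $ i = (lam a b c y *\<^sub>R a + lam b c a y *\<^sub>R b + lam c a b y *\<^sub>R c) $ i" for i
    using D unfolding lam_def by (simp add: field_simps)
  then show ?thesis by (simp add: vec_eq_iff)
qed

lemma lam_combo:
  assumes "nondeg a b c" "u + v + w = 1"
  shows "lam a b c (u *\<^sub>R a + v *\<^sub>R b + w *\<^sub>R c) = u"
proof -
  have "cr (u *\<^sub>R a + v *\<^sub>R b + w *\<^sub>R c - b) (c - b) = u * cr (a - b) (c - b)"
  proof -
    have v: "v = 1 - u - w" using assms(2) by simp
    show ?thesis unfolding v by (simp add: cr_def algebra_simps)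
  qed
  then show ?thesis using assms(1) by (simp add: lam_def nondeg_def)
qed

lemma hull3_perm: "convex hull {b,c,a} = convex hull {a,b,c}" "convex hull {c,a,b} = convex hull {a,b,c}"
    "convex hull {a,c,b} = convex hull {a,b,c}" for a b c :: point
  by (simp_all add: insert_commute)

lemma in_tri_iff:
  assumes "nondeg a b c"
  shows "y \<in> convex hull {a,b,c} \<longleftrightarrow> 0 \<le> lam a b c y \<and> 0 \<le> lam b c a y \<and> 0 \<le> lam c a b y"
proof
  assume "y \<in> convex hull {a,b,c}"
  then obtain u v w where y: "0 \<le> u" "0 \<le> v" "0 \<le> w" "u + v + w = 1" "y = u *\<^sub>R a + v *\<^sub>R b + w *\<^sub>R c"
    by (auto simp: convex_hull_3)
  have "lam a b c y = u" unfolding y(5) by (rule lam_combo[OF assms y(4)])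
  moreover have "lam b c a y = v"
    using lam_combo[of b c a v w u] assms y(4) unfolding y(5) by (simp add: nondeg_cyc add_ac)
  moreover have "lam c a b y = w"
    using lam_combo[of c a b w u v] assms y(4) unfolding y(5) by (simp add: nondeg_cyc2 add_ac)
  ultimately show "0 \<le> lam a b c y \<and> 0 \<le> lam b c a y \<and> 0 \<le> lam c a b y" using y by simp
next
  assume "0 \<le> lam a b c y \<and> 0 \<le> lam b c a y \<and> 0 \<le> lam c a b y"
  then show "y \<in> convex hull {a,b,c}"
    unfolding convex_hull_3 using lam_sum[OF assms, of y] lam_repr[OF assms, of y] by blast
qed

lemma continuous_lam: "continuous_on A (lam a b c)"
  unfolding lam_eq[abs_def] by (intro continuous_intros)

lemma GDERIV_lam: "GDERIV (lam a b c) x :> glam a b c"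
  unfolding gderiv_def lam_eq[abs_def]
  by (auto intro!: derivative_eq_intros simp: inner_commute)

text \<open>For the inclusion from left to right: a small step against the gradient stays in the
  triangle and strictly lowers the coordinate, which was therefore positive.\<close>

lemma interior_tri:
  assumes "nondeg a b c"
  shows "interior (convex hull {a,b,c}) = {y. 0 < lam a b c y \<and> 0 < lam b c a y \<and> 0 < lam c a b y}" (is "_ = ?I")
proof
  have "open ?I" by (intro open_Collect_conj open_Collect_less continuous_lam continuous_on_const)
  moreover have "?I \<subseteq> convex hull {a,b,c}" by (simp add: subset_iff in_tri_iff[OF assms] less_imp_le)
  ultimately show "?I \<subseteq> interior (convex hull {a,b,c})" by (rule interior_maximal[rotated])
next
  have pos: "0 < lam a b c y" if nd: "nondeg a b c" and y: "y \<in> interior (convex hull {a,b,c})" for a b c y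
  proof -
    obtain e where e: "e > 0" "ball y e \<subseteq> convex hull {a,b,c}" using y by (auto simp: mem_interior)
    let ?g = "glam a b c"
    have g0: "?g \<noteq> 0" using glam_inner[of a b c "a - b"] nd by (auto simp: nondeg_def)
    define z where "z = y - (e / 2 / norm ?g) *\<^sub>R ?g"
    have "z \<in> ball y e" unfolding z_def using e g0 by (simp add: dist_norm)
    then have "0 \<le> lam a b c z" using e in_tri_iff[OF nd] by blast
    moreover have "lam a b c z = lam a b c y - (e / 2 / norm ?g) * (norm ?g)\<^sup>2"
      unfolding lam_diff[of a b c z y] by (simp add: z_def power2_norm_eq_inner)
    moreover have "(e / 2 / norm ?g) * (norm ?g)\<^sup>2 > 0" using e g0 by simp
    ultimately show ?thesis by linarith
  qed
  show "interior (convex hull {a,b,c}) \<subseteq> ?I"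
    using pos[of a b c] pos[of b c a] pos[of c a b] assms
    by (auto simp: nondeg_cyc nondeg_cyc2 hull3_perm)
qed

lemma nondeg_imp:
  assumes "nondeg a b c"
  shows "a \<noteq> b" "b \<noteq> c" "a \<noteq> c" "\<not> affine_dependent {a,b,c}"
proof -
  show d: "a \<noteq> b" "b \<noteq> c" "a \<noteq> c" using assms by (auto simp: nondeg_def cr_def)
  have "\<not> collinear {a,b,c}"
  proof
    assume "collinear {a,b,c}"
    then have "collinear {b,a,c}" by (simp add: insert_commute)
    then have "collinear {0, a - b, c - b}" using collinear_3[of a b c] by (simp add: insert_commute)
    then obtain t where "c - b = t *\<^sub>R (a - b) \<or> a - b = 0" using d by (auto simp: collinear_lemma)
    then show False using assms d by (auto simp: nondeg_def cr_def)
  qed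
  then show "\<not> affine_dependent {a,b,c}" using collinear_3_eq_affine_dependent by blast
qed

lemma parallel_of_cr:
  fixes u w :: point
  assumes "u \<noteq> 0" "u $ 1 * w $ 2 = u $ 2 * w $ 1"
  shows "\<exists>t. w = t *\<^sub>R u"
proof (cases "u $ 1 = 0")
  case True
  then have "u $ 2 \<noteq> 0" using assms(1) by (auto simp: vec_eq_iff forall_2)
  then have "w = (w $ 2 / u $ 2) *\<^sub>R u" using True assms(2) by (simp add: vec_eq_iff forall_2)
  then show ?thesis by blast
next
  case False
  then have "w = (w $ 1 / u $ 1) *\<^sub>R u" using assms(2) by (simp add: vec_eq_iff forall_2 nonzero_eq_divide_eq mult.commute)
  then show ?thesis by blast
qed

lemma simplex2_nondeg:
  assumes "2 simplex (K :: point set)"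
  obtains a b c where "nondeg a b c" "K = convex hull {a,b,c}"
proof -
  obtain C :: "point set" where C: "\<not> affine_dependent C" "int (card C) = 2 + 1" "K = convex hull C"
    using assms unfolding simplex_def by auto
  have "card C = 3" using C(2) by simp
  then obtain a b c where abc: "C = {a,b,c}" "a \<noteq> b" "b \<noteq> c" "a \<noteq> c" by (metis card_3_iff)
  have "nondeg a b c"
  proof (rule ccontr)
    assume "\<not> nondeg a b c"
    then have z: "(a - b) $ 1 * (c - b) $ 2 = (a - b) $ 2 * (c - b) $ 1" by (simp add: nondeg_def cr_def)
    let ?u = "a - b" let ?w = "c - b"
    have "\<exists>t. ?w = t *\<^sub>R ?u" by (rule parallel_of_cr[OF _ z]) (use abc in auto)
    then have "collinear {0, ?u, ?w}" by (auto simp: collinear_lemma)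
    then have "collinear {a,b,c}" using collinear_3[of a b c] by (simp add: insert_commute)
    then show False using C(1) abc collinear_3_eq_affine_dependent by blast
  qed
  then show ?thesis using that C abc by blast
qed

text \<open>Triangles are bare point sets, so their vertices are recovered as extreme points,
  independently of a naming a, b, c.\<close>

definition verts :: "point set \<Rightarrow> point set" where "verts K = {x. x extreme_point_of K}"

lemma verts_tri: "nondeg a b c \<Longrightarrow> verts (convex hull {a,b,c}) = {a,b,c}"
  using extreme_point_of_convex_hull_affine_independent[OF nondeg_imp(4)] by (auto simp: verts_def)

lemma tri_at_vertex:
  assumes "2 simplex K" "a \<in> verts K"
  obtains b c where "nondeg a b c" "K = convex hull {a,b,c}"
proof -
  obtain p q r where t: "nondeg p q r" "K = convex hull {p,q,r}" using simplex2_nondeg[OF assms(1)] by blast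
  then consider "a = p" | "a = q" | "a = r" using assms(2) verts_tri by blast
  then show ?thesis
    using that t nondeg_cyc nondeg_cyc2 hull3_perm(1) hull3_perm(2) by (metis (no_types, lifting))
qed

text \<open>Also intrinsic: a triangle together with one of its vertices names the opposite
  edge.\<close>

definition opp :: "point set \<Rightarrow> point \<Rightarrow> point set" where "opp K a = convex hull (verts K - {a})"

lemma opp_tri:
  assumes "nondeg a b c" shows "opp (convex hull {a,b,c}) a = closed_segment b c"
proof -
  have "{a,b,c} - {a} = {b,c}" using nondeg_imp[OF assms] by auto
  then show ?thesis unfolding opp_def verts_tri[OF assms] by (simp add: segment_convex_hull)
qed

lemma edge_iff:
  assumes "nondeg a b c"
  shows "y \<in> closed_segment b c \<longleftrightarrow> y \<in> convex hull {a,b,c} \<and> lam a b c y = 0"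
proof
  assume "y \<in> closed_segment b c"
  then obtain t where t: "0 \<le> t" "t \<le> 1" "y = (1 - t) *\<^sub>R b + t *\<^sub>R c" by (auto simp: closed_segment_def)
  have "y \<in> convex hull {a,b,c}"
    using hull_mono[of "{b,c}" "{a,b,c}" convex] \<open>y \<in> closed_segment b c\<close> by (auto simp: segment_convex_hull)
  moreover have "lam a b c y = 0" using lam_combo[OF assms, of 0 "1 - t" t] t by simp
  ultimately show "y \<in> convex hull {a,b,c} \<and> lam a b c y = 0" by simp
next
  assume y: "y \<in> convex hull {a,b,c} \<and> lam a b c y = 0"
  then have "y = lam b c a y *\<^sub>R b + lam c a b y *\<^sub>R c" "lam b c a y = 1 - lam c a b y"
    using lam_repr[OF assms, of y] lam_sum[OF assms, of y] by simp_all
  moreover have "0 \<le> lam b c a y" "0 \<le> lam c a b y" using y in_tri_iff[OF assms] by auto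
  ultimately show "y \<in> closed_segment b c" unfolding closed_segment_def by (intro CollectI exI[of _ "lam c a b y"]) auto
qed

lemma open_edge_iff:
  assumes "nondeg a b c"
  shows "y \<in> open_segment b c \<longleftrightarrow> lam a b c y = 0 \<and> 0 < lam b c a y \<and> 0 < lam c a b y"
proof -
  have n: "nondeg b c a" "nondeg c a b" using assms by (simp_all add: nondeg_cyc nondeg_cyc2)
  have vb: "y = b" if "lam a b c y = 0" "lam c a b y = 0"
    using lam_repr[OF assms, of y] lam_sum[OF assms, of y] that by simp
  have vc: "y = c" if "lam a b c y = 0" "lam b c a y = 0"
    using lam_repr[OF assms, of y] lam_sum[OF assms, of y] that by simp
  show ?thesis
  proof
    assume "y \<in> open_segment b c"
    then have y: "y \<in> closed_segment b c" "y \<noteq> b" "y \<noteq> c" by (auto simp: open_segment_def)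
    then have "lam a b c y = 0" "0 \<le> lam b c a y" "0 \<le> lam c a b y"
      using edge_iff[OF assms] in_tri_iff[OF assms] by auto
    then show "lam a b c y = 0 \<and> 0 < lam b c a y \<and> 0 < lam c a b y" using vb vc y by (auto simp: less_le)
  next
    assume y: "lam a b c y = 0 \<and> 0 < lam b c a y \<and> 0 < lam c a b y"
    then have "y \<in> closed_segment b c" using edge_iff[OF assms] in_tri_iff[OF assms] by auto
    moreover have "y \<noteq> b" "y \<noteq> c" using y lam_vertex[OF n(1)] lam_vertex[OF n(2)] by auto
    ultimately show "y \<in> open_segment b c" by (auto simp: open_segment_def)
  qed
qed

lemma tri_point_cases:
  assumes "2 simplex K" "y \<in> K" "y \<notin> verts K" "y \<notin> interior K"
  obtains a b c where "nondeg a b c" "K = convex hull {a,b,c}" "y \<in> open_segment b c"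
proof -
  obtain a b c where t: "nondeg a b c" "K = convex hull {a,b,c}" using simplex2_nondeg[OF assms(1)] by blast
  have n: "nondeg b c a" "nondeg c a b" using t(1) by (simp_all add: nondeg_cyc nondeg_cyc2)
  have yv: "y \<noteq> a" "y \<noteq> b" "y \<noteq> c" using assms(3) t verts_tri by auto
  have ge: "0 \<le> lam a b c y" "0 \<le> lam b c a y" "0 \<le> lam c a b y" using assms(2) t in_tri_iff by auto
  have "lam a b c y = 0 \<or> lam b c a y = 0 \<or> lam c a b y = 0"
    using assms(4) ge unfolding t(2) interior_tri[OF t(1)] by auto
  then show ?thesis
  proof (elim disjE)
    assume "lam a b c y = 0"
    then have "y \<in> open_segment b c" using edge_iff[OF t(1), of y] assms(2) t(2) yv by (simp add: open_segment_def)
    then show ?thesis using that t by blast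
  next
    assume "lam b c a y = 0"
    then have "y \<in> open_segment c a" using edge_iff[OF n(1), of y] assms(2) t(2) yv by (simp add: open_segment_def hull3_perm)
    then show ?thesis using that n(1) t(2) hull3_perm(1) by metis
  next
    assume "lam c a b y = 0"
    then have "y \<in> open_segment a b" using edge_iff[OF n(2), of y] assms(2) t(2) yv by (simp add: open_segment_def hull3_perm)
    then show ?thesis using that n(2) t(2) hull3_perm(2) by metis
  qed
qed

text \<open>Near a relative interior point of an edge the two other coordinates stay positive, so
  the triangle looks like a half plane there.\<close>

lemma tri_local:
  assumes "nondeg a b c" "y \<in> open_segment b c"
  obtains e where "e > 0" "\<And>z. z \<in> ball y e \<Longrightarrow> z \<in> convex hull {a,b,c} \<longleftrightarrow> 0 \<le> lam a b c z"
    "\<And>z. z \<in> ball y e \<Longrightarrow> z \<in> interior (convex hull {a,b,c}) \<longleftrightarrow> 0 < lam a b c z"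
proof -
  have "open {z. 0 < lam b c a z \<and> 0 < lam c a b z}"
    by (intro open_Collect_conj open_Collect_less continuous_lam continuous_on_const)
  moreover have "y \<in> {z. 0 < lam b c a z \<and> 0 < lam c a b z}" using assms open_edge_iff by auto
  ultimately obtain e where e: "e > 0" "ball y e \<subseteq> {z. 0 < lam b c a z \<and> 0 < lam c a b z}"
    using openE by blast
  then have p: "0 < lam b c a z" "0 < lam c a b z" if "z \<in> ball y e" for z using that by auto
  show ?thesis
    by (rule that[OF e(1)]) (use p in \<open>auto simp: in_tri_iff[OF assms(1)] interior_tri[OF assms(1)] less_imp_le\<close>)
qed

lemma interior_tri_ne:
  assumes "2 simplex (K::point set)" shows "interior K \<noteq> {}"
proof -
  obtain a b c where t: "nondeg a b c" "K = convex hull {a,b,c}" using simplex2_nondeg[OF assms(1)] by blast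
  define y where "y = (1/3) *\<^sub>R a + (1/3) *\<^sub>R b + (1/3) *\<^sub>R c"
  have "lam a b c y = 1/3" unfolding y_def by (rule lam_combo[OF t(1)]) simp
  moreover have "lam b c a y = 1/3"
    using lam_combo[of b c a "1/3" "1/3" "1/3"] t(1) unfolding y_def by (simp add: nondeg_cyc add_ac)
  moreover have "lam c a b y = 1/3"
    using lam_combo[of c a b "1/3" "1/3" "1/3"] t(1) unfolding y_def by (simp add: nondeg_cyc2 add_ac)
  ultimately have "y \<in> interior K" unfolding t(2) interior_tri[OF t(1)] by simp
  then show ?thesis by auto
qed

lemma tri_facts:
  assumes "2 simplex (K::point set)"
  shows "convex K" "compact K" "closed K" "finite (verts K)" "card (verts K) = 3" "verts K \<subseteq> K"
    "closure (interior K) = K" "connected (interior K)"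
proof -
  obtain a b c where t: "nondeg a b c" "K = convex hull {a,b,c}" using simplex2_nondeg[OF assms(1)] by blast
  show c: "convex K" "compact K" "closed K" unfolding t(2) by (auto simp: finite_imp_compact_convex_hull compact_imp_closed)
  show "finite (verts K)" "card (verts K) = 3" using t verts_tri nondeg_imp[OF t(1)] by auto
  show "verts K \<subseteq> K" by (auto simp: verts_def extreme_point_of_def)
  show "closure (interior K) = K" using convex_closure_interior[OF c(1) interior_tri_ne[OF assms]] c(3) by simp
  show "connected (interior K)" using c(1) by (simp add: convex_connected convex_interior)
qed

text \<open>Across the ball the coordinate rises by its slope times 2 r, yet on the triangle it
  stays between 0 and 1.\<close>

lemma glam_ball:
  assumes "nondeg a b c" "ball x r \<subseteq> convex hull {a,b,c}" "r > 0"
  shows "norm (glam a b c) * (2 * r) \<le> 1"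
proof -
  let ?g = "glam a b c"
  have g0: "?g \<noteq> 0" using glam_inner[of a b c "a - b"] assms(1) by (auto simp: nondeg_def)
  have le: "norm ?g * (2 * s) \<le> 1" if s: "0 < s" "s < r" for s
  proof -
    define y where "y = x + (s / norm ?g) *\<^sub>R ?g" define z where "z = x - (s / norm ?g) *\<^sub>R ?g"
    have "y \<in> ball x r" "z \<in> ball x r" using s g0 by (simp_all add: y_def z_def dist_norm)
    then have yz: "y \<in> convex hull {a,b,c}" "z \<in> convex hull {a,b,c}" using assms(2) by auto
    have "lam a b c y \<le> 1" "0 \<le> lam a b c z"
      using in_tri_iff[OF assms(1)] yz lam_sum[OF assms(1), of y] by (smt (verit))+
    moreover have "lam a b c y = lam a b c z + norm ?g * (2 * s)"
    proof -
      have "y - z = (2 * s / norm ?g) *\<^sub>R ?g" unfolding y_def z_def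
        by (simp add: scaleR_2[symmetric] flip: scaleR_add_left)
      then have "?g \<bullet> (y - z) = (2 * s / norm ?g) * (norm ?g)\<^sup>2" by (simp add: power2_norm_eq_inner)
      then show ?thesis using lam_diff[of a b c y z] g0 by (simp add: power2_eq_square)
    qed
    ultimately show ?thesis by linarith
  qed
  show ?thesis
  \<comment> \<open>The ball is open, so the estimate is available for radii s below r only; an s
    close enough to r contradicts a failure at r.\<close>
  proof (rule ccontr)
    assume "\<not> ?thesis"
    then have 1: "1 / (2 * norm ?g) < r" using g0 by (simp add: field_simps)
    obtain s where s: "1 / (2 * norm ?g) < s" "s < r" using dense[OF 1] by blast
    have "0 < s" using s(1) g0 by (meson divide_pos_pos less_trans mult_pos_pos zero_less_norm_iff zero_less_numeral zero_less_one)
    then show False using le[of s] s g0 by (simp add: field_simps)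
  qed
qed

text \<open>A proper common face that contains a point which is no vertex must be a full edge. The
  third vertices lie on opposite sides of it, since otherwise the interiors would overlap; \<kappa>
  > 0 records this.\<close>

lemma two_triangles:
  assumes K: "2 simplex K" "2 simplex K'" and f: "K \<inter> K' face_of K" "K \<inter> K' face_of K'"
    and ne: "K \<noteq> K'" and x: "x \<in> K" "x \<in> K'" "x \<notin> verts K"
  obtains a b c a' \<kappa> where "nondeg a b c" "K = convex hull {a,b,c}" "nondeg a' b c" "K' = convex hull {a',b,c}"
    "x \<in> open_segment b c" "\<kappa> > 0" "\<And>y. lam a' b c y = - \<kappa> * lam a b c y" "K \<inter> K' = closed_segment b c"
proof -
  have dim: "aff_dim K = 2" "aff_dim K' = 2" using K by (auto simp: aff_dim_simplex)
  have fl: "K \<inter> K' \<noteq> K" "K \<inter> K' \<noteq> K'"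
    using face_of_aff_dim_lt[OF tri_facts(1)[OF K(1)] f(1)] face_of_aff_dim_lt[OF tri_facts(1)[OF K(2)] f(2)] f ne dim K
      face_of_aff_dim_lt[OF tri_facts(1)[OF K(1)]] face_of_aff_dim_lt[OF tri_facts(1)[OF K(2)]]
    by (metis Int_commute order_less_irrefl)+
  obtain p q r where pqr: "nondeg p q r" "K = convex hull {p,q,r}" using simplex2_nondeg[OF K(1)] by blast
  have xi: "x \<notin> interior K"
    using face_of_disjoint_interior[OF f(1) fl(1)] x by auto
  obtain a b c where t: "nondeg a b c" "K = convex hull {a,b,c}" "x \<in> open_segment b c"
    using tri_point_cases[OF K(1) x(1) x(3) xi] by blast
  have xF: "x \<in> K \<inter> K'" using x by simp
  \<comment> \<open>A face that contains a relative interior point of a segment of K contains both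
    ends of the segment.\<close>
  have bcF: "b \<in> K \<inter> K'" "c \<in> K \<inter> K'"
  proof -
    have "b \<in> K" "c \<in> K" unfolding t(2) by (auto intro: hull_inc)
    then show "b \<in> K \<inter> K'" "c \<in> K \<inter> K'" using f(1) xF t(3) unfolding face_of_def by blast+
  qed
  have v: "b \<in> verts K'" "c \<in> verts K'"
  proof -
    have "b \<in> verts K" "c \<in> verts K" using t verts_tri by auto
    then have "b extreme_point_of (K \<inter> K')" "c extreme_point_of (K \<inter> K')"
      using extreme_point_of_face[OF f(1)] bcF by (auto simp: verts_def)
    then show "b \<in> verts K'" "c \<in> verts K'" using extreme_point_of_face[OF f(2)] by (auto simp: verts_def)
  qed
  have bc: "b \<noteq> c" using nondeg_imp[OF t(1)] by simp
  obtain a' where a': "nondeg a' b c" "K' = convex hull {a',b,c}"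
  proof -
    obtain u w where uw: "nondeg b u w" "K' = convex hull {b,u,w}" using tri_at_vertex[OF K(2) v(1)] by blast
    have "c = u \<or> c = w" using v(2) bc verts_tri[OF uw(1)] uw(2) by auto
    then show ?thesis
    proof
      assume "c = u"
      then have "nondeg w b c" "K' = convex hull {w,b,c}" using uw by (auto simp: nondeg_cyc nondeg_cyc2 insert_commute)
      then show ?thesis using that by blast
    next
      assume "c = w"
      then have "nondeg u b c" "K' = convex hull {u,b,c}" using uw nondeg_swap nondeg_cyc nondeg_cyc2 by (auto simp: insert_commute)
      then show ?thesis using that by blast
    qed
  qed
  \<comment> \<open>Both coordinates are the same determinant divided by two signed areas, so they
    differ by a constant factor.\<close>
  define \<kappa> where "\<kappa> = - (cr (a - b) (c - b) / cr (a' - b) (c - b))"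
  have D: "cr (a - b) (c - b) \<noteq> 0" "cr (a' - b) (c - b) \<noteq> 0" using t(1) a'(1) by (simp_all add: nondeg_def)
  have k: "lam a' b c y = - \<kappa> * lam a b c y" for y using D by (simp add: lam_def \<kappa>_def)
  \<comment> \<open>With \<kappa> negative both coordinates grow in the same direction, and a small
    step from x lands in both interiors.\<close>
  have "\<not> \<kappa> < 0"
  proof
    assume kn: "\<kappa> < 0"
    obtain e where e: "e > 0" "\<And>z. z \<in> ball x e \<Longrightarrow> z \<in> interior K \<longleftrightarrow> 0 < lam a b c z"
      using tri_local[OF t(1) t(3)] t(2) by metis
    obtain e' where e': "e' > 0" "\<And>z. z \<in> ball x e' \<Longrightarrow> z \<in> interior K' \<longleftrightarrow> 0 < lam a' b c z"
      using tri_local[OF a'(1) t(3)] a'(2) by metis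
    let ?g = "glam a b c"
    have g0: "?g \<noteq> 0" using glam_inner[of a b c "a - b"] t(1) by (auto simp: nondeg_def)
    define s where "s = min e e' / 2 / norm ?g"
    define z where "z = x + s *\<^sub>R ?g"
    have s: "s > 0" "s * norm ?g < e" "s * norm ?g < e'" using e e' g0 by (auto simp: s_def)
    then have zb: "z \<in> ball x e" "z \<in> ball x e'" by (simp_all add: z_def dist_norm)
    have "lam a b c x = 0" using t open_edge_iff by blast
    then have "lam a b c z = s * (norm ?g)\<^sup>2" unfolding lam_diff[of a b c z x] by (simp add: z_def power2_norm_eq_inner)
    then have "lam a b c z > 0" using s g0 by simp
    then have "z \<in> interior K" "z \<in> interior K'" using zb e e' k[of z] kn by (simp_all add: mult_neg_pos)
    then show False using face_of_disjoint_interior[OF f(1) fl(1)] interior_subset by blast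
  qed
  then have kp: "\<kappa> > 0" using D by (simp add: \<kappa>_def linorder_not_less order_less_le)
  have "K \<inter> K' = closed_segment b c"
  proof
    show "closed_segment b c \<subseteq> K \<inter> K'"
      using bcF tri_facts(1)[OF K(1)] tri_facts(1)[OF K(2)] by (simp add: closed_segment_subset)
    show "K \<inter> K' \<subseteq> closed_segment b c"
    proof
      fix y assume y: "y \<in> K \<inter> K'"
      then have "0 \<le> lam a b c y" "0 \<le> lam a' b c y" using t(2) a'(2) in_tri_iff[OF t(1)] in_tri_iff[OF a'(1)] by auto
      then have "lam a b c y = 0" using k[of y] kp by (smt (verit) mult_neg_pos mult_pos_pos mult_minus_left)
      then show "y \<in> closed_segment b c" using y t(2) edge_iff[OF t(1)] by simp
    qed
  qed
  then show ?thesis using that[OF t(1,2) a' t(3) kp k] by blast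
qed

section \<open>Weak gradients\<close>

lemma GDERIV_unique:
  assumes "GDERIV f x :> D" "GDERIV f x :> E" shows "D = E"
proof -
  have "(\<lambda>h. h \<bullet> D) = (\<lambda>h. h \<bullet> E)"
    using assms unfolding gderiv_def by (rule has_derivative_unique)
  then have "(D - E) \<bullet> D = (D - E) \<bullet> E" by meson
  then have "(D - E) \<bullet> (D - E) = 0" by (simp add: inner_diff_right)
  then show ?thesis by simp
qed

lemma GDERIV_transfer:
  assumes "GDERIV f x :> D" "open U" "x \<in> U" "\<And>y. y \<in> U \<Longrightarrow> f y = g y"
  shows "GDERIV g x :> D"
proof -
  have "(f has_derivative (\<lambda>h. h \<bullet> D)) (at x)" using assms(1) by (simp add: gderiv_def)
  then have "(g has_derivative (\<lambda>h. h \<bullet> D)) (at x)"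
    by (rule has_derivative_transform_within_open[OF _ assms(2,3)]) (rule assms(4))
  then show ?thesis by (simp add: gderiv_def)
qed

lemma test_function_zero:
  assumes "test_function \<Omega> \<phi> D" "x \<notin> closure {x. \<phi> x \<noteq> 0}"
  shows "\<phi> x = 0" "D x = 0"
proof -
  show "\<phi> x = 0" using assms(2) closure_subset[of "{x. \<phi> x \<noteq> 0}"] by auto
  have "GDERIV \<phi> x :> D x" using assms(1) by (simp add: test_function_def)
  moreover have "GDERIV (\<lambda>x. 0) x :> 0" by (simp add: gderiv_def)
  then have "GDERIV \<phi> x :> 0"
    by (rule GDERIV_transfer[of _ _ _ "- closure {x. \<phi> x \<noteq> 0}"])
       (use assms(2) closure_subset[of "{x. \<phi> x \<noteq> 0}"] in auto)
  ultimately show "D x = 0" by (rule GDERIV_unique)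
qed

lemma test_function_outside:
  assumes "test_function \<Omega> \<phi> D" "x \<notin> \<Omega>" shows "\<phi> x = 0" "D x = 0"
  using test_function_zero[OF assms(1), of x] assms by (auto simp: test_function_def)

lemma test_function_bounded:
  assumes t: "test_function \<Omega> \<phi> D"
  obtains B where "B \<ge> 0" "\<And>x. \<bar>\<phi> x\<bar> \<le> B" "\<And>x. norm (D x) \<le> B" "\<And>x y. \<bar>\<phi> x - \<phi> y\<bar> \<le> B * norm (x - y)"
    "continuous_on UNIV \<phi>" "continuous_on UNIV D"
proof -
  let ?S = "closure {x. \<phi> x \<noteq> 0}"
  have d: "(\<phi> has_derivative (\<lambda>h. h \<bullet> D x)) (at x)" for x using t by (simp add: test_function_def gderiv_def)
  have c: "continuous_on UNIV \<phi>"
    by (meson d continuous_at_imp_continuous_on has_derivative_continuous)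
  have cD: "continuous_on UNIV D" using t by (simp add: test_function_def)
  have S: "compact ?S" using t by (simp add: test_function_def)
  have "bounded (\<phi> ` ?S)" "bounded (D ` ?S)"
    using compact_imp_bounded[OF compact_continuous_image[OF continuous_on_subset[OF c] S]]
      compact_imp_bounded[OF compact_continuous_image[OF continuous_on_subset[OF cD] S]] by auto
  then obtain B1 B2 where B: "\<And>x. x \<in> ?S \<Longrightarrow> norm (\<phi> x) \<le> B1" "\<And>x. x \<in> ?S \<Longrightarrow> norm (D x) \<le> B2"
    by (auto simp: bounded_iff)
  define B where "B = \<bar>B1\<bar> + \<bar>B2\<bar>"
  have b1: "\<bar>\<phi> x\<bar> \<le> B" for x
    using B(1)[of x] test_function_zero[OF t, of x] by (cases "x \<in> ?S") (auto simp: B_def)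
  have b2: "norm (D x) \<le> B" for x
    using B(2)[of x] test_function_zero[OF t, of x] by (cases "x \<in> ?S") (auto simp: B_def)
  have "\<bar>\<phi> x - \<phi> y\<bar> \<le> B * norm (x - y)" for x y
  proof -
    have "norm (\<phi> x - \<phi> y) \<le> B * norm (x - y)"
    proof (rule differentiable_bound[OF convex_UNIV])
      show "(\<phi> has_derivative (\<lambda>h. h \<bullet> D z)) (at z within UNIV)" for z using d by simp
      show "onorm (\<lambda>h. h \<bullet> D z) \<le> B" for z
        using b2[of z] by (intro onorm_le) (metis Cauchy_Schwarz_ineq2 mult.commute mult_right_mono norm_ge_zero order_trans real_norm_def)
    qed auto
    then show ?thesis by simp
  qed
  then show ?thesis using that[of B] b1 b2 c cD by (simp add: B_def)
qed

lemma lebesgue_on_integral: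
  fixes f :: "point \<Rightarrow> 'b::{banach, second_countable_topology}"
  assumes "S \<in> sets lebesgue"
  shows "(LINT x|lebesgue_on S. f x) = (LINT x|lebesgue. indicator S x *\<^sub>R f x)"
  by (rule integral_restrict_space) (use assms in auto)

lemma lebesgue_on_integrable:
  fixes f :: "point \<Rightarrow> 'b::{banach, second_countable_topology}"
  assumes "S \<in> sets lebesgue"
  shows "integrable (lebesgue_on S) f \<longleftrightarrow> integrable lebesgue (\<lambda>x. indicator S x *\<^sub>R f x)"
  by (rule integrable_restrict_space) (use assms in auto)

lemma lebesgue_on_AE:
  assumes "S \<in> sets lebesgue"
  shows "(AE x in lebesgue_on S. P x) \<longleftrightarrow> (AE x in lebesgue. x \<in> S \<longrightarrow> P x)"
  by (rule AE_restrict_space_iff) (use assms in auto)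

lemma integrable_bounded_lebesgue_on:
  fixes f :: "point \<Rightarrow> 'b::{banach, second_countable_topology}"
  assumes "S \<in> lmeasurable" "f \<in> borel_measurable (lebesgue_on S)" "AE x in lebesgue_on S. norm (f x) \<le> B"
  shows "integrable (lebesgue_on S) f"
proof -
  interpret finite_measure "lebesgue_on S" using assms(1) by (rule finite_measure_lebesgue_on)
  show ?thesis by (rule integrable_const_bound[OF assms(3,2)])
qed

lemma lborel_translation:
  fixes f :: "point \<Rightarrow> real"
  assumes "f \<in> borel_measurable borel"
  shows "(LINT x|lborel. f (x + c)) = (LINT x|lborel. f x)" "integrable lborel f \<Longrightarrow> integrable lborel (\<lambda>x. f (x + c))"
proof -
  have d: "distr lborel borel ((+) c) = (lborel :: point measure)" by (rule lborel_distr_plus)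
  have "(LINT x|lborel. f x) = (LINT x|distr lborel borel ((+) c). f x)" by (simp add: d)
  also have "\<dots> = (LINT x|lborel. f (c + x))" using assms by (intro integral_distr) auto
  finally show "(LINT x|lborel. f (x + c)) = (LINT x|lborel. f x)" by (simp add: add.commute)
  assume "integrable lborel f"
  then have "integrable (distr lborel borel ((+) c)) f" by (simp add: d)
  then have "integrable lborel (\<lambda>x. f (c + x))" by (intro integrable_distr[of "(+) c" lborel borel f]) auto
  then show "integrable lborel (\<lambda>x. f (x + c))" by (simp add: add.commute)
qed

text \<open>Integration by parts for difference quotients is translation invariance of the integral;
  the step is then sent to 0 by dominated convergence, with majorants from the Lipschitz bounds of w
  and \<phi>. The Lipschitz condition is restricted to segments inside \<Omega> because \<Omega>
  need not be convex. Polynomials and nodal interpolants are both covered.\<close>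

lemma weak_gradient_lipschitz:
  fixes w :: "point \<Rightarrow> real" and g :: "point \<Rightarrow> point"
  assumes O: "open \<Omega>" "bounded \<Omega>" and w: "w \<in> borel_measurable borel" "\<And>x. x \<in> \<Omega> \<Longrightarrow> \<bar>w x\<bar> \<le> B"
    and lip: "\<And>x y. closed_segment x y \<subseteq> \<Omega> \<Longrightarrow> \<bar>w x - w y\<bar> \<le> M * norm (x - y)"
    and g: "g \<in> borel_measurable (lebesgue_on \<Omega>)" "AE x in lebesgue_on \<Omega>. GDERIV w x :> g x"
  shows "weak_gradient \<Omega> w g"
  unfolding weak_gradient_def
proof (intro allI impI)
  fix \<phi> D assume t: "test_function \<Omega> \<phi> D"
  let ?S = "closure {x. \<phi> x \<noteq> 0}"
  have Ob: "\<Omega> \<in> sets borel" using O by simp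
  have Ol: "\<Omega> \<in> lmeasurable" using O by (simp add: bounded_set_imp_lmeasurable)
  have Os: "\<Omega> \<in> sets lebesgue" using Ol by (simp add: fmeasurableD)
  obtain C where C: "C \<ge> 0" "\<And>x. \<bar>\<phi> x\<bar> \<le> C" "\<And>x. norm (D x) \<le> C" "\<And>x y. \<bar>\<phi> x - \<phi> y\<bar> \<le> C * norm (x - y)"
    "continuous_on UNIV \<phi>" "continuous_on UNIV D" using test_function_bounded[OF t] by blast
  have \<phi>m: "\<phi> \<in> borel_measurable borel" and Dm: "D \<in> borel_measurable borel"
    using C by (auto intro: borel_measurable_continuous_onI)
  have S: "compact ?S" "?S \<subseteq> \<Omega>" using t by (auto simp: test_function_def)
  obtain \<epsilon> where \<epsilon>: "\<epsilon> > 0" "(\<Union>x\<in>?S. ball x \<epsilon>) \<subseteq> \<Omega>"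
    using compact_subset_open_imp_ball_epsilon_subset[OF S(1) O(1) S(2)] by metis
  \<comment> \<open>Extension by zero allows translations on the whole plane.\<close>
  define w1 where "w1 x = indicator \<Omega> x * w x" for x
  have w1m: "w1 \<in> borel_measurable borel" unfolding w1_def using w Ob by simp
  define B' where "B' = \<bar>B\<bar>"
  have w1b: "\<bar>w1 x\<bar> \<le> B' * indicator \<Omega> x" for x using w(2)[of x] by (auto simp: w1_def B'_def indicator_def)
  define M' where "M' = \<bar>M\<bar>"
  have lip': "\<bar>w x - w y\<bar> \<le> M' * norm (x - y)" if "closed_segment x y \<subseteq> \<Omega>" for x y
    using lip[OF that] by (smt (verit) M'_def mult_right_mono norm_ge_zero)
  \<comment> \<open>The difference quotient in the direction g x itself tends to |g x|^2 and is at
    most M' |g x|.\<close>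
  have gb: "AE x in lebesgue_on \<Omega>. norm (g x) \<le> M'"
  proof -
    have "norm (g x) \<le> M'" if x: "x \<in> \<Omega>" and gd: "GDERIV w x :> g x" for x
    proof -
      obtain d where d: "d > 0" "ball x d \<subseteq> \<Omega>" using O(1) x openE by blast
      have "((\<lambda>t. w (x + t *\<^sub>R g x)) has_real_derivative (g x \<bullet> g x)) (at 0)"
      proof -
        have "((\<lambda>t. w (x + t *\<^sub>R g x)) has_derivative (\<lambda>s. (s *\<^sub>R g x) \<bullet> g x)) (at 0)"
          by (rule has_derivative_compose[where f="\<lambda>t. x + t *\<^sub>R g x" and g=w and g'="\<lambda>h. h \<bullet> g x"])
             (use gd in \<open>auto simp: gderiv_def intro!: derivative_eq_intros\<close>)
        then show ?thesis by (simp add: has_field_derivative_def mult_commute_abs)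
      qed
      then have lim: "((\<lambda>t. (w (x + t *\<^sub>R g x) - w x) / t) \<longlongrightarrow> g x \<bullet> g x) (at 0)"
        by (simp add: DERIV_def)
      have "\<forall>\<^sub>F t in at 0. (w (x + t *\<^sub>R g x) - w x) / t \<le> M' * norm (g x)"
      proof -
        have "\<forall>\<^sub>F t in at (0::real). \<bar>t\<bar> < d / (norm (g x) + 1) \<and> t \<noteq> 0"
        proof -
          have "d / (norm (g x) + 1) > 0" using d by (simp add: add_nonneg_pos)
          then show ?thesis unfolding eventually_at by (intro exI[of _ "d / (norm (g x) + 1)"]) (auto simp: dist_real_def)
        qed
        then show ?thesis
        proof (rule eventually_mono)
          fix t :: real assume "\<bar>t\<bar> < d / (norm (g x) + 1) \<and> t \<noteq> 0"
          then have t: "\<bar>t\<bar> * (norm (g x) + 1) < d" "t \<noteq> 0"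
            using add_nonneg_pos[OF norm_ge_zero[of "g x"] zero_less_one] by (simp_all add: pos_less_divide_eq)
          then have "\<bar>t\<bar> * norm (g x) < d" by (smt (verit) distrib_left mult_cancel_left1)
          then have "x + t *\<^sub>R g x \<in> ball x d" by (simp add: dist_norm)
          then have "closed_segment (x + t *\<^sub>R g x) x \<subseteq> \<Omega>"
            using d by (meson centre_in_ball closed_segment_subset convex_ball order_trans)
          from lip'[OF this] have "\<bar>w (x + t *\<^sub>R g x) - w x\<bar> \<le> M' * (\<bar>t\<bar> * norm (g x))" by simp
          then have "\<bar>(w (x + t *\<^sub>R g x) - w x) / t\<bar> \<le> M' * norm (g x)"
            using t by (simp add: abs_divide divide_le_eq mult_ac)
          then show "(w (x + t *\<^sub>R g x) - w x) / t \<le> M' * norm (g x)" by linarith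
        qed
      qed
      then have "g x \<bullet> g x \<le> M' * norm (g x)" by (rule tendsto_upperbound[OF lim]) simp
      then have "norm (g x) * norm (g x) \<le> M' * norm (g x)" by (simp add: power2_norm_eq_inner[symmetric] power2_eq_square)
      then show ?thesis by (metis M'_def abs_ge_zero mult_right_le_imp_le norm_ge_zero order_le_less)
    qed
    then show ?thesis using g(2) unfolding lebesgue_on_AE[OF Os] by (auto elim!: eventually_mono)
  qed
  have i1: "integrable (lebesgue_on \<Omega>) (\<lambda>x. w x *\<^sub>R D x)"
  proof (rule integrable_bounded_lebesgue_on[OF Ol])
    show "(\<lambda>x. w x *\<^sub>R D x) \<in> borel_measurable (lebesgue_on \<Omega>)"
      using w Dm Os by (intro measurable_restrict_space1 measurable_completion) auto
    show "AE x in lebesgue_on \<Omega>. norm (w x *\<^sub>R D x) \<le> B' * C"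
      unfolding lebesgue_on_AE[OF Os] using w(2) C(3) by (intro AE_I2) (force intro!: mult_mono simp: B'_def)
  qed
  have i2: "integrable (lebesgue_on \<Omega>) (\<lambda>x. \<phi> x *\<^sub>R g x)"
  proof (rule integrable_bounded_lebesgue_on[OF Ol])
    have "\<phi> \<in> borel_measurable (lebesgue_on \<Omega>)"
      using \<phi>m by (intro measurable_restrict_space1 measurable_completion) auto
    then show "(\<lambda>x. \<phi> x *\<^sub>R g x) \<in> borel_measurable (lebesgue_on \<Omega>)" using g(1) by simp
    show "AE x in lebesgue_on \<Omega>. norm (\<phi> x *\<^sub>R g x) \<le> C * M'"
      using gb by eventually_elim (use C in \<open>auto intro!: mult_mono\<close>)
  qed
  have main: "(LINT x|lebesgue_on \<Omega>. w x * (D x \<bullet> e)) = - (LINT x|lebesgue_on \<Omega>. \<phi> x * (g x \<bullet> e))"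
    if e: "norm e = 1" for e
  proof -
    define t where "t n = \<epsilon> / 2 * inverse (real (Suc n))" for n
    have tp: "0 < t n" "t n < \<epsilon>" for n
    proof -
      show "0 < t n" using \<epsilon> by (simp add: t_def)
      have "inverse (real (Suc n)) \<le> 1" by (simp add: inverse_le_1_iff)
      then have "t n \<le> \<epsilon> / 2 * 1" unfolding t_def using \<epsilon> by (intro mult_left_mono) auto
      then show "t n < \<epsilon>" using \<epsilon> by simp
    qed
    have t0: "t \<longlonglongrightarrow> 0" unfolding t_def using tendsto_mult_right_zero[OF LIMSEQ_inverse_real_of_nat] by simp
    define F where "F n x = w1 x * ((\<phi> (x + t n *\<^sub>R e) - \<phi> x) / t n)" for n x
    define G where "G n x = \<phi> x * ((w1 (x - t n *\<^sub>R e) - w1 x) / t n)" for n x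
    have Fm: "F n \<in> borel_measurable borel" and Gm: "G n \<in> borel_measurable borel" for n
      unfolding F_def G_def using w1m \<phi>m by measurable
    \<comment> \<open>Discrete integration by parts: the shift is moved from \<phi> to w by
      translating the first product.\<close>
    have FG: "(LINT x|lborel. F n x) = (LINT x|lborel. G n x)" for n
    proof -
      have m1: "(\<lambda>x. w1 (x - t n *\<^sub>R e) * \<phi> x) \<in> borel_measurable borel" using w1m \<phi>m by measurable
      have m2: "(\<lambda>x. w1 x * \<phi> x) \<in> borel_measurable borel" using w1m \<phi>m by measurable
      have ind: "integrable lborel (\<lambda>x. (B' * C) * indicator \<Omega> x)"
        using Ob O emeasure_bounded_finite[OF O(2)] by (intro integrable_mult_right integrable_real_indicator) auto
      have bd: "norm (w1 x * \<phi> y) \<le> norm ((B' * C) * indicator \<Omega> x)" for x y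
      proof -
        have "\<bar>w1 x\<bar> * \<bar>\<phi> y\<bar> \<le> (B' * indicator \<Omega> x) * C"
          using w1b[of x] C(2)[of y] by (intro mult_mono) (auto simp: B'_def)
        then show ?thesis using C(1) by (simp add: abs_mult B'_def mult_ac)
      qed
      have j0: "integrable lborel (\<lambda>x. w1 x * \<phi> x)"
        by (rule Bochner_Integration.integrable_bound[OF ind]) (use m2 bd in auto)
      have j1: "integrable lborel (\<lambda>x. w1 x * \<phi> (x + t n *\<^sub>R e))"
        by (rule Bochner_Integration.integrable_bound[OF ind])
           (use \<phi>m w1m bd in auto)
      have k1: "(LINT x|lborel. w1 x * \<phi> (x + t n *\<^sub>R e)) = (LINT x|lborel. w1 (x - t n *\<^sub>R e) * \<phi> x)"
        using lborel_translation(1)[OF m1, of "t n *\<^sub>R e"] by simp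
      have j2: "integrable lborel (\<lambda>x. w1 (x - t n *\<^sub>R e) * \<phi> x)"
      proof -
        have "(\<lambda>x. w1 x * \<phi> (x + t n *\<^sub>R e)) \<in> borel_measurable borel" using w1m \<phi>m by measurable
        from lborel_translation(2)[OF this j1, of "- (t n *\<^sub>R e)"] show ?thesis by simp
      qed
      have "(LINT x|lborel. F n x) = (1 / t n) * ((LINT x|lborel. w1 x * \<phi> (x + t n *\<^sub>R e)) - (LINT x|lborel. w1 x * \<phi> x))"
        unfolding Bochner_Integration.integral_diff[OF j1 j0, symmetric] integral_mult_right_zero[symmetric]
        by (intro Bochner_Integration.integral_cong refl) (simp add: F_def field_simps)
      also have "\<dots> = (1 / t n) * ((LINT x|lborel. w1 (x - t n *\<^sub>R e) * \<phi> x) - (LINT x|lborel. w1 x * \<phi> x))"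
        by (simp add: k1)
      also have "\<dots> = (LINT x|lborel. G n x)"
        unfolding Bochner_Integration.integral_diff[OF j2 j0, symmetric] integral_mult_right_zero[symmetric]
        by (intro Bochner_Integration.integral_cong refl) (simp add: G_def field_simps)
      finally show ?thesis .
    qed
    have domain_props: "integrable lebesgue (\<lambda>x. k * indicator \<Omega> x :: real)" for k
      using Ol by (intro integrable_mult_right integrable_real_indicator) (auto simp: fmeasurable_def)
    have Flim: "(\<lambda>n. LINT x|lebesgue. F n x) \<longlonglongrightarrow> (LINT x|lebesgue. w1 x * (D x \<bullet> e))"
    proof (rule integral_dominated_convergence[where w="\<lambda>x. (B' * C) * indicator \<Omega> x"])
      show "(\<lambda>x. w1 x * (D x \<bullet> e)) \<in> borel_measurable lebesgue" "F n \<in> borel_measurable lebesgue" for n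
        using w1m Dm Fm by (auto intro!: measurable_completion)
      show "AE x in lebesgue. norm (F n x) \<le> (B' * C) * indicator \<Omega> x" for n
      proof (intro AE_I2)
        fix x
        have "\<bar>\<phi> (x + t n *\<^sub>R e) - \<phi> x\<bar> \<le> C * t n" using C(4)[of "x + t n *\<^sub>R e" x] e tp(1)[of n] by simp
        then have "\<bar>(\<phi> (x + t n *\<^sub>R e) - \<phi> x) / t n\<bar> \<le> C" using tp(1)[of n] by (simp add: abs_divide divide_le_eq)
        then have "\<bar>F n x\<bar> \<le> (B' * indicator \<Omega> x) * C" unfolding F_def abs_mult
          using w1b[of x] by (intro mult_mono) (auto simp: B'_def)
        then show "norm (F n x) \<le> (B' * C) * indicator \<Omega> x" by (simp add: mult_ac)
      qed
      have "(\<lambda>n. (\<phi> (x + t n *\<^sub>R e) - \<phi> x) / t n) \<longlonglongrightarrow> D x \<bullet> e" for x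
      proof -
        have "((\<lambda>s. \<phi> (x + s *\<^sub>R e)) has_real_derivative (e \<bullet> D x)) (at 0)"
        proof -
          have "((\<lambda>s. \<phi> (x + s *\<^sub>R e)) has_derivative (\<lambda>s. (s *\<^sub>R e) \<bullet> D x)) (at 0)"
            by (rule has_derivative_compose[where f="\<lambda>s. x + s *\<^sub>R e" and g=\<phi> and g'="\<lambda>h. h \<bullet> D x"])
               (use t in \<open>auto simp: test_function_def gderiv_def intro!: derivative_eq_intros\<close>)
          then show ?thesis by (simp add: has_field_derivative_def mult_commute_abs)
        qed
        then have "((\<lambda>s. (\<phi> (x + s *\<^sub>R e) - \<phi> x) / s) \<longlongrightarrow> e \<bullet> D x) (at 0)" by (simp add: DERIV_def)
        moreover have "filterlim t (at 0) sequentially"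
          using t0 tp(1) by (intro filterlim_atI) (auto simp: less_imp_neq intro!: always_eventually simp: less_imp_neq[THEN not_sym])
        ultimately show ?thesis unfolding inner_commute[of "D x"] by (rule filterlim_compose)
      qed
      then show "AE x in lebesgue. (\<lambda>n. F n x) \<longlonglongrightarrow> w1 x * (D x \<bullet> e)"
        unfolding F_def by (intro AE_I2 tendsto_mult tendsto_const)
    qed (rule domain_props)
    have Glim: "(\<lambda>n. LINT x|lebesgue. G n x) \<longlonglongrightarrow> (LINT x|lebesgue. - (indicator \<Omega> x * (\<phi> x * (g x \<bullet> e))))"
    proof (rule integral_dominated_convergence[where w="\<lambda>x. (C * M') * indicator \<Omega> x"])
      have "(\<lambda>x. \<phi> x * (g x \<bullet> e)) \<in> borel_measurable (lebesgue_on \<Omega>)"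
      proof -
        have "\<phi> \<in> borel_measurable (lebesgue_on \<Omega>)"
          using \<phi>m by (intro measurable_restrict_space1 measurable_completion) auto
        then show ?thesis using g(1) by simp
      qed
      then have "(\<lambda>x. indicator \<Omega> x *\<^sub>R (\<phi> x * (g x \<bullet> e))) \<in> borel_measurable lebesgue"
        by (subst (asm) borel_measurable_restrict_space_iff) (use Os in auto)
      then show "(\<lambda>x. - (indicator \<Omega> x * (\<phi> x * (g x \<bullet> e)))) \<in> borel_measurable lebesgue" by simp
      show "G n \<in> borel_measurable lebesgue" for n using Gm by (auto intro!: measurable_completion)
      have seg: "closed_segment (x - t n *\<^sub>R e) x \<subseteq> \<Omega>" if "x \<in> ?S" for x n
      proof -
        have "x - t n *\<^sub>R e \<in> ball x \<epsilon>" using e tp[of n] by (simp add: dist_norm)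
        then have "closed_segment (x - t n *\<^sub>R e) x \<subseteq> ball x \<epsilon>" using \<epsilon>(1) by (simp add: closed_segment_subset)
        then show ?thesis using \<epsilon>(2) that by blast
      qed
      show "AE x in lebesgue. norm (G n x) \<le> (C * M') * indicator \<Omega> x" for n
      proof (intro AE_I2)
        fix x
        show "norm (G n x) \<le> (C * M') * indicator \<Omega> x"
        proof (cases "x \<in> ?S")
          case False
          then show ?thesis using test_function_zero(1)[OF t False] C(1) by (simp add: G_def M'_def)
        next
          case True
          from seg[OF True, of n] have "x - t n *\<^sub>R e \<in> \<Omega>" "x \<in> \<Omega>" by auto
          then have "\<bar>w1 (x - t n *\<^sub>R e) - w1 x\<bar> \<le> M' * t n" using lip'[OF seg[OF True, of n]] e tp(1)[of n] by (simp add: w1_def)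
          then have "\<bar>(w1 (x - t n *\<^sub>R e) - w1 x) / t n\<bar> \<le> M'" using tp(1)[of n] by (simp add: abs_divide divide_le_eq)
          then have "\<bar>G n x\<bar> \<le> C * M'" unfolding G_def abs_mult using C(1,2) by (intro mult_mono) auto
          then show ?thesis using \<open>x \<in> \<Omega>\<close> by simp
        qed
      qed
      have lim: "(\<lambda>n. G n x) \<longlonglongrightarrow> - (indicator \<Omega> x * (\<phi> x * (g x \<bullet> e)))" if x: "x \<in> \<Omega> \<longrightarrow> GDERIV w x :> g x" for x
      proof (cases "x \<in> ?S")
        case False
        then show ?thesis using test_function_zero(1)[OF t False] by (simp add: G_def)
      next
        case True
        then have xO: "x \<in> \<Omega>" using S by auto
        have "((\<lambda>s. w (x + s *\<^sub>R e)) has_real_derivative (e \<bullet> g x)) (at 0)"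
        proof -
          have "((\<lambda>s. w (x + s *\<^sub>R e)) has_derivative (\<lambda>s. (s *\<^sub>R e) \<bullet> g x)) (at 0)"
            by (rule has_derivative_compose[where f="\<lambda>s. x + s *\<^sub>R e" and g=w and g'="\<lambda>h. h \<bullet> g x"])
               (use x xO in \<open>auto simp: gderiv_def intro!: derivative_eq_intros\<close>)
          then show ?thesis by (simp add: has_field_derivative_def mult_commute_abs)
        qed
        then have "((\<lambda>s. (w (x + s *\<^sub>R e) - w x) / s) \<longlongrightarrow> e \<bullet> g x) (at 0)" by (simp add: DERIV_def)
        moreover have "filterlim (\<lambda>n. - t n) (at 0) sequentially"
          using tendsto_minus[OF t0] tp(1) by (intro filterlim_atI) (auto simp: less_imp_neq intro!: always_eventually simp: less_imp_neq[THEN not_sym])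
        ultimately have "(\<lambda>n. (w (x + (- t n) *\<^sub>R e) - w x) / (- t n)) \<longlonglongrightarrow> e \<bullet> g x" by (rule filterlim_compose)
        then have "(\<lambda>n. \<phi> x * (- ((w (x + (- t n) *\<^sub>R e) - w x) / (- t n)))) \<longlonglongrightarrow> \<phi> x * (- (e \<bullet> g x))"
          by (intro tendsto_intros)
        moreover have "\<phi> x * (- ((w (x + (- t n) *\<^sub>R e) - w x) / (- t n))) = G n x" for n
        proof -
          have "x - t n *\<^sub>R e \<in> \<Omega>" using seg[OF True, of n] by auto
          then show ?thesis using xO by (simp add: G_def w1_def)
        qed
        ultimately show ?thesis using xO by (simp add: inner_commute)
      qed
      show "AE x in lebesgue. (\<lambda>n. G n x) \<longlonglongrightarrow> - (indicator \<Omega> x * (\<phi> x * (g x \<bullet> e)))"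
        using g(2) unfolding lebesgue_on_AE[OF Os] by eventually_elim (rule lim)
    qed (rule domain_props)
    have "(LINT x|lebesgue. F n x) = (LINT x|lebesgue. G n x)" for n
      using FG[of n] Fm[of n] Gm[of n] by (simp add: integral_completion)
    then have "(LINT x|lebesgue. w1 x * (D x \<bullet> e)) = (LINT x|lebesgue. - (indicator \<Omega> x * (\<phi> x * (g x \<bullet> e))))"
      using Flim Glim LIMSEQ_unique by auto
    then show ?thesis unfolding lebesgue_on_integral[OF Os] w1_def by (simp add: mult.assoc)
  qed
  show "(LINT x|lebesgue_on \<Omega>. w x *\<^sub>R D x) = - (LINT x|lebesgue_on \<Omega>. \<phi> x *\<^sub>R g x)"
  proof (rule euclidean_eqI)
    fix e :: point assume "e \<in> Basis"
    then have "norm e = 1" by simp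
    from main[OF this] show "(LINT x|lebesgue_on \<Omega>. w x *\<^sub>R D x) \<bullet> e = - (LINT x|lebesgue_on \<Omega>. \<phi> x *\<^sub>R g x) \<bullet> e"
      using i1 i2 by (simp flip: integral_inner_left)
  qed
qed

lemma weak_gradient_poly:
  assumes "open \<Omega>" "bounded \<Omega>" "p \<in> polys k" "\<And>x. GDERIV p x :> D x" "continuous_on UNIV D"
  shows "weak_gradient \<Omega> p D"
proof -
  obtain R where R: "\<Omega> \<subseteq> cball 0 R" using assms(2) unfolding bounded_iff by (auto simp: subset_iff)
  have cp: "continuous_on UNIV p" using polys_continuous[OF assms(3)] .
  have "bounded (p ` cball 0 R)" "bounded (D ` cball 0 R)"
    using compact_imp_bounded[OF compact_continuous_image[OF continuous_on_subset[OF cp] compact_cball]]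
      compact_imp_bounded[OF compact_continuous_image[OF continuous_on_subset[OF assms(5)] compact_cball]] by auto
  then obtain B M where B: "\<And>x. x \<in> cball 0 R \<Longrightarrow> norm (p x) \<le> B" "\<And>x. x \<in> cball 0 R \<Longrightarrow> norm (D x) \<le> M"
    unfolding bounded_iff ball_simps by blast
  show ?thesis
  proof (rule weak_gradient_lipschitz[OF assms(1,2)])
    show "p \<in> borel_measurable borel" using cp by (rule borel_measurable_continuous_onI)
    show "\<bar>p x\<bar> \<le> B" if "x \<in> \<Omega>" for x using B(1)[of x] R that by auto
    show "\<bar>p x - p y\<bar> \<le> M * norm (x - y)" if s: "closed_segment x y \<subseteq> \<Omega>" for x y
    proof -
      have "norm (p x - p y) \<le> M * norm (x - y)"
      proof (rule differentiable_bound[of "closed_segment x y"])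
        show "(p has_derivative (\<lambda>h. h \<bullet> D z)) (at z within closed_segment x y)" for z
          using assms(4)[of z] unfolding gderiv_def by (rule has_derivative_at_withinI)
        show "onorm (\<lambda>h. h \<bullet> D z) \<le> M" if "z \<in> closed_segment x y" for z
          using B(2)[of z] R s that
          by (intro onorm_le) (metis Cauchy_Schwarz_ineq2 mult.commute mult_right_mono norm_ge_zero order_trans real_norm_def subsetD)
      qed auto
      then show ?thesis by simp
    qed
    show "D \<in> borel_measurable (lebesgue_on \<Omega>)"
      using borel_measurable_continuous_onI[OF assms(5)] by (intro measurable_restrict_space1 measurable_completion) auto
    show "AE x in lebesgue_on \<Omega>. GDERIV p x :> D x" using assms(4) by simp
  qed
qed

section \<open>Continuously differentiable bumps and uniqueness of the weak gradient\<close>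

definition pos_square :: "real \<Rightarrow> real" where "pos_square t = (max 0 t)\<^sup>2"

text \<open>The square is what makes the derivative continuous at 0, and test functions are asked to
  be C^1 only.\<close>

lemma pos_square_deriv: "(pos_square has_real_derivative 2 * max 0 t) (at t)"
proof (cases "t = 0")
  case True
  have "((\<lambda>h. (pos_square (0 + h) - pos_square 0) / h) \<longlongrightarrow> 0) (at 0)"
  proof (rule Lim_null_comparison)
    show "\<forall>\<^sub>F h in at 0. norm ((pos_square (0 + h) - pos_square 0) / h) \<le> \<bar>h\<bar>"
      by (intro always_eventually) (auto simp: pos_square_def max_def power2_eq_square)
    show "((\<lambda>h::real. \<bar>h\<bar>) \<longlongrightarrow> 0) (at 0)" using tendsto_rabs_zero[OF tendsto_ident_at] .
  qed
  then show ?thesis using True by (simp add: DERIV_def)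
next
  case False
  then consider "t > 0" | "t < 0" by linarith
  then show ?thesis
  proof cases
    case 1
    have "((\<lambda>t. t\<^sup>2) has_real_derivative 2 * t) (at t)" by (auto intro!: derivative_eq_intros)
    then have "(pos_square has_real_derivative 2 * t) (at t)"
      by (rule has_field_derivative_transform_within_open[of _ _ _ "{0<..}"]) (use 1 in \<open>auto simp: pos_square_def\<close>)
    then show ?thesis using 1 by simp
  next
    case 2
    have "((\<lambda>t. 0) has_real_derivative 0) (at t)" by simp
    then have "(pos_square has_real_derivative 0) (at t)"
      by (rule has_field_derivative_transform_within_open[of _ _ _ "{..<0}"]) (use 2 in \<open>auto simp: pos_square_def\<close>)
    then show ?thesis using 2 by simp
  qed
qed

lemma pos_square_ge0: "pos_square t \<ge> 0" and pos_square_zero_iff: "pos_square t = 0 \<longleftrightarrow> t \<le> 0"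
  by (auto simp: pos_square_def max_def)

lemma continuous_pos_square: "continuous_on A pos_square" unfolding pos_square_def[abs_def] by (intro continuous_intros)

lemma GDERIV_pos_square:
  assumes "GDERIV f x :> D" shows "GDERIV (\<lambda>x. pos_square (f x)) x :> (2 * max 0 (f x)) *\<^sub>R D"
  using GDERIV_DERIV_compose[OF assms pos_square_deriv] by simp

text \<open>f is positive exactly on the open box and f / C stays in [0, 1], so the powers of 1 - f
  / C tend to 0 inside the box and equal 1 outside.\<close>

lemma box_indicator_approx:
  fixes a b :: point
  assumes "a $ 1 < b $ 1" "a $ 2 < b $ 2" "cbox a b \<subseteq> U"
  obtains \<psi> D where "\<And>m. test_function U (\<psi> m) (D m)" "\<And>m x. \<bar>\<psi> m x\<bar> \<le> 1" "\<And>x. (\<lambda>m. \<psi> m x) \<longlonglongrightarrow> indicator (box a b) x"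
proof -
  define f where "f x = pos_square (x $ 1 - a $ 1) * pos_square (b $ 1 - x $ 1) * (pos_square (x $ 2 - a $ 2) * pos_square (b $ 2 - x $ 2))" for x :: point
  have gc: "GDERIV (\<lambda>x::point. x $ i - c) x :> axis i 1" "GDERIV (\<lambda>x::point. c - x $ i) x :> - axis i 1" for i c x
    unfolding gderiv_def
    by (auto intro!: derivative_eq_intros bounded_linear.has_derivative[OF bounded_linear_vec_nth] simp: inner_axis)
  have "\<exists>D. (\<forall>x. GDERIV f x :> D x) \<and> continuous_on UNIV D"
  proof (intro exI conjI allI)
    fix x show "GDERIV f x :> ((pos_square (x $ 1 - a $ 1) * pos_square (b $ 1 - x $ 1)) *\<^sub>R
        (pos_square (x $ 2 - a $ 2) *\<^sub>R ((2 * max 0 (b $ 2 - x $ 2)) *\<^sub>R (- axis 2 1)) + pos_square (b $ 2 - x $ 2) *\<^sub>R ((2 * max 0 (x $ 2 - a $ 2)) *\<^sub>R axis 2 1))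
      + (pos_square (x $ 2 - a $ 2) * pos_square (b $ 2 - x $ 2)) *\<^sub>R
        (pos_square (x $ 1 - a $ 1) *\<^sub>R ((2 * max 0 (b $ 1 - x $ 1)) *\<^sub>R (- axis 1 1)) + pos_square (b $ 1 - x $ 1) *\<^sub>R ((2 * max 0 (x $ 1 - a $ 1)) *\<^sub>R axis 1 1)))"
      unfolding f_def by (intro GDERIV_mult GDERIV_pos_square gc)
  qed (intro continuous_intros continuous_on_compose2[OF continuous_pos_square[of UNIV]] continuous_on_component; simp)
  then obtain Df where Df: "\<And>x. GDERIV f x :> Df x" "continuous_on UNIV Df" by blast
  have cf: "continuous_on UNIV f" unfolding f_def
    by (intro continuous_intros continuous_on_compose2[OF continuous_pos_square[of UNIV]] continuous_on_component) auto
  have f0: "0 \<le> f x" for x by (simp add: f_def pos_square_ge0)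
  have boxiff: "x \<in> box a b \<longleftrightarrow> a $ 1 < x $ 1 \<and> x $ 1 < b $ 1 \<and> a $ 2 < x $ 2 \<and> x $ 2 < b $ 2" for x
    by (auto simp: mem_box_cart forall_2)
  have fpos: "f x > 0 \<longleftrightarrow> x \<in> box a b" and fz: "f x = 0 \<longleftrightarrow> x \<notin> box a b" for x
  proof -
    show "f x = 0 \<longleftrightarrow> x \<notin> box a b" by (auto simp: f_def boxiff pos_square_zero_iff not_less)
    then show "f x > 0 \<longleftrightarrow> x \<in> box a b" using f0[of x] by (auto simp: less_le)
  qed
  obtain C where C: "C > 0" "\<And>x. f x \<le> C"
  proof -
    have "bounded (f ` cbox a b)" using compact_imp_bounded[OF compact_continuous_image[OF continuous_on_subset[OF cf] compact_cbox]] by auto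
    then obtain B where B: "\<And>x. x \<in> cbox a b \<Longrightarrow> norm (f x) \<le> B" by (auto simp: bounded_iff)
    have "f x \<le> \<bar>B\<bar> + 1" for x
      using B[of x] fz[of x] box_subset_cbox[of a b] by (cases "x \<in> box a b") (auto simp: subset_iff)
    then show ?thesis using that[of "\<bar>B\<bar> + 1"] by simp
  qed
  define \<psi> where "\<psi> m x = 1 - (1 - f x / C) ^ m" for m :: nat and x
  define D where "D m x = (real m * (1 - f x / C) ^ (m - 1) / C) *\<^sub>R Df x" for m :: nat and x
  have r: "0 \<le> 1 - f x / C" "1 - f x / C \<le> 1" for x using C f0[of x] by (auto simp: divide_le_eq)
  show ?thesis
  proof (rule that[of \<psi> D])
    fix m
    show "test_function U (\<psi> m) (D m)" unfolding test_function_def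
    proof (intro conjI allI)
      fix x
      have "((\<lambda>t. 1 - (1 - t / C) ^ m) has_real_derivative (real m * (1 - f x / C) ^ (m - 1) / C)) (at (f x))"
        using C by (auto intro!: derivative_eq_intros)
      from GDERIV_DERIV_compose[OF Df(1) this] show "GDERIV (\<psi> m) x :> D m x" by (simp add: \<psi>_def[abs_def] D_def)
    next
      show "continuous_on UNIV (D m)" unfolding D_def using C by (intro continuous_intros cf Df(2)) auto
      have "{x. \<psi> m x \<noteq> 0} \<subseteq> cbox a b"
      proof
        fix x assume "x \<in> {x. \<psi> m x \<noteq> 0}"
        then have "f x \<noteq> 0" by (auto simp: \<psi>_def)
        then show "x \<in> cbox a b" using fz box_subset_cbox by blast
      qed
      then have s: "closure {x. \<psi> m x \<noteq> 0} \<subseteq> cbox a b" by (simp add: closure_minimal closed_cbox)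
      then show "compact (closure {x. \<psi> m x \<noteq> 0})" by (meson bounded_cbox bounded_subset closed_closure compact_eq_bounded_closed)
      show "closure {x. \<psi> m x \<noteq> 0} \<subseteq> U" using s assms(3) by simp
    qed
    show "\<bar>\<psi> m x\<bar> \<le> 1" for x unfolding \<psi>_def using r[of x] by (simp add: power_le_one)
  next
    fix x
    show "(\<lambda>m. \<psi> m x) \<longlonglongrightarrow> indicator (box a b) x"
    proof (cases "x \<in> box a b")
      case True
      then have "f x / C > 0" using fpos C by simp
      then have "norm (1 - f x / C) < 1" using r[of x] unfolding real_norm_def by linarith
      then have "(\<lambda>m. (1 - f x / C) ^ m) \<longlonglongrightarrow> 0" by (rule LIMSEQ_power_zero)
      then have "(\<lambda>m. 1 - (1 - f x / C) ^ m) \<longlonglongrightarrow> 1 - 0" by (intro tendsto_diff tendsto_const)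
      then show ?thesis using True by (simp add: \<psi>_def)
    next
      case False
      then have "f x = 0" using fz by simp
      then show ?thesis using False by (simp add: \<psi>_def)
    qed
  qed
qed

text \<open>Box indicators are limits of bounded test functions, so the integrals of G over boxes
  vanish; Lebesgue differentiation then gives G = 0 almost everywhere.\<close>

lemma fundamental_lemma:
  fixes G :: "point \<Rightarrow> point"
  assumes U: "open U" and G: "integrable (lebesgue_on U) G"
    and z: "\<And>\<phi> D. test_function U \<phi> D \<Longrightarrow> (LINT x|lebesgue_on U. \<phi> x *\<^sub>R G x) = 0"
  shows "AE x in lebesgue_on U. G x = 0"
proof -
  have Us: "U \<in> sets lebesgue" using U by simp
  define F where "F x = indicator U x *\<^sub>R G x" for x
  have Fi: "integrable lebesgue F" using G unfolding lebesgue_on_integrable[OF Us] F_def[abs_def] .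
  have Fon: "F absolutely_integrable_on S" if "S \<in> sets lebesgue" for S
    unfolding set_integrable_def using that Fi by (rule integrable_mult_indicator)
  have zero: "integral (cbox a b) F = 0" if "a $ 1 < b $ 1" "a $ 2 < b $ 2" "cbox a b \<subseteq> U" for a b
  proof -
    note ab = that
    obtain \<psi> D where p: "\<And>m. test_function U (\<psi> m) (D m)" "\<And>m x. \<bar>\<psi> m x\<bar> \<le> 1" "\<And>x. (\<lambda>m. \<psi> m x) \<longlonglongrightarrow> indicator (box a b) x"
      using box_indicator_approx[OF ab] by blast
    have pm: "\<psi> m \<in> borel_measurable lebesgue" for m
    proof -
      obtain B where "continuous_on UNIV (\<psi> m)" using test_function_bounded[OF p(1)] by metis
      then show ?thesis by (intro measurable_completion) (simp add: borel_measurable_continuous_onI)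
    qed
    have "(\<lambda>m. LINT x|lebesgue. \<psi> m x *\<^sub>R F x) \<longlonglongrightarrow> (LINT x|lebesgue. indicator (box a b) x *\<^sub>R F x)"
    proof (rule integral_dominated_convergence[where w="\<lambda>x. norm (F x)"])
      show "(\<lambda>x. indicat_real (box a b) x *\<^sub>R F x) \<in> borel_measurable lebesgue"
        using Fi by (intro borel_measurable_scaleR borel_measurable_indicator) auto
      show "(\<lambda>x. \<psi> m x *\<^sub>R F x) \<in> borel_measurable lebesgue" for m using pm Fi by auto
      show "integrable lebesgue (\<lambda>x. norm (F x))" using Fi by simp
      show "AE x in lebesgue. (\<lambda>m. \<psi> m x *\<^sub>R F x) \<longlonglongrightarrow> indicator (box a b) x *\<^sub>R F x"
        by (intro AE_I2 tendsto_intros p(3))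
      show "AE x in lebesgue. norm (\<psi> m x *\<^sub>R F x) \<le> norm (F x)" for m
        using p(2) by (intro AE_I2) (simp add: mult_left_le_one_le)
    qed
    moreover have "(LINT x|lebesgue. \<psi> m x *\<^sub>R F x) = 0" for m
      using z[OF p(1)[of m]] unfolding lebesgue_on_integral[OF Us] F_def by (simp add: mult.commute)
    ultimately have "(LINT x|lebesgue. indicator (box a b) x *\<^sub>R F x) = 0" by (simp add: LIMSEQ_const_iff)
    then have "integral (box a b) F = 0"
      using set_lebesgue_integral_eq_integral(2)[OF Fon[of "box a b"]] by (simp add: set_lebesgue_integral_def)
    then show ?thesis using integral_open_interval by metis
  qed
  have "F integrable_on cbox a b" for a b using Fon[of "cbox a b"] set_lebesgue_integral_eq_integral(1) by auto
  \<comment> \<open>Lebesgue's differentiation theorem, over squares with lower left corner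
    x.\<close>
  from integrable_ccontinuous_explicit[OF this] obtain N where N: "negligible N"
    "\<And>x e. x \<notin> N \<Longrightarrow> 0 < e \<Longrightarrow> \<exists>d>0. \<forall>h. 0 < h \<and> h < d \<longrightarrow> norm (integral (cbox x (x + h *\<^sub>R One)) F /\<^sub>R h ^ DIM(point) - F x) < e"
    by metis
  have Fz: "F x = 0" if x: "x \<in> U" "x \<notin> N" for x
  proof -
    have "norm (F x) < e" if e: "e > 0" for e
    proof -
      obtain d where d: "d > 0" "\<And>h. 0 < h \<and> h < d \<Longrightarrow> norm (integral (cbox x (x + h *\<^sub>R One)) F /\<^sub>R h ^ DIM(point) - F x) < e"
        using N(2)[OF x(2) e] by blast
      obtain r where r: "r > 0" "ball x r \<subseteq> U" using U x openE by blast
      \<comment> \<open>A square of side below r / 2 has all its points within distance r of the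
        corner x.\<close>
      define h where "h = min (d / 2) (r / 4)"
      have h: "0 < h" "h < d" "h < r / 2" using d r by (auto simp: h_def)
      have O1: "(One::point) $ 1 = 1" "(One::point) $ 2 = 1"
        unfolding cart_eq_inner_axis by (simp_all add: inner_sum_left_Basis axis_in_Basis_iff)
      have "cbox x (x + h *\<^sub>R One) \<subseteq> ball x r"
      proof
        fix y assume "y \<in> cbox x (x + h *\<^sub>R One)"
        then have "\<bar>y $ 1 - x $ 1\<bar> \<le> h" "\<bar>y $ 2 - x $ 2\<bar> \<le> h" using O1 by (auto simp: mem_box_cart forall_2)
        then have "norm (y - x) \<le> h + h" using norm_le_l1_cart[of "y - x"] by (simp add: sum_2)
        then show "y \<in> ball x r" using h by (simp add: dist_norm norm_minus_commute)
      qed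
      then have "cbox x (x + h *\<^sub>R One) \<subseteq> U" using r by auto
      then have "integral (cbox x (x + h *\<^sub>R One)) F = 0" using zero[of x "x + h *\<^sub>R One"] h O1 by simp
      then show ?thesis using d(2)[of h] h by simp
    qed
    then show ?thesis by (metis less_irrefl zero_less_norm_iff)
  qed
  have "AE x in lebesgue. x \<notin> N"
    using N(1) unfolding negligible_iff_null_sets by (rule AE_not_in)
  then show ?thesis unfolding lebesgue_on_AE[OF Us]
    by eventually_elim (use Fz in \<open>auto simp: F_def\<close>)
qed

text \<open>A test function supported in U is one for \<Omega> as well, so on U both fields
  represent the weak gradient of the same function, and their difference integrates to 0 against
  every test function.\<close>

lemma weak_gradient_local_unique:
  assumes O: "open \<Omega>" "bounded \<Omega>" and U: "open U" "U \<subseteq> \<Omega>"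
    and g: "integrable (lebesgue_on \<Omega>) g" "weak_gradient \<Omega> v g"
    and q: "integrable (lebesgue_on U) q" "weak_gradient U p q"
    and vp: "AE x in lebesgue. x \<in> U \<longrightarrow> v x = p x"
    and v: "v \<in> borel_measurable (lebesgue_on \<Omega>)" and p: "p \<in> borel_measurable borel"
  shows "AE x in lebesgue. x \<in> U \<longrightarrow> g x = q x"
proof -
  have Os: "\<Omega> \<in> sets lebesgue" and Us: "U \<in> sets lebesgue" using O U by auto
  have gU: "integrable (lebesgue_on U) g"
  proof -
    have "(\<lambda>x. indicat_real U x *\<^sub>R indicat_real \<Omega> x *\<^sub>R g x) = (\<lambda>x. indicat_real U x *\<^sub>R g x)"
      using U(2) by (auto simp: indicator_def fun_eq_iff)
    then show ?thesis
      using integrable_mult_indicator[OF Us g(1)[unfolded lebesgue_on_integrable[OF Os]]]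
      unfolding lebesgue_on_integrable[OF Us] by simp
  qed
  have "AE x in lebesgue_on U. g x - q x = 0"
  proof (rule fundamental_lemma[OF U(1)])
    show "integrable (lebesgue_on U) (\<lambda>x. g x - q x)" using gU q by simp
    fix \<phi> D assume t: "test_function U \<phi> D"
    then have t': "test_function \<Omega> \<phi> D" using U(2) by (auto simp: test_function_def)
    note z = test_function_outside[OF t]
    obtain B where B: "B \<ge> 0" "\<And>x. \<bar>\<phi> x\<bar> \<le> B" "continuous_on UNIV \<phi>" using test_function_bounded[OF t] by metis
    have \<phi>m: "\<phi> \<in> borel_measurable (lebesgue_on S)" for S
      using borel_measurable_continuous_onI[OF B(3)] by (intro measurable_restrict_space1 measurable_completion) auto
    have int: "integrable (lebesgue_on S) (\<lambda>x. \<phi> x *\<^sub>R f x)" if "integrable (lebesgue_on S) f" for S and f :: "point \<Rightarrow> point"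
    proof (rule Bochner_Integration.integrable_bound[of _ "\<lambda>x. B *\<^sub>R f x"])
      show "integrable (lebesgue_on S) (\<lambda>x. B *\<^sub>R f x)" using that by simp
      show "(\<lambda>x. \<phi> x *\<^sub>R f x) \<in> borel_measurable (lebesgue_on S)" using \<phi>m that by auto
      show "AE x in lebesgue_on S. norm (\<phi> x *\<^sub>R f x) \<le> norm (B *\<^sub>R f x)"
        using B by (intro AE_I2) (auto intro!: mult_right_mono)
    qed
    have r: "(LINT x|lebesgue_on \<Omega>. h x) = (LINT x|lebesgue_on U. h x)" if "\<And>x. x \<notin> U \<Longrightarrow> h x = 0" for h :: "point \<Rightarrow> point"
      unfolding lebesgue_on_integral[OF Os] lebesgue_on_integral[OF Us]
      by (intro Bochner_Integration.integral_cong refl) (use that U(2) in \<open>auto simp: indicator_def\<close>)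
    have "(LINT x|lebesgue_on U. \<phi> x *\<^sub>R g x) = (LINT x|lebesgue_on \<Omega>. \<phi> x *\<^sub>R g x)" by (rule r[symmetric]) (simp add: z)
    also have "\<dots> = - (LINT x|lebesgue_on \<Omega>. v x *\<^sub>R D x)" using g(2) t' by (simp add: weak_gradient_def)
    also have "(LINT x|lebesgue_on \<Omega>. v x *\<^sub>R D x) = (LINT x|lebesgue_on U. v x *\<^sub>R D x)" by (rule r) (simp add: z)
    also have "\<dots> = (LINT x|lebesgue_on U. p x *\<^sub>R D x)"
      unfolding lebesgue_on_integral[OF Us]
    proof (rule integral_cong_AE)
      obtain B' where "continuous_on UNIV D" using test_function_bounded[OF t] by metis
      then have Dm: "D \<in> borel_measurable lebesgue" by (intro measurable_completion) (simp add: borel_measurable_continuous_onI)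
      have "(\<lambda>x. indicator \<Omega> x *\<^sub>R v x) \<in> borel_measurable lebesgue"
        using v by (subst (asm) borel_measurable_restrict_space_iff) (use Os in auto)
      then have "(\<lambda>x. (indicator U x * (indicator \<Omega> x *\<^sub>R v x)) *\<^sub>R D x) \<in> borel_measurable lebesgue"
        using Us Dm by simp
      moreover have "(\<lambda>x. (indicat_real U x * (indicator \<Omega> x *\<^sub>R v x)) *\<^sub>R D x) = (\<lambda>x. indicator U x *\<^sub>R v x *\<^sub>R D x)"
        using U(2) by (auto simp: fun_eq_iff indicator_def)
      ultimately show "(\<lambda>x. indicat_real U x *\<^sub>R v x *\<^sub>R D x) \<in> borel_measurable lebesgue" by simp
      show "(\<lambda>x. indicat_real U x *\<^sub>R p x *\<^sub>R D x) \<in> borel_measurable lebesgue"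
        using Us Dm measurable_completion[of p lborel borel] p by simp
      show "AE x in lebesgue. indicator U x *\<^sub>R v x *\<^sub>R D x = indicator U x *\<^sub>R p x *\<^sub>R D x"
        using vp by eventually_elim (auto simp: indicator_def)
    qed
    also have "- \<dots> = (LINT x|lebesgue_on U. \<phi> x *\<^sub>R q x)" using q(2) t by (simp add: weak_gradient_def)
    finally have "(LINT x|lebesgue_on U. \<phi> x *\<^sub>R g x) = (LINT x|lebesgue_on U. \<phi> x *\<^sub>R q x)" .
    then show "(LINT x|lebesgue_on U. \<phi> x *\<^sub>R (g x - q x)) = 0"
      using int[OF gU] int[OF q(1)] by (simp add: scaleR_diff_right)
  qed
  then show ?thesis unfolding lebesgue_on_AE[OF Us] by simp
qed

lemma radial_test_function:
  fixes z :: point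
  assumes "e > 0" "cball z e \<subseteq> \<Omega>"
  shows "test_function \<Omega> (\<lambda>x. pos_square (1 - (norm (x - z))\<^sup>2 / e\<^sup>2)) (\<lambda>x. (- 4 / e\<^sup>2 * max 0 (1 - (norm (x - z))\<^sup>2 / e\<^sup>2)) *\<^sub>R (x - z))"
  unfolding test_function_def
proof (intro conjI allI)
  fix x
  have "GDERIV (\<lambda>x. 1 - (norm (x - z))\<^sup>2 / e\<^sup>2) x :> (- 2 / e\<^sup>2) *\<^sub>R (x - z)"
    unfolding gderiv_def power2_norm_eq_inner using assms(1)
    by (auto intro!: derivative_eq_intros simp: fun_eq_iff inner_commute field_simps inner_diff_left inner_diff_right)
  from GDERIV_pos_square[OF this] show "GDERIV (\<lambda>x. pos_square (1 - (norm (x - z))\<^sup>2 / e\<^sup>2)) x :> (- 4 / e\<^sup>2 * max 0 (1 - (norm (x - z))\<^sup>2 / e\<^sup>2)) *\<^sub>R (x - z)"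
    by (simp add: mult_ac)
next
  show "continuous_on UNIV (\<lambda>x. (- 4 / e\<^sup>2 * max 0 (1 - (norm (x - z))\<^sup>2 / e\<^sup>2)) *\<^sub>R (x - z))"
    using assms(1) by (intro continuous_intros) auto
  have "{x. pos_square (1 - (norm (x - z))\<^sup>2 / e\<^sup>2) \<noteq> 0} \<subseteq> cball z e"
  proof
    fix x assume "x \<in> {x. pos_square (1 - (norm (x - z))\<^sup>2 / e\<^sup>2) \<noteq> 0}"
    then have "\<not> 1 - (norm (x - z))\<^sup>2 / e\<^sup>2 \<le> 0" unfolding pos_square_zero_iff[symmetric] by simp
    then have "(norm (x - z))\<^sup>2 < e\<^sup>2" using assms(1) by (simp add: le_divide_eq del: power_mono_iff)
    then have "norm (x - z) < e" using assms(1) by (intro power2_less_imp_less[of "norm (x - z)" e]) auto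
    then show "x \<in> cball z e" by (simp add: dist_norm norm_minus_commute)
  qed
  then have s: "closure {x. pos_square (1 - (norm (x - z))\<^sup>2 / e\<^sup>2) \<noteq> 0} \<subseteq> cball z e" by (simp add: closure_minimal)
  then show "compact (closure {x. pos_square (1 - (norm (x - z))\<^sup>2 / e\<^sup>2) \<noteq> 0})"
    by (meson bounded_cball bounded_subset closed_closure compact_eq_bounded_closed)
  show "closure {x. pos_square (1 - (norm (x - z))\<^sup>2 / e\<^sup>2) \<noteq> 0} \<subseteq> \<Omega>" using s assms(2) by blast
qed

text \<open>No line integral is needed here: for a radial bump \<open>\<eta>\<close> the integral of \<open>- \<nabla>\<eta> \<bullet> n\<close> over the half
  disc is positive because the integrand is, and by scaling it is of order \<open>\<epsilon>\<close>, whereas all other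
  terms are of order \<open>\<epsilon>\<^sup>2\<close>.\<close>

lemma one_sided_jump:
  fixes z n :: point
  assumes O: "open \<Omega>" "bounded \<Omega>" and z: "ball z r \<subseteq> \<Omega>" "r > 0" and n: "norm n = 1"
    and PQ: "P \<in> polys k" "Q \<in> polys k" "\<And>x. GDERIV P x :> DP x" "\<And>x. GDERIV Q x :> DQ x"
      "continuous_on UNIV DP" "continuous_on UNIV DQ"
    and g: "integrable (lebesgue_on \<Omega>) g" "integrable (lebesgue_on \<Omega>) v" "weak_gradient \<Omega> v g"
    and ae: "AE x in lebesgue. x \<in> ball z r \<longrightarrow> 0 < (x - z) \<bullet> n \<longrightarrow> v x = P x \<and> g x = DP x"
      "AE x in lebesgue. x \<in> ball z r \<longrightarrow> (x - z) \<bullet> n < 0 \<longrightarrow> v x = Q x \<and> g x = DQ x"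
  shows "P z \<le> Q z"
proof (rule ccontr)
  assume "\<not> P z \<le> Q z"
  define d where "d = P z - Q z"
  have d: "d > 0" using \<open>\<not> P z \<le> Q z\<close> by (simp add: d_def)
  have Os: "\<Omega> \<in> sets lebesgue" using O by auto
  have Ol: "\<Omega> \<in> lmeasurable" using O by (simp add: bounded_set_imp_lmeasurable)
  define H where "H = {x. 0 < (x - z) \<bullet> n}"
  have Ho: "open H" unfolding H_def by (intro open_Collect_less continuous_intros)
  have "bounded ((\<lambda>x. DP x - DQ x) ` cball z r)"
    by (intro compact_imp_bounded compact_continuous_image continuous_on_diff compact_cball continuous_on_subset[OF PQ(5)] continuous_on_subset[OF PQ(6)]) auto
  \<comment> \<open>M bounds the jump of the gradient across the line.\<close>
  then obtain M where M: "\<And>x. x \<in> cball z r \<Longrightarrow> norm (DP x - DQ x) \<le> M" unfolding bounded_iff ball_simps by blast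
  have M0: "M \<ge> 0" using M[of z] z(2) norm_ge_zero order_trans by (meson centre_in_cball less_imp_le)
  have "isCont (\<lambda>x. P x - Q x) z"
    using polys_continuous[OF PQ(1), of UNIV] polys_continuous[OF PQ(2), of UNIV]
    by (intro continuous_intros) (simp_all add: continuous_on_eq_continuous_at)
  then obtain \<delta> where \<delta>: "\<delta> > 0" "\<And>x. dist x z < \<delta> \<Longrightarrow> dist (P x - Q x) (P z - Q z) < d / 2"
    unfolding continuous_at using d by (metis (no_types, lifting) LIM_def \<open>isCont (\<lambda>x. P x - Q x) z\<close> dist_self half_gt_zero isCont_def)
  \<comment> \<open>The first bound keeps P - Q above d / 2, the second keeps the ball inside
    \<Omega>, and the third makes e M smaller than 7 d / 512, the number that the comparison of
    areas at the end produces.\<close>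
  define e where "e = min (min (\<delta> / 2) (r / 2)) (d / (200 * (M + 1)))"
  have e: "e > 0" "e < \<delta>" "e < r" "e \<le> d / (200 * (M + 1))" using \<delta> z(2) d M0 by (auto simp: e_def)
  have eM: "e * M < d * 7 / 512"
  proof -
    have "e * (200 * (M + 1)) \<le> d" using e(4) M0 by (simp add: pos_le_divide_eq)
    then have "e * M \<le> d / 200 - e" by (simp add: algebra_simps)
    then show ?thesis using d e by linarith
  qed
  have cb: "cball z e \<subseteq> \<Omega>" using e z by (auto simp: subset_iff)
  define \<rho> where "\<rho> x = 1 - (norm (x - z))\<^sup>2 / e\<^sup>2" for x
  define \<eta> where "\<eta> x = pos_square (\<rho> x)" for x
  define D where "D x = (- 4 / e\<^sup>2 * max 0 (\<rho> x)) *\<^sub>R (x - z)" for x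
  have t: "test_function \<Omega> \<eta> D" unfolding \<eta>_def[abs_def] D_def[abs_def] \<rho>_def by (rule radial_test_function[OF e(1) cb])
  obtain C where C: "C \<ge> 0" "\<And>x. \<bar>\<eta> x\<bar> \<le> C" "\<And>x. norm (D x) \<le> C" "continuous_on UNIV \<eta>" "continuous_on UNIV D"
    using test_function_bounded[OF t] by metis
  have out: "\<rho> x \<le> 0" if "x \<notin> ball z e" for x
  proof -
    have "e\<^sup>2 \<le> (norm (x - z))\<^sup>2" using that e(1) by (intro power_mono) (auto simp: dist_norm norm_minus_commute)
    then show ?thesis using e(1) by (simp add: \<rho>_def le_divide_eq)
  qed
  have eta1: "0 \<le> \<eta> x" "\<eta> x \<le> 1" for x
  proof -
    have "\<rho> x \<le> 1" by (simp add: \<rho>_def)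
    then show "0 \<le> \<eta> x" "\<eta> x \<le> 1" by (auto simp: \<eta>_def pos_square_def max_def power_le_one)
  qed
  have mC: "\<eta> \<in> borel_measurable (lebesgue_on \<Omega>)" "D \<in> borel_measurable (lebesgue_on \<Omega>)"
    using borel_measurable_continuous_onI[OF C(4)] borel_measurable_continuous_onI[OF C(5)]
    by (auto intro!: measurable_restrict_space1 measurable_completion)
  have Qc: "continuous_on UNIV Q" by (rule polys_continuous[OF PQ(2)])
  have clO: "compact (closure \<Omega>)" using O(2) by (simp add: compact_closure)
  have onO: "integrable (lebesgue_on \<Omega>) f" if "continuous_on UNIV f" for f :: "point \<Rightarrow> 'b::euclidean_space"
  proof -
    have i: "integrable (lebesgue_on (closure \<Omega>)) f" using integrable_on_compact[OF clO continuous_on_subset[OF that]] by simp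
    have "closure \<Omega> \<in> sets lebesgue" by simp
    then have "integrable lebesgue (\<lambda>x. indicator \<Omega> x *\<^sub>R (indicator (closure \<Omega>) x *\<^sub>R f x))"
      using integrable_mult_indicator[OF Os] i lebesgue_on_integrable by blast
    moreover have "(\<lambda>x. indicator \<Omega> x *\<^sub>R (indicator (closure \<Omega>) x *\<^sub>R f x)) = (\<lambda>x. indicator \<Omega> x *\<^sub>R f x)"
      using closure_subset[of \<Omega>] by (auto simp: indicator_def fun_eq_iff)
    ultimately show ?thesis unfolding lebesgue_on_integrable[OF Os] by simp
  qed
  have iD: "integrable (lebesgue_on \<Omega>) (\<lambda>x. f x *\<^sub>R D x)" if "integrable (lebesgue_on \<Omega>) f" for f :: "point \<Rightarrow> real"
  proof (rule Bochner_Integration.integrable_bound[of _ "\<lambda>x. C * f x"])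
    show "AE x in lebesgue_on \<Omega>. norm (f x *\<^sub>R D x) \<le> norm (C * f x)"
      using C(1,3) by (intro AE_I2) (auto simp: abs_mult mult.commute[of C] intro!: mult_left_mono)
  qed (use that mC in auto)
  have ie: "integrable (lebesgue_on \<Omega>) (\<lambda>x. \<eta> x *\<^sub>R f x)" if "integrable (lebesgue_on \<Omega>) f" for f :: "point \<Rightarrow> point"
  proof (rule Bochner_Integration.integrable_bound[of _ f])
    show "AE x in lebesgue_on \<Omega>. norm (\<eta> x *\<^sub>R f x) \<le> norm (f x)"
      using eta1 by (intro AE_I2) (auto simp: mult_left_le_one_le)
  qed (use that mC in auto)
  \<comment> \<open>Q is smooth on all of \<Omega>; subtracting it leaves P - Q on one half disc and
    0 on the other.\<close>
  have wQ: "weak_gradient \<Omega> Q DQ" by (rule weak_gradient_poly[OF O PQ(2,4,6)])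
  have "(LINT x|lebesgue_on \<Omega>. (v x - Q x) *\<^sub>R D x) = (LINT x|lebesgue_on \<Omega>. v x *\<^sub>R D x) - (LINT x|lebesgue_on \<Omega>. Q x *\<^sub>R D x)"
    using iD[OF g(2)] iD[OF onO[OF Qc]] by (simp add: scaleR_diff_left)
  also have "\<dots> = - ((LINT x|lebesgue_on \<Omega>. \<eta> x *\<^sub>R g x) - (LINT x|lebesgue_on \<Omega>. \<eta> x *\<^sub>R DQ x))"
    using g(3) wQ t by (simp add: weak_gradient_def)
  also have "\<dots> = - (LINT x|lebesgue_on \<Omega>. \<eta> x *\<^sub>R (g x - DQ x))"
    using ie[OF g(1)] ie[OF onO[OF PQ(6)]] by (simp add: scaleR_diff_right)
  finally have eq0: "(LINT x|lebesgue_on \<Omega>. (v x - Q x) *\<^sub>R D x) = - (LINT x|lebesgue_on \<Omega>. \<eta> x *\<^sub>R (g x - DQ x))" .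
  have j1: "integrable (lebesgue_on \<Omega>) (\<lambda>x. (v x - Q x) *\<^sub>R D x)" using g(2) onO[OF Qc] by (intro iD) simp
  have j2: "integrable (lebesgue_on \<Omega>) (\<lambda>x. \<eta> x *\<^sub>R (g x - DQ x))" using g(1) onO[OF PQ(6)] by (intro ie) simp
  define L where "L x = (v x - Q x) * (- (D x \<bullet> n))" for x
  define R where "R x = \<eta> x * ((g x - DQ x) \<bullet> n)" for x
  have eq: "(LINT x|lebesgue_on \<Omega>. L x) = (LINT x|lebesgue_on \<Omega>. R x)"
  proof -
    have "(LINT x|lebesgue_on \<Omega>. L x) = - ((LINT x|lebesgue_on \<Omega>. (v x - Q x) *\<^sub>R D x) \<bullet> n)"
      unfolding L_def using j1 by (simp flip: integral_inner_left)
    also have "\<dots> = (LINT x|lebesgue_on \<Omega>. R x)"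
      unfolding R_def eq0 using j2 by (simp flip: integral_inner_left)
    finally show ?thesis .
  qed
  have Li: "integrable (lebesgue_on \<Omega>) L" unfolding L_def using integrable_inner_left[OF j1, of n] by (simp add: integrable_minus)
  have Ri: "integrable (lebesgue_on \<Omega>) R" unfolding R_def using integrable_inner_left[OF j2, of n] by simp
  \<comment> \<open>A disc in the half disc on which the bump is steep: its points are within 3 e /
    4 of z, so \<rho> is at least 7/16, and at least e / 4 away from the line.\<close>
  define B where "B = ball (z + (e / 2) *\<^sub>R n) (e / 4)"
  have Bm: "B \<in> lmeasurable" "B \<subseteq> \<Omega>" and B: "x \<in> B \<Longrightarrow> x \<in> ball z e \<and> 7 / 16 \<le> \<rho> x \<and> e / 4 \<le> (x - z) \<bullet> n" for x
  proof -
    show "B \<in> lmeasurable" by (simp add: B_def)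
    show *: "x \<in> ball z e \<and> 7 / 16 \<le> \<rho> x \<and> e / 4 \<le> (x - z) \<bullet> n" if "x \<in> B" for x
    proof -
      define y where "y = x - (z + (e / 2) *\<^sub>R n)"
      have y: "norm y < e / 4" using that by (simp add: B_def y_def dist_norm norm_minus_commute)
      have xz: "x - z = (e / 2) *\<^sub>R n + y" by (simp add: y_def)
      have "norm (x - z) \<le> e / 2 + norm y" unfolding xz using norm_triangle_ineq[of "(e / 2) *\<^sub>R n" y] n e(1) by simp
      then have n34: "norm (x - z) \<le> 3 / 4 * e" using y by simp
      have "(norm (x - z))\<^sup>2 \<le> (3 / 4 * e)\<^sup>2" using n34 by (intro power_mono) auto
      then have "(norm (x - z))\<^sup>2 / e\<^sup>2 \<le> 9 / 16" using e(1) by (simp add: divide_le_eq power_mult_distrib power_divide)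
      moreover have "\<bar>y \<bullet> n\<bar> \<le> norm y" using Cauchy_Schwarz_ineq2[of y n] n by simp
      then have "(x - z) \<bullet> n \<ge> e / 2 - e / 4"
        unfolding xz using y n by (simp add: inner_add_left power2_norm_eq_inner[symmetric])
      moreover have "x \<in> ball z e" using n34 e(1) by (simp add: dist_norm norm_minus_commute)
      ultimately show ?thesis by (simp add: \<rho>_def)
    qed
    then have "B \<subseteq> ball z e" by blast
    then show "B \<subseteq> \<Omega>" using cb ball_subset_cball by blast
  qed
  have hyper: "AE x in lebesgue. (x - z) \<bullet> n \<noteq> 0"
  proof -
    have "negligible {x. n \<bullet> x = n \<bullet> z}" using n by (intro negligible_hyperplane) auto
    then have "AE x in lebesgue. x \<notin> {x. n \<bullet> x = n \<bullet> z}" unfolding negligible_iff_null_sets by (rule AE_not_in)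
    then show ?thesis by eventually_elim (auto simp: inner_diff_left inner_diff_right inner_commute)
  qed
  \<comment> \<open>A lower bound for L on B: half the jump times the smallest slope of the bump
    there.\<close>
  define q where "q = d / 2 * (4 / e\<^sup>2 * (7 / 16) * (e / 4))"
  have Dn: "- (D x \<bullet> n) = 4 / e\<^sup>2 * max 0 (\<rho> x) * ((x - z) \<bullet> n)" for x by (simp add: D_def)
  have Lge: "AE x in lebesgue_on \<Omega>. q * indicator B x \<le> L x"
    unfolding lebesgue_on_AE[OF Os] using ae(1) ae(2) hyper
  proof eventually_elim
    case (elim x)
    show ?case
    proof (intro impI)
      assume xO: "x \<in> \<Omega>"
      show "q * indicator B x \<le> L x"
      proof (cases "x \<in> ball z e")
        case False
        then have "L x = 0" using out[of x] by (simp add: L_def Dn)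
        moreover have "x \<notin> B" using B False by blast
        ultimately show ?thesis by simp
      next
        case True
        then have xr: "x \<in> ball z r" using e by auto
        show ?thesis
        proof (cases "0 < (x - z) \<bullet> n")
          case False
          then have "v x = Q x" using elim xr by (smt (verit))
          then have "L x = 0" by (simp add: L_def)
          moreover have "x \<notin> B" using B False e by fastforce
          ultimately show ?thesis by simp
        next
          case pos: True
          have "v x - Q x \<ge> d / 2"
          proof -
            have "dist x z < \<delta>" using True e by (simp add: dist_commute)
            from \<delta>(2)[OF this] have "\<bar>(P x - Q x) - d\<bar> < d / 2" by (simp add: d_def dist_real_def)
            then show ?thesis using elim xr pos by (smt (verit) field_sum_of_halves)
          qed
          show ?thesis
          proof (cases "x \<in> B")
            case True
            have "4 / e\<^sup>2 * (7 / 16) * (e / 4) \<le> - (D x \<bullet> n)"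
              unfolding Dn using B[OF True] e(1) by (intro mult_mono) auto
            then have "q \<le> L x" unfolding q_def L_def using \<open>v x - Q x \<ge> d / 2\<close> d e(1) by (intro mult_mono) auto
            then show ?thesis using True by simp
          next
            case False
            have "0 \<le> - (D x \<bullet> n)" unfolding Dn using pos e(1) by simp
            then have "0 \<le> L x" unfolding L_def using \<open>v x - Q x \<ge> d / 2\<close> d by (intro mult_nonneg_nonneg) auto
            then show ?thesis using False by simp
          qed
        qed
      qed
    qed
  qed
  have Rle: "AE x in lebesgue_on \<Omega>. R x \<le> M * indicator (ball z e) x"
    unfolding lebesgue_on_AE[OF Os] using ae(1) ae(2) hyper
  proof eventually_elim
    case (elim x)
    show ?case
    proof (intro impI)
      assume xO: "x \<in> \<Omega>"
      show "R x \<le> M * indicator (ball z e) x"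
      proof (cases "x \<in> ball z e")
        case False
        then have "\<eta> x = 0" using out[of x] by (simp add: \<eta>_def pos_square_zero_iff)
        then show ?thesis using False by (simp add: R_def)
      next
        case True
        then have xr: "x \<in> ball z r" using e by auto
        have "norm (g x - DQ x) \<le> M"
        proof (cases "0 < (x - z) \<bullet> n")
          case True
          then have "g x = DP x" using elim xr by simp
          then show ?thesis using M[of x] xr by simp
        next
          case False
          then have "g x = DQ x" using elim xr by (smt (verit))
          then show ?thesis using M0 by simp
        qed
        then have "(g x - DQ x) \<bullet> n \<le> M" using Cauchy_Schwarz_ineq2[of "g x - DQ x" n] n by simp
        then have "R x \<le> \<eta> x * M" unfolding R_def using eta1(1)[of x] by (rule mult_left_mono)
        also have "\<dots> \<le> 1 * M" using eta1(2)[of x] M0 by (rule mult_right_mono)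
        finally have "R x \<le> 1 * M" .
        then show ?thesis using True by simp
      qed
    qed
  qed
  have ind: "integrable (lebesgue_on \<Omega>) (\<lambda>x. c * indicator S x :: real)" "(LINT x|lebesgue_on \<Omega>. c * indicator S x) = c * measure lebesgue S"
    if "S \<in> lmeasurable" "S \<subseteq> \<Omega>" for c S
  proof -
    have "(\<lambda>x. indicator \<Omega> x *\<^sub>R (c * indicator S x)) = (\<lambda>x. c * indicat_real S x)" using that(2) by (auto simp: indicator_def fun_eq_iff)
    moreover have "integrable lebesgue (\<lambda>x. c * indicat_real S x)" "(LINT x|lebesgue. c * indicat_real S x) = c * measure lebesgue S"
      using that(1) by (auto simp: fmeasurable_def intro!: integrable_mult_right integrable_real_indicator)
    ultimately show "integrable (lebesgue_on \<Omega>) (\<lambda>x. c * indicator S x :: real)" "(LINT x|lebesgue_on \<Omega>. c * indicator S x) = c * measure lebesgue S"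
      unfolding lebesgue_on_integrable[OF Os] lebesgue_on_integral[OF Os] by simp_all
  qed
  have "q * measure lebesgue B \<le> (LINT x|lebesgue_on \<Omega>. L x)"
    using integral_mono_AE[OF ind(1)[OF Bm] Li Lge] unfolding ind(2)[OF Bm] .
  also have "\<dots> \<le> M * measure lebesgue (ball z e)"
  proof -
    have bz: "ball z e \<in> lmeasurable" "ball z e \<subseteq> \<Omega>" using cb ball_subset_cball by auto
    show ?thesis unfolding eq using integral_mono_AE[OF Ri ind(1)[OF bz] Rle] unfolding ind(2)[OF bz] .
  qed
  finally have finite_mesh: "q * measure lebesgue B \<le> M * measure lebesgue (ball z e)" .
  have mB: "measure lebesgue B = pi * (e / 4)\<^sup>2" "measure lebesgue (ball z e) = pi * e\<^sup>2"
    using e(1) unfolding B_def by (simp_all add: content_ball unit_ball_vol_2)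
  have "q * (pi * (e / 4)\<^sup>2) = (d * 7 / 512 / e) * (pi * e\<^sup>2)" using e(1) by (simp add: q_def power2_eq_square field_simps)
  then have "(d * 7 / 512 / e) * (pi * e\<^sup>2) \<le> M * (pi * e\<^sup>2)" using finite_mesh mB by simp
  then have "d * 7 / 512 / e \<le> M" by (rule mult_right_le_imp_le) (use e(1) in simp)
  then have "d * 7 / 512 \<le> e * M" using e(1) by (simp add: pos_divide_le_eq mult.commute)
  then show False using eM by simp
qed

text \<open>The one-sided inequality is applied twice, the second time with the two sides and the
  normal reversed.\<close>

lemma no_jump:
  fixes z n :: point
  assumes "open \<Omega>" "bounded \<Omega>" "ball z r \<subseteq> \<Omega>" "r > 0" "norm n = 1"
    "P \<in> polys k" "Q \<in> polys k" "\<And>x. GDERIV P x :> DP x" "\<And>x. GDERIV Q x :> DQ x"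
      "continuous_on UNIV DP" "continuous_on UNIV DQ"
    "integrable (lebesgue_on \<Omega>) g" "integrable (lebesgue_on \<Omega>) v" "weak_gradient \<Omega> v g"
    "AE x in lebesgue. x \<in> ball z r \<longrightarrow> 0 < (x - z) \<bullet> n \<longrightarrow> v x = P x \<and> g x = DP x"
    "AE x in lebesgue. x \<in> ball z r \<longrightarrow> (x - z) \<bullet> n < 0 \<longrightarrow> v x = Q x \<and> g x = DQ x"
  shows "P z = Q z"
proof (rule antisym)
  show "P z \<le> Q z" by (rule one_sided_jump[OF assms(1-5) assms(6-16)])
  show "Q z \<le> P z"
    by (rule one_sided_jump[OF assms(1-4) _ assms(7,6,9,8,11,10,12,13,14), of "- n"]) (use assms(5,15,16) in auto)
qed

section \<open>Polygonal domains and their chords\<close>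

text \<open>\<Omega> avoids the curve and has its whole frontier on it, so it is open and closed in
  the component of the complement that contains it, and fills that component; boundedness excludes
  the outside. Every curve point has outside points nearby, so none is interior to the
  closure.\<close>

lemma jordan_domain:
  fixes c :: "real \<Rightarrow> complex"
  assumes c: "simple_path c" "pathfinish c = pathstart c"
    and O: "open \<Omega>" "connected \<Omega>" "bounded \<Omega>" "frontier \<Omega> = path_image c"
  shows "\<Omega> = inside (path_image c)" "interior (closure \<Omega>) = \<Omega>"
proof -
  let ?J = "path_image c"
  let ?I = "inside ?J" let ?E = "outside ?J"
  have J: "open ?I" "connected ?I" "open ?E" "connected ?E" "\<not> bounded ?E" "?I \<inter> ?E = {}" "?I \<union> ?E = - ?J"
    "frontier ?I = ?J" "frontier ?E = ?J"
    using Jordan_inside_outside[OF c] by auto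
  have Jne: "?J \<noteq> {}" by simp
  then have One: "\<Omega> \<noteq> {}" using O(4) by auto
  have closure_domain: "closure \<Omega> = \<Omega> \<union> ?J" using O(4) by (metis closure_Un_frontier)
  have domain_disjoint_frontier: "\<Omega> \<inter> ?J = {}" using O(1,4) frontier_disjoint_eq by blast
  have eq: "\<Omega> = S" if S: "open S" "connected S" "S \<inter> ?J = {}" "\<Omega> \<inter> S \<noteq> {}" "\<Omega> \<subseteq> S" for S
  proof -
    have "openin (top_of_set S) \<Omega>" using O(1) S(5) by (simp add: open_subset)
    moreover have "\<Omega> = S \<inter> closure \<Omega>" using closure_domain S domain_disjoint_frontier by blast
    then have "closedin (top_of_set S) \<Omega>" by (metis closed_closure closedin_closed_Int)
    ultimately show ?thesis using S(2,4) by (metis connected_clopen inf_bot_left)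
  qed
  have "\<Omega> \<subseteq> ?I \<union> ?E" using domain_disjoint_frontier J(7) by blast
  then consider "\<Omega> \<subseteq> ?I" | "\<Omega> \<subseteq> ?E"
    using connectedD[OF O(2) J(1,3)] J(6) by blast
  then show I: "\<Omega> = ?I"
  proof cases
    case 1
    then show ?thesis using eq[OF J(1,2)] J(7) One by blast
  next
    case 2
    then have "\<Omega> = ?E" using eq[OF J(3,4)] J(7) One by blast
    then show ?thesis using J(5) O(3) by simp
  qed
  show "interior (closure \<Omega>) = \<Omega>"
  proof
    show "\<Omega> \<subseteq> interior (closure \<Omega>)" using O(1) closure_subset interior_maximal by blast
    show "interior (closure \<Omega>) \<subseteq> \<Omega>"
    proof
      fix x assume x: "x \<in> interior (closure \<Omega>)"
      show "x \<in> \<Omega>"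
      proof (rule ccontr)
        assume "x \<notin> \<Omega>"
        then have "x \<in> closure ?E" using x closure_domain interior_subset J(9) by (metis UnE closure_Un_frontier subsetD UnI2)
        then have "interior (closure \<Omega>) \<inter> ?E \<noteq> {}" using x open_Int_closure_eq_empty[OF open_interior] by blast
        then show False using closure_domain I J(6,7) interior_subset by blast
      qed
    qed
  qed
qed

text \<open>\<open>c1\<close> and \<open>c2\<close> are the two arcs into which the end points of the chord cut the boundary.\<close>

definition separated_parts :: "'a::real_normed_vector set \<Rightarrow> 'a \<Rightarrow> 'a \<Rightarrow> 'a set \<Rightarrow> 'a set \<Rightarrow> 'a set \<Rightarrow> 'a set \<Rightarrow> bool" where
  "separated_parts \<Omega> p q D1 D2 c1 c2 \<longleftrightarrow>
     open D1 \<and> open D2 \<and> connected D1 \<and> connected D2 \<and> D1 \<inter> D2 = {} \<and> D1 \<union> D2 = \<Omega> - open_segment p q \<and>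
     closure D1 = D1 \<union> (c1 \<union> closed_segment p q) \<and> closure D2 = D2 \<union> (c2 \<union> closed_segment p q) \<and>
     c1 \<union> c2 = frontier \<Omega> \<and> c1 \<inter> c2 = {p, q} \<and> infinite c1 \<and> infinite c2"

text \<open>The theta curve theorem: the chord splits the inside of the boundary curve into the
  insides of the two closed curves formed by the chord and one boundary arc.\<close>

lemma jordan_chord:
  fixes c :: "real \<Rightarrow> complex"
  assumes c: "simple_path c" "pathfinish c = pathstart c"
    and O: "open \<Omega>" "connected \<Omega>" "bounded \<Omega>" "frontier \<Omega> = path_image c"
    and pq: "p \<noteq> q" "p \<in> frontier \<Omega>" "q \<in> frontier \<Omega>" "open_segment p q \<subseteq> \<Omega>"
  shows "\<exists>D1 D2 c1 c2. separated_parts \<Omega> p q D1 D2 c1 c2"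
proof -
  have I: "\<Omega> = inside (path_image c)" by (rule jordan_domain[OF c O])
  obtain u d where ud: "arc u" "arc d" "pathstart u = p" "pathfinish u = q" "pathstart d = q" "pathfinish d = p"
    "path_image u \<inter> path_image d = {p, q}" "path_image u \<union> path_image d = path_image c"
    using exists_double_arc[OF c, of p q] pq(1,2,3) O(4) by auto
  have domain_disjoint_frontier: "\<Omega> \<inter> path_image c = {}" using I inside_no_overlap by blast
  have seg: "closed_segment p q \<inter> path_image c = {p, q}"
    using pq domain_disjoint_frontier O(4) by (auto simp: closed_segment_eq_open)
  let ?l = "linepath p q"
  have su: "path_image u \<inter> closed_segment p q = {p, q}" and sd: "path_image d \<inter> closed_segment p q = {p, q}"
    using seg ud by blast+
  have ne: "open_segment p q \<noteq> {}" using pq(1) by simp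
  have nonempty: "path_image ?l \<inter> inside (path_image u \<union> path_image (reversepath d)) \<noteq> {}"
  proof -
    have "open_segment p q \<subseteq> inside (path_image u \<union> path_image d)" using pq(4) I ud(8) by simp
    moreover obtain x where "x \<in> open_segment p q" using ne by blast
    ultimately show ?thesis using open_closed_segment[of x p q] by auto
  qed
  obtain s: "inside (path_image u \<union> closed_segment p q) \<inter> inside (path_image d \<union> closed_segment p q) = {}"
     "inside (path_image u \<union> closed_segment p q) \<union> inside (path_image d \<union> closed_segment p q) \<union> (closed_segment p q - {p,q}) = \<Omega>"
    using split_inside_simple_closed_curve[of u p q "reversepath d" ?l] ud pq(1) su sd nonempty I
    by (auto simp: arc_imp_simple_path simple_path_reversepath Int_commute)
  define D1 where "D1 = inside (path_image u \<union> closed_segment p q)"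
  define D2 where "D2 = inside (path_image d \<union> closed_segment p q)"
  have j1: "simple_path (u +++ linepath q p)" "path_image (u +++ linepath q p) = path_image u \<union> closed_segment p q"
    using ud pq(1) su by (auto simp: simple_path_join_loop_eq arc_linepath path_image_join closed_segment_commute)
  have j2: "simple_path (d +++ linepath p q)" "path_image (d +++ linepath p q) = path_image d \<union> closed_segment p q"
    using ud pq(1) sd by (auto simp: simple_path_join_loop_eq arc_linepath path_image_join closed_segment_commute)
  have "open D1 \<and> connected D1 \<and> frontier D1 = path_image u \<union> closed_segment p q"
    using Jordan_inside_outside[OF j1(1)] ud by (auto simp: j1(2) D1_def)
  moreover have "open D2 \<and> connected D2 \<and> frontier D2 = path_image d \<union> closed_segment p q"
    using Jordan_inside_outside[OF j2(1)] ud by (auto simp: j2(2) D2_def)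
  \<comment> \<open>Infinitely many points on each arc guarantee one that is no mesh vertex when an
    ear is sought.\<close>
  moreover have inf: "infinite (path_image u)" "infinite (path_image d)"
  proof -
    have "connected (path_image u)" "connected (path_image d)" using ud by (simp_all add: connected_arc_image)
    moreover have "p \<in> path_image u" "q \<in> path_image u" "p \<in> path_image d" "q \<in> path_image d" using ud(7) by auto
    ultimately show "infinite (path_image u)" "infinite (path_image d)"
      using pq(1) connected_finite_iff_sing by (metis empty_iff singletonD)+
  qed
  moreover have "D1 \<union> D2 = \<Omega> - open_segment p q"
  proof -
    have "open_segment p q \<inter> D1 = {}" "open_segment p q \<inter> D2 = {}"
      unfolding D1_def D2_def using inside_no_overlap open_closed_segment by blast+
    then show ?thesis using s(2) unfolding D1_def[symmetric] D2_def[symmetric] by (auto simp: open_segment_def)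
  qed
  ultimately have "separated_parts \<Omega> p q D1 D2 (path_image u) (path_image d)"
    unfolding separated_parts_def using s(1) ud(7,8) O(4) D1_def D2_def by (metis closure_Un_frontier)
  then show ?thesis by blast
qed

section \<open>Transport of the Jordan curve statements from the complex plane; polygons as closed
  paths\<close>

definition to_c :: "point \<Rightarrow> complex" where "to_c x = Complex (x $ 1) (x $ 2)"
definition of_c :: "complex \<Rightarrow> point" where "of_c z = vector [Re z, Im z]"

lemma to_of_c: "to_c (of_c z) = z" "of_c (to_c x) = x"
  by (simp_all add: to_c_def of_c_def vec_eq_iff forall_2 complex_eq_iff)

lemma linear_to_c: "linear to_c" and linear_of_c: "linear of_c"
  by (auto intro!: linearI simp: to_c_def of_c_def vec_eq_iff forall_2 complex_eq_iff)

lemma bij_to_c: "bij to_c" and bij_of_c: "bij of_c"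
  using to_of_c by (auto intro!: o_bij[of _ to_c] o_bij[of _ of_c] simp: fun_eq_iff)

lemmas inj_of_c = bij_is_inj[OF bij_of_c]
lemmas inj_to_c = bij_is_inj[OF bij_to_c]

lemma image_of_to [simp]: "of_c ` (to_c ` S) = S" "to_c ` (of_c ` T) = T"
  by (auto simp: image_image to_of_c)

lemma linear_bijection_image:
  fixes f :: "'a::euclidean_space \<Rightarrow> 'b::euclidean_space"
  assumes "linear f" "bij f"
  shows "open (f ` S) \<longleftrightarrow> open S" "interior (f ` S) = f ` interior S" "closure (f ` S) = f ` closure S"
    "frontier (f ` S) = f ` frontier S" "connected S \<Longrightarrow> connected (f ` S)" "bounded S \<Longrightarrow> bounded (f ` S)"
    "open_segment (f a) (f b) = f ` open_segment a b" "closed_segment (f a) (f b) = f ` closed_segment a b"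
proof -
  have i: "inj f" using assms(2) by (rule bij_is_inj)
  show "open (f ` S) \<longleftrightarrow> open S" by (rule open_bijective_linear_image_eq[OF assms])
  show a: "interior (f ` S) = f ` interior S" by (rule interior_bijective_linear_image[OF assms])
  show b: "closure (f ` S) = f ` closure S" by (rule closure_injective_linear_image[OF assms(1) i, symmetric])
  show "frontier (f ` S) = f ` frontier S" unfolding frontier_def a b using i by (simp add: image_set_diff)
  show "connected S \<Longrightarrow> connected (f ` S)" using assms(1) by (rule connected_linear_image)
  show "bounded S \<Longrightarrow> bounded (f ` S)" using assms(1) bounded_linear_image linear_linear linear_conv_bounded_linear by blast
  show "closed_segment (f a) (f b) = f ` closed_segment a b" by (rule closed_segment_linear_image[OF assms(1)])
  show "open_segment (f a) (f b) = f ` open_segment a b" by (rule open_segment_linear_image[OF assms(1) i])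
qed

lemmas to_c_img = linear_bijection_image[OF linear_to_c bij_to_c]
lemmas of_c_img = linear_bijection_image[OF linear_of_c bij_of_c]

lemma planar_domain:
  fixes c :: "real \<Rightarrow> point"
  assumes c: "simple_path c" "pathfinish c = pathstart c"
    and O: "open \<Omega>" "connected \<Omega>" "bounded \<Omega>" "frontier \<Omega> = path_image c"
  shows "interior (closure \<Omega>) = \<Omega>"
    "\<lbrakk>p \<noteq> q; p \<in> frontier \<Omega>; q \<in> frontier \<Omega>; open_segment p q \<subseteq> \<Omega>\<rbrakk> \<Longrightarrow> \<exists>D1 D2 c1 c2. separated_parts \<Omega> p q D1 D2 c1 c2"
proof -
  have c': "simple_path (to_c \<circ> c)" "pathfinish (to_c \<circ> c) = pathstart (to_c \<circ> c)"
    using c by (simp_all add: simple_path_linear_image_eq[OF linear_to_c inj_to_c] pathstart_compose pathfinish_compose)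
  have O': "open (to_c ` \<Omega>)" "connected (to_c ` \<Omega>)" "bounded (to_c ` \<Omega>)" "frontier (to_c ` \<Omega>) = path_image (to_c \<circ> c)"
    using O by (simp_all add: to_c_img path_image_compose)
  have "to_c ` interior (closure \<Omega>) = to_c ` \<Omega>" using jordan_domain(2)[OF c' O'] by (simp add: to_c_img)
  then show "interior (closure \<Omega>) = \<Omega>" by (metis image_of_to(1))
  assume pq: "p \<noteq> q" "p \<in> frontier \<Omega>" "q \<in> frontier \<Omega>" "open_segment p q \<subseteq> \<Omega>"
  have "to_c p \<noteq> to_c q" using pq(1) inj_to_c by (simp add: inj_eq)
  moreover have "to_c p \<in> frontier (to_c ` \<Omega>)" "to_c q \<in> frontier (to_c ` \<Omega>)" using pq by (simp_all add: to_c_img)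
  moreover have "open_segment (to_c p) (to_c q) \<subseteq> to_c ` \<Omega>" using pq(4) by (auto simp: to_c_img)
  ultimately obtain D1 D2 c1 c2 where "separated_parts (to_c ` \<Omega>) (to_c p) (to_c q) D1 D2 c1 c2"
    using jordan_chord[OF c' O'] by blast
  then have s: "open D1" "open D2" "connected D1" "connected D2" "D1 \<inter> D2 = {}" "D1 \<union> D2 = to_c ` \<Omega> - open_segment (to_c p) (to_c q)"
     "closure D1 = D1 \<union> (c1 \<union> closed_segment (to_c p) (to_c q))" "closure D2 = D2 \<union> (c2 \<union> closed_segment (to_c p) (to_c q))"
     "c1 \<union> c2 = frontier (to_c ` \<Omega>)" "c1 \<inter> c2 = {to_c p, to_c q}" "infinite c1" "infinite c2"
    by (simp_all add: separated_parts_def)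
  have "separated_parts \<Omega> p q (of_c ` D1) (of_c ` D2) (of_c ` c1) (of_c ` c2)"
    unfolding separated_parts_def
  proof (intro conjI)
    show "open (of_c ` D1)" "open (of_c ` D2)" "connected (of_c ` D1)" "connected (of_c ` D2)"
      using s(1-4) by (simp_all add: of_c_img)
    show "of_c ` D1 \<inter> of_c ` D2 = {}" using s(5) by (simp flip: image_Int[OF inj_of_c])
    have "of_c ` (D1 \<union> D2) = \<Omega> - open_segment p q"
      unfolding s(6) by (simp add: image_set_diff[OF inj_of_c] to_c_img)
    then show "of_c ` D1 \<union> of_c ` D2 = \<Omega> - open_segment p q" by (simp add: image_Un)
    show "closure (of_c ` D1) = of_c ` D1 \<union> (of_c ` c1 \<union> closed_segment p q)"
      unfolding of_c_img s(7) by (simp add: image_Un to_c_img)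
    show "closure (of_c ` D2) = of_c ` D2 \<union> (of_c ` c2 \<union> closed_segment p q)"
      unfolding of_c_img s(8) by (simp add: image_Un to_c_img)
    show "of_c ` c1 \<union> of_c ` c2 = frontier \<Omega>" using s(9) by (simp add: to_c_img flip: image_Un)
    show "of_c ` c1 \<inter> of_c ` c2 = {p, q}" using s(10) by (simp add: to_of_c flip: image_Int[OF inj_of_c])
    show "infinite (of_c ` c1)" "infinite (of_c ` c2)"
      using s(11,12) inj_of_c by (simp_all add: finite_image_iff inj_on_subset[of _ UNIV])
  qed
  then show "\<exists>D1 D2 c1 c2. separated_parts \<Omega> p q D1 D2 c1 c2" by blast
qed

text \<open>The sides are appended one at a time. Common points of two sides are ends of both and
  the corners are distinct, so a new side meets the preceding ones only where it is attached; the
  last side closes the loop and meets the arc in two corners.\<close>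

lemma simple_polygon_path:
  assumes "simple_polygon vs"
  obtains \<gamma> where "simple_path \<gamma>" "pathfinish \<gamma> = pathstart \<gamma>" "path_image \<gamma> = (\<Union>i<length vs. side vs i)"
proof -
  let ?n = "length vs"
  have n: "?n \<ge> 3" "distinct vs" and sides: "\<And>i j. i < ?n \<Longrightarrow> j < ?n \<Longrightarrow> i \<noteq> j \<Longrightarrow> side vs i \<inter> side vs j \<subseteq> side_ends vs i \<inter> side_ends vs j"
    using assms by (auto simp: simple_polygon_def)
  have vne: "vs ! i \<noteq> vs ! j" if "i < ?n" "j < ?n" "i \<noteq> j" for i j using n(2) that by (simp add: nth_eq_iff_index_eq)
  have ends: "side_ends vs i = {vs ! i, vs ! Suc i}" "side vs i = closed_segment (vs ! i) (vs ! Suc i)" if "Suc i < ?n" for i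
    using that by (simp_all add: side_ends_def side_def)
  have arcs: "\<exists>\<gamma>. arc \<gamma> \<and> pathstart \<gamma> = vs ! 0 \<and> pathfinish \<gamma> = vs ! Suc m \<and> path_image \<gamma> = (\<Union>i\<le>m. side vs i)"
    if "Suc m < ?n" for m
    using that
  proof (induction m)
    case 0
    have "vs ! 0 \<noteq> vs ! Suc 0" using 0 by (intro vne) auto
    then show ?case using ends(2)[OF 0] by (intro exI[of _ "linepath (vs ! 0) (vs ! Suc 0)"]) (simp add: arc_linepath)
  next
    case (Suc m)
    then obtain \<gamma> where g: "arc \<gamma>" "pathstart \<gamma> = vs ! 0" "pathfinish \<gamma> = vs ! Suc m" "path_image \<gamma> = (\<Union>i\<le>m. side vs i)" by auto
    let ?l = "linepath (vs ! Suc m) (vs ! Suc (Suc m))"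
    have l: "arc ?l" using Suc.prems by (intro arc_linepath vne) auto
    have "path_image \<gamma> \<inter> path_image ?l \<subseteq> {pathstart ?l}"
    proof
      fix x assume x: "x \<in> path_image \<gamma> \<inter> path_image ?l"
      then obtain i where i: "i \<le> m" "x \<in> side vs i" using g by auto
      have "x \<in> side vs (Suc m)" using x ends(2)[OF Suc.prems] by simp
      then have "x \<in> side_ends vs i \<inter> side_ends vs (Suc m)" using sides[of i "Suc m"] i Suc.prems by auto
      then have "(x = vs ! i \<or> x = vs ! Suc i) \<and> (x = vs ! Suc m \<or> x = vs ! Suc (Suc m))"
        using ends(1)[of i] ends(1)[OF Suc.prems] i Suc.prems by auto
      moreover have "vs ! i \<noteq> vs ! Suc (Suc m)" "vs ! Suc i \<noteq> vs ! Suc (Suc m)"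
        using vne[of i "Suc (Suc m)"] vne[of "Suc i" "Suc (Suc m)"] i Suc.prems by auto
      ultimately show "x \<in> {pathstart ?l}" by auto
    qed
    then have "arc (\<gamma> +++ ?l)" using g l by (intro arc_join) auto
    moreover have "path_image (\<gamma> +++ ?l) = (\<Union>i\<le>Suc m. side vs i)"
      using g ends(2)[OF Suc.prems] by (subst path_image_join) (auto simp: atMost_Suc)
    ultimately show ?case using g by (intro exI[of _ "\<gamma> +++ ?l"]) simp
  qed
  define m where "m = ?n - 2"
  have m: "Suc (Suc m) = ?n" using n(1) by (simp add: m_def)
  obtain \<gamma> where g: "arc \<gamma>" "pathstart \<gamma> = vs ! 0" "pathfinish \<gamma> = vs ! Suc m" "path_image \<gamma> = (\<Union>i\<le>m. side vs i)"
    using arcs[of m] m by auto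
  let ?l = "linepath (vs ! Suc m) (vs ! 0)"
  have last: "side vs (Suc m) = closed_segment (vs ! Suc m) (vs ! 0)" "side_ends vs (Suc m) = {vs ! Suc m, vs ! 0}"
    using m by (simp_all add: side_def side_ends_def)
  have l: "arc ?l" using m by (intro arc_linepath vne) auto
  have "path_image \<gamma> \<inter> path_image ?l \<subseteq> {pathstart \<gamma>, pathstart ?l}"
  proof
    fix x assume x: "x \<in> path_image \<gamma> \<inter> path_image ?l"
    then obtain i where i: "i \<le> m" "x \<in> side vs i" using g by auto
    have "x \<in> side_ends vs (Suc m)" using sides[of i "Suc m"] i m x last by auto
    then show "x \<in> {pathstart \<gamma>, pathstart ?l}" using last g by auto
  qed
  then have "simple_path (\<gamma> +++ ?l)" using g l by (intro simple_path_join_loop) auto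
  moreover have "path_image (\<gamma> +++ ?l) = (\<Union>i<?n. side vs i)"
  proof -
    have "{..<?n} = insert (Suc m) {..m}" using m by auto
    then show ?thesis using g last by (subst path_image_join) auto
  qed
  ultimately show ?thesis using that[of "\<gamma> +++ ?l"] g by simp
qed

lemma polygonal_domain_regular:
  assumes "polygonal_domain vs \<Omega>"
  shows "interior (closure \<Omega>) = \<Omega>"
    "\<lbrakk>p \<noteq> q; p \<in> frontier \<Omega>; q \<in> frontier \<Omega>; open_segment p q \<subseteq> \<Omega>\<rbrakk> \<Longrightarrow> \<exists>D1 D2 c1 c2. separated_parts \<Omega> p q D1 D2 c1 c2"
proof -
  obtain \<gamma> where g: "simple_path \<gamma>" "pathfinish \<gamma> = pathstart \<gamma>" "path_image \<gamma> = (\<Union>i<length vs. side vs i)"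
    using simple_polygon_path assms unfolding polygonal_domain_def by blast
  have O: "open \<Omega>" "connected \<Omega>" "bounded \<Omega>" "frontier \<Omega> = path_image \<gamma>"
    using assms g(3) by (auto simp: polygonal_domain_def)
  show "interior (closure \<Omega>) = \<Omega>" by (rule planar_domain(1)[OF g(1,2) O])
  show "\<lbrakk>p \<noteq> q; p \<in> frontier \<Omega>; q \<in> frontier \<Omega>; open_segment p q \<subseteq> \<Omega>\<rbrakk> \<Longrightarrow> \<exists>D1 D2 c1 c2. separated_parts \<Omega> p q D1 D2 c1 c2"
    by (rule planar_domain(2)[OF g(1,2) O])
qed

section \<open>Fitted triangulations\<close>

locale mesh =
  fixes vs :: "point list" and \<Omega> :: "point set" and \<T> :: "point set set"
  assumes pd: "polygonal_domain vs \<Omega>" and ft: "fitted_triangulation \<Omega> \<T>"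
begin

abbreviation V :: "point set" where "V \<equiv> \<Union>K\<in>\<T>. verts K"

lemma domain_props: "open \<Omega>" "connected \<Omega>" "bounded \<Omega>" "frontier \<Omega> = (\<Union>i<length vs. side vs i)"
  using pd by (auto simp: polygonal_domain_def)

text \<open>Excludes slits, and lets a disc that is covered by triangles be recognised as part of
  \<Omega>.\<close>

lemma interior_closure_domain: "interior (closure \<Omega>) = \<Omega>" by (rule polygonal_domain_regular(1)[OF pd])

lemma finite_mesh: "finite \<T>" and mesh_simplex: "K \<in> \<T> \<Longrightarrow> 2 simplex K" and cover: "\<Union>\<T> = closure \<Omega>"
  and face: "K \<in> \<T> \<Longrightarrow> K' \<in> \<T> \<Longrightarrow> K \<inter> K' face_of K" "K \<in> \<T> \<Longrightarrow> K' \<in> \<T> \<Longrightarrow> K \<inter> K' face_of K'"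
proof -
  show "finite \<T>" "K \<in> \<T> \<Longrightarrow> 2 simplex K" "\<Union>\<T> = closure \<Omega>" "K \<in> \<T> \<Longrightarrow> K' \<in> \<T> \<Longrightarrow> K \<inter> K' face_of K"
    using ft by (auto simp: fitted_triangulation_def triangulation_def)
  show "K \<in> \<T> \<Longrightarrow> K' \<in> \<T> \<Longrightarrow> K \<inter> K' face_of K'"
    using ft by (metis Int_commute fitted_triangulation_def triangulation_def)
qed

lemma finV: "finite V" using finite_mesh tri_facts(4)[OF mesh_simplex] by blast

lemma domain_disjoint_frontier: "\<Omega> \<inter> frontier \<Omega> = {}" using domain_props(1) frontier_disjoint_eq by blast

lemma closure_domain: "closure \<Omega> = \<Omega> \<union> frontier \<Omega>" by (metis closure_Un_frontier)

lemma triangle_in_closure: "K \<in> \<T> \<Longrightarrow> K \<subseteq> closure \<Omega>" using cover by blast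

lemma interior_in_domain: "K \<in> \<T> \<Longrightarrow> interior K \<subseteq> \<Omega>" using interior_closure_domain interior_mono[OF triangle_in_closure] by blast

lemma in_some_triangle: "x \<in> closure \<Omega> \<Longrightarrow> \<exists>K\<in>\<T>. x \<in> K" using cover by blast

text \<open>A triangle inside another one would be a proper face of it of the same
  dimension.\<close>

lemma triangle_not_in_other: assumes "K \<in> \<T>" "K' \<in> \<T>" "K \<noteq> K'" shows "K \<inter> K' \<noteq> K"
proof
  assume e: "K \<inter> K' = K"
  have "aff_dim K = 2" "aff_dim K' = 2" using assms mesh_simplex by (auto simp: aff_dim_simplex)
  moreover have "K face_of K'" using face(2)[OF assms(1,2)] e by simp
  ultimately show False using face_of_aff_dim_lt[OF tri_facts(1)[OF mesh_simplex[OF assms(2)]]] assms(3) by force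
qed

lemma interior_disjoint: assumes "K \<in> \<T>" "K' \<in> \<T>" "K \<noteq> K'" shows "interior K \<inter> K' = {}"
  using face_of_disjoint_interior[OF face(1)[OF assms(1,2)] triangle_not_in_other[OF assms]] interior_subset by blast

text \<open>No hanging nodes: an extreme point of a common face is a vertex of both
  triangles.\<close>

lemma mesh_vertex_is_vertex: assumes "x \<in> V" "x \<in> K" "K \<in> \<T>" shows "x \<in> verts K"
proof -
  obtain K' where K': "K' \<in> \<T>" "x \<in> verts K'" using assms by blast
  then have "x \<in> K \<inter> K'" using assms tri_facts(6)[OF mesh_simplex] by blast
  moreover have "x extreme_point_of (K \<inter> K')"
    using extreme_point_of_face[OF face(2)[OF assms(3) K'(1)]] K'(2) calculation by (simp add: verts_def)
  ultimately show ?thesis using extreme_point_of_face[OF face(1)[OF assms(3) K'(1)]] by (simp add: verts_def)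
qed

text \<open>Two triangles on opposite sides of an edge cover a disc around each relative interior
  point of it; such discs lie in the interior of the closure, which is \<Omega>.\<close>

lemma shared_edge:
  assumes "K \<in> \<T>" "K' \<in> \<T>" "K \<noteq> K'" "x \<in> K" "x \<in> K'" "x \<notin> V"
  obtains a b c a' \<kappa> where "nondeg a b c" "K = convex hull {a,b,c}" "nondeg a' b c" "K' = convex hull {a',b,c}"
    "x \<in> open_segment b c" "\<kappa> > 0" "\<And>y. lam a' b c y = - \<kappa> * lam a b c y" "K \<inter> K' = closed_segment b c" "open_segment b c \<subseteq> \<Omega>"
proof -
  have xv: "x \<notin> verts K" using assms by blast
  obtain a b c a' \<kappa> where t: "nondeg a b c" "K = convex hull {a,b,c}" "nondeg a' b c" "K' = convex hull {a',b,c}"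
    "x \<in> open_segment b c" "\<kappa> > 0" "\<And>y. lam a' b c y = - \<kappa> * lam a b c y" "K \<inter> K' = closed_segment b c"
    using two_triangles[OF mesh_simplex[OF assms(1)] mesh_simplex[OF assms(2)] face(1)[OF assms(1,2)] face(2)[OF assms(1,2)] assms(3,4,5) xv] by metis
  have "open_segment b c \<subseteq> interior (closure \<Omega>)"
  proof
    fix y assume y: "y \<in> open_segment b c"
    obtain e where e: "e > 0" "\<And>z. z \<in> ball y e \<Longrightarrow> z \<in> K \<longleftrightarrow> 0 \<le> lam a b c z" using tri_local[OF t(1) y] t(2) by metis
    obtain e' where e': "e' > 0" "\<And>z. z \<in> ball y e' \<Longrightarrow> z \<in> K' \<longleftrightarrow> 0 \<le> lam a' b c z" using tri_local[OF t(3) y] t(4) by metis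
    have "ball y (min e e') \<subseteq> closure \<Omega>"
    proof
      fix z assume z: "z \<in> ball y (min e e')"
      have "0 \<le> lam a b c z \<or> 0 \<le> lam a' b c z" using t(6) t(7)[of z] by (smt (verit) mult_neg_neg mult_minus_left mult_nonneg_nonneg mult_pos_neg)
      then have "z \<in> K \<or> z \<in> K'" using e e' z by auto
      then show "z \<in> closure \<Omega>" using triangle_in_closure assms by blast
    qed
    then show "y \<in> interior (closure \<Omega>)" using e(1) e'(1) by (metis mem_interior min_less_iff_conj)
  qed
  then show ?thesis using that[OF t] interior_closure_domain by simp
qed

text \<open>Two triangles through x would share an edge around x, and the relative interior of such
  an edge is in \<Omega>.\<close>

lemma boundary_unique:
  assumes "x \<in> frontier \<Omega>" "x \<notin> V" "K \<in> \<T>" "K' \<in> \<T>" "x \<in> K" "x \<in> K'" shows "K = K'"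
proof (rule ccontr)
  assume ne: "K \<noteq> K'"
  obtain b c where "x \<in> open_segment b c" "open_segment b c \<subseteq> \<Omega>" using shared_edge[OF assms(3,4) ne assms(5,6,2)] by metis
  then show False using domain_disjoint_frontier assms(1) by blast
qed

lemma edge_not_V:
  assumes "K \<in> \<T>" "nondeg a b c" "K = convex hull {a,b,c}" "x \<in> open_segment b c" shows "x \<notin> V"
proof
  assume "x \<in> V"
  have "x \<in> K" using open_closed_segment[OF assms(4)] edge_iff[OF assms(2)] assms(3) by blast
  then have "x \<in> {a,b,c}" using mesh_vertex_is_vertex[OF \<open>x \<in> V\<close> _ assms(1)] verts_tri[OF assms(2)] assms(3) by simp
  then show False using assms(4) open_edge_iff[OF assms(2)] lam_vertex[OF assms(2)] by (auto simp: open_segment_def)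
qed

text \<open>Suppose a point y of the open edge were in \<Omega>. Points just across the edge near y
  belong to a second triangle; it contains y and hence, by conformity, the whole edge including x.
  But x lies in one triangle only.\<close>

lemma edge_boundary:
  assumes K: "K \<in> \<T>" "nondeg a b c" "K = convex hull {a,b,c}" and x: "x \<in> open_segment b c" "x \<in> frontier \<Omega>"
  shows "closed_segment b c \<subseteq> frontier \<Omega>"
proof -
  have in_K: "y \<in> K" if "y \<in> open_segment b c" for y using open_closed_segment[OF that] edge_iff[OF K(2)] K(3) by blast
  have "open_segment b c \<subseteq> frontier \<Omega>"
  proof
    fix y assume y: "y \<in> open_segment b c"
    show "y \<in> frontier \<Omega>"
    proof (rule ccontr)
      assume "y \<notin> frontier \<Omega>"
      then have yO: "y \<in> \<Omega>" using in_K[OF y] triangle_in_closure[OF K(1)] closure_domain by blast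
      obtain e where e: "e > 0" "\<And>z. z \<in> ball y e \<Longrightarrow> z \<in> K \<longleftrightarrow> 0 \<le> lam a b c z" using tri_local[OF K(2) y] K(3) by metis
      obtain r where r: "r > 0" "ball y r \<subseteq> \<Omega>" using yO domain_props(1) openE by blast
      \<comment> \<open>The triangles that miss y keep away from y, so every triangle met close to y
        contains y.\<close>
      define S where "S = \<Union>{K' \<in> \<T>. y \<notin> K'}"
      have "closed S" unfolding S_def using finite_mesh tri_facts(3)[OF mesh_simplex] by (intro closed_Union) auto
      then have "open (- S)" by (rule open_Compl)
      moreover have "y \<in> - S" by (simp add: S_def)
      ultimately obtain s where s: "s > 0" "ball y s \<subseteq> - S" using openE by blast
      let ?g = "glam a b c"
      have g0: "?g \<noteq> 0" using glam_inner[of a b c "a - b"] K(2) by (auto simp: nondeg_def)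
      define m where "m = min e (min r s)"
      have m: "m > 0" "m \<le> e" "m \<le> r" "m \<le> s" using e r s by (auto simp: m_def)
      define z where "z = y - (m / 2 / norm ?g) *\<^sub>R ?g"
      have zb: "z \<in> ball y m" unfolding z_def using m g0 by (simp add: dist_norm)
      have "lam a b c y = 0" using y open_edge_iff[OF K(2)] by blast
      then have "lam a b c z = - ((m / 2 / norm ?g) * (norm ?g)\<^sup>2)" unfolding lam_diff[of a b c z y] by (simp add: z_def power2_norm_eq_inner)
      moreover have "(m / 2 / norm ?g) * (norm ?g)\<^sup>2 > 0" using m g0 by simp
      ultimately have "lam a b c z < 0" by linarith
      then have zK: "z \<notin> K" using e(2)[of z] zb m by auto
      have "z \<in> \<Omega>" using r zb m by auto
      then obtain K' where K': "K' \<in> \<T>" "z \<in> K'" using in_some_triangle closure_subset by blast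
      have "z \<in> ball y s" using zb m by simp
      then have "z \<notin> S" using s by blast
      then have "y \<in> K'" using K' by (auto simp: S_def)
      have ne: "K \<noteq> K'" using zK K' by blast
      have yV: "y \<notin> V" and xV: "x \<notin> V" using edge_not_V[OF K] y x by blast+
      obtain a1 b1 c1 where sh: "K = convex hull {a1,b1,c1}" "nondeg a1 b1 c1" "y \<in> open_segment b1 c1" "K \<inter> K' = closed_segment b1 c1"
        using shared_edge[OF K(1) K'(1) ne in_K[OF y] \<open>y \<in> K'\<close> yV] by metis
      have "x \<in> K'"
      proof -
        have f: "K \<inter> K' face_of K" by (rule face(1)[OF K(1) K'(1)])
        have bc: "b \<in> K" "c \<in> K" unfolding K(3) by (auto intro: hull_inc)
        have "y \<in> K \<inter> K'" using in_K[OF y] \<open>y \<in> K'\<close> by simp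
        then have "b \<in> K \<inter> K'" "c \<in> K \<inter> K'" using f bc y unfolding face_of_def by blast+
        then have "closed_segment b c \<subseteq> K'" using tri_facts(1)[OF mesh_simplex[OF K'(1)]] by (simp add: closed_segment_subset)
        then show ?thesis using open_closed_segment[OF x(1)] by blast
      qed
      then show False using boundary_unique[OF x(2) xV K(1) K'(1) in_K[OF x(1)]] ne by blast
    qed
  qed
  moreover have "closure (open_segment b c) = closed_segment b c" using nondeg_imp[OF K(2)] by simp
  ultimately show ?thesis by (metis closure_minimal frontier_closed)
qed

lemma edge_cases:
  assumes K: "K \<in> \<T>" "nondeg a b c" "K = convex hull {a,b,c}"
  shows "closed_segment b c \<subseteq> frontier \<Omega> \<or> open_segment b c \<subseteq> \<Omega>"
proof (cases "open_segment b c \<inter> frontier \<Omega> = {}")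
  case True
  have "open_segment b c \<subseteq> closure \<Omega>"
    using open_closed_segment edge_iff[OF K(2)] K(3) triangle_in_closure[OF K(1)] by blast
  then show ?thesis using True closure_domain by blast
next
  case False
  then show ?thesis using edge_boundary[OF K] by blast
qed

lemma boundary_edge:
  assumes "x \<in> frontier \<Omega>" "x \<notin> V" "K \<in> \<T>" "x \<in> K"
  obtains a b c where "nondeg a b c" "K = convex hull {a,b,c}" "x \<in> open_segment b c" "closed_segment b c \<subseteq> frontier \<Omega>"
proof -
  have "x \<notin> verts K" using assms by blast
  moreover have "x \<notin> interior K" using interior_in_domain[OF assms(3)] domain_disjoint_frontier assms(1) by blast
  ultimately obtain a b c where t: "nondeg a b c" "K = convex hull {a,b,c}" "x \<in> open_segment b c"
    using tri_point_cases[OF mesh_simplex[OF assms(3)] assms(4)] by metis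
  then show ?thesis using that edge_boundary[OF assms(3) t assms(1)] by blast
qed

text \<open>Close to x only K is present. A point of \<Omega> on the edge line or beyond it would
  have a neighbour in \<Omega> strictly beyond, which no triangle covers.\<close>

lemma boundary_local:
  assumes K: "K \<in> \<T>" "nondeg a b c" "K = convex hull {a,b,c}" and x: "x \<in> open_segment b c" "x \<in> frontier \<Omega>"
  obtains e where "e > 0" "\<And>y. y \<in> ball x e \<Longrightarrow> y \<in> \<Omega> \<longleftrightarrow> 0 < lam a b c y" "\<And>y. y \<in> ball x e \<Longrightarrow> y \<in> \<Omega> \<Longrightarrow> y \<in> interior K"
proof -
  have xK: "x \<in> K" using open_closed_segment[OF x(1)] edge_iff[OF K(2)] K(3) by blast
  have xV: "x \<notin> V" by (rule edge_not_V[OF K x(1)])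
  obtain e where e: "e > 0" "\<And>z. z \<in> ball x e \<Longrightarrow> z \<in> K \<longleftrightarrow> 0 \<le> lam a b c z"
      "\<And>z. z \<in> ball x e \<Longrightarrow> z \<in> interior K \<longleftrightarrow> 0 < lam a b c z" using tri_local[OF K(2) x(1)] K(3) by metis
  define S where "S = \<Union>(\<T> - {K})"
  have "closed S" unfolding S_def using finite_mesh tri_facts(3)[OF mesh_simplex] by (intro closed_Union) auto
  then have "open (- S)" by (rule open_Compl)
  moreover have "x \<in> - S" unfolding S_def using boundary_unique[OF x(2) xV K(1) _ xK] by blast
  ultimately obtain s where s: "s > 0" "ball x s \<subseteq> - S" using openE by blast
  define m where "m = min e s / 2"
  have m: "m > 0" "m < e" "m < s" using e s by (auto simp: m_def)
  have inK: "z \<in> K" if "z \<in> ball x s" "z \<in> closure \<Omega>" for z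
    using that s in_some_triangle[of z] by (auto simp: S_def)
  let ?g = "glam a b c"
  have g0: "?g \<noteq> 0" using glam_inner[of a b c "a - b"] K(2) by (auto simp: nondeg_def)
  have pos: "0 < lam a b c y" if y: "y \<in> ball x m" "y \<in> \<Omega>" for y
  proof (rule ccontr)
    assume "\<not> 0 < lam a b c y"
    have "open (\<Omega> \<inter> ball x m)" using domain_props(1) by auto
    moreover have "y \<in> \<Omega> \<inter> ball x m" using y by simp
    ultimately obtain r where r: "r > 0" "ball y r \<subseteq> \<Omega> \<inter> ball x m" using openE by metis
    define z where "z = y - (r / 2 / norm ?g) *\<^sub>R ?g"
    have "z \<in> ball y r" unfolding z_def using r g0 by (simp add: dist_norm)
    then have z: "z \<in> \<Omega>" "z \<in> ball x m" using r by auto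
    then have "z \<in> K" using inK[of z] m closure_subset[of \<Omega>] by auto
    then have "0 \<le> lam a b c z" using e(2)[of z] z m by auto
    moreover have "lam a b c z = lam a b c y - ((r / 2 / norm ?g) * (norm ?g)\<^sup>2)" unfolding lam_diff[of a b c z y] by (simp add: z_def power2_norm_eq_inner)
    moreover have "(r / 2 / norm ?g) * (norm ?g)\<^sup>2 > 0" using r g0 by simp
    ultimately show False using \<open>\<not> 0 < lam a b c y\<close> by linarith
  qed
  show ?thesis
  proof (rule that[OF m(1)])
    fix y assume y: "y \<in> ball x m"
    show iff: "y \<in> \<Omega> \<longleftrightarrow> 0 < lam a b c y" using pos[OF y] e(3)[of y] y m interior_in_domain[OF K(1)] by auto
    show "y \<in> \<Omega> \<Longrightarrow> y \<in> interior K" using iff e(3)[of y] y m by auto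
  qed
qed

text \<open>\<open>outer_normal\<close> is a definite description, so uniqueness is proved along
  with the half plane property.\<close>

lemma outer_normal_eq:
  assumes K: "K \<in> \<T>" "nondeg a b c" "K = convex hull {a,b,c}" and x: "x \<in> open_segment b c" "x \<in> frontier \<Omega>"
  shows "outer_normal \<Omega> x = - (glam a b c /\<^sub>R norm (glam a b c))"
proof -
  let ?g = "glam a b c"
  have g0: "?g \<noteq> 0" using glam_inner[of a b c "a - b"] K(2) by (auto simp: nondeg_def)
  define \<nu>0 where "\<nu>0 = - (?g /\<^sub>R norm ?g)"
  have n0: "norm \<nu>0 = 1" using g0 by (simp add: \<nu>0_def)
  obtain e where e: "e > 0" "\<And>y. y \<in> ball x e \<Longrightarrow> y \<in> \<Omega> \<longleftrightarrow> 0 < lam a b c y" using boundary_local[OF K x] by metis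
  have lx: "lam a b c x = 0" using x open_edge_iff[OF K(2)] by blast
  have "(y - x) \<bullet> \<nu>0 < 0 \<longleftrightarrow> 0 < lam a b c y" for y
    using lam_diff[of a b c y x] lx g0 by (simp add: \<nu>0_def inner_commute zero_less_mult_iff)
  then have h0: "\<forall>y\<in>ball x e. y \<in> \<Omega> \<longleftrightarrow> (y - x) \<bullet> \<nu>0 < 0" using e by simp
  show ?thesis unfolding outer_normal_def \<nu>0_def[symmetric]
  proof (rule the_equality)
    show "norm \<nu>0 = 1 \<and> (\<exists>\<epsilon>>0. \<forall>y\<in>ball x \<epsilon>. y \<in> \<Omega> \<longleftrightarrow> (y - x) \<bullet> \<nu>0 < 0)" using n0 e(1) h0 by blast
    fix \<nu> assume "norm \<nu> = 1 \<and> (\<exists>\<epsilon>>0. \<forall>y\<in>ball x \<epsilon>. y \<in> \<Omega> \<longleftrightarrow> (y - x) \<bullet> \<nu> < 0)"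
    then obtain \<epsilon> where n: "norm \<nu> = 1" and ep: "\<epsilon> > 0" "\<forall>y\<in>ball x \<epsilon>. y \<in> \<Omega> \<longleftrightarrow> (y - x) \<bullet> \<nu> < 0" by blast
    show "\<nu> = \<nu>0"
    proof (rule ccontr)
      assume ne: "\<nu> \<noteq> \<nu>0"
      have "(norm (\<nu> - \<nu>0))\<^sup>2 > 0" using ne by simp
      then have lt: "\<nu> \<bullet> \<nu>0 < 1" using n n0
        by (simp add: power2_norm_eq_inner inner_diff_left inner_diff_right inner_commute norm_eq_1)
      define m where "m = min e \<epsilon>"
      define s where "s = m / 2 / norm (\<nu>0 - \<nu>)"
      have s: "s > 0" using e(1) ep(1) ne by (simp add: s_def m_def)
      \<comment> \<open>Moving along \<nu>0 - \<nu> decreases the component along \<nu> and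
        increases the one along \<nu>0, so the two half planes disagree at y.\<close>
      define y where "y = x + s *\<^sub>R (\<nu>0 - \<nu>)"
      have "norm (y - x) = m / 2" using ne e(1) ep(1) by (simp add: y_def s_def m_def)
      then have yb: "y \<in> ball x e" "y \<in> ball x \<epsilon>" using e(1) ep(1) by (auto simp: dist_norm norm_minus_commute m_def)
      have "(y - x) \<bullet> \<nu> = s * (\<nu> \<bullet> \<nu>0 - 1)" "(y - x) \<bullet> \<nu>0 = s * (1 - \<nu> \<bullet> \<nu>0)"
        using n n0 by (simp_all add: y_def inner_diff_left inner_diff_right inner_commute norm_eq_1)
      then have "(y - x) \<bullet> \<nu> < 0" "\<not> (y - x) \<bullet> \<nu>0 < 0" using s lt by (simp_all add: mult_pos_neg mult_less_0_iff)
      then show False using h0 ep(2) yb by blast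
    qed
  qed
qed

text \<open>A boundary edge is encoded by its triangle and the vertex opposite to it.\<close>

definition BE :: "(point set \<times> point) set" where
  "BE = {(K, a). K \<in> \<T> \<and> a \<in> verts K \<and> opp K a \<subseteq> frontier \<Omega>}"

lemma finBE: "finite BE"
proof -
  have "BE \<subseteq> (SIGMA K:\<T>. verts K)" by (auto simp: BE_def)
  then show ?thesis using finite_mesh tri_facts(4)[OF mesh_simplex] by (meson finite_SigmaI finite_subset)
qed

lemma BE_tri:
  assumes "(K, a) \<in> BE"
  obtains b c where "K \<in> \<T>" "nondeg a b c" "K = convex hull {a,b,c}" "opp K a = closed_segment b c" "closed_segment b c \<subseteq> frontier \<Omega>"
proof -
  have K: "K \<in> \<T>" "a \<in> verts K" "opp K a \<subseteq> frontier \<Omega>" using assms by (auto simp: BE_def)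
  obtain b c where t: "nondeg a b c" "K = convex hull {a,b,c}" using tri_at_vertex[OF mesh_simplex[OF K(1)] K(2)] by metis
  then show ?thesis using that K opp_tri[OF t(1)] by auto
qed

lemma BE_I:
  assumes "K \<in> \<T>" "nondeg a b c" "K = convex hull {a,b,c}" "closed_segment b c \<subseteq> frontier \<Omega>"
  shows "(K, a) \<in> BE"
  using assms opp_tri[OF assms(2)] verts_tri[OF assms(2)] by (auto simp: BE_def)

text \<open>Turns boundary integrals into sums over \<open>BE\<close>: up to mesh vertices, the
  edges partition the boundary.\<close>

lemma BE_ex1:
  assumes x: "x \<in> frontier \<Omega>" "x \<notin> V"
  obtains e where "e \<in> BE" "x \<in> opp (fst e) (snd e)" "\<And>e'. e' \<in> BE \<Longrightarrow> x \<in> opp (fst e') (snd e') \<Longrightarrow> e' = e"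
proof -
  obtain K where K: "K \<in> \<T>" "x \<in> K" using x in_some_triangle closure_domain by blast
  obtain a b c where t: "nondeg a b c" "K = convex hull {a,b,c}" "x \<in> open_segment b c" "closed_segment b c \<subseteq> frontier \<Omega>"
    using boundary_edge[OF x K] by metis
  have 1: "(K, a) \<in> BE" by (rule BE_I[OF K(1) t(1,2,4)])
  have 2: "x \<in> opp K a" using opp_tri[OF t(1)] t open_closed_segment by simp
  have pos: "lam b c a x > 0" "lam c a b x > 0" using t open_edge_iff by blast+
  have nd: "nondeg b c a" "nondeg c a b" using t(1) by (simp_all add: nondeg_cyc nondeg_cyc2)
  have "(K', a') = (K, a)" if e: "(K', a') \<in> BE" "x \<in> opp K' a'" for K' a'
  proof -
    obtain b' c' where t': "K' \<in> \<T>" "nondeg a' b' c'" "K' = convex hull {a',b',c'}" "opp K' a' = closed_segment b' c'"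
      using BE_tri[OF e(1)] by metis
    have "x \<in> K'" using e(2) t' edge_iff[OF t'(2)] by simp
    then have KK: "K' = K" using boundary_unique[OF x t'(1) K(1) _ K(2)] by simp
    then have "a' \<in> {a,b,c}" using e(1) verts_tri[OF t(1)] t(2) by (auto simp: BE_def)
    moreover have "a' \<noteq> b" using e(2) KK opp_tri[OF nd(1)] edge_iff[OF nd(1)] t(2) pos by (auto simp: hull3_perm)
    moreover have "a' \<noteq> c" using e(2) KK opp_tri[OF nd(2)] edge_iff[OF nd(2)] t(2) pos by (auto simp: hull3_perm)
    ultimately show ?thesis using KK by simp
  qed
  then have "e' = (K, a)" if "e' \<in> BE" "x \<in> opp (fst e') (snd e')" for e'
    using that by (cases e') simp
  then show ?thesis by (rule that[of "(K, a)", rotated 2]) (use 1 2 in auto)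
qed

end

section \<open>Integrals over the boundary\<close>

text \<open>The integral of a function that is not integrable is 0 by convention, so additivity and
  monotonicity need this condition on every side.\<close>

definition bintegrable :: "point list \<Rightarrow> (point \<Rightarrow> real) \<Rightarrow> bool" where
  "bintegrable vs f \<longleftrightarrow> (\<forall>i<length vs. set_integrable lborel {0..1} (\<lambda>t. f (linepath (vs ! i) (vs ! (Suc i mod length vs)) t)))"

lemma boundary_integral_add:
  assumes "bintegrable vs f" "bintegrable vs g"
  shows "bintegrable vs (\<lambda>x. f x + g x)" "boundary_integral vs (\<lambda>x. f x + g x) = boundary_integral vs f + boundary_integral vs g"
proof -
  show "bintegrable vs (\<lambda>x. f x + g x)" using assms by (auto simp: bintegrable_def intro: set_integral_add)
  show "boundary_integral vs (\<lambda>x. f x + g x) = boundary_integral vs f + boundary_integral vs g"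
    using assms unfolding boundary_integral_def bintegrable_def Let_def
    by (simp add: set_integral_add(2) distrib_left sum.distrib)
qed

lemma boundary_integral_cmult:
  shows "bintegrable vs f \<Longrightarrow> bintegrable vs (\<lambda>x. c * f x)" "boundary_integral vs (\<lambda>x. c * f x) = c * boundary_integral vs f"
proof -
  show "bintegrable vs f \<Longrightarrow> bintegrable vs (\<lambda>x. c * f x)" by (auto simp: bintegrable_def)
  show "boundary_integral vs (\<lambda>x. c * f x) = c * boundary_integral vs f"
    unfolding boundary_integral_def Let_def by (simp add: sum_distrib_left mult_ac)
qed

lemma boundary_integral_sum:
  assumes "finite I" "\<And>i. i \<in> I \<Longrightarrow> bintegrable vs (f i)"
  shows "bintegrable vs (\<lambda>x. \<Sum>i\<in>I. f i x) \<and> boundary_integral vs (\<lambda>x. \<Sum>i\<in>I. f i x) = (\<Sum>i\<in>I. boundary_integral vs (f i))"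
  using assms
proof (induction rule: finite_induct)
  case empty
  show ?case by (simp add: bintegrable_def boundary_integral_def set_integrable_def set_lebesgue_integral_def)
next
  case (insert i I)
  then show ?case using boundary_integral_add[of vs "f i" "\<lambda>x. \<Sum>i\<in>I. f i x"] by simp
qed

lemma boundary_integral_mono:
  assumes "bintegrable vs f" "bintegrable vs g" "\<And>x. f x \<le> g x"
  shows "boundary_integral vs f \<le> boundary_integral vs g"
  using assms unfolding boundary_integral_def bintegrable_def Let_def
  by (intro sum_mono mult_left_mono set_integral_mono) auto

text \<open>A side is parametrised injectively, so finitely many points pull back to finitely many
  parameters. Hence the arbitrary values of traces and normals at vertices do no harm.\<close>

lemma boundary_integral_cong_finite:
  assumes S: "finite S" and vs: "\<And>i. i < length vs \<Longrightarrow> vs ! i \<noteq> vs ! (Suc i mod length vs)"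
    and eq: "\<And>i x. i < length vs \<Longrightarrow> x \<in> side vs i \<Longrightarrow> x \<notin> S \<Longrightarrow> f x = g x"
  shows "boundary_integral vs f = boundary_integral vs g" "bintegrable vs f \<longleftrightarrow> bintegrable vs g"
proof -
  have *: "(LINT t:{0..1}|lborel. f (linepath (vs ! i) (vs ! (Suc i mod length vs)) t)) = (LINT t:{0..1}|lborel. g (linepath (vs ! i) (vs ! (Suc i mod length vs)) t))
    \<and> (set_integrable lborel {0..1} (\<lambda>t. f (linepath (vs ! i) (vs ! (Suc i mod length vs)) t)) \<longleftrightarrow> set_integrable lborel {0..1} (\<lambda>t. g (linepath (vs ! i) (vs ! (Suc i mod length vs)) t)))"
    if i: "i < length vs" for i
  proof -
    let ?l = "linepath (vs ! i) (vs ! (Suc i mod length vs))"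
    define X where "X = {0..1} \<inter> ?l -` S"
    have inj: "inj_on ?l {0..1}" using vs[OF i] by (metis inj_on_linepath)
    have "finite X" unfolding X_def using finite_vimage_IntI[OF S inj] by (simp add: Int_commute)
    then have X: "countable X" by (rule countable_finite)
    have e: "indicat_real {0..1} t *\<^sub>R f (?l t) = indicat_real {0..1} t *\<^sub>R g (?l t)" if "t \<notin> X" for t
    proof (cases "t \<in> {0..1}")
      case True
      then have "?l t \<in> side vs i" unfolding side_def using linepath_in_path by metis
      moreover have "?l t \<notin> S" using True that by (simp add: X_def)
      ultimately show ?thesis using eq[OF i] by simp
    qed simp
    show ?thesis unfolding set_lebesgue_integral_def set_integrable_def
      using integral_discrete_difference[OF X, of lborel "\<lambda>t. indicat_real {0..1} t *\<^sub>R f (?l t)" "\<lambda>t. indicat_real {0..1} t *\<^sub>R g (?l t)"]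
        integrable_discrete_difference[OF X, of lborel "\<lambda>t. indicat_real {0..1} t *\<^sub>R f (?l t)" "\<lambda>t. indicat_real {0..1} t *\<^sub>R g (?l t)"] e by simp
  qed
  show "boundary_integral vs f = boundary_integral vs g" unfolding boundary_integral_def Let_def using * by (intro sum.cong) auto
  show "bintegrable vs f \<longleftrightarrow> bintegrable vs g" unfolding bintegrable_def using * by blast
qed

section \<open>Arc length of mesh edges, measured along the polygon\<close>

lemma closed_linepath_vimage: "closed F \<Longrightarrow> closed (linepath a b -` F)"
  by (rule continuous_closed_vimage) (simp_all add: continuous_linepath_at)

lemma bintegrable_closed:
  assumes "closed F" "continuous_on UNIV q"
  shows "bintegrable vs (\<lambda>x. indicator F x * q x)"
  unfolding bintegrable_def
proof (intro allI impI)
  fix i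
  let ?l = "linepath (vs ! i) (vs ! (Suc i mod length vs))"
  have c: "continuous_on UNIV (\<lambda>t. q (?l t))" by (intro continuous_on_compose2[OF assms(2)] continuous_on_linepath) auto
  have closure_domain: "closed (?l -` F)" by (rule closed_linepath_vimage[OF assms(1)])
  have "set_integrable lborel {0..1} (\<lambda>t. q (?l t))"
    using borel_integrable_atLeastAtMost'[of 0 1 "\<lambda>t. q (?l t)"] continuous_on_subset[OF c] by simp
  then have "set_integrable lborel ({0..1} \<inter> (?l -` F)) (\<lambda>t. q (?l t))"
    by (rule set_integrable_subset) (use closure_domain in auto)
  moreover have "(\<lambda>t. indicat_real ({0..1} \<inter> (?l -` F)) t *\<^sub>R q (?l t)) = (\<lambda>t. indicat_real {0..1} t *\<^sub>R (indicator F (?l t) * q (?l t)))"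
    by (auto simp: indicator_def fun_eq_iff)
  ultimately show "set_integrable lborel {0..1} (\<lambda>t. indicator F (?l t) * q (?l t))" unfolding set_integrable_def by simp
qed

lemma segment_length:
  fixes a b u v :: point
  assumes "closed_segment u v \<subseteq> closed_segment a b" "a \<noteq> b"
  shows "dist a b * (LINT t:{0..1}|lborel. indicator (closed_segment u v) (linepath a b t)) = dist u v"
proof -
  have gen: "dist a b * (LINT t:{0..1}|lborel. indicator (closed_segment u v) (linepath a b t)) = dist u v"
    if st: "0 \<le> s" "s \<le> t0" "t0 \<le> 1" "u = linepath a b s" "v = linepath a b t0" for s t0 u v
  proof -
    have d: "linepath a b t1 - linepath a b t2 = (t1 - t2) *\<^sub>R (b - a)" for t1 t2 by (simp add: linepath_def algebra_simps)
    have "linepath a b t \<in> closed_segment u v \<longleftrightarrow> t \<in> {s..t0}" for t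
    proof
      assume "linepath a b t \<in> closed_segment u v"
      then obtain r where r: "0 \<le> r" "r \<le> 1" "linepath a b t = (1 - r) *\<^sub>R u + r *\<^sub>R v" by (auto simp: closed_segment_def)
      have "linepath a b t = linepath a b ((1 - r) * s + r * t0)" unfolding r(3) st by (simp add: linepath_def algebra_simps)
      then have "(t - ((1 - r) * s + r * t0)) *\<^sub>R (b - a) = 0" by (simp flip: d)
      then have "t = (1 - r) * s + r * t0" using assms(2) by simp
      then have "t = s + r * (t0 - s)" by (simp add: algebra_simps)
      moreover have "0 \<le> r * (t0 - s)" "r * (t0 - s) \<le> t0 - s" using r st by (auto intro: mult_left_le_one_le)
      ultimately show "t \<in> {s..t0}" by simp
    next
      assume t: "t \<in> {s..t0}"
      show "linepath a b t \<in> closed_segment u v"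
      proof (cases "s = t0")
        case True then show ?thesis using t st by auto
      next
        case False
        define r where "r = (t - s) / (t0 - s)"
        have r: "0 \<le> r" "r \<le> 1" "t = s + r * (t0 - s)" using t st False by (auto simp: r_def)
        have "linepath a b t = (1 - r) *\<^sub>R u + r *\<^sub>R v" unfolding r(3) st by (simp add: linepath_def algebra_simps)
        then show ?thesis using r by (auto simp: closed_segment_def)
      qed
    qed
    then have "(\<lambda>t. indicator {0..1} t *\<^sub>R indicat_real (closed_segment u v) (linepath a b t)) = indicat_real {s..t0}"
      using st by (auto simp: fun_eq_iff indicator_def)
    then have "(LINT t:{0..1}|lborel. indicator (closed_segment u v) (linepath a b t)) = t0 - s"
      unfolding set_lebesgue_integral_def using st by simp
    moreover have "dist u v = (t0 - s) * dist a b" unfolding st dist_norm d using st by (simp add: norm_minus_commute)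
    ultimately show ?thesis by simp
  qed
  have "u \<in> closed_segment a b" "v \<in> closed_segment a b" using assms(1) by auto
  then obtain s t where s: "0 \<le> s" "s \<le> 1" "u = linepath a b s" and t: "0 \<le> t" "t \<le> 1" "v = linepath a b t"
    by (auto simp: in_segment linepath_def)
  show ?thesis
  proof (cases "s \<le> t")
    case True then show ?thesis using gen s t by blast
  next
    case False
    then have "dist a b * (LINT t:{0..1}|lborel. indicator (closed_segment v u) (linepath a b t)) = dist v u" using gen[of t s v u] s t by simp
    then show ?thesis by (simp add: closed_segment_commute dist_commute)
  qed
qed

text \<open>Both sides are the length of the intersection, which is empty or a segment. This
  exchanges the parametrisations of a polygon side and of a mesh edge.\<close>

lemma segment_length_sym:
  fixes a b p q :: point
  assumes "a \<noteq> b" "p \<noteq> q"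
  shows "dist a b * (LINT t:{0..1}|lborel. indicator (closed_segment p q) (linepath a b t))
       = dist p q * (LINT t:{0..1}|lborel. indicator (closed_segment a b) (linepath p q t))"
proof -
  let ?I = "closed_segment a b \<inter> closed_segment p q"
  have e: "(LINT t:{0..1}|lborel. indicat_real (closed_segment p q) (linepath a b t))
    = (LINT t:{0..1}|lborel. indicator (closed_segment a b \<inter> closed_segment p q) (linepath a b t))"
    for a b p q :: point
  proof -
    have *: "indicat_real {0..1} t *\<^sub>R indicat_real (closed_segment p q) (linepath a b t)
      = indicat_real {0..1} t *\<^sub>R indicat_real (closed_segment a b \<inter> closed_segment p q) (linepath a b t)" for t
      using linepath_in_path[of t a b] by (cases "t \<in> {0..1}") (simp_all add: indicator_def)
    show ?thesis unfolding set_lebesgue_integral_def by (simp only: *)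
  qed
  show ?thesis
  proof (cases "?I = {}")
    case True
    then have "closed_segment p q \<inter> closed_segment a b = {}" by blast
    then show ?thesis unfolding e[of p q a b] e[of a b p q] using True by (simp add: set_lebesgue_integral_def)
  next
    case False
    have "compact ?I" "convex ?I" by (auto intro: compact_Int convex_Int)
    moreover have "collinear ?I" by (meson collinear_closed_segment collinear_subset inf_le1)
    ultimately obtain u v where uv: "?I = closed_segment u v" using compact_convex_collinear_segment[OF False] by metis
    then have "closed_segment p q \<inter> closed_segment a b = closed_segment u v" by blast
    then show ?thesis unfolding e[of p q a b] e[of a b p q] uv
      using segment_length[of u v a b] segment_length[of u v p q] assms uv by (metis inf_le1 inf_le2)
  qed
qed

lemma polygon_sides_distinct_ends:
  assumes "simple_polygon vs" "i < length vs" shows "vs ! i \<noteq> vs ! (Suc i mod length vs)"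
proof -
  have n: "length vs \<ge> 3" "distinct vs" using assms(1) by (auto simp: simple_polygon_def)
  have "Suc i mod length vs \<noteq> i" using assms(2) n(1) by (cases "Suc i = length vs") auto
  moreover have "Suc i mod length vs < length vs" using assms(2) by (intro mod_less_divisor) linarith
  ultimately show ?thesis using n(2) assms(2) by (simp add: nth_eq_iff_index_eq)
qed

lemma (in mesh) sides:
  "i < length vs \<Longrightarrow> vs ! i \<noteq> vs ! (Suc i mod length vs)"
  "i < length vs \<Longrightarrow> j < length vs \<Longrightarrow> i \<noteq> j \<Longrightarrow> side vs i \<inter> side vs j \<subseteq> set vs"
  "i < length vs \<Longrightarrow> side vs i \<subseteq> frontier \<Omega>"
proof -
  have sp: "simple_polygon vs" using pd by (simp add: polygonal_domain_def)
  show "vs ! i \<noteq> vs ! (Suc i mod length vs)" if "i < length vs" by (rule polygon_sides_distinct_ends[OF sp that])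
  show "side vs i \<inter> side vs j \<subseteq> set vs" if "i < length vs" "j < length vs" "i \<noteq> j"
  proof -
    have "side vs i \<inter> side vs j \<subseteq> side_ends vs i" using sp that unfolding simple_polygon_def by blast
    also have "\<dots> \<subseteq> set vs" using that by (auto simp: side_ends_def intro!: nth_mem mod_less_divisor)
    finally show ?thesis .
  qed
  show "side vs i \<subseteq> frontier \<Omega>" if "i < length vs" using domain_props(4) that by blast
qed

text \<open>Written along [p, q] instead of along the polygon, the integrand becomes the number of
  sides through a point, which is 1 apart from corners. The edge may thus be placed in any way among
  the sides, even across a straight angle.\<close>

lemma (in mesh) boundary_length:
  assumes pq: "p \<noteq> q" "closed_segment p q \<subseteq> frontier \<Omega>"
  shows "boundary_integral vs (indicator (closed_segment p q)) = dist p q"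
proof -
  let ?n = "length vs"
  have inj: "inj_on (linepath p q) {0..1}" using pq(1) by (metis inj_on_linepath)
  define X where "X = {0..1} \<inter> linepath p q -` set vs"
  have "finite X" unfolding X_def using finite_vimage_IntI[OF _ inj, of "set vs"] by (simp add: Int_commute)
  then have X: "countable X" by (rule countable_finite)
  have one: "(\<Sum>i<?n. indicat_real (side vs i) (linepath p q t)) = 1" if t: "t \<in> {0..1}" "t \<notin> X" for t
  proof -
    have "linepath p q t \<in> closed_segment p q" using t(1) linepath_in_path by blast
    then obtain i where i: "i < ?n" "linepath p q t \<in> side vs i" using pq(2) domain_props(4) by blast
    have "linepath p q t \<notin> side vs j" if "j < ?n" "j \<noteq> i" for j
      using sides(2)[of i j] i that t by (auto simp: X_def)
    then have "(\<Sum>j<?n. indicat_real (side vs j) (linepath p q t)) = (\<Sum>j<?n. if j = i then 1 else 0)"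
      using i by (intro sum.cong) (auto simp: indicator_def)
    then show ?thesis using i by simp
  qed
  have si: "set_integrable lborel {0..1} (\<lambda>t. indicat_real (side vs i) (linepath p q t))" for i
  proof -
    have "closed (linepath p q -` side vs i)" unfolding side_def
      by (rule closed_linepath_vimage) simp
    then have b: "{0..1} \<inter> linepath p q -` side vs i \<in> sets borel" by auto
    have "integrable lborel (indicat_real ({0..1} \<inter> linepath p q -` side vs i))"
    proof (rule integrable_real_indicator)
      show "{0..1} \<inter> linepath p q -` side vs i \<in> sets lborel" using b by simp
      show "emeasure lborel ({0..1} \<inter> linepath p q -` side vs i) < \<infinity>"
        by (rule le_less_trans[OF emeasure_mono[of _ "{0..1}"]]) auto
    qed
    moreover have "indicat_real ({0..1} \<inter> linepath p q -` side vs i) = (\<lambda>t. indicator {0..1} t *\<^sub>R indicat_real (side vs i) (linepath p q t))"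
      by (auto simp: indicator_def fun_eq_iff)
    ultimately show ?thesis unfolding set_integrable_def by simp
  qed
  have "boundary_integral vs (indicator (closed_segment p q)) = (\<Sum>i<?n. dist p q * (LINT t:{0..1}|lborel. indicat_real (side vs i) (linepath p q t)))"
    unfolding boundary_integral_def Let_def side_def
    by (intro sum.cong refl segment_length_sym pq(1)) (use sides(1) in auto)
  also have "\<dots> = dist p q * (LINT t:{0..1}|lborel. (\<Sum>i<?n. indicat_real (side vs i) (linepath p q t)))"
  proof -
    have "(LINT t:{0..1}|lborel. (\<Sum>i<?n. indicat_real (side vs i) (linepath p q t)))
      = (\<Sum>i<?n. LINT t:{0..1}|lborel. indicat_real (side vs i) (linepath p q t))"
      unfolding set_lebesgue_integral_def scaleR_sum_right
      by (rule Bochner_Integration.integral_sum) (use si in \<open>auto simp: set_integrable_def\<close>)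
    then show ?thesis by (simp add: sum_distrib_left)
  qed
  also have "(LINT t:{0..1}|lborel. (\<Sum>i<?n. indicat_real (side vs i) (linepath p q t))) = (LINT t:{0..1::real}|lborel. (1::real))"
  proof -
    have *: "indicat_real {0..1} t *\<^sub>R (\<Sum>i<?n. indicat_real (side vs i) (linepath p q t)) = indicat_real {0..1} t *\<^sub>R 1"
      if "t \<notin> X" for t using one[of t] that by (cases "t \<in> {0..1}") auto
    show ?thesis unfolding set_lebesgue_integral_def
      by (intro integral_discrete_difference[OF X, of lborel
          "\<lambda>t. indicat_real {0..1} t *\<^sub>R (\<Sum>i<?n. indicat_real (side vs i) (linepath p q t))" "\<lambda>t. indicat_real {0..1} t *\<^sub>R 1"] *) auto
  qed
  also have "\<dots> = 1" by (simp add: set_lebesgue_integral_def)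
  finally show ?thesis by simp
qed

context mesh begin

definition eint :: "point set \<times> point \<Rightarrow> (point \<Rightarrow> real) \<Rightarrow> real" where
  "eint e q = boundary_integral vs (\<lambda>x. indicator (opp (fst e) (snd e)) x * q x)"

lemma opp_closed: "e \<in> BE \<Longrightarrow> closed (opp (fst e) (snd e))"
  by (cases e) (metis BE_tri closed_segment fst_conv snd_conv)

text \<open>Edge by edge, f is replaced by a function that is continuous on the whole plane;
  agreement off the vertices is enough, and integrability of f is inherited.\<close>

lemma boundary_integral_eq:
  assumes q: "\<And>e. e \<in> BE \<Longrightarrow> continuous_on UNIV (q e)"
    and f: "\<And>x e. e \<in> BE \<Longrightarrow> x \<in> opp (fst e) (snd e) \<Longrightarrow> x \<notin> V \<Longrightarrow> f x = q e x"
  shows "boundary_integral vs f = (\<Sum>e\<in>BE. eint e (q e))" "bintegrable vs f"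
proof -
  define g where "g x = (\<Sum>e\<in>BE. indicator (opp (fst e) (snd e)) x * q e x)" for x
  have gi: "bintegrable vs g" "boundary_integral vs g = (\<Sum>e\<in>BE. eint e (q e))"
    using boundary_integral_sum[OF finBE, of vs "\<lambda>e x. indicator (opp (fst e) (snd e)) x * q e x"] bintegrable_closed[OF opp_closed q]
    unfolding g_def[abs_def] eint_def by auto
  have eq: "f x = g x" if x: "x \<in> frontier \<Omega>" "x \<notin> V" for x
  proof -
    obtain e where e: "e \<in> BE" "x \<in> opp (fst e) (snd e)" "\<And>e'. e' \<in> BE \<Longrightarrow> x \<in> opp (fst e') (snd e') \<Longrightarrow> e' = e"
      by (rule BE_ex1[OF x]) (rule that)
    have "indicator (opp (fst e') (snd e')) x * q e' x = (if e' = e then q e x else 0)" if "e' \<in> BE" for e'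
    proof (cases "e' = e")
      case True
      then show ?thesis using e(2) by simp
    next
      case False
      then have "x \<notin> opp (fst e') (snd e')" using e(3)[OF that] by metis
      then show ?thesis using False by simp
    qed
    then have "g x = (\<Sum>e'\<in>BE. if e' = e then q e x else 0)" unfolding g_def by (intro sum.cong refl)
    also have "\<dots> = q e x" using e(1) finBE by simp
    finally show ?thesis using f[OF e(1,2) x(2)] by simp
  qed
  have "boundary_integral vs f = boundary_integral vs g" "bintegrable vs f \<longleftrightarrow> bintegrable vs g"
    by (rule boundary_integral_cong_finite[OF finV sides(1)]; use eq sides(3) in blast)+
  then show "boundary_integral vs f = (\<Sum>e\<in>BE. eint e (q e))" "bintegrable vs f" using gi by simp_all
qed

lemma eint_lin:
  assumes "e \<in> BE" "continuous_on UNIV f" "continuous_on UNIV g"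
  shows "eint e (\<lambda>x. f x + c * g x) = eint e f + c * eint e g"
proof -
  note i = bintegrable_closed[OF opp_closed[OF assms(1)]]
  have "eint e (\<lambda>x. f x + c * g x) = boundary_integral vs (\<lambda>x. indicator (opp (fst e) (snd e)) x * f x + c * (indicator (opp (fst e) (snd e)) x * g x))"
    unfolding eint_def by (simp add: algebra_simps)
  also have "\<dots> = eint e f + c * eint e g"
    unfolding eint_def using boundary_integral_add(2)[OF i[OF assms(2)] boundary_integral_cmult(1)[OF i[OF assms(3)]]] boundary_integral_cmult(2) by simp
  finally show ?thesis .
qed

lemma eint_cmult: "eint e (\<lambda>x. c * g x) = c * eint e g"
proof -
  have "eint e (\<lambda>x. c * g x) = boundary_integral vs (\<lambda>x. c * (indicator (opp (fst e) (snd e)) x * g x))"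
    unfolding eint_def by (simp add: algebra_simps)
  then show ?thesis unfolding eint_def by (simp add: boundary_integral_cmult(2))
qed

lemma eint_mono:
  assumes "e \<in> BE" "continuous_on UNIV f" "continuous_on UNIV g" "\<And>x. x \<in> opp (fst e) (snd e) \<Longrightarrow> f x \<le> g x"
  shows "eint e f \<le> eint e g"
  unfolding eint_def
  by (intro boundary_integral_mono bintegrable_closed opp_closed assms) (use assms(4) in \<open>auto simp: indicator_def\<close>)

lemma eint_cong: "(\<And>x. x \<in> opp (fst e) (snd e) \<Longrightarrow> f x = g x) \<Longrightarrow> eint e f = eint e g"
proof -
  assume "\<And>x. x \<in> opp (fst e) (snd e) \<Longrightarrow> f x = g x"
  then have "(\<lambda>x. indicator (opp (fst e) (snd e)) x * f x) = (\<lambda>x. indicator (opp (fst e) (snd e)) x * g x)"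
    by (auto simp: indicator_def fun_eq_iff)
  then show ?thesis by (simp add: eint_def)
qed

lemma eint_const:
  assumes "K \<in> \<T>" "nondeg a b c" "K = convex hull {a,b,c}" "closed_segment b c \<subseteq> frontier \<Omega>"
  shows "eint (K, a) (\<lambda>x. r) = r * norm (c - b)"
proof -
  have "eint (K, a) (\<lambda>x. r * 1) = r * eint (K, a) (\<lambda>x. 1)" by (rule eint_cmult)
  also have "eint (K, a) (\<lambda>x. 1) = dist b c"
    unfolding eint_def using boundary_length[OF nondeg_imp(2)[OF assms(2)] assms(4)] opp_tri[OF assms(2)] assms(3)
    by (simp add: eta_contract_eq)
  finally show ?thesis by (simp add: dist_norm norm_minus_commute)
qed

end

section \<open>Finite element functions\<close>

lemma onorm_inner_le:
  fixes d :: point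
  assumes "norm d \<le> L" shows "onorm (\<lambda>h. h \<bullet> d) \<le> L"
proof (rule onorm_le)
  fix h
  have "\<bar>h \<bullet> d\<bar> \<le> norm h * norm d" by (rule Cauchy_Schwarz_ineq2)
  also have "\<dots> \<le> norm h * L" using assms by (intro mult_left_mono) auto
  finally show "norm (h \<bullet> d) \<le> L * norm h" by (simp add: mult.commute)
qed

text \<open>The interior points where they differ form an open null set, which is empty; a
  polynomial that vanishes on an open set vanishes.\<close>

lemma poly_AE_unique:
  assumes "p \<in> polys k" "q \<in> polys m" "2 simplex K" "AE x in lebesgue. x \<in> K \<longrightarrow> p x = q x"
  shows "p = q"
proof -
  define d where "d x = p x + (-1) * q x" for x
  have d: "d \<in> polys (max k m)" unfolding d_def[abs_def]
    by (intro add_in_polys scale_in_polys polys_mono[OF assms(1)] polys_mono[OF assms(2)]) auto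
  define S where "S = interior K \<inter> {x. d x \<noteq> 0}"
  have "open {x. d x \<noteq> 0}" using polys_continuous[OF d] by (intro open_Collect_neq continuous_on_const)
  then have "open S" unfolding S_def by auto
  moreover have "negligible S"
  proof -
    have "AE x in lebesgue. x \<notin> S" using assms(4) by eventually_elim (use interior_subset in \<open>auto simp: S_def d_def\<close>)
    then show ?thesis using \<open>open S\<close> unfolding negligible_iff_null_sets by (subst (asm) AE_iff_null_sets[symmetric]) auto
  qed
  ultimately have "S = {}" using open_not_negligible by blast
  then have "d x = 0" if "x \<in> interior K" for x using that by (auto simp: S_def)
  then have "d x = 0" for x using polys_zero[OF d open_interior interior_tri_ne[OF assms(3)]] by blast
  then show ?thesis by (auto simp: d_def fun_eq_iff)
qed

lemma tri_lmeasurable: assumes "2 simplex (K::point set)" shows "K \<in> lmeasurable" "K \<in> sets lebesgue"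
  using tri_facts(2)[OF assms] by (auto simp: lmeasurable_compact fmeasurableD)

lemma L2_integrable:
  fixes f :: "point \<Rightarrow> 'a::euclidean_space"
  assumes "S \<in> lmeasurable" "f \<in> L2 S" shows "integrable (lebesgue_on S) f"
proof -
  interpret finite_measure "lebesgue_on S" using assms(1) by (rule finite_measure_lebesgue_on)
  have f: "f \<in> borel_measurable (lebesgue_on S)" "integrable (lebesgue_on S) (\<lambda>x. (norm (f x))\<^sup>2)" using assms(2) by (auto simp: L2_def)
  show ?thesis
  proof (rule Bochner_Integration.integrable_bound[of _ "\<lambda>x. 1 + (norm (f x))\<^sup>2"])
    show "integrable (lebesgue_on S) (\<lambda>x. 1 + (norm (f x))\<^sup>2)" using f by (intro Bochner_Integration.integrable_add integrable_const)
    have "t \<le> 1 + t\<^sup>2" if "t \<ge> 0" for t :: real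
      using that zero_le_power2[of "t - 1"] by (simp add: power2_diff)
    then show "AE x in lebesgue_on S. norm (f x) \<le> norm (1 + (norm (f x))\<^sup>2)" by (intro AE_I2) simp
  qed (rule f)
qed

lemma L2_bounded:
  fixes f :: "point \<Rightarrow> 'a::euclidean_space"
  assumes "S \<in> lmeasurable" "f \<in> borel_measurable (lebesgue_on S)" "AE x in lebesgue_on S. norm (f x) \<le> B"
  shows "f \<in> L2 S"
proof -
  have "integrable (lebesgue_on S) (\<lambda>x. (norm (f x))\<^sup>2)"
  proof (rule integrable_bounded_lebesgue_on[OF assms(1), where B="B\<^sup>2"])
    show "AE x in lebesgue_on S. norm ((norm (f x))\<^sup>2) \<le> B\<^sup>2"
      using assms(3) by eventually_elim (auto intro: power_mono)
  qed (use assms(2) in auto)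
  then show ?thesis using assms(2) by (simp add: L2_def)
qed

lemma L2_add:
  fixes f g :: "point \<Rightarrow> 'a::euclidean_space"
  assumes "f \<in> L2 S" "g \<in> L2 S" shows "(\<lambda>x. f x + c *\<^sub>R g x) \<in> L2 S"
proof -
  have f: "f \<in> borel_measurable (lebesgue_on S)" "integrable (lebesgue_on S) (\<lambda>x. (norm (f x))\<^sup>2)"
    and g: "g \<in> borel_measurable (lebesgue_on S)" "integrable (lebesgue_on S) (\<lambda>x. (norm (g x))\<^sup>2)" using assms by (auto simp: L2_def)
  have "integrable (lebesgue_on S) (\<lambda>x. (norm (f x + c *\<^sub>R g x))\<^sup>2)"
  proof (rule Bochner_Integration.integrable_bound[of _ "\<lambda>x. 2 * (norm (f x))\<^sup>2 + (2 * c\<^sup>2) * (norm (g x))\<^sup>2"])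
    show "integrable (lebesgue_on S) (\<lambda>x. 2 * (norm (f x))\<^sup>2 + (2 * c\<^sup>2) * (norm (g x))\<^sup>2)" using f g by simp
    show "AE x in lebesgue_on S. norm ((norm (f x + c *\<^sub>R g x))\<^sup>2) \<le> norm (2 * (norm (f x))\<^sup>2 + (2 * c\<^sup>2) * (norm (g x))\<^sup>2)"
    proof (intro AE_I2)
      fix x
      have "(norm (f x + c *\<^sub>R g x))\<^sup>2 \<le> (norm (f x) + norm (c *\<^sub>R g x))\<^sup>2" by (intro power_mono norm_triangle_ineq) simp
      also have "\<dots> \<le> 2 * (norm (f x))\<^sup>2 + 2 * (norm (c *\<^sub>R g x))\<^sup>2"
        using zero_le_power2[of "norm (f x) - norm (c *\<^sub>R g x)"] unfolding power2_diff power2_sum by linarith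
      also have "\<dots> = 2 * (norm (f x))\<^sup>2 + (2 * c\<^sup>2) * (norm (g x))\<^sup>2" by (simp add: power_mult_distrib)
      finally show "norm ((norm (f x + c *\<^sub>R g x))\<^sup>2) \<le> norm (2 * (norm (f x))\<^sup>2 + (2 * c\<^sup>2) * (norm (g x))\<^sup>2)" by simp
    qed
  qed (use f g in auto)
  then show ?thesis using f g by (simp add: L2_def)
qed

lemma L2_inner_integrable:
  fixes f g :: "point \<Rightarrow> point"
  assumes "f \<in> L2 S" "g \<in> L2 S" shows "integrable (lebesgue_on S) (\<lambda>x. f x \<bullet> g x)"
proof -
  have f: "f \<in> borel_measurable (lebesgue_on S)" "integrable (lebesgue_on S) (\<lambda>x. (norm (f x))\<^sup>2)"
    and g: "g \<in> borel_measurable (lebesgue_on S)" "integrable (lebesgue_on S) (\<lambda>x. (norm (g x))\<^sup>2)" using assms by (auto simp: L2_def)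
  show ?thesis
  proof (rule Bochner_Integration.integrable_bound[of _ "\<lambda>x. (norm (f x))\<^sup>2 + (norm (g x))\<^sup>2"])
    show "integrable (lebesgue_on S) (\<lambda>x. (norm (f x))\<^sup>2 + (norm (g x))\<^sup>2)" using f g by simp
    show "AE x in lebesgue_on S. norm (f x \<bullet> g x) \<le> norm ((norm (f x))\<^sup>2 + (norm (g x))\<^sup>2)"
    proof (intro AE_I2)
      fix x
      have "\<bar>f x \<bullet> g x\<bar> \<le> norm (f x) * norm (g x)" by (rule Cauchy_Schwarz_ineq2)
      also have "\<dots> \<le> (norm (f x))\<^sup>2 + (norm (g x))\<^sup>2"
        using zero_le_power2[of "norm (f x) - norm (g x)"] zero_le_power2[of "norm (f x)"] zero_le_power2[of "norm (g x)"]
        unfolding power2_diff by linarith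
      finally show "norm (f x \<bullet> g x) \<le> norm ((norm (f x))\<^sup>2 + (norm (g x))\<^sup>2)" by simp
    qed
  qed (use f g in auto)
qed

text \<open>Written in the form used by \<open>fe_grad_trace\<close>, so that the trace of the
  gradient is identified by unfolding.\<close>

definition pgrad :: "(point \<Rightarrow> real) \<Rightarrow> point \<Rightarrow> point" where "pgrad p x = (THE D. GDERIV p x :> D)"

lemma pgrad_eq: "GDERIV p x :> D \<Longrightarrow> pgrad p x = D"
  unfolding pgrad_def using GDERIV_unique by blast

lemma pgrad_poly:
  assumes "p \<in> polys k"
  shows "GDERIV p x :> pgrad p x" "continuous_on UNIV (pgrad p)" "(\<lambda>x. pgrad p x $ 1) \<in> polys k" "(\<lambda>x. pgrad p x $ 2) \<in> polys k"
proof -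
  obtain D where D: "\<And>x. GDERIV p x :> D x" "(\<lambda>x. D x $ 1) \<in> polys k" "(\<lambda>x. D x $ 2) \<in> polys k" using polys_gderiv[OF assms] by metis
  have eq: "pgrad p = D" using pgrad_eq D(1) by blast
  show "GDERIV p x :> pgrad p x" "(\<lambda>x. pgrad p x $ 1) \<in> polys k" "(\<lambda>x. pgrad p x $ 2) \<in> polys k" using D eq by simp_all
  have "continuous_on UNIV (\<lambda>x. \<chi> i. D x $ i)"
  proof (rule continuous_on_vec_lambda)
    fix i :: 2 show "continuous_on UNIV (\<lambda>x. D x $ i)"
      using exhaust_2[of i] polys_continuous[OF D(2)] polys_continuous[OF D(3)] by auto
  qed
  then show "continuous_on UNIV (pgrad p)" using eq by (simp add: vec_lambda_eta)
qed

text \<open>The components of the gradient are polynomials, so the inverse estimate bounds it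
  pointwise; the mean value inequality on the convex K turns this into a bound on the
  oscillation.\<close>

lemma poly_osc:
  assumes p: "p \<in> polys k" and K: "2 simplex K" and xy: "x \<in> K" "y \<in> K"
  shows "measure lebesgue K * (norm (pgrad p x))\<^sup>2 \<le> inv_const k * (LINT z|lebesgue_on K. (norm (pgrad p z))\<^sup>2)"
    "measure lebesgue K * (p x - p y)\<^sup>2 \<le> (diameter K)\<^sup>2 * (inv_const k * (LINT z|lebesgue_on K. (norm (pgrad p z))\<^sup>2))"
proof -
  note tf = tri_facts[OF K]
  let ?E = "LINT z|lebesgue_on K. (norm (pgrad p z))\<^sup>2"
  have int: "integrable (lebesgue_on K) (\<lambda>z. (pgrad p z $ i)\<^sup>2)" for i
    by (intro integrable_on_compact[OF tf(2)] continuous_intros continuous_on_subset[OF pgrad_poly(2)[OF p]] continuous_on_component) auto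
  have nsq: "(norm (pgrad p z))\<^sup>2 = (pgrad p z $ 1)\<^sup>2 + (pgrad p z $ 2)\<^sup>2" for z
    unfolding power2_norm_eq_inner inner_vec_def sum_2 by (simp add: power2_eq_square)
  have g: "measure lebesgue K * (norm (pgrad p z))\<^sup>2 \<le> inv_const k * ?E" if z: "z \<in> K" for z
    using inverse_estimate[OF pgrad_poly(3)[OF p] tf(1,2) z] inverse_estimate[OF pgrad_poly(4)[OF p] tf(1,2) z]
    unfolding nsq using int by (simp add: distrib_left)
  show "measure lebesgue K * (norm (pgrad p x))\<^sup>2 \<le> inv_const k * ?E" by (rule g[OF xy(1)])
  have m: "measure lebesgue K > 0"
  proof -
    have "\<not> negligible K" using interior_tri_ne[OF K] open_not_negligible[OF open_interior] negligible_subset interior_subset by metis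
    then show ?thesis using tri_lmeasurable[OF K]
      by (metis measure_nonneg negligible_iff_measure order_le_less)
  qed
  define B where "B = sqrt (inv_const k * ?E / measure lebesgue K)"
  have E0: "?E \<ge> 0" by simp
  have B0: "0 \<le> inv_const k * ?E / measure lebesgue K" using E0 inv_const_pos[of k] m by simp
  have Bp: "0 \<le> B" unfolding B_def using B0 by simp
  have b: "norm (pgrad p z) \<le> B" if "z \<in> K" for z
  proof -
    have "(norm (pgrad p z))\<^sup>2 \<le> inv_const k * ?E / measure lebesgue K" using g[OF that] m by (simp add: pos_le_divide_eq mult.commute)
    then show ?thesis unfolding B_def by (rule real_le_rsqrt)
  qed
  have "norm (p x - p y) \<le> B * norm (x - y)"
  proof (rule differentiable_bound[OF tf(1)])
    show "(p has_derivative (\<lambda>h. h \<bullet> pgrad p z)) (at z within K)" for z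
      using pgrad_poly(1)[OF p, of z] unfolding gderiv_def by (rule has_derivative_at_withinI)
    show "onorm (\<lambda>h. h \<bullet> pgrad p z) \<le> B" if "z \<in> K" for z
      by (rule onorm_inner_le[OF b[OF that]])
  qed (use xy in auto)
  also have "\<dots> \<le> B * diameter K" using diameter_bounded_bound[OF compact_imp_bounded[OF tf(2)] xy] Bp
    by (intro mult_left_mono) (auto simp: dist_norm)
  finally have "\<bar>p x - p y\<bar>\<^sup>2 \<le> (B * diameter K)\<^sup>2" by (intro power_mono) auto
  then have "(p x - p y)\<^sup>2 \<le> (inv_const k * ?E / measure lebesgue K) * (diameter K)\<^sup>2"
    unfolding B_def power_mult_distrib real_sqrt_pow2[OF B0] by simp
  then show "measure lebesgue K * (p x - p y)\<^sup>2 \<le> (diameter K)\<^sup>2 * (inv_const k * ?E)" using m by (simp add: field_simps)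
qed

section \<open>Element polynomials, gradients and continuity of finite element functions\<close>

locale fe_mesh = mesh +
  fixes k :: nat assumes k1: "k \<ge> 1"
begin

abbreviation fe :: "(point \<Rightarrow> real) set" where "fe \<equiv> fe_space \<Omega> \<T> k"

definition ep :: "(point \<Rightarrow> real) \<Rightarrow> point set \<Rightarrow> point \<Rightarrow> real" where "ep v K = elem_poly v K"

lemma domain_measurable: "\<Omega> \<in> lmeasurable" "\<Omega> \<in> sets lebesgue"
  using domain_props by (auto simp: bounded_set_imp_lmeasurable fmeasurableD)

text \<open>\<open>elem_poly\<close> is a choice among polynomials of all degrees; uniqueness on a
  triangle makes the choice immaterial.\<close>

lemma ep_unique:
  assumes "K \<in> \<T>" "AE x in lebesgue. x \<in> K \<longrightarrow> v x = p x" "p \<in> polys m"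
  shows "ep v K = p"
proof -
  have ae: "AE x in lebesgue_on K. v x = p x" using assms(2) by (simp add: lebesgue_on_AE[OF tri_lmeasurable(2)[OF mesh_simplex[OF assms(1)]]])
  have "(\<exists>k. ep v K \<in> polys k) \<and> (AE x in lebesgue_on K. v x = ep v K x)"
    unfolding ep_def elem_poly_def by (rule someI[of "\<lambda>p. (\<exists>k. p \<in> polys k) \<and> (AE x in lebesgue_on K. v x = p x)" p]) (use ae assms in auto)
  then obtain k' where k': "ep v K \<in> polys k'" "AE x in lebesgue. x \<in> K \<longrightarrow> v x = ep v K x"
    by (auto simp: lebesgue_on_AE[OF tri_lmeasurable(2)[OF mesh_simplex[OF assms(1)]]])
  show ?thesis
  proof (rule poly_AE_unique[OF k'(1) assms(3) mesh_simplex[OF assms(1)]])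
    show "AE x in lebesgue. x \<in> K \<longrightarrow> ep v K x = p x" using k'(2) assms(2) by eventually_elim auto
  qed
qed

lemma ep_poly:
  assumes "v \<in> fe" "K \<in> \<T>"
  shows "ep v K \<in> polys k" "AE x in lebesgue. x \<in> K \<longrightarrow> v x = ep v K x"
proof -
  obtain p where "p \<in> polys k" "AE x in lebesgue_on K. v x = p x" using assms by (auto simp: fe_space_def)
  then have p: "p \<in> polys k" "AE x in lebesgue. x \<in> K \<longrightarrow> v x = p x"
    by (auto simp: lebesgue_on_AE[OF tri_lmeasurable(2)[OF mesh_simplex[OF assms(2)]]])
  have "ep v K = p" by (rule ep_unique[OF assms(2) p(2,1)])
  then show "ep v K \<in> polys k" "AE x in lebesgue. x \<in> K \<longrightarrow> v x = ep v K x" using p by simp_all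
qed

lemma weak_gradient_add:
  assumes "v \<in> L2 \<Omega>" "g \<in> L2 \<Omega>" "weak_gradient \<Omega> v g" "w \<in> L2 \<Omega>" "h \<in> L2 \<Omega>" "weak_gradient \<Omega> w h"
  shows "weak_gradient \<Omega> (\<lambda>x. v x + c * w x) (\<lambda>x. g x + c *\<^sub>R h x)"
  unfolding weak_gradient_def
proof (intro allI impI)
  fix \<phi> D assume t: "test_function \<Omega> \<phi> D"
  obtain B where B: "B \<ge> 0" "\<And>x. \<bar>\<phi> x\<bar> \<le> B" "\<And>x. norm (D x) \<le> B" "continuous_on UNIV \<phi>" "continuous_on UNIV D"
    using test_function_bounded[OF t] by metis
  have m: "\<phi> \<in> borel_measurable (lebesgue_on \<Omega>)" "D \<in> borel_measurable (lebesgue_on \<Omega>)"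
    using borel_measurable_continuous_onI[OF B(4)] borel_measurable_continuous_onI[OF B(5)]
    by (auto intro!: measurable_restrict_space1 measurable_completion)
  have i1: "integrable (lebesgue_on \<Omega>) (\<lambda>x. f x *\<^sub>R D x)" if "f \<in> L2 \<Omega>" for f :: "point \<Rightarrow> real"
  proof (rule Bochner_Integration.integrable_bound[of _ "\<lambda>x. B * f x"])
    show "integrable (lebesgue_on \<Omega>) (\<lambda>x. B * f x)" using L2_integrable[OF domain_measurable(1) that] by simp
    then show "(\<lambda>x. f x *\<^sub>R D x) \<in> borel_measurable (lebesgue_on \<Omega>)" using m that by (auto simp: L2_def)
    show "AE x in lebesgue_on \<Omega>. norm (f x *\<^sub>R D x) \<le> norm (B * f x)"
      using B(1,3) by (intro AE_I2) (auto simp: abs_mult mult.commute[of B] intro!: mult_left_mono)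
  qed
  have i2: "integrable (lebesgue_on \<Omega>) (\<lambda>x. \<phi> x *\<^sub>R f x)" if "f \<in> L2 \<Omega>" for f :: "point \<Rightarrow> point"
  proof (rule Bochner_Integration.integrable_bound[of _ "\<lambda>x. B *\<^sub>R f x"])
    show "integrable (lebesgue_on \<Omega>) (\<lambda>x. B *\<^sub>R f x)" using L2_integrable[OF domain_measurable(1) that] by simp
    then show "(\<lambda>x. \<phi> x *\<^sub>R f x) \<in> borel_measurable (lebesgue_on \<Omega>)" using m that by (auto simp: L2_def)
    show "AE x in lebesgue_on \<Omega>. norm (\<phi> x *\<^sub>R f x) \<le> norm (B *\<^sub>R f x)"
      using B(1,2) by (intro AE_I2) (auto intro!: mult_right_mono)
  qed
  have "(LINT x|lebesgue_on \<Omega>. (v x + c * w x) *\<^sub>R D x) = (LINT x|lebesgue_on \<Omega>. v x *\<^sub>R D x) + c *\<^sub>R (LINT x|lebesgue_on \<Omega>. w x *\<^sub>R D x)"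
    using i1[OF assms(1)] i1[OF assms(4)] by (simp add: scaleR_add_left flip: scaleR_scaleR)
  also have "\<dots> = - (LINT x|lebesgue_on \<Omega>. \<phi> x *\<^sub>R g x) - c *\<^sub>R (LINT x|lebesgue_on \<Omega>. \<phi> x *\<^sub>R h x)"
    using assms(3,6) t by (simp add: weak_gradient_def)
  also have "\<dots> = - (LINT x|lebesgue_on \<Omega>. \<phi> x *\<^sub>R (g x + c *\<^sub>R h x))"
  proof -
    have "(\<lambda>x. \<phi> x *\<^sub>R (g x + c *\<^sub>R h x)) = (\<lambda>x. \<phi> x *\<^sub>R g x + c *\<^sub>R (\<phi> x *\<^sub>R h x))"
      by (simp add: fun_eq_iff scaleR_add_right mult.commute)
    then show ?thesis using i2[OF assms(2)] i2[OF assms(5)] by (simp only:) (simp del: scaleR_scaleR)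
  qed
  finally show "(LINT x|lebesgue_on \<Omega>. (v x + c * w x) *\<^sub>R D x) = - (LINT x|lebesgue_on \<Omega>. \<phi> x *\<^sub>R (g x + c *\<^sub>R h x))" .
qed

lemma grad_props:
  assumes "v \<in> fe" shows "grad \<Omega> v \<in> L2 \<Omega>" "weak_gradient \<Omega> v (grad \<Omega> v)" "v \<in> L2 \<Omega>"
proof -
  have "v \<in> H1 \<Omega>" using assms by (simp add: fe_space_def)
  then obtain g where g: "g \<in> L2 \<Omega> \<and> weak_gradient \<Omega> v g" and v: "v \<in> L2 \<Omega>" by (auto simp: H1_def)
  show "v \<in> L2 \<Omega>" by (rule v)
  show "grad \<Omega> v \<in> L2 \<Omega>" "weak_gradient \<Omega> v (grad \<Omega> v)"
    unfolding grad_def using someI[of "\<lambda>g. g \<in> L2 \<Omega> \<and> weak_gradient \<Omega> v g", OF g] by auto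
qed

lemma fe_add:
  assumes "v \<in> fe" "w \<in> fe"
  shows "(\<lambda>x. v x + c * w x) \<in> fe" "K \<in> \<T> \<Longrightarrow> ep (\<lambda>x. v x + c * w x) K = (\<lambda>x. ep v K x + c * ep w K x)"
proof -
  have p: "(\<lambda>x. ep v K x + c * ep w K x) \<in> polys k" "AE x in lebesgue. x \<in> K \<longrightarrow> v x + c * w x = ep v K x + c * ep w K x"
    if "K \<in> \<T>" for K
  proof -
    show "(\<lambda>x. ep v K x + c * ep w K x) \<in> polys k"
      by (intro add_in_polys scale_in_polys ep_poly(1) assms that)
    show "AE x in lebesgue. x \<in> K \<longrightarrow> v x + c * w x = ep v K x + c * ep w K x"
      using ep_poly(2)[OF assms(1) that] ep_poly(2)[OF assms(2) that] by eventually_elim auto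
  qed
  then show "K \<in> \<T> \<Longrightarrow> ep (\<lambda>x. v x + c * w x) K = (\<lambda>x. ep v K x + c * ep w K x)" by (intro ep_unique)
  have "(\<lambda>x. v x + c * w x) \<in> L2 \<Omega>" using L2_add[OF grad_props(3)[OF assms(1)] grad_props(3)[OF assms(2)], of c] by simp
  moreover have "(\<lambda>x. grad \<Omega> v x + c *\<^sub>R grad \<Omega> w x) \<in> L2 \<Omega>" by (intro L2_add grad_props assms)
  moreover have "weak_gradient \<Omega> (\<lambda>x. v x + c * w x) (\<lambda>x. grad \<Omega> v x + c *\<^sub>R grad \<Omega> w x)"
    by (intro weak_gradient_add grad_props assms)
  ultimately have "(\<lambda>x. v x + c * w x) \<in> H1 \<Omega>" by (auto simp: H1_def)
  moreover have "\<exists>q\<in>polys k. AE x in lebesgue_on K. v x + c * w x = q x" if "K \<in> \<T>" for K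
    unfolding lebesgue_on_AE[OF tri_lmeasurable(2)[OF mesh_simplex[OF that]]] using p[OF that] by (intro bexI) auto
  ultimately show "(\<lambda>x. v x + c * w x) \<in> fe" by (simp add: fe_space_def)
qed

lemma fe_const: "(\<lambda>x. c) \<in> fe"
proof -
  have "(\<lambda>x. c) \<in> L2 \<Omega>" by (rule L2_bounded[OF domain_measurable(1), where B="\<bar>c\<bar>"]) auto
  moreover have "(\<lambda>x. 0::point) \<in> L2 \<Omega>" by (rule L2_bounded[OF domain_measurable(1), where B=0]) auto
  moreover have "weak_gradient \<Omega> (\<lambda>x. c) (\<lambda>x. 0)"
    by (rule weak_gradient_poly[OF domain_props(1,3) const_in_polys[of c 0] GDERIV_const]) auto
  ultimately show ?thesis using const_in_polys[of c k] by (auto simp: fe_space_def H1_def intro!: bexI[of _ "\<lambda>x. c"])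
qed

definition dp :: "(point \<Rightarrow> real) \<Rightarrow> point set \<Rightarrow> point \<Rightarrow> point" where "dp v K = pgrad (ep v K)"

text \<open>On the interior of K both are weak gradients of the same polynomial, and the frontier of
  K is a null set.\<close>

lemma grad_eq:
  assumes "v \<in> fe" "K \<in> \<T>"
  shows "AE x in lebesgue. x \<in> K \<longrightarrow> grad \<Omega> v x = dp v K x"
proof -
  note tf = tri_facts[OF mesh_simplex[OF assms(2)]]
  note p = ep_poly[OF assms]
  note pg = pgrad_poly[OF p(1)]
  have bi: "bounded (interior K)" using tf(2) compact_imp_bounded interior_subset bounded_subset by metis
  have "AE x in lebesgue. x \<in> interior K \<longrightarrow> grad \<Omega> v x = dp v K x"
  proof (rule weak_gradient_local_unique[OF domain_props(1,3) open_interior interior_in_domain[OF assms(2)]])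
    show "integrable (lebesgue_on \<Omega>) (grad \<Omega> v)" by (intro L2_integrable domain_measurable grad_props assms)
    show "weak_gradient \<Omega> v (grad \<Omega> v)" by (intro grad_props assms)
    show "integrable (lebesgue_on (interior K)) (dp v K)"
    proof -
      have i: "integrable (lebesgue_on K) (dp v K)" unfolding dp_def by (intro integrable_on_compact tf continuous_on_subset[OF pg(2)]) simp
      have isl: "interior K \<in> sets lebesgue" by simp
      have "(\<lambda>x. indicat_real (interior K) x *\<^sub>R indicat_real K x *\<^sub>R dp v K x) = (\<lambda>x. indicat_real (interior K) x *\<^sub>R dp v K x)"
        using interior_subset[of K] by (auto simp: fun_eq_iff indicator_def)
      then show ?thesis using integrable_mult_indicator[OF isl i[unfolded lebesgue_on_integrable[OF tri_lmeasurable(2)[OF mesh_simplex[OF assms(2)]]]]]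
        unfolding lebesgue_on_integrable[OF isl] by simp
    qed
    show "weak_gradient (interior K) (ep v K) (dp v K)" unfolding dp_def
      by (rule weak_gradient_poly[OF open_interior bi p(1) pg(1,2)])
    show "AE x in lebesgue. x \<in> interior K \<longrightarrow> v x = ep v K x" using p(2) by eventually_elim (use interior_subset in auto)
    show "v \<in> borel_measurable (lebesgue_on \<Omega>)" using grad_props(3)[OF assms(1)] by (simp add: L2_def)
    show "ep v K \<in> borel_measurable borel" using polys_continuous[OF p(1)] by (rule borel_measurable_continuous_onI)
  qed
  moreover have "AE x in lebesgue. x \<notin> frontier K"
    using negligible_convex_frontier[OF tf(1)] unfolding negligible_iff_null_sets by (rule AE_not_in)
  ultimately show ?thesis by eventually_elim (auto simp: frontier_def tf(3) closure_closed[OF tf(3)])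
qed

lemma AE_interior: "AE x in lebesgue. x \<in> closure \<Omega> \<longrightarrow> (\<exists>K\<in>\<T>. x \<in> interior K)"
proof -
  have "negligible (\<Union>K\<in>\<T>. frontier K)"
    using finite_mesh by (intro negligible_Union) (auto intro: negligible_convex_frontier tri_facts(1)[OF mesh_simplex])
  then have "AE x in lebesgue. x \<notin> (\<Union>K\<in>\<T>. frontier K)" unfolding negligible_iff_null_sets by (rule AE_not_in)
  then show ?thesis
  proof eventually_elim
    case (elim x)
    show ?case
    proof
      assume "x \<in> closure \<Omega>"
      then obtain K where "K \<in> \<T>" "x \<in> K" using in_some_triangle by blast
      then show "\<exists>K\<in>\<T>. x \<in> interior K" using elim closure_subset[of K] by (auto simp: frontier_def)
    qed
  qed
qed

lemma integral_split:
  fixes f :: "point \<Rightarrow> real"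
  assumes f: "f \<in> borel_measurable (lebesgue_on \<Omega>)" and h: "\<And>K. K \<in> \<T> \<Longrightarrow> continuous_on UNIV (h K)"
    and eq: "\<And>K. K \<in> \<T> \<Longrightarrow> AE x in lebesgue. x \<in> K \<longrightarrow> f x = h K x"
  shows "(LINT x|lebesgue_on \<Omega>. f x) = (\<Sum>K\<in>\<T>. LINT x|lebesgue_on K. h K x)"
proof -
  have hi: "integrable lebesgue (\<lambda>x. indicator K x *\<^sub>R h K x)" if "K \<in> \<T>" for K
    using integrable_on_compact[OF tri_facts(2)[OF mesh_simplex[OF that]] continuous_on_subset[OF h[OF that]]]
    unfolding lebesgue_on_integrable[OF tri_lmeasurable(2)[OF mesh_simplex[OF that]]] by simp
  have "(LINT x|lebesgue_on \<Omega>. f x) = (LINT x|lebesgue. indicator \<Omega> x *\<^sub>R f x)" by (rule lebesgue_on_integral[OF domain_measurable(2)])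
  also have "\<dots> = (LINT x|lebesgue. (\<Sum>K\<in>\<T>. indicator K x *\<^sub>R h K x))"
  proof (rule integral_cong_AE)
    show "(\<lambda>x. indicat_real \<Omega> x *\<^sub>R f x) \<in> borel_measurable lebesgue"
      using f by (subst (asm) borel_measurable_restrict_space_iff) (use domain_measurable in auto)
    show "(\<lambda>x. \<Sum>K\<in>\<T>. indicat_real K x *\<^sub>R h K x) \<in> borel_measurable lebesgue" using hi by (intro borel_measurable_sum) auto
    have all: "AE x in lebesgue. \<forall>K\<in>\<T>. x \<in> K \<longrightarrow> f x = h K x" using finite_mesh eq by (intro AE_finite_allI) auto
    show "AE x in lebesgue. indicat_real \<Omega> x *\<^sub>R f x = (\<Sum>K\<in>\<T>. indicat_real K x *\<^sub>R h K x)"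
      using all AE_interior
    proof eventually_elim
      case (elim x)
      show ?case
      proof (cases "x \<in> closure \<Omega>")
        case False
        then have "\<And>K. K \<in> \<T> \<Longrightarrow> x \<notin> K" "x \<notin> \<Omega>" using triangle_in_closure closure_subset by blast+
        then show ?thesis by simp
      next
        case True
        then obtain K where K: "K \<in> \<T>" "x \<in> interior K" using elim by blast
        then have xK: "x \<in> K" "x \<in> \<Omega>" using interior_subset interior_in_domain by blast+
        have "indicat_real K' x *\<^sub>R h K' x = (if K' = K then h K x else 0)" if "K' \<in> \<T>" for K'
        proof (cases "K' = K")
          case False
          then have "x \<notin> K'" using interior_disjoint[OF K(1) that] K(2) by blast
          then show ?thesis using False by simp
        qed (use xK in simp)
        then have "(\<Sum>K\<in>\<T>. indicat_real K x *\<^sub>R h K x) = (\<Sum>K'\<in>\<T>. if K' = K then h K x else 0)" by (intro sum.cong refl)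
        also have "\<dots> = h K x" using K(1) finite_mesh by simp
        finally show ?thesis using xK K(1) elim by simp
      qed
    qed
  qed
  also have "\<dots> = (\<Sum>K\<in>\<T>. LINT x|lebesgue. indicator K x *\<^sub>R h K x)" by (rule Bochner_Integration.integral_sum) (rule hi)
  also have "\<dots> = (\<Sum>K\<in>\<T>. LINT x|lebesgue_on K. h K x)"
    by (intro sum.cong refl lebesgue_on_integral[symmetric] tri_lmeasurable(2) mesh_simplex)
  finally show ?thesis .
qed

lemma dp_cont: "v \<in> fe \<Longrightarrow> K \<in> \<T> \<Longrightarrow> continuous_on UNIV (dp v K)"
  unfolding dp_def by (intro pgrad_poly(2)) (rule ep_poly)

lemma L2_inner_grad:
  assumes "v \<in> fe" "w \<in> fe"
  shows "L2_inner \<Omega> (grad \<Omega> v) (grad \<Omega> w) = (\<Sum>K\<in>\<T>. LINT x|lebesgue_on K. dp v K x \<bullet> dp w K x)"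
  unfolding L2_inner_def
proof (rule integral_split)
  show "(\<lambda>x. grad \<Omega> v x \<bullet> grad \<Omega> w x) \<in> borel_measurable (lebesgue_on \<Omega>)"
    using L2_inner_integrable[OF grad_props(1)[OF assms(1)] grad_props(1)[OF assms(2)]] by auto
  fix K assume K: "K \<in> \<T>"
  show "continuous_on UNIV (\<lambda>x. dp v K x \<bullet> dp w K x)" by (intro continuous_intros dp_cont assms K)
  show "AE x in lebesgue. x \<in> K \<longrightarrow> grad \<Omega> v x \<bullet> grad \<Omega> w x = dp v K x \<bullet> dp w K x"
    using grad_eq[OF assms(1) K] grad_eq[OF assms(2) K] by eventually_elim auto
qed

lemma dp_add:
  assumes "v \<in> fe" "w \<in> fe" "K \<in> \<T>"
  shows "dp (\<lambda>x. v x + c * w x) K x = dp v K x + c *\<^sub>R dp w K x"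
proof -
  have "GDERIV (\<lambda>x. ep v K x + c * ep w K x) x :> dp v K x + (c *\<^sub>R dp w K x + ep w K x *\<^sub>R 0)"
    unfolding dp_def by (intro GDERIV_add GDERIV_mult pgrad_poly(1)[OF ep_poly(1)] assms GDERIV_const)
  then show ?thesis unfolding dp_def fe_add(2)[OF assms] by (simp add: pgrad_eq)
qed

definition E :: "(point \<Rightarrow> real) \<Rightarrow> point set \<Rightarrow> real" where
  "E v K = (LINT x|lebesgue_on K. (norm (dp v K x))\<^sup>2)"

definition En :: "(point \<Rightarrow> real) \<Rightarrow> real" where "En v = (\<Sum>K\<in>\<T>. E v K)"

lemma E_ge0: "E v K \<ge> 0" and En_ge0: "En v \<ge> 0" and E_le: "K \<in> \<T> \<Longrightarrow> E v K \<le> En v"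
proof -
  show e: "E v K \<ge> 0" for K by (simp add: E_def)
  show "En v \<ge> 0" unfolding En_def by (intro sum_nonneg e)
  show "K \<in> \<T> \<Longrightarrow> E v K \<le> En v" unfolding En_def using finite_mesh e by (intro member_le_sum) auto
qed

lemma En_eq: "v \<in> fe \<Longrightarrow> L2_inner \<Omega> (grad \<Omega> v) (grad \<Omega> v) = En v"
  by (simp add: L2_inner_grad En_def E_def power2_norm_eq_inner)

text \<open>Along the unit normal of the common edge one triangle lies on each side of x, so
  \<open>no_jump\<close> applies. Vertices are left to \<open>vertex_continuous\<close>.\<close>

lemma no_jump_edge:
  assumes v: "v \<in> fe" and K: "K \<in> \<T>" "K' \<in> \<T>" "x \<in> K" "x \<in> K'" "x \<notin> V"
  shows "ep v K x = ep v K' x"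
proof (cases "K = K'")
  case False
  obtain a b c a' \<kappa> where t: "nondeg a b c" "K = convex hull {a,b,c}" "nondeg a' b c" "K' = convex hull {a',b,c}"
    "x \<in> open_segment b c" "\<kappa> > 0" "\<And>y. lam a' b c y = - \<kappa> * lam a b c y" "open_segment b c \<subseteq> \<Omega>"
    using shared_edge[OF K(1,2) False K(3,4,5)] by metis
  obtain e where e: "e > 0" "\<And>z. z \<in> ball x e \<Longrightarrow> z \<in> K \<longleftrightarrow> 0 \<le> lam a b c z" using tri_local[OF t(1) t(5)] t(2) by metis
  obtain e' where e': "e' > 0" "\<And>z. z \<in> ball x e' \<Longrightarrow> z \<in> K' \<longleftrightarrow> 0 \<le> lam a' b c z" using tri_local[OF t(3) t(5)] t(4) by metis
  obtain s where s: "s > 0" "ball x s \<subseteq> \<Omega>" using t(5,8) domain_props(1) openE by blast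
  define r where "r = min s (min e e')"
  have r: "r > 0" "r \<le> s" "r \<le> e" "r \<le> e'" using s e e' by (auto simp: r_def)
  let ?g = "glam a b c"
  have g0: "?g \<noteq> 0" using glam_inner[of a b c "a - b"] t(1) by (auto simp: nondeg_def)
  define n where "n = ?g /\<^sub>R norm ?g"
  have n: "norm n = 1" using g0 by (simp add: n_def)
  have lx: "lam a b c x = 0" using t open_edge_iff by blast
  have ln: "(y - x) \<bullet> n = lam a b c y / norm ?g" for y
    using lam_diff[of a b c y x] lx by (simp add: n_def inner_commute divide_inverse)
  note p = ep_poly[OF v K(1)] note p' = ep_poly[OF v K(2)]
  show ?thesis
  proof (rule no_jump[OF domain_props(1,3) _ r(1) n p(1) p'(1) pgrad_poly(1)[OF p(1)] pgrad_poly(1)[OF p'(1)]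
        pgrad_poly(2)[OF p(1)] pgrad_poly(2)[OF p'(1)] L2_integrable[OF domain_measurable(1) grad_props(1)[OF v]] L2_integrable[OF domain_measurable(1) grad_props(3)[OF v]] grad_props(2)[OF v]])
    show "ball x r \<subseteq> \<Omega>" using s r by (meson order_trans subset_ball)
    show "AE y in lebesgue. y \<in> ball x r \<longrightarrow> 0 < (y - x) \<bullet> n \<longrightarrow> v y = ep v K y \<and> grad \<Omega> v y = pgrad (ep v K) y"
      using p(2) grad_eq[OF v K(1)]
    proof eventually_elim
      case (elim y)
      show ?case
      proof (intro impI)
        assume "y \<in> ball x r" "0 < (y - x) \<bullet> n"
        then have "y \<in> K" using e(2)[of y] r g0 by (auto simp: ln zero_less_divide_iff)
        then show "v y = ep v K y \<and> grad \<Omega> v y = pgrad (ep v K) y" using elim by (simp add: dp_def)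
      qed
    qed
    show "AE y in lebesgue. y \<in> ball x r \<longrightarrow> (y - x) \<bullet> n < 0 \<longrightarrow> v y = ep v K' y \<and> grad \<Omega> v y = pgrad (ep v K') y"
      using p'(2) grad_eq[OF v K(2)]
    proof eventually_elim
      case (elim y)
      show ?case
      proof (intro impI)
        assume y: "y \<in> ball x r" "(y - x) \<bullet> n < 0"
        then have "lam a b c y < 0" using g0 by (auto simp: ln divide_less_0_iff)
        then have "0 \<le> lam a' b c y" using t(6) t(7)[of y] by (simp add: mult_nonneg_nonpos mult_nonpos_nonneg mult_less_0_iff zero_le_mult_iff)
        then have "y \<in> K'" using e'(2)[of y] r y(1) by auto
        then show "v y = ep v K' y \<and> grad \<Omega> v y = pgrad (ep v K') y" using elim by (simp add: dp_def)
      qed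
    qed
  qed
qed simp

text \<open>The intervals \<open>[inf v, sup v]\<close> over the pieces \<open>K \<inter> U\<close> leave no gap, because a level in a gap
  would split the connected set \<open>U - V\<close>.\<close>

lemma chained_elements_bound:
  assumes v: "v \<in> fe" and U: "open U" "connected U" "U \<subseteq> \<Omega>"
    and c: "\<And>K x y. K \<in> \<T> \<Longrightarrow> x \<in> K \<inter> U \<Longrightarrow> y \<in> K \<inter> U \<Longrightarrow> \<bar>ep v K x - ep v K y\<bar> \<le> c K"
    and K: "K \<in> \<T>" "K' \<in> \<T>" "x \<in> K" "y \<in> K'" "x \<in> U - V" "y \<in> U - V"
  shows "\<bar>ep v K x - ep v K' y\<bar> \<le> (\<Sum>K\<in>{K \<in> \<T>. K \<inter> U \<noteq> {}}. c K)"
proof -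
  let ?T = "{K \<in> \<T>. K \<inter> U \<noteq> {}}"
  have finT: "finite ?T" using finite_mesh by simp
  \<comment> \<open>Bounded oscillation puts the values on K \<inter> U into an interval of length c
    K that starts at their infimum.\<close>
  define l where "l K = Inf (ep v K ` (K \<inter> U))" for K
  have I: "ep v K x \<in> {l K .. l K + c K}" if "K \<in> ?T" "x \<in> K \<inter> U" for K x
  proof -
    have KT: "K \<in> \<T>" using that by simp
    have bd: "bdd_below (ep v K ` (K \<inter> U))"
      using c[OF KT that(2)] by (intro bdd_belowI[of _ "ep v K x - c K"]) (auto simp: abs_le_iff algebra_simps)
    have "l K \<le> ep v K x" unfolding l_def using bd that by (intro cInf_lower) auto
    moreover have "ep v K x - c K \<le> l K" unfolding l_def
      using that c[OF KT that(2)] by (intro cInf_greatest) (auto simp: abs_le_iff algebra_simps)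
    ultimately show ?thesis by simp
  qed
  have c0: "0 \<le> c K" if "K \<in> ?T" for K using that c[of K] by fastforce
  have gap: "\<exists>K\<in>?T. r \<in> {l K .. l K + c K}"
    if r: "ep v K1 x1 \<le> r" "r \<le> ep v K2 x2" "K1 \<in> \<T>" "K2 \<in> \<T>" "x1 \<in> K1" "x2 \<in> K2" "x1 \<in> U - V" "x2 \<in> U - V" for r K1 K2 x1 x2
  proof (rule ccontr)
    assume no: "\<not> ?thesis"
    have lt: "ep v K x < r" if "K \<in> ?T" "x \<in> K \<inter> U" "l K + c K < r" for K x using I[OF that(1,2)] that(3) by simp
    have gt: "r < ep v K x" if "K \<in> ?T" "x \<in> K \<inter> U" "r < l K" for K x using I[OF that(1,2)] that(3) by simp
    \<comment> \<open>The triangles with values below the level r, and those with values above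
      it.\<close>
    define A where "A = \<Union>{K \<in> ?T. l K + c K < r}" define B where "B = \<Union>{K \<in> ?T. r < l K}"
    have conn: "connected (U - V)" using connected_open_delete_finite[of U V] U finV by simp
    have clAB: "closed A" "closed B" unfolding A_def B_def using tri_facts(3)[OF mesh_simplex] by (auto intro!: closed_Union intro: finite_subset[OF _ finite_mesh])
    have cov: "U - V \<subseteq> A \<union> B"
    proof
      fix z assume z: "z \<in> U - V"
      then have "z \<in> closure \<Omega>" using U(3) closure_subset[of \<Omega>] by auto
      from in_some_triangle[OF this] obtain K where Kz: "K \<in> \<T>" "z \<in> K" by auto
      then have "K \<in> ?T" using z by blast
      then have "r < l K \<or> l K + c K < r" using no by force
      then show "z \<in> A \<union> B" unfolding A_def B_def using \<open>K \<in> ?T\<close> Kz by blast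
    qed
    have disj: "A \<inter> B \<inter> (U - V) = {}"
    proof -
      have False if z: "z \<in> A" "z \<in> B" "z \<in> U - V" for z
      proof -
        obtain Ka where a: "Ka \<in> ?T" "l Ka + c Ka < r" "z \<in> Ka" using z(1) by (auto simp: A_def)
        obtain Kb where b: "Kb \<in> ?T" "r < l Kb" "z \<in> Kb" using z(2) by (auto simp: B_def)
        have "ep v Ka z = ep v Kb z" using a b z(3) by (intro no_jump_edge[OF v]) auto
        moreover have "ep v Ka z < r" using lt a z(3) by blast
        moreover have "r < ep v Kb z" using gt b z(3) by blast
        ultimately show False by simp
      qed
      then show ?thesis by blast
    qed
    have neA: "A \<inter> (U - V) \<noteq> {}"
    proof -
      have T1: "K1 \<in> ?T" using r by blast
      then have "r < l K1 \<or> l K1 + c K1 < r" using no by force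
      moreover have "\<not> r < l K1" using I[OF T1, of x1] r by auto
      ultimately have "x1 \<in> A" unfolding A_def using T1 r by blast
      then show ?thesis using r by blast
    qed
    have neB: "B \<inter> (U - V) \<noteq> {}"
    proof -
      have T2: "K2 \<in> ?T" using r by blast
      then have "r < l K2 \<or> l K2 + c K2 < r" using no by force
      moreover have "\<not> l K2 + c K2 < r" using I[OF T2, of x2] r by auto
      ultimately have "x2 \<in> B" unfolding B_def using T2 r by blast
      then show ?thesis using r by blast
    qed
    show False using connected_closedD[OF conn disj cov clAB] neA neB by blast
  qed
  have main: "ep v K2 x2 - ep v K1 x1 \<le> (\<Sum>K\<in>?T. c K)"
    if r: "ep v K1 x1 \<le> ep v K2 x2" "K1 \<in> \<T>" "K2 \<in> \<T>" "x1 \<in> K1" "x2 \<in> K2" "x1 \<in> U - V" "x2 \<in> U - V" for K1 K2 x1 x2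
  proof -
    have sub: "{ep v K1 x1 .. ep v K2 x2} \<subseteq> (\<Union>K\<in>?T. {l K .. l K + c K})"
    proof
      fix r' assume "r' \<in> {ep v K1 x1 .. ep v K2 x2}"
      then show "r' \<in> (\<Union>K\<in>?T. {l K .. l K + c K})" using gap[of K1 x1 r' K2 x2] r(2-) by auto
    qed
    \<comment> \<open>The values in between are covered by intervals of lengths c K; comparing
      Lebesgue measures replaces an explicit ordering of the triangles.\<close>
    have "measure lebesgue {ep v K1 x1 .. ep v K2 x2} \<le> measure lebesgue (\<Union>K\<in>?T. {l K .. l K + c K})"
      by (rule measure_mono_fmeasurable[OF sub]) (use finT in \<open>auto intro!: fmeasurable.finite_UN\<close>)
    also have "\<dots> \<le> (\<Sum>K\<in>?T. measure lebesgue {l K .. l K + c K})"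
      by (rule measure_UNION_le[OF finT]) auto
    also have "\<dots> = (\<Sum>K\<in>?T. c K)" using c0 by (intro sum.cong refl) auto
    finally show ?thesis using r(1) by simp
  qed
  show ?thesis
  proof (cases "ep v K x \<le> ep v K' y")
    case True
    then show ?thesis using main[OF True K] by simp
  next
    case False
    then have "ep v K' y \<le> ep v K x" by simp
    from main[OF this K(2,1,4,3,6,5)] False show ?thesis by simp
  qed
qed

lemma point_in_U:
  assumes "K \<in> \<T>" "open U" "K \<inter> U \<noteq> {}"
  obtains x where "x \<in> K" "x \<in> U - V"
proof -
  have "closure (interior K) \<inter> U \<noteq> {}" using assms(3) tri_facts(7)[OF mesh_simplex[OF assms(1)]] by simp
  then have "interior K \<inter> U \<noteq> {}" using open_Int_closure_eq_empty[OF assms(2)] by blast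
  moreover have "open (interior K \<inter> U)" using assms(2) by auto
  ultimately have "infinite (interior K \<inter> U)" using finite_imp_not_open by blast
  then obtain x where "x \<in> interior K \<inter> U" "x \<notin> V" using finV by (meson finite_subset subsetI)
  then show ?thesis using that interior_subset by blast
qed

text \<open>The chain bound holds between points of U off the vertices; moving from x and y to such
  points of their triangles costs at most one more sum each, hence the factor 3.\<close>

lemma linked_elements_bound:
  assumes v: "v \<in> fe" and U: "open U" "connected U" "U \<subseteq> \<Omega>"
    and o: "\<And>K x y. K \<in> \<T> \<Longrightarrow> x \<in> K \<Longrightarrow> y \<in> K \<Longrightarrow> \<bar>ep v K x - ep v K y\<bar> \<le> c K"
    and K: "K \<in> \<T>" "K' \<in> \<T>" "K \<inter> U \<noteq> {}" "K' \<inter> U \<noteq> {}" "x \<in> K" "y \<in> K'"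
  shows "\<bar>ep v K x - ep v K' y\<bar> \<le> 3 * (\<Sum>K\<in>{K \<in> \<T>. K \<inter> U \<noteq> {}}. c K)"
proof -
  let ?T = "{K \<in> \<T>. K \<inter> U \<noteq> {}}"
  obtain x1 where x1: "x1 \<in> K" "x1 \<in> U - V" by (rule point_in_U[OF K(1) U(1) K(3)])
  obtain y1 where y1: "y1 \<in> K'" "y1 \<in> U - V" by (rule point_in_U[OF K(2) U(1) K(4)])
  have "\<bar>ep v K x1 - ep v K' y1\<bar> \<le> (\<Sum>K\<in>?T. c K)"
    by (rule chained_elements_bound[OF v U _ K(1,2) x1(1) y1(1) x1(2) y1(2)]) (use o in blast)
  moreover have "\<bar>ep v K x - ep v K x1\<bar> \<le> c K" "\<bar>ep v K' y1 - ep v K' y\<bar> \<le> c K'" using o K x1 y1 by blast+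
  moreover have c0: "0 \<le> c K" if "K \<in> ?T" for K using that o[of K] by fastforce
  have "c K \<le> (\<Sum>K\<in>?T. c K)" "c K' \<le> (\<Sum>K\<in>?T. c K)" using finite_mesh K c0 by (auto intro!: member_le_sum)
  ultimately show ?thesis by linarith
qed

text \<open>\<open>no_jump_edge\<close> says nothing at vertices. In a ball of radius \<epsilon>
  around a, each of finitely many triangles contributes an oscillation of order \<epsilon>, and
  \<epsilon> tends to 0.\<close>

lemma vertex_continuous:
  assumes v: "v \<in> fe" and a: "a \<in> \<Omega>" "a \<in> K" "a \<in> K'" "K \<in> \<T>" "K' \<in> \<T>"
  shows "ep v K a = ep v K' a"
proof -
  obtain r where r: "r > 0" "ball a r \<subseteq> \<Omega>" using domain_props(1) a(1) openE by blast
  have "\<exists>L. \<forall>x\<in>closure \<Omega>. norm (dp v K x) \<le> L" if "K \<in> \<T>" for K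
  proof -
    have "compact (dp v K ` closure \<Omega>)"
      by (intro compact_continuous_image continuous_on_subset[OF dp_cont[OF v that]]) (use domain_props(3) in \<open>auto simp: compact_closure\<close>)
    from compact_imp_bounded[OF this] show ?thesis unfolding bounded_iff ball_simps .
  qed
  then obtain L0 where L0: "\<And>K x. K \<in> \<T> \<Longrightarrow> x \<in> closure \<Omega> \<Longrightarrow> norm (dp v K x) \<le> L0 K" by metis
  define L where "L = (\<Sum>K\<in>\<T>. \<bar>L0 K\<bar>)"
  have L: "norm (dp v K x) \<le> L" if "K \<in> \<T>" "x \<in> closure \<Omega>" for K x
  proof -
    have "\<bar>L0 K\<bar> \<le> L" unfolding L_def using that finite_mesh by (intro member_le_sum) auto
    then show ?thesis using L0[OF that] by linarith
  qed
  have lip: "\<bar>ep v K x - ep v K y\<bar> \<le> L * norm (x - y)" if "K \<in> \<T>" "x \<in> K" "y \<in> K" for K x y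
  proof -
    have "norm (ep v K x - ep v K y) \<le> L * norm (x - y)"
    proof (rule differentiable_bound[OF tri_facts(1)[OF mesh_simplex[OF that(1)]]])
      show "(ep v K has_derivative (\<lambda>h. h \<bullet> dp v K z)) (at z within K)" for z
        using pgrad_poly(1)[OF ep_poly(1)[OF v that(1)], of z] unfolding gderiv_def dp_def by (rule has_derivative_at_withinI)
      show "onorm (\<lambda>h. h \<bullet> dp v K z) \<le> L" if "z \<in> K" for z
        by (rule onorm_inner_le[OF L[OF \<open>K \<in> \<T>\<close>]]) (use triangle_in_closure \<open>K \<in> \<T>\<close> that in auto)
    qed (use that in auto)
    then show ?thesis by simp
  qed
  \<comment> \<open>Twice the number of triangles for the chain through the ball, whose diameter is
    2 \<epsilon>, and 2 for the moves from a to points off the vertices.\<close>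
  define M where "M = L * (2 * real (card \<T>) + 2)"
  have Lp: "L \<ge> 0" unfolding L_def by (simp add: sum_nonneg)
  have small: "\<bar>ep v K a - ep v K' a\<bar> \<le> M * \<epsilon>" if e: "0 < \<epsilon>" "\<epsilon> < r" for \<epsilon>
  proof -
    let ?U = "ball a \<epsilon>"
    have U: "open ?U" "connected ?U" "?U \<subseteq> \<Omega>" using r e by (auto simp: subset_iff)
    have ne: "K \<inter> ?U \<noteq> {}" "K' \<inter> ?U \<noteq> {}" using a e by auto
    obtain x1 where x1: "x1 \<in> K" "x1 \<in> ?U - V" by (rule point_in_U[OF a(4) U(1) ne(1)])
    obtain y1 where y1: "y1 \<in> K'" "y1 \<in> ?U - V" by (rule point_in_U[OF a(5) U(1) ne(2)])
    have "\<bar>ep v K x1 - ep v K' y1\<bar> \<le> (\<Sum>K\<in>{K \<in> \<T>. K \<inter> ?U \<noteq> {}}. L * (2 * \<epsilon>))"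
    proof (rule chained_elements_bound[OF v U _ a(4,5) x1(1) y1(1) x1(2) y1(2)])
      fix K x y assume h: "K \<in> \<T>" "x \<in> K \<inter> ?U" "y \<in> K \<inter> ?U"
      have "norm (x - y) \<le> 2 * \<epsilon>"
      proof -
        have "dist x y \<le> dist a x + dist a y" by (metis dist_commute dist_triangle)
        then show ?thesis using h by (simp add: dist_norm)
      qed
      then have "L * norm (x - y) \<le> L * (2 * \<epsilon>)" using Lp by (rule mult_left_mono)
      then show "\<bar>ep v K x - ep v K y\<bar> \<le> L * (2 * \<epsilon>)" using lip[of K x y] h by auto
    qed
    also have "\<dots> \<le> real (card \<T>) * (L * (2 * \<epsilon>))"
    proof -
      have "real (card {K \<in> \<T>. K \<inter> ?U \<noteq> {}}) * (L * (2 * \<epsilon>)) \<le> real (card \<T>) * (L * (2 * \<epsilon>))"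
        using Lp e card_mono[OF finite_mesh, of "{K \<in> \<T>. K \<inter> ?U \<noteq> {}}"] by (intro mult_right_mono) auto
      then show ?thesis by simp
    qed
    finally have 1: "\<bar>ep v K x1 - ep v K' y1\<bar> \<le> real (card \<T>) * (L * (2 * \<epsilon>))" .
    have "\<bar>ep v K a - ep v K x1\<bar> \<le> L * \<epsilon>" "\<bar>ep v K' y1 - ep v K' a\<bar> \<le> L * \<epsilon>"
    proof -
      have "norm (a - x1) \<le> \<epsilon>" "norm (y1 - a) \<le> \<epsilon>" using x1 y1 by (auto simp: dist_norm norm_minus_commute)
      then have "L * norm (a - x1) \<le> L * \<epsilon>" "L * norm (y1 - a) \<le> L * \<epsilon>" using Lp by (auto intro: mult_left_mono)
      then show "\<bar>ep v K a - ep v K x1\<bar> \<le> L * \<epsilon>" "\<bar>ep v K' y1 - ep v K' a\<bar> \<le> L * \<epsilon>"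
        using lip[OF a(4,2) x1(1)] lip[OF a(5) y1(1) a(3)] by linarith+
    qed
    then show ?thesis using 1 unfolding M_def by (simp add: algebra_simps)
  qed
  have *: "\<bar>ep v K a - ep v K' a\<bar> \<le> e" if "e > 0" for e
  proof -
    have M0: "M \<ge> 0" using Lp by (simp add: M_def)
    define \<epsilon> where "\<epsilon> = min (r / 2) (e / (M + 1))"
    have "0 < e / (M + 1)" using that M0 by (intro divide_pos_pos) auto
    then have ep: "0 < \<epsilon>" "\<epsilon> < r" "\<epsilon> \<le> e / (M + 1)" using r by (auto simp: \<epsilon>_def)
    have le: "M * \<epsilon> \<le> e"
    proof -
      have "M * \<epsilon> \<le> (M + 1) * \<epsilon>" using ep(1) by simp
      also have "\<dots> \<le> e" using ep(3) M0 by (simp add: pos_le_divide_eq mult.commute)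
      finally show ?thesis .
    qed
    show ?thesis by (rule order_trans[OF small[OF ep(1,2)] le])
  qed
  have "\<bar>ep v K a - ep v K' a\<bar> \<le> 0"
  proof (rule field_le_epsilon)
    fix e :: real assume "0 < e"
    from *[OF this] show "\<bar>ep v K a - ep v K' a\<bar> \<le> 0 + e" by simp
  qed
  then show ?thesis by simp
qed

end

section \<open>Interpolation and the Nitsche form\<close>

text \<open>K does not determine the order of the two other vertices; by \<open>lam_swap\<close>
  either order gives the same function.\<close>

definition bary :: "point set \<Rightarrow> point \<Rightarrow> point \<Rightarrow> real" where
  "bary K z = (SOME f. \<exists>b c. nondeg z b c \<and> K = convex hull {z,b,c} \<and> f = lam z b c)"

lemma bary_eq:
  assumes "nondeg a b c" shows "bary (convex hull {a,b,c}) a = lam a b c"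
  unfolding bary_def
proof (rule some_equality)
  show "\<exists>b' c'. nondeg a b' c' \<and> convex hull {a,b,c} = convex hull {a,b',c'} \<and> lam a b c = lam a b' c'" using assms by blast
  fix f assume "\<exists>b' c'. nondeg a b' c' \<and> convex hull {a,b,c} = convex hull {a,b',c'} \<and> f = lam a b' c'"
  then obtain b' c' where h: "nondeg a b' c'" "convex hull {a,b,c} = convex hull {a,b',c'}" "f = lam a b' c'" by blast
  have eq: "{a,b,c} = {a,b',c'}" using arg_cong[OF h(2), of verts] unfolding verts_tri[OF assms] verts_tri[OF h(1)] .
  have d: "{a,b,c} - {a} = {b,c}" "{a,b',c'} - {a} = {b',c'}"
    using nondeg_imp[OF assms] nondeg_imp[OF h(1)] by auto
  have "{b',c'} = {b,c}" using arg_cong[OF eq, of "\<lambda>S. S - {a}"] unfolding d by (rule sym)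
  then have "(b' = b \<and> c' = c) \<or> (b' = c \<and> c' = b)" by (simp add: doubleton_eq_iff)
  then show "f = lam a b c" using h(3) lam_swap by (auto simp: fun_eq_iff)
qed

definition interp :: "(point \<Rightarrow> real) \<Rightarrow> point set \<Rightarrow> point \<Rightarrow> real" where
  "interp u K y = (\<Sum>z\<in>verts K. u z * bary K z y)"

lemma interp_tri:
  assumes "nondeg a b c"
  shows "interp u (convex hull {a,b,c}) y = u a * lam a b c y + u b * lam b c a y + u c * lam c a b y"
proof -
  have n: "nondeg b c a" "nondeg c a b" using assms by (simp_all add: nondeg_cyc nondeg_cyc2)
  have "bary (convex hull {a,b,c}) a = lam a b c" "bary (convex hull {a,b,c}) b = lam b c a" "bary (convex hull {a,b,c}) c = lam c a b"
    using bary_eq[OF assms] bary_eq[OF n(1)] bary_eq[OF n(2)] by (simp_all add: hull3_perm)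
  then show ?thesis unfolding interp_def verts_tri[OF assms] using nondeg_imp[OF assms] by simp
qed

lemma interp_GDERIV:
  assumes "nondeg a b c"
  shows "GDERIV (interp u (convex hull {a,b,c})) y :> u a *\<^sub>R glam a b c + u b *\<^sub>R glam b c a + u c *\<^sub>R glam c a b"
proof -
  have *: "GDERIV (\<lambda>y. r * lam a b c y) y :> r *\<^sub>R glam a b c" for r a b c
    using GDERIV_mult[OF GDERIV_const[of r y] GDERIV_lam[of a b c y]] by simp
  show ?thesis unfolding interp_tri[OF assms, abs_def] by (intro GDERIV_add *)
qed

lemma lam_in_polys: "m \<ge> 1 \<Longrightarrow> lam a b c \<in> polys m"
  using affine_in_polys[of m "glam a b c" "- (glam a b c \<bullet> b)"] by (simp add: lam_eq[abs_def] inner_diff_right)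

lemma interp_in_polys: "m \<ge> 1 \<Longrightarrow> 2 simplex K \<Longrightarrow> interp u K \<in> polys m"
proof -
  assume m: "m \<ge> 1" and K: "2 simplex K"
  obtain a b c where t: "nondeg a b c" "K = convex hull {a,b,c}" using simplex2_nondeg[OF K] by metis
  show ?thesis unfolding t(2) interp_tri[OF t(1), abs_def] by (intro add_in_polys scale_in_polys lam_in_polys m)
qed

lemma interp_vertex:
  assumes "2 simplex K" "z \<in> verts K" shows "interp u K z = u z"
proof -
  obtain b c where t: "nondeg z b c" "K = convex hull {z,b,c}" by (rule tri_at_vertex[OF assms])
  have n: "nondeg b c z" "nondeg c z b" using t(1) by (simp_all add: nondeg_cyc nondeg_cyc2)
  show ?thesis unfolding t(2) interp_tri[OF t(1)] using lam_vertex[OF t(1)] lam_vertex[OF n(1)] lam_vertex[OF n(2)] by simp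
qed

lemma interp_edge:
  assumes "nondeg a b c"
  shows "interp u (convex hull {a,b,c}) ((1 - t) *\<^sub>R b + t *\<^sub>R c) = (1 - t) * u b + t * u c"
proof -
  let ?x = "(1 - t) *\<^sub>R b + t *\<^sub>R c"
  have n: "nondeg b c a" "nondeg c a b" using assms by (simp_all add: nondeg_cyc nondeg_cyc2)
  have "lam a b c ?x = 0" using lam_combo[OF assms, of 0 "1 - t" t] by simp
  moreover have "lam b c a ?x = 1 - t" using lam_combo[OF n(1), of "1 - t" t 0] by simp
  moreover have "lam c a b ?x = t" using lam_combo[OF n(2), of t 0 "1 - t"] by (simp add: add.commute)
  ultimately show ?thesis unfolding interp_tri[OF assms] by simp
qed

text \<open>The gradient is constant, so its value at the origin represents it.\<close>

definition gb :: "point set \<Rightarrow> point \<Rightarrow> point" where "gb K a = pgrad (bary K a) 0"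

lemma gb_eq: "nondeg a b c \<Longrightarrow> gb (convex hull {a,b,c}) a = glam a b c"
  unfolding gb_def bary_eq by (rule pgrad_eq[OF GDERIV_lam])

text \<open>The coordinate of the opposite vertex decreases across the edge towards the outside, so
  this is the outward unit normal.\<close>

definition nu :: "point set \<times> point \<Rightarrow> point" where "nu e = - (gb (fst e) (snd e) /\<^sub>R norm (gb (fst e) (snd e)))"

context fe_mesh begin

lemma elem_at: "x \<in> closure \<Omega> \<Longrightarrow> elem_at \<T> x \<in> \<T> \<and> x \<in> elem_at \<T> x"
  unfolding elem_at_def by (rule someI_ex) (use in_some_triangle in blast)

text \<open>The continuous piecewise linear function with nodal values u. The choice that
  \<open>elem_at\<close> makes where triangles meet is immaterial by
  \<open>interp_agree\<close>.\<close>

definition wI :: "(point \<Rightarrow> real) \<Rightarrow> point \<Rightarrow> real" where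
  "wI u x = (if x \<in> closure \<Omega> then interp u (elem_at \<T> x) x else 0)"

text \<open>On a common edge both interpolants are determined by the values at its ends, at a vertex
  by the value there.\<close>

lemma interp_agree:
  assumes "K \<in> \<T>" "K' \<in> \<T>" "x \<in> K" "x \<in> K'" shows "interp u K x = interp u K' x"
proof (cases "K = K' \<or> x \<in> V")
  case True
  then show ?thesis
  proof
    assume "K = K'"
    then show ?thesis by (simp only:)
  next
    assume x: "x \<in> V"
    have "interp u K x = u x" by (rule interp_vertex[OF mesh_simplex[OF assms(1)] mesh_vertex_is_vertex[OF x assms(3,1)]])
    moreover have "interp u K' x = u x" by (rule interp_vertex[OF mesh_simplex[OF assms(2)] mesh_vertex_is_vertex[OF x assms(4,2)]])
    ultimately show ?thesis by (rule trans[OF _ sym])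
  qed
next
  case False
  then have ne: "K \<noteq> K'" "x \<notin> V" by blast+
  obtain a b c a' where t: "nondeg a b c" "K = convex hull {a,b,c}" "nondeg a' b c" "K' = convex hull {a',b,c}"
    "x \<in> open_segment b c"
    using shared_edge[OF assms(1,2) ne(1) assms(3,4) ne(2)] by metis
  obtain s where s: "x = (1 - s) *\<^sub>R b + s *\<^sub>R c" using open_closed_segment[OF t(5)] unfolding in_segment by blast
  show ?thesis unfolding t(2) t(4) s interp_edge[OF t(1)] interp_edge[OF t(3)] ..
qed

lemma wI_eq: "K \<in> \<T> \<Longrightarrow> x \<in> K \<Longrightarrow> wI u x = interp u K x"
proof -
  assume K: "K \<in> \<T>" "x \<in> K"
  then have x: "x \<in> closure \<Omega>" using triangle_in_closure by blast
  from elem_at[OF this] have e: "elem_at \<T> x \<in> \<T>" "x \<in> elem_at \<T> x" by auto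
  show ?thesis using interp_agree[OF e(1) K(1) e(2) K(2)] x by (simp add: wI_def)
qed

text \<open>Membership in \<open>H1\<close> comes from \<open>weak_gradient_lipschitz\<close>;
  affine pieces are admissible because k is at least 1.\<close>

lemma wI_props:
  shows "wI u \<in> fe" "K \<in> \<T> \<Longrightarrow> ep (wI u) K = interp u K"
proof -
  have ip: "interp u K \<in> polys k" if "K \<in> \<T>" for K using interp_in_polys[OF k1 mesh_simplex[OF that]] .
  show "K \<in> \<T> \<Longrightarrow> ep (wI u) K = interp u K"
    by (rule ep_unique[OF _ _ ip]) (auto simp: wI_eq)
  have "\<exists>g. \<forall>y. GDERIV (interp u K) y :> g" if "K \<in> \<T>" for K
  proof -
    note KT = that
    obtain a b c where t: "nondeg a b c" "K = convex hull {a,b,c}" using simplex2_nondeg[OF mesh_simplex[OF KT]] by metis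
    show ?thesis unfolding t(2) using interp_GDERIV[OF t(1)] by blast
  qed
  then obtain g where g: "\<And>K y. K \<in> \<T> \<Longrightarrow> GDERIV (interp u K) y :> g K" by metis
  define M where "M = (\<Sum>K\<in>\<T>. norm (g K))"
  have M: "norm (g K) \<le> M" if "K \<in> \<T>" for K unfolding M_def using finite_mesh that by (intro member_le_sum) auto
  have M0: "M \<ge> 0" unfolding M_def by (simp add: sum_nonneg)
  have ipl: "\<bar>interp u K x - interp u K y\<bar> \<le> M * norm (x - y)" if "K \<in> \<T>" for K x y
  proof -
    have "norm (interp u K x - interp u K y) \<le> M * norm (x - y)"
    proof (rule differentiable_bound[OF convex_UNIV])
      show "(interp u K has_derivative (\<lambda>h. h \<bullet> g K)) (at z within UNIV)" for z using g[OF that, of z] by (simp add: gderiv_def)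
      show "onorm (\<lambda>h. h \<bullet> g K) \<le> M" for z :: point by (rule onorm_inner_le[OF M[OF that]])
    qed auto
    then show ?thesis by simp
  qed
  have lip: "\<bar>wI u x - wI u y\<bar> \<le> M * norm (x - y)" if s: "closed_segment x y \<subseteq> \<Omega>" for x y
  proof -
    define f where "f t = wI u (linepath x y t)" for t
    \<comment> \<open>The triangles cut a segment in \<Omega> into finitely many closed pieces, on
      each of which the function is affine; the Lipschitz constants of the pieces do not add
      up.\<close>
    have "lipschitz_on (M * norm (x - y)) {0..1::real} f"
    proof (rule lipschitz_on_closed_Union[where I=\<T> and U="\<lambda>K. {0..1} \<inter> linepath x y -` K"])
      fix K assume K: "K \<in> \<T>"
      show "closed ({0..1} \<inter> linepath x y -` K)" using closed_linepath_vimage[OF tri_facts(3)[OF mesh_simplex[OF K]]] by (intro closed_Int) auto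
      show "lipschitz_on (M * norm (x - y)) ({0..1} \<inter> linepath x y -` K) f"
      proof (rule lipschitz_onI)
        fix s t assume st: "s \<in> {0..1} \<inter> linepath x y -` K" "t \<in> {0..1} \<inter> linepath x y -` K"
        have "linepath x y s - linepath x y t = (s - t) *\<^sub>R (y - x)" by (simp add: linepath_def algebra_simps)
        then have "norm (linepath x y s - linepath x y t) = norm (x - y) * dist s t" by (simp add: dist_real_def norm_minus_commute)
        then show "dist (f s) (f t) \<le> M * norm (x - y) * dist s t"
          using st ipl[OF K, of "linepath x y s" "linepath x y t"] wI_eq[OF K] by (simp add: f_def dist_real_def)
      qed (use M0 in simp)
    next
      show "{0..1} \<subseteq> (\<Union>K\<in>\<T>. {0..1} \<inter> linepath x y -` K)"
      proof
        fix t :: real assume t: "t \<in> {0..1}"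
        then have "linepath x y t \<in> closure \<Omega>" using linepath_in_path s closure_subset by blast
        then show "t \<in> (\<Union>K\<in>\<T>. {0..1} \<inter> linepath x y -` K)" using in_some_triangle t by fastforce
      qed
    qed (use finite_mesh M0 in auto)
    then have "dist (f 0) (f 1) \<le> M * norm (x - y) * dist (0::real) 1" by (rule lipschitz_onD) auto
    then show ?thesis by (simp add: f_def dist_real_def linepath_0' linepath_1')
  qed
  have meas: "wI u \<in> borel_measurable borel"
  proof (rule borel_measurableI)
    fix S :: "real set" assume S: "open S"
    have ipm: "K \<inter> (interp u K -` S) \<in> sets borel" if "K \<in> \<T>" for K
    proof -
      have "interp u K \<in> borel_measurable borel" using polys_continuous[OF ip[OF that]] by (rule borel_measurable_continuous_onI)
      from measurable_sets[OF this, of S] show ?thesis using S tri_facts(3)[OF mesh_simplex[OF that]] by auto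
    qed
    have "wI u -` S = (\<Union>K\<in>\<T>. K \<inter> (interp u K -` S)) \<union> (if 0 \<in> S then - closure \<Omega> else {})"
    proof (intro set_eqI iffI)
      fix x assume x: "x \<in> wI u -` S"
      show "x \<in> (\<Union>K\<in>\<T>. K \<inter> (interp u K -` S)) \<union> (if 0 \<in> S then - closure \<Omega> else {})"
      proof (cases "x \<in> closure \<Omega>")
        case True
        then obtain K where "K \<in> \<T>" "x \<in> K" using in_some_triangle by blast
        then show ?thesis using x wI_eq by auto
      qed (use x in \<open>auto simp: wI_def\<close>)
    next
      fix x assume x: "x \<in> (\<Union>K\<in>\<T>. K \<inter> (interp u K -` S)) \<union> (if 0 \<in> S then - closure \<Omega> else {})"
      then consider K where "K \<in> \<T>" "x \<in> K" "interp u K x \<in> S" | "0 \<in> S" "x \<notin> closure \<Omega>" by (auto split: if_splits)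
      then show "x \<in> wI u -` S"
      proof cases
        case 1 then show ?thesis using wI_eq[OF 1(1,2)] by simp
      next
        case 2 then show ?thesis by (simp add: wI_def)
      qed
    qed
    moreover have "(\<Union>K\<in>\<T>. K \<inter> (interp u K -` S)) \<in> sets borel" using finite_mesh ipm by (intro sets.finite_UN) auto
    ultimately show "wI u -` S \<inter> space borel \<in> sets borel" by auto
  qed
  have "\<exists>B. \<forall>x\<in>closure \<Omega>. \<bar>interp u K x\<bar> \<le> B" if "K \<in> \<T>" for K
  proof -
    have "compact (interp u K ` closure \<Omega>)"
      by (intro compact_continuous_image polys_continuous[OF ip[OF that]]) (use domain_props(3) in \<open>auto simp: compact_closure\<close>)
    from compact_imp_bounded[OF this] show ?thesis unfolding bounded_iff ball_simps real_norm_def .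
  qed
  then obtain B0 where B0: "\<And>K x. K \<in> \<T> \<Longrightarrow> x \<in> closure \<Omega> \<Longrightarrow> \<bar>interp u K x\<bar> \<le> B0 K" by metis
  define B where "B = (\<Sum>K\<in>\<T>. \<bar>B0 K\<bar>)"
  have bd: "\<bar>wI u x\<bar> \<le> B" if "x \<in> \<Omega>" for x
  proof -
    have xc: "x \<in> closure \<Omega>" using that closure_subset by blast
    then obtain K where K: "K \<in> \<T>" "x \<in> K" using in_some_triangle by blast
    have "\<bar>B0 K\<bar> \<le> B" unfolding B_def using K finite_mesh by (intro member_le_sum) auto
    then show ?thesis using B0[OF K(1) xc] wI_eq[OF K] by auto
  qed
  \<comment> \<open>The piecewise constant gradient, set to 0 on the null set of edges.\<close>
  define G where "G x = (\<Sum>K\<in>\<T>. indicat_real (interior K) x *\<^sub>R g K)" for x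
  have Gm: "G \<in> borel_measurable borel" unfolding G_def by (intro borel_measurable_sum borel_measurable_scaleR borel_measurable_indicator) auto
  have Geq: "G x = g K" if "K \<in> \<T>" "x \<in> interior K" for x K
  proof -
    have "indicat_real (interior K') x *\<^sub>R g K' = (if K' = K then g K else 0)" if "K' \<in> \<T>" for K'
    proof (cases "K' = K")
      case False
      then have "x \<notin> interior K'" using interior_disjoint[OF \<open>K \<in> \<T>\<close> that] \<open>x \<in> interior K\<close> interior_subset by blast
      then show ?thesis using False by simp
    qed (use \<open>x \<in> interior K\<close> in simp)
    then have "G x = (\<Sum>K'\<in>\<T>. if K' = K then g K else 0)" unfolding G_def by (intro sum.cong refl)
    then show ?thesis using that(1) finite_mesh by simp
  qed
  have Gb: "norm (G x) \<le> M" for x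
  proof (cases "\<exists>K\<in>\<T>. x \<in> interior K")
    case True
    then show ?thesis using Geq M by metis
  next
    case False
    then have "G x = 0" unfolding G_def by (intro sum.neutral) auto
    then show ?thesis using M0 by simp
  qed
  have GmO: "G \<in> borel_measurable (lebesgue_on \<Omega>)" using Gm by (intro measurable_restrict_space1 measurable_completion) auto
  have wmO: "wI u \<in> borel_measurable (lebesgue_on \<Omega>)" using meas by (intro measurable_restrict_space1 measurable_completion) auto
  have "weak_gradient \<Omega> (wI u) G"
  proof (rule weak_gradient_lipschitz[OF domain_props(1,3) meas bd lip GmO])
    show "AE x in lebesgue_on \<Omega>. GDERIV (wI u) x :> G x"
      unfolding lebesgue_on_AE[OF domain_measurable(2)] using AE_interior
    proof eventually_elim
      case (elim x)
      show ?case
      proof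
        assume "x \<in> \<Omega>"
        then obtain K where K: "K \<in> \<T>" "x \<in> interior K" using elim closure_subset by blast
        show "GDERIV (wI u) x :> G x" unfolding Geq[OF K]
          by (rule GDERIV_transfer[OF g[OF K(1)] open_interior K(2)]) (rule wI_eq[OF K(1) subsetD[OF interior_subset], symmetric])
      qed
    qed
  qed
  moreover have "wI u \<in> L2 \<Omega>" by (rule L2_bounded[OF domain_measurable(1) wmO, where B=B]) (use bd in \<open>auto simp: lebesgue_on_AE[OF domain_measurable(2)]\<close>)
  moreover have "G \<in> L2 \<Omega>" by (rule L2_bounded[OF domain_measurable(1) GmO, where B=M]) (use Gb in auto)
  ultimately have "wI u \<in> H1 \<Omega>" by (auto simp: H1_def)
  moreover have "\<exists>p\<in>polys k. AE x in lebesgue_on K. wI u x = p x" if "K \<in> \<T>" for K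
    unfolding lebesgue_on_AE[OF tri_lmeasurable(2)[OF mesh_simplex[OF that]]]
    by (intro bexI[OF _ ip[OF that]]) (use wI_eq[OF that] in auto)
  ultimately show "wI u \<in> fe" by (simp add: fe_space_def)
qed

lemma dp_wI:
  assumes "K \<in> \<T>" "nondeg a b c" "K = convex hull {a,b,c}"
  shows "dp (wI u) K x = u a *\<^sub>R glam a b c + u b *\<^sub>R glam b c a + u c *\<^sub>R glam c a b"
proof -
  have "ep (wI u) K = interp u (convex hull {a,b,c})" using wI_props(2)[OF assms(1)] assms(3) by simp
  then show ?thesis unfolding dp_def by (simp add: pgrad_eq[OF interp_GDERIV[OF assms(2)]])
qed

text \<open>A boundary point off the vertices lies in one triangle only, which forces the choice in
  \<open>elem_at\<close>. The last claim makes the sum over triangles in \<open>half_norm_sq\<close>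
  count each edge once.\<close>

lemma traces:
  assumes v: "v \<in> fe" and e: "(K, a) \<in> BE" and x: "x \<in> opp K a" "x \<notin> V"
  shows "fe_trace \<T> v x = ep v K x" "fe_grad_trace \<T> v x = dp v K x" "outer_normal \<Omega> x = nu (K, a)"
    "K' \<in> \<T> \<Longrightarrow> x \<in> frontier K' \<longleftrightarrow> K' = K"
proof -
  obtain b c where t: "K \<in> \<T>" "nondeg a b c" "K = convex hull {a,b,c}" "opp K a = closed_segment b c" "closed_segment b c \<subseteq> frontier \<Omega>"
    using BE_tri[OF e] by metis
  have xF: "x \<in> frontier \<Omega>" and xK: "x \<in> K" using x t edge_iff[OF t(2)] by auto
  have "elem_at \<T> x \<in> \<T> \<and> x \<in> elem_at \<T> x" using xF closure_domain by (intro elem_at) blast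
  then have "elem_at \<T> x = K" using boundary_unique[OF xF x(2)] t(1) xK by blast
  then show "fe_trace \<T> v x = ep v K x" "fe_grad_trace \<T> v x = dp v K x"
    by (simp_all add: fe_trace_def fe_grad_trace_def ep_def dp_def pgrad_def)
  have "b \<in> V" "c \<in> V" using verts_tri[OF t(2)] t(1,3) by blast+
  then have "x \<in> open_segment b c" using x t(4) by (auto simp: open_segment_def)
  then show "outer_normal \<Omega> x = nu (K, a)" using outer_normal_eq[OF t(1-3) _ xF] gb_eq[OF t(2)] t(3) by (simp add: nu_def)
  assume K': "K' \<in> \<T>"
  show "x \<in> frontier K' \<longleftrightarrow> K' = K"
  proof
    assume "x \<in> frontier K'"
    then have "x \<in> K'" using tri_facts(3)[OF mesh_simplex[OF K']] by (auto simp: frontier_def)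
    then show "K' = K" using boundary_unique[OF xF x(2) K' t(1) _ xK] by blast
  next
    assume "K' = K"
    then show "x \<in> frontier K'" using xK interior_in_domain[OF t(1)] domain_disjoint_frontier xF closure_subset[of K] by (auto simp: frontier_def)
  qed
qed

section \<open>The form and the norm as sums over triangles and boundary edges\<close>

lemma ep_cont: "v \<in> fe \<Longrightarrow> e \<in> BE \<Longrightarrow> continuous_on UNIV (ep v (fst e))"
  using ep_poly(1) polys_continuous by (fastforce simp: BE_def)

lemma dpnu_cont: "v \<in> fe \<Longrightarrow> e \<in> BE \<Longrightarrow> continuous_on UNIV (\<lambda>x. dp v (fst e) x \<bullet> nu e)"
  by (intro continuous_intros dp_cont) (auto simp: BE_def)

lemma nitsche_eq:
  assumes "v \<in> fe" "w \<in> fe"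
  shows "nitsche_form vs \<Omega> \<T> v w = (\<Sum>K\<in>\<T>. LINT x|lebesgue_on K. dp v K x \<bullet> dp w K x)
     - (\<Sum>e\<in>BE. eint e (\<lambda>x. (dp v (fst e) x \<bullet> nu e) * ep w (fst e) x))
     + (\<Sum>e\<in>BE. eint e (\<lambda>x. ep v (fst e) x * (dp w (fst e) x \<bullet> nu e)))"
proof -
  have "boundary_integral vs (\<lambda>x. (fe_grad_trace \<T> v x \<bullet> outer_normal \<Omega> x) * fe_trace \<T> w x)
      = (\<Sum>e\<in>BE. eint e (\<lambda>x. (dp v (fst e) x \<bullet> nu e) * ep w (fst e) x))"
  proof (rule boundary_integral_eq(1))
    show "continuous_on UNIV (\<lambda>x. (dp v (fst e) x \<bullet> nu e) * ep w (fst e) x)" if "e \<in> BE" for e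
      by (intro continuous_on_mult dpnu_cont ep_cont assms that)
    show "(fe_grad_trace \<T> v x \<bullet> outer_normal \<Omega> x) * fe_trace \<T> w x = (dp v (fst e) x \<bullet> nu e) * ep w (fst e) x"
      if "e \<in> BE" "x \<in> opp (fst e) (snd e)" "x \<notin> V" for x e
      using traces[of _ "fst e" "snd e" x] that assms by simp
  qed
  moreover have "boundary_integral vs (\<lambda>x. fe_trace \<T> v x * (fe_grad_trace \<T> w x \<bullet> outer_normal \<Omega> x))
      = (\<Sum>e\<in>BE. eint e (\<lambda>x. ep v (fst e) x * (dp w (fst e) x \<bullet> nu e)))"
  proof (rule boundary_integral_eq(1))
    show "continuous_on UNIV (\<lambda>x. ep v (fst e) x * (dp w (fst e) x \<bullet> nu e))" if "e \<in> BE" for e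
      by (intro continuous_on_mult dpnu_cont ep_cont assms that)
    show "fe_trace \<T> v x * (fe_grad_trace \<T> w x \<bullet> outer_normal \<Omega> x) = ep v (fst e) x * (dp w (fst e) x \<bullet> nu e)"
      if "e \<in> BE" "x \<in> opp (fst e) (snd e)" "x \<notin> V" for x e
      using traces[of _ "fst e" "snd e" x] that assms by simp
  qed
  ultimately show ?thesis unfolding nitsche_form_def L2_inner_grad[OF assms] by simp
qed

definition Hn :: "(point \<Rightarrow> real) \<Rightarrow> real" where
  "Hn v = (\<Sum>e\<in>BE. inverse (diameter (fst e)) * eint e (\<lambda>x. (ep v (fst e) x)\<^sup>2))"

lemma half_norm_eq:
  assumes "v \<in> fe" shows "half_norm_sq vs \<T> v = Hn v"
proof -
  have "boundary_integral vs (\<lambda>x. indicator (frontier K) x * (fe_trace \<T> v x)\<^sup>2)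
      = (\<Sum>e\<in>BE. if fst e = K then eint e (\<lambda>x. (ep v (fst e) x)\<^sup>2) else 0)" if K: "K \<in> \<T>" for K
  proof -
    have "boundary_integral vs (\<lambda>x. indicator (frontier K) x * (fe_trace \<T> v x)\<^sup>2)
      = (\<Sum>e\<in>BE. eint e (\<lambda>x. (if fst e = K then 1 else 0) * (ep v (fst e) x)\<^sup>2))"
    proof (rule boundary_integral_eq(1))
      show "continuous_on UNIV (\<lambda>x. (if fst e = K then 1 else 0) * (ep v (fst e) x)\<^sup>2)" if "e \<in> BE" for e
        by (intro continuous_intros ep_cont assms that)
      show "indicator (frontier K) x * (fe_trace \<T> v x)\<^sup>2 = (if fst e = K then 1 else 0) * (ep v (fst e) x)\<^sup>2"
        if "e \<in> BE" "x \<in> opp (fst e) (snd e)" "x \<notin> V" for x e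
        using traces(1)[OF assms, of "fst e" "snd e" x] traces(4)[OF assms, of "fst e" "snd e" x K] that K by (auto simp: indicator_def)
    qed
    then show ?thesis unfolding eint_cmult by (simp add: if_distrib if_distribR cong: if_cong)
  qed
  then have "half_norm_sq vs \<T> v = (\<Sum>K\<in>\<T>. \<Sum>e\<in>BE. if fst e = K then inverse (diameter (fst e)) * eint e (\<lambda>x. (ep v (fst e) x)\<^sup>2) else 0)"
    unfolding half_norm_sq_def by (simp add: sum_distrib_left if_distrib cong: if_cong)
  also have "\<dots> = (\<Sum>e\<in>BE. \<Sum>K\<in>\<T>. if fst e = K then inverse (diameter (fst e)) * eint e (\<lambda>x. (ep v (fst e) x)\<^sup>2) else 0)"
    by (rule sum.swap)
  also have "\<dots> = Hn v" unfolding Hn_def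
    by (intro sum.cong refl) (use finite_mesh in \<open>auto simp: BE_def\<close>)
  finally show ?thesis .
qed

definition N2 :: "(point \<Rightarrow> real) \<Rightarrow> real" where "N2 v = En v + Hn v"

lemma norm_eq: "v \<in> fe \<Longrightarrow> norm_1h vs \<Omega> \<T> v = sqrt (N2 v)"
  by (simp add: norm_1h_def En_eq half_norm_eq N2_def)

lemma eint_nonneg:
  assumes "e \<in> BE" "continuous_on UNIV f" "\<And>x. 0 \<le> f x" shows "0 \<le> eint e f"
proof -
  have "eint e (\<lambda>x. 0 * 1) = 0" by (subst eint_cmult) simp
  then show ?thesis using eint_mono[OF assms(1) _ assms(2), of "\<lambda>x. 0"] assms(3) by simp
qed

lemma diam_ge0: "e \<in> BE \<Longrightarrow> 0 \<le> inverse (diameter (fst e))"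
  using compact_imp_bounded[OF tri_facts(2)[OF mesh_simplex]] by (fastforce simp: BE_def intro: diameter_ge_0)

lemma Hn_ge0: "v \<in> fe \<Longrightarrow> 0 \<le> Hn v"
  unfolding Hn_def by (intro sum_nonneg mult_nonneg_nonneg diam_ge0 eint_nonneg continuous_intros ep_cont) auto

lemma N2_ge0: "v \<in> fe \<Longrightarrow> 0 \<le> N2 v" using Hn_ge0 En_ge0 by (simp add: N2_def)

text \<open>The pointwise bound (s + t)^2 \<le> 2 s^2 + 2 t^2, integrated; it takes the place of a
  triangle inequality for the norm.\<close>

lemma N2_add:
  assumes "v \<in> fe" "w \<in> fe"
  shows "N2 (\<lambda>x. v x + c * w x) \<le> 2 * N2 v + 2 * c\<^sup>2 * N2 w"
proof -
  have "E (\<lambda>x. v x + c * w x) K \<le> 2 * E v K + 2 * c\<^sup>2 * E w K" if K: "K \<in> \<T>" for K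
  proof -
    have int: "integrable (lebesgue_on K) f" if "continuous_on UNIV f" for f :: "point \<Rightarrow> real"
      by (intro integrable_on_compact[OF tri_facts(2)[OF mesh_simplex[OF K]]] continuous_on_subset[OF that]) simp
    have cn: "continuous_on UNIV (\<lambda>x. (norm (dp v K x))\<^sup>2)" if "v \<in> fe" for v
      by (intro continuous_intros dp_cont that K)
    note c = cn[OF assms(1)] cn[OF assms(2)] cn[OF fe_add(1)[OF assms]]
    have "E (\<lambda>x. v x + c * w x) K \<le> (LINT x|lebesgue_on K. 2 * (norm (dp v K x))\<^sup>2 + (2 * c\<^sup>2) * (norm (dp w K x))\<^sup>2)"
      unfolding E_def
    proof (rule integral_mono[OF int int])
      fix x
      have "(norm (dp (\<lambda>x. v x + c * w x) K x))\<^sup>2 = (norm (dp v K x + c *\<^sub>R dp w K x))\<^sup>2" by (simp add: dp_add[OF assms K])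
      also have "\<dots> \<le> (norm (dp v K x) + norm (c *\<^sub>R dp w K x))\<^sup>2" by (intro power_mono norm_triangle_ineq) simp
      also have "\<dots> \<le> 2 * (norm (dp v K x))\<^sup>2 + 2 * (norm (c *\<^sub>R dp w K x))\<^sup>2"
        using zero_le_power2[of "norm (dp v K x) - norm (c *\<^sub>R dp w K x)"] unfolding power2_diff power2_sum by linarith
      finally show "(norm (dp (\<lambda>x. v x + c * w x) K x))\<^sup>2 \<le> 2 * (norm (dp v K x))\<^sup>2 + (2 * c\<^sup>2) * (norm (dp w K x))\<^sup>2"
        by (simp add: power_mult_distrib)
    qed (use c in \<open>auto intro!: continuous_intros\<close>)
    also have "\<dots> = 2 * E v K + 2 * c\<^sup>2 * E w K" unfolding E_def using int[OF c(1)] int[OF c(2)] by simp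
    finally show ?thesis .
  qed
  then have 1: "En (\<lambda>x. v x + c * w x) \<le> 2 * En v + 2 * c\<^sup>2 * En w"
    unfolding En_def sum_distrib_left sum.distrib[symmetric] by (intro sum_mono)
  have "inverse (diameter (fst e)) * eint e (\<lambda>x. (ep (\<lambda>x. v x + c * w x) (fst e) x)\<^sup>2)
     \<le> 2 * (inverse (diameter (fst e)) * eint e (\<lambda>x. (ep v (fst e) x)\<^sup>2)) + 2 * c\<^sup>2 * (inverse (diameter (fst e)) * eint e (\<lambda>x. (ep w (fst e) x)\<^sup>2))"
    if e: "e \<in> BE" for e
  proof -
    have K: "fst e \<in> \<T>" using e by (auto simp: BE_def)
    have c: "continuous_on UNIV (\<lambda>x. (ep u (fst e) x)\<^sup>2)" if "u \<in> fe" for u by (intro continuous_intros ep_cont that e)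
    have "eint e (\<lambda>x. (ep (\<lambda>x. v x + c * w x) (fst e) x)\<^sup>2) \<le> eint e (\<lambda>x. 2 * (ep v (fst e) x)\<^sup>2 + (2 * c\<^sup>2) * (ep w (fst e) x)\<^sup>2)"
    proof (rule eint_mono[OF e])
      fix x
      show "(ep (\<lambda>x. v x + c * w x) (fst e) x)\<^sup>2 \<le> 2 * (ep v (fst e) x)\<^sup>2 + (2 * c\<^sup>2) * (ep w (fst e) x)\<^sup>2"
        unfolding fe_add(2)[OF assms K] using zero_le_power2[of "ep v (fst e) x - c * ep w (fst e) x"]
        unfolding power2_diff power2_sum power_mult_distrib by linarith
    qed (intro continuous_intros ep_cont e assms fe_add(1)[OF assms])+
    also have "\<dots> = eint e (\<lambda>x. 2 * (ep v (fst e) x)\<^sup>2) + (2 * c\<^sup>2) * eint e (\<lambda>x. (ep w (fst e) x)\<^sup>2)"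
      by (rule eint_lin[OF e]) (intro continuous_intros ep_cont e assms)+
    finally have "eint e (\<lambda>x. (ep (\<lambda>x. v x + c * w x) (fst e) x)\<^sup>2) \<le> 2 * eint e (\<lambda>x. (ep v (fst e) x)\<^sup>2) + (2 * c\<^sup>2) * eint e (\<lambda>x. (ep w (fst e) x)\<^sup>2)"
      by (simp add: eint_cmult)
    from mult_left_mono[OF this diam_ge0[OF e]] show ?thesis by (simp add: algebra_simps)
  qed
  then have 2: "Hn (\<lambda>x. v x + c * w x) \<le> 2 * Hn v + 2 * c\<^sup>2 * Hn w"
    unfolding Hn_def sum_distrib_left sum.distrib[symmetric] by (intro sum_mono)
  show ?thesis using 1 2 by (simp add: N2_def algebra_simps)
qed

lemma nitsche_lin:
  assumes "v \<in> fe" "w \<in> fe" "z \<in> fe"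
  shows "nitsche_form vs \<Omega> \<T> v (\<lambda>x. w x + c * z x) = nitsche_form vs \<Omega> \<T> v w + c * nitsche_form vs \<Omega> \<T> v z"
proof -
  have 1: "(LINT x|lebesgue_on K. dp v K x \<bullet> dp (\<lambda>x. w x + c * z x) K x)
      = (LINT x|lebesgue_on K. dp v K x \<bullet> dp w K x) + c * (LINT x|lebesgue_on K. dp v K x \<bullet> dp z K x)" if K: "K \<in> \<T>" for K
  proof -
    have int: "integrable (lebesgue_on K) f" if "continuous_on UNIV f" for f :: "point \<Rightarrow> real"
      by (intro integrable_on_compact[OF tri_facts(2)[OF mesh_simplex[OF K]]] continuous_on_subset[OF that]) simp
    have "integrable (lebesgue_on K) (\<lambda>x. dp v K x \<bullet> dp w K x)" "integrable (lebesgue_on K) (\<lambda>x. dp v K x \<bullet> dp z K x)"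
      by (intro int continuous_intros dp_cont assms K)+
    then show ?thesis by (simp add: dp_add[OF assms(2,3) K] inner_add_right)
  qed
  have 2: "eint e (\<lambda>x. (dp v (fst e) x \<bullet> nu e) * ep (\<lambda>x. w x + c * z x) (fst e) x)
     = eint e (\<lambda>x. (dp v (fst e) x \<bullet> nu e) * ep w (fst e) x) + c * eint e (\<lambda>x. (dp v (fst e) x \<bullet> nu e) * ep z (fst e) x)"
    and 3: "eint e (\<lambda>x. ep v (fst e) x * (dp (\<lambda>x. w x + c * z x) (fst e) x \<bullet> nu e))
     = eint e (\<lambda>x. ep v (fst e) x * (dp w (fst e) x \<bullet> nu e)) + c * eint e (\<lambda>x. ep v (fst e) x * (dp z (fst e) x \<bullet> nu e))"
    if e: "e \<in> BE" for e
  proof -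
    have K: "fst e \<in> \<T>" using e by (auto simp: BE_def)
    have "eint e (\<lambda>x. (dp v (fst e) x \<bullet> nu e) * ep (\<lambda>x. w x + c * z x) (fst e) x)
      = eint e (\<lambda>x. (dp v (fst e) x \<bullet> nu e) * ep w (fst e) x + c * ((dp v (fst e) x \<bullet> nu e) * ep z (fst e) x))"
      by (simp add: fe_add(2)[OF assms(2,3) K] algebra_simps)
    also have "\<dots> = eint e (\<lambda>x. (dp v (fst e) x \<bullet> nu e) * ep w (fst e) x) + c * eint e (\<lambda>x. (dp v (fst e) x \<bullet> nu e) * ep z (fst e) x)"
      by (rule eint_lin[OF e]; intro continuous_on_mult dpnu_cont ep_cont assms e)
    finally show "eint e (\<lambda>x. (dp v (fst e) x \<bullet> nu e) * ep (\<lambda>x. w x + c * z x) (fst e) x)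
     = eint e (\<lambda>x. (dp v (fst e) x \<bullet> nu e) * ep w (fst e) x) + c * eint e (\<lambda>x. (dp v (fst e) x \<bullet> nu e) * ep z (fst e) x)" .
    have "eint e (\<lambda>x. ep v (fst e) x * (dp (\<lambda>x. w x + c * z x) (fst e) x \<bullet> nu e))
      = eint e (\<lambda>x. ep v (fst e) x * (dp w (fst e) x \<bullet> nu e) + c * (ep v (fst e) x * (dp z (fst e) x \<bullet> nu e)))"
      by (simp add: dp_add[OF assms(2,3) K] inner_add_left algebra_simps)
    also have "\<dots> = eint e (\<lambda>x. ep v (fst e) x * (dp w (fst e) x \<bullet> nu e)) + c * eint e (\<lambda>x. ep v (fst e) x * (dp z (fst e) x \<bullet> nu e))"
      by (rule eint_lin[OF e]; intro continuous_on_mult dpnu_cont ep_cont assms e)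
    finally show "eint e (\<lambda>x. ep v (fst e) x * (dp (\<lambda>x. w x + c * z x) (fst e) x \<bullet> nu e))
     = eint e (\<lambda>x. ep v (fst e) x * (dp w (fst e) x \<bullet> nu e)) + c * eint e (\<lambda>x. ep v (fst e) x * (dp z (fst e) x \<bullet> nu e))" .
  qed
  show ?thesis
    unfolding nitsche_eq[OF assms(1,2)] nitsche_eq[OF assms(1,3)] nitsche_eq[OF assms(1) fe_add(1)[OF assms(2,3)]]
    by (simp add: 1 2 3 sum.distrib sum_distrib_left algebra_simps cong: sum.cong)
qed

lemma nitsche_diag: "v \<in> fe \<Longrightarrow> nitsche_form vs \<Omega> \<T> v v = En v"
  by (simp add: nitsche_eq En_def E_def power2_norm_eq_inner mult.commute)

text \<open>Used in contraposition: a test function of positive norm is admissible in the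
  supremum.\<close>

lemma zero_norm:
  assumes "z \<in> fe" "\<not> nonzero_on \<Omega> z" shows "N2 z = 0"
proof -
  have ep0: "ep z K = (\<lambda>x. 0)" if K: "K \<in> \<T>" for K
  proof (rule ep_unique[OF K _ const_in_polys])
    have "AE x in lebesgue. x \<in> \<Omega> \<longrightarrow> z x = 0" using assms(2) by (simp add: nonzero_on_def lebesgue_on_AE[OF domain_measurable(2)])
    moreover have "AE x in lebesgue. x \<notin> frontier K"
      using negligible_convex_frontier[OF tri_facts(1)[OF mesh_simplex[OF K]]] unfolding negligible_iff_null_sets by (rule AE_not_in)
    ultimately show "AE x in lebesgue. x \<in> K \<longrightarrow> z x = 0"
      by eventually_elim (use interior_in_domain[OF K] closure_subset[of K] in \<open>auto simp: frontier_def\<close>)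
  qed
  have "dp z K x = 0" if "K \<in> \<T>" for K x unfolding dp_def ep0[OF that] by (rule pgrad_eq[OF GDERIV_const])
  then have "En z = 0" by (simp add: En_def E_def)
  moreover have "eint e (\<lambda>x. (ep z (fst e) x)\<^sup>2) = 0" if "e \<in> BE" for e
  proof -
    have "fst e \<in> \<T>" using that by (auto simp: BE_def)
    then show ?thesis using eint_cmult[of e 0 "\<lambda>x. 1"] ep0 by simp
  qed
  then have "Hn z = 0" by (simp add: Hn_def)
  ultimately show ?thesis by (simp add: N2_def)
qed

section \<open>Test functions\<close>

text \<open>Testing with v + \<delta> w gives at least (1 - \<delta> \<beta>) \<open>En v\<close> +
  \<delta> \<alpha> S. For \<delta> near 1 / (2 \<beta> + 1) this controls X = \<open>En v\<close> +
  S, while \<kappa> and \<gamma> bound the squared norms of v and of the test function by multiples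
  of X. S stands for the part of the trace that w makes visible.\<close>

lemma inf_sup_from_test:
  assumes v: "v \<in> fe" and w: "w \<in> fe" and S: "S \<ge> 0" and pos: "\<alpha> > 0" "\<beta> \<ge> 0" "\<gamma> \<ge> 0" "\<kappa> \<ge> 0"
    and a: "nitsche_form vs \<Omega> \<T> v w \<ge> \<alpha> * S - \<beta> * En v" and nw: "N2 w \<le> \<gamma> * S" and hv: "Hn v \<le> \<kappa> * (S + En v)"
  defines "cs \<equiv> min (1/2) (\<alpha> / (2 * (2 * \<beta> + 1))) / (sqrt (2 * (1 + \<kappa>) + 2 * \<gamma>) * sqrt (1 + \<kappa>))"
  shows "ereal (cs * norm_1h vs \<Omega> \<T> v) \<le>
     (SUP w\<in>{w \<in> fe. nonzero_on \<Omega> w}. ereal (nitsche_form vs \<Omega> \<T> v w / norm_1h vs \<Omega> \<T> w))"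
proof -
  define m where "m = min (1/2) (\<alpha> / (2 * (2 * \<beta> + 1)))"
  define P where "P = 2 * (1 + \<kappa>) + 2 * \<gamma>"
  have m: "m > 0" and P: "P > 0" using pos by (simp_all add: m_def P_def)
  have cs: "cs = m / (sqrt P * sqrt (1 + \<kappa>))" by (simp add: cs_def m_def P_def)
  show ?thesis
  proof (cases "N2 v = 0")
    case True
    \<comment> \<open>When v has norm 0 a single nonnegative quotient is enough, and one of the
      constants 1 and -1 provides it.\<close>
    define s where "s = (if nitsche_form vs \<Omega> \<T> v (\<lambda>x. 1) \<ge> 0 then 1 else (-1::real))"
    have f1: "(\<lambda>x. s) \<in> fe" and f0: "(\<lambda>x. 0) \<in> fe" by (rule fe_const)+
    have z: "nitsche_form vs \<Omega> \<T> v (\<lambda>x. 0) = 0"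
      using nitsche_lin[OF v f0 f0, of 1] by simp
    have sa: "nitsche_form vs \<Omega> \<T> v (\<lambda>x. s) = s * nitsche_form vs \<Omega> \<T> v (\<lambda>x. 1)"
      using nitsche_lin[OF v f0 fe_const[of 1], of s] z by simp
    have ge: "0 \<le> nitsche_form vs \<Omega> \<T> v (\<lambda>x. s) / norm_1h vs \<Omega> \<T> (\<lambda>x. s)"
    proof (rule divide_nonneg_nonneg)
      show "0 \<le> nitsche_form vs \<Omega> \<T> v (\<lambda>x. s)"
        using sa by (simp add: s_def)
      show "0 \<le> norm_1h vs \<Omega> \<T> (\<lambda>x. s)" using N2_ge0[OF f1] by (simp add: norm_eq[OF f1])
    qed
    have "nonzero_on \<Omega> (\<lambda>x. s)"
    proof -
      have "\<Omega> \<noteq> {}"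
      proof
        assume "\<Omega> = {}"
        then have "frontier \<Omega> = {}" by simp
        then have "length vs = 0" using domain_props(4) by (auto simp: side_def)
        then show False using pd by (simp add: polygonal_domain_def simple_polygon_def)
      qed
      then have "\<not> negligible \<Omega>" using domain_props(1) open_not_negligible by blast
      have "\<not> (AE x in lebesgue. x \<notin> \<Omega>)"
      proof
        assume "AE x in lebesgue. x \<notin> \<Omega>"
        then have "\<Omega> \<in> null_sets lebesgue" using domain_measurable(2) by (subst AE_iff_null_sets) auto
        then show False using \<open>\<not> negligible \<Omega>\<close> by (simp add: negligible_iff_null_sets)
      qed
      moreover have "s \<noteq> 0" by (simp add: s_def)
      ultimately show ?thesis unfolding nonzero_on_def lebesgue_on_AE[OF domain_measurable(2)] by (simp only: simp_thms)
    qed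
    then have "ereal 0 \<le> (SUP w\<in>{w \<in> fe. nonzero_on \<Omega> w}. ereal (nitsche_form vs \<Omega> \<T> v w / norm_1h vs \<Omega> \<T> w))"
      using f1 ge by (intro SUP_upper2[of "\<lambda>x. s"]) auto
    then show ?thesis using True by (simp add: norm_eq[OF v])
  next
    case False
    then have Nv: "N2 v > 0" using N2_ge0[OF v] by simp
    define X where "X = En v + S"
    have X0: "N2 v \<le> (1 + \<kappa>) * X" using hv S pos unfolding N2_def X_def by (simp add: algebra_simps)
    then have X: "X > 0" using Nv pos by (smt (verit) mult_nonneg_nonpos)
    \<comment> \<open>Keeps \<delta> \<beta> at most 1/2, so that half of the energy
      survives.\<close>
    define \<delta>0 where "\<delta>0 = 1 / (2 * \<beta> + 1)"
    have d0: "0 < \<delta>0" "\<delta>0 \<le> 1" "\<delta>0 * \<beta> \<le> 1/2" using pos by (auto simp: \<delta>0_def field_simps)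
    have zf: "(\<lambda>x. v x + \<delta> * w x) \<in> fe" for \<delta> by (rule fe_add(1)[OF v w])
    have main: "m * X \<le> nitsche_form vs \<Omega> \<T> v (\<lambda>x. v x + \<delta> * w x)" "N2 (\<lambda>x. v x + \<delta> * w x) \<le> P * X"
      if d: "\<delta>0 / 2 \<le> \<delta>" "\<delta> \<le> \<delta>0" for \<delta>
    proof -
      have dp: "0 < \<delta>" using d d0 by linarith
      have "nitsche_form vs \<Omega> \<T> v (\<lambda>x. v x + \<delta> * w x) = En v + \<delta> * nitsche_form vs \<Omega> \<T> v w"
        using nitsche_lin[OF v v w] nitsche_diag[OF v] by simp
      also have "\<dots> \<ge> En v + \<delta> * (\<alpha> * S - \<beta> * En v)" using mult_left_mono[OF a, of \<delta>] dp by simp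
      finally have 1: "nitsche_form vs \<Omega> \<T> v (\<lambda>x. v x + \<delta> * w x) \<ge> (1 - \<delta> * \<beta>) * En v + (\<delta> * \<alpha>) * S" by (simp add: algebra_simps)
      have "\<delta> * \<beta> \<le> 1/2" using mult_right_mono[OF d(2) pos(2)] d0(3) by linarith
      then have 2: "m * En v \<le> (1 - \<delta> * \<beta>) * En v" using En_ge0 by (intro mult_right_mono) (auto simp: m_def)
      have "m \<le> \<delta>0 / 2 * \<alpha>" unfolding m_def \<delta>0_def by (rule min.coboundedI2) simp
      also have "\<dots> \<le> \<delta> * \<alpha>" using d(1) pos(1) by (intro mult_right_mono) auto
      finally have 3: "m * S \<le> (\<delta> * \<alpha>) * S" using S by (intro mult_right_mono)
      show "m * X \<le> nitsche_form vs \<Omega> \<T> v (\<lambda>x. v x + \<delta> * w x)" using 1 2 3 unfolding X_def by (simp add: distrib_left)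
      have "\<delta>\<^sup>2 \<le> 1" using d d0 dp by (intro power_le_one) auto
      then have "\<delta>\<^sup>2 * N2 w \<le> 1 * (\<gamma> * S)" using nw N2_ge0[OF w] by (intro mult_mono) auto
      then have "N2 (\<lambda>x. v x + \<delta> * w x) \<le> 2 * ((1 + \<kappa>) * X) + 2 * (\<gamma> * S)"
        using N2_add[OF v w, of \<delta>] X0 by linarith
      also have "\<dots> \<le> P * X"
      proof -
        have "\<gamma> * S \<le> \<gamma> * X" using En_ge0[of v] pos(3) unfolding X_def by (intro mult_left_mono) auto
        then show ?thesis unfolding P_def by (simp add: algebra_simps)
      qed
      finally show "N2 (\<lambda>x. v x + \<delta> * w x) \<le> P * X" .
    qed
    \<comment> \<open>The test function could have norm 0, but not for both \<delta>0 and \<delta>0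
      / 2: v is twice the test function for \<delta>0 / 2 minus the one for \<delta>0.\<close>
    obtain \<delta> where d: "\<delta>0 / 2 \<le> \<delta>" "\<delta> \<le> \<delta>0" "N2 (\<lambda>x. v x + \<delta> * w x) > 0"
    proof (cases "N2 (\<lambda>x. v x + \<delta>0 * w x) = 0 \<and> N2 (\<lambda>x. v x + (\<delta>0 / 2) * w x) = 0")
      case True
      let ?z1 = "\<lambda>x. v x + (\<delta>0 / 2) * w x" and ?z2 = "\<lambda>x. v x + \<delta>0 * w x"
      have f: "(\<lambda>x. 0 + 2 * ?z1 x) \<in> fe" by (rule fe_add(1)[OF fe_const zf])
      have z0: "N2 (\<lambda>x. 0::real) = 0" by (rule zero_norm[OF fe_const]) (simp add: nonzero_on_def)
      have "N2 (\<lambda>x. 0 + 2 * ?z1 x) \<le> 0" using N2_add[OF fe_const[of 0] zf, of 2 "\<delta>0 / 2"] z0 True by simp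
      then have "N2 (\<lambda>x. (0 + 2 * ?z1 x) + (-1) * ?z2 x) \<le> 0" using N2_add[OF f zf, of "-1" \<delta>0] True by simp
      moreover have "(\<lambda>x. (0 + 2 * ?z1 x) + (-1) * ?z2 x) = v" by (simp add: fun_eq_iff algebra_simps)
      ultimately show ?thesis using Nv by simp
    next
      case False
      then have "N2 (\<lambda>x. v x + \<delta>0 * w x) > 0 \<or> N2 (\<lambda>x. v x + (\<delta>0 / 2) * w x) > 0" using N2_ge0[OF zf, of \<delta>0] N2_ge0[OF zf, of "\<delta>0 / 2"] by linarith
      then show ?thesis using that[of \<delta>0] that[of "\<delta>0 / 2"] d0 by auto
    qed
    let ?z = "\<lambda>x. v x + \<delta> * w x"
    have nz: "nonzero_on \<Omega> ?z" using zero_norm[OF zf, of \<delta>] d(3) by auto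
    have "cs * sqrt (N2 v) \<le> m * X / sqrt (N2 ?z)"
    proof -
      have "sqrt (N2 v) \<le> sqrt (1 + \<kappa>) * sqrt X" using X0 by (simp flip: real_sqrt_mult)
      then have "m / (sqrt P * sqrt (1 + \<kappa>)) * sqrt (N2 v) \<le> m / (sqrt P * sqrt (1 + \<kappa>)) * (sqrt (1 + \<kappa>) * sqrt X)"
        using m P pos by (intro mult_left_mono) auto
      also have "\<dots> = m * sqrt X / sqrt P" using pos by simp
      also have "\<dots> = m * X / sqrt (P * X)"
        using X P by (simp add: real_sqrt_mult field_simps)
      also have "\<dots> \<le> m * X / sqrt (N2 ?z)" using main(2)[OF d(1,2)] d(3) m X by (intro divide_left_mono mult_pos_pos) auto
      finally show ?thesis by (simp add: cs)
    qed
    also have "\<dots> \<le> nitsche_form vs \<Omega> \<T> v ?z / sqrt (N2 ?z)" using main(1)[OF d(1,2)] d(3) by (intro divide_right_mono) auto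
    finally have "ereal (cs * norm_1h vs \<Omega> \<T> v) \<le> ereal (nitsche_form vs \<Omega> \<T> v ?z / norm_1h vs \<Omega> \<T> ?z)"
      by (simp add: norm_eq[OF v] norm_eq[OF zf])
    also have "\<dots> \<le> (SUP w\<in>{w \<in> fe. nonzero_on \<Omega> w}. ereal (nitsche_form vs \<Omega> \<T> v w / norm_1h vs \<Omega> \<T> w))"
      by (rule SUP_upper) (use zf nz in auto)
    finally show ?thesis .
  qed
qed

text \<open>Here the hat function of the opposite vertex vanishes on the whole boundary, so that testing with it
  sees the trace of \<open>v\<close> on the edge but not the consistency term.\<close>

definition GE :: "(point set \<times> point) set" where "GE = {e \<in> BE. snd e \<in> \<Omega>}"

end

section \<open>Scale-free estimates on shape regular triangles\<close>

locale sr_mesh = fe_mesh +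
  fixes c :: real
  assumes sr: "shape_regular c \<T>"
begin

text \<open>\<open>inradius\<close> is a supremum; half of the guaranteed radius is strictly smaller
  than it, so an actual ball of that radius exists.\<close>

lemma tri_ball:
  assumes K: "K \<in> \<T>"
  obtains x where "diameter K > 0" "c > 0" "ball x (diameter K / (2 * c)) \<subseteq> K"
proof -
  note tf = tri_facts[OF mesh_simplex[OF K]]
  have bK: "bounded K" using tf(2) compact_imp_bounded by blast
  let ?R = "{r. r > 0 \<and> (\<exists>x. ball x r \<subseteq> K)}"
  obtain y r where y: "r > 0" "ball y r \<subseteq> K" using interior_tri_ne[OF mesh_simplex[OF K]] by (meson all_not_in_conv mem_interior)
  have bnd: "r \<le> diameter K" if "r \<in> ?R" for r
  proof -
    from that have "r > 0" "\<exists>x. ball x r \<subseteq> K" by auto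
    then obtain x where x: "r > 0" "ball x r \<subseteq> K" by blast
    have "diameter (ball x r) = 2 * r" using x(1) by (simp add: diameter_ball)
    then show ?thesis using diameter_subset[OF x(2) bK] x(1) by simp
  qed
  have ne: "?R \<noteq> {}" using y by auto
  have bdd: "bdd_above ?R" using bnd by (auto simp: bdd_above_def)
  have ip: "inradius K > 0"
  proof -
    have "r \<le> inradius K" unfolding inradius_def using y bdd by (intro cSup_upper) auto
    then show ?thesis using y by linarith
  qed
  have "r \<le> diameter K" by (rule bnd) (use y in blast)
  then have d0: "diameter K > 0" using y(1) by linarith
  have le: "diameter K / inradius K \<le> c" using sr K by (simp add: shape_regular_def)
  then have c0: "c > 0" using d0 ip by (meson divide_pos_pos less_le_trans)
  have "diameter K / (2 * c) < inradius K"
  proof -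
    have "diameter K \<le> c * inradius K" using le ip by (simp add: pos_divide_le_eq)
    then have "diameter K / (2 * c) \<le> c * inradius K / (2 * c)" using c0 by (intro divide_right_mono) auto
    also have "\<dots> = inradius K / 2" using c0 by simp
    finally show ?thesis using ip by linarith
  qed
  then obtain s where s: "s \<in> ?R" "diameter K / (2 * c) < s" unfolding inradius_def using less_cSup_iff[OF ne bdd] by blast
  then obtain x where "ball x s \<subseteq> K" by auto
  then have "ball x (diameter K / (2 * c)) \<subseteq> K" using s(2) by (meson less_imp_le order_trans subset_ball)
  then show ?thesis using that d0 c0 by blast
qed

lemma mesh_nonempty: "\<exists>K. K \<in> \<T>"
proof -
  have "length vs \<ge> 3" using pd by (simp add: polygonal_domain_def simple_polygon_def)
  then have "vs ! 0 \<in> frontier \<Omega>" using domain_props(4) by (force simp: side_def)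
  then show ?thesis using in_some_triangle closure_domain by blast
qed

lemma c_pos: "c > 0" using mesh_nonempty tri_ball by metis

lemma diam_pos: "K \<in> \<T> \<Longrightarrow> diameter K > 0" using tri_ball by metis

lemma area_lower: assumes "K \<in> \<T>" shows "pi / (4 * c\<^sup>2) * (diameter K)\<^sup>2 \<le> measure lebesgue K"
proof -
  obtain x where x: "diameter K > 0" "c > 0" "ball x (diameter K / (2 * c)) \<subseteq> K" using tri_ball[OF assms] by metis
  have "measure lebesgue (ball x (diameter K / (2 * c))) \<le> measure lebesgue K"
    by (rule measure_mono_fmeasurable[OF x(3)]) (use tri_lmeasurable[OF mesh_simplex[OF assms]] in auto)
  moreover have "measure lebesgue (ball x (diameter K / (2 * c))) = pi * (diameter K / (2 * c))\<^sup>2"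
    using x by (simp add: content_ball unit_ball_vol_2)
  moreover have "pi * (diameter K / (2 * c))\<^sup>2 = pi / (4 * c\<^sup>2) * (diameter K)\<^sup>2" by (simp add: power_divide power_mult_distrib)
  ultimately show ?thesis by simp
qed

lemma area_upper: assumes "K \<in> \<T>" shows "measure lebesgue K \<le> pi * (diameter K)\<^sup>2"
proof -
  note tf = tri_facts[OF mesh_simplex[OF assms]]
  obtain x where x: "x \<in> K" using interior_tri_ne[OF mesh_simplex[OF assms]] interior_subset by blast
  have "K \<subseteq> cball x (diameter K)" using diameter_bounded_bound[OF compact_imp_bounded[OF tf(2)] x] by auto
  then have "measure lebesgue K \<le> measure lebesgue (cball x (diameter K))"
    by (rule measure_mono_fmeasurable) (use tri_lmeasurable[OF mesh_simplex[OF assms]] in auto)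
  also have "\<dots> = pi * (diameter K)\<^sup>2" using diam_pos[OF assms] by (simp add: content_cball unit_ball_vol_2)
  finally show ?thesis .
qed

lemma vert_dist: assumes "K \<in> \<T>" "x \<in> K" "y \<in> K" shows "norm (x - y) \<le> diameter K"
  using diameter_bounded_bound[OF compact_imp_bounded[OF tri_facts(2)[OF mesh_simplex[OF assms(1)]]] assms(2,3)] by (simp add: dist_norm)

lemma glam_le:
  assumes "K \<in> \<T>" "nondeg a b d" "K = convex hull {a,b,d}" shows "norm (glam a b d) \<le> c / diameter K"
proof -
  obtain x where x: "diameter K > 0" "c > 0" "ball x (diameter K / (2 * c)) \<subseteq> K" using tri_ball[OF assms(1)] by metis
  have "norm (glam a b d) * (2 * (diameter K / (2 * c))) \<le> 1" by (rule glam_ball[OF assms(2)]) (use x assms(3) in auto)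
  then show ?thesis using x by (simp add: field_simps)
qed

text \<open>The gradient bound for another coordinate bounds the edge from below, and edge length
  over gradient length is twice the area. Edge length times gradient length is the flux of a hat
  function through the edge, bounded from both sides independently of h.\<close>

lemma edge_len:
  assumes K: "K \<in> \<T>" "nondeg a b d" "K = convex hull {a,b,d}"
  shows "diameter K / c \<le> norm (d - b)" "norm (d - b) \<le> diameter K"
    "1 / c \<le> norm (d - b) * norm (glam a b d)" "norm (d - b) * norm (glam a b d) \<le> c"
    "norm (d - b) = \<bar>cr (a - b) (d - b)\<bar> * norm (glam a b d)"
proof -
  have n: "nondeg b d a" using K(2) by (simp add: nondeg_cyc)
  have d0: "diameter K > 0" by (rule diam_pos[OF K(1)])
  have in_K: "a \<in> K" "b \<in> K" "d \<in> K" unfolding K(3) by (auto intro: hull_inc)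
  have "1 = glam b d a \<bullet> (b - d)" using lam_vertex(1)[OF n] by (simp add: lam_eq)
  also have "\<dots> \<le> norm (glam b d a) * norm (b - d)" by (rule norm_cauchy_schwarz)
  also have "\<dots> \<le> c / diameter K * norm (b - d)" using glam_le[OF K(1) n] K(3) by (intro mult_right_mono) (auto simp: hull3_perm)
  finally show 1: "diameter K / c \<le> norm (d - b)" using d0 c_pos by (simp add: field_simps norm_minus_commute)
  show 2: "norm (d - b) \<le> diameter K" using vert_dist[OF K(1) in_K(3,2)] .
  have D: "cr (a - b) (d - b) \<noteq> 0" using K(2) by (simp add: nondeg_def)
  have n0: "norm (d - b) > 0" using nondeg_imp[OF K(2)] by simp
  show 3: "norm (d - b) = \<bar>cr (a - b) (d - b)\<bar> * norm (glam a b d)" using D by (simp add: norm_glam)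
  have "\<bar>cr (a - b) (d - b)\<bar> \<le> norm (a - b) * norm (d - b)" by (rule abs_cr_le)
  also have "\<dots> \<le> diameter K * norm (d - b)" using vert_dist[OF K(1) in_K(1,2)] by (intro mult_right_mono) auto
  finally have 4: "\<bar>cr (a - b) (d - b)\<bar> \<le> diameter K * norm (d - b)" .
  have "norm (d - b) \<le> diameter K * norm (d - b) * norm (glam a b d)"
    using mult_right_mono[OF 4, of "norm (glam a b d)"] 3 by simp
  then have "1 \<le> diameter K * norm (glam a b d)" using n0 by (simp add: mult.commute mult.left_commute)
  then have "1 / c \<le> (diameter K * norm (glam a b d)) / c" using c_pos by (intro divide_right_mono) auto
  then have "1 / c \<le> diameter K / c * norm (glam a b d)" by simp
  also have "\<dots> \<le> norm (d - b) * norm (glam a b d)" using 1 by (intro mult_right_mono) auto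
  finally show "1 / c \<le> norm (d - b) * norm (glam a b d)" .
  have "norm (d - b) * norm (glam a b d) \<le> diameter K * (c / diameter K)" using 2 glam_le[OF K] d0 by (intro mult_mono) auto
  then show "norm (d - b) * norm (glam a b d) \<le> c" using d0 by simp
qed

text \<open>The inverse constant divided by the lower bound for the ratio of area to squared
  diameter.\<close>

definition Co :: real where "Co = inv_const k / (pi / (4 * c\<^sup>2))"

lemma Co_pos: "Co > 0" unfolding Co_def using inv_const_pos c_pos by simp

text \<open>In the plane the area is comparable to the squared diameter, so the oscillation is
  bounded by the energy without a power of the mesh size.\<close>

lemma element_oscillation:
  assumes v: "v \<in> fe" and K: "K \<in> \<T>" and xy: "x \<in> K" "y \<in> K"
  shows "(ep v K x - ep v K y)\<^sup>2 \<le> Co * E v K" "(diameter K)\<^sup>2 * (norm (dp v K x))\<^sup>2 \<le> Co * E v K"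
proof -
  define A where "A = pi / (4 * c\<^sup>2)"
  have d0: "diameter K > 0" by (rule diam_pos[OF K])
  have a0: "A > 0" using c_pos by (simp add: A_def)
  have Co: "Co = inv_const k / A" by (simp add: Co_def A_def)
  have E: "E v K = (LINT z|lebesgue_on K. (norm (pgrad (ep v K) z))\<^sup>2)" by (simp add: E_def dp_def)
  note os = poly_osc[OF ep_poly(1)[OF v K] mesh_simplex[OF K] xy, folded E]
  note al = area_lower[OF K, folded A_def]
  have "(A * (diameter K)\<^sup>2) * (ep v K x - ep v K y)\<^sup>2 \<le> (diameter K)\<^sup>2 * (inv_const k * E v K)"
    using mult_right_mono[OF al zero_le_power2[of "ep v K x - ep v K y"]] os(2) by linarith
  then have "(diameter K)\<^sup>2 * (A * (ep v K x - ep v K y)\<^sup>2) \<le> (diameter K)\<^sup>2 * (inv_const k * E v K)" by (simp only: mult_ac)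
  then have "A * (ep v K x - ep v K y)\<^sup>2 \<le> inv_const k * E v K" by (rule mult_left_le_imp_le) (use d0 in simp)
  then show "(ep v K x - ep v K y)\<^sup>2 \<le> Co * E v K" unfolding Co using a0 by (simp add: pos_le_divide_eq mult.commute)
  have "(A * (diameter K)\<^sup>2) * (norm (dp v K x))\<^sup>2 \<le> inv_const k * E v K"
    using mult_right_mono[OF al zero_le_power2[of "norm (dp v K x)"]] os(1) unfolding dp_def by linarith
  then show "(diameter K)\<^sup>2 * (norm (dp v K x))\<^sup>2 \<le> Co * E v K" unfolding Co using a0 by (simp add: pos_le_divide_eq mult_ac)
qed

text \<open>Cauchy-Schwarz over at most M triangles bounds the squared difference by 9 M
  \<open>Co\<close> times the energy, 9 being the square of the factor in
  \<open>linked_elements_bound\<close>; passing from the difference to the value doubles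
  this.\<close>

lemma linked_elements_square_bound:
  assumes v: "v \<in> fe" and U: "open U" "connected U" "U \<subseteq> \<Omega>"
    and K: "K \<in> \<T>" "K' \<in> \<T>" "K \<inter> U \<noteq> {}" "K' \<inter> U \<noteq> {}" "x \<in> K" "y \<in> K'"
    and M: "real (card {K \<in> \<T>. K \<inter> U \<noteq> {}}) \<le> M"
  shows "(ep v K x)\<^sup>2 \<le> 2 * (ep v K' y)\<^sup>2 + 18 * M * Co * En v"
proof -
  let ?T = "{K \<in> \<T>. K \<inter> U \<noteq> {}}"
  define os where "os K = sqrt (Co * E v K)" for K
  have os0: "0 \<le> Co * E v K" for K using Co_pos E_ge0 by simp
  have "\<bar>ep v K x - ep v K' y\<bar> \<le> 3 * (\<Sum>K\<in>?T. os K)"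
  proof (rule linked_elements_bound[OF v U _ K])
    show "\<bar>ep v K x - ep v K y\<bar> \<le> os K" if "K \<in> \<T>" "x \<in> K" "y \<in> K" for K x y
      unfolding os_def using element_oscillation(1)[OF v that] by (metis real_sqrt_abs real_sqrt_le_iff)
  qed
  then have "\<bar>ep v K x - ep v K' y\<bar>\<^sup>2 \<le> (3 * (\<Sum>K\<in>?T. os K))\<^sup>2" by (intro power_mono) auto
  also have "\<dots> = 9 * (\<Sum>K\<in>?T. 1 * os K)\<^sup>2" by (simp add: power_mult_distrib)
  also have "\<dots> \<le> 9 * ((\<Sum>K\<in>?T. 1\<^sup>2) * (\<Sum>K\<in>?T. (os K)\<^sup>2))" by (intro mult_left_mono Cauchy_Schwarz_ineq_sum) simp
  also have "\<dots> = 9 * (real (card ?T) * (\<Sum>K\<in>?T. Co * E v K))" using os0 by (simp add: os_def)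
  also have "\<dots> \<le> 9 * (M * (Co * En v))"
  proof -
    have "(\<Sum>K\<in>?T. Co * E v K) \<le> (\<Sum>K\<in>\<T>. Co * E v K)" using finite_mesh os0 by (intro sum_mono2) auto
    then have "(\<Sum>K\<in>?T. Co * E v K) \<le> Co * En v" by (simp add: En_def sum_distrib_left)
    then show ?thesis using M os0 by (intro mult_left_mono mult_mono sum_nonneg) (auto intro: order_trans[OF of_nat_0_le_iff])
  qed
  finally have 1: "(ep v K x - ep v K' y)\<^sup>2 \<le> 9 * (M * (Co * En v))" by simp
  have "(ep v K x)\<^sup>2 \<le> 2 * (ep v K' y)\<^sup>2 + 2 * (ep v K x - ep v K' y)\<^sup>2"
    using zero_le_power2[of "ep v K x - 2 * ep v K' y"] by (simp add: power2_eq_square algebra_simps)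
  then show ?thesis using 1 by (simp add: mult_ac)
qed

lemma eint_bounds:
  assumes e: "e \<in> BE" and f: "continuous_on UNIV f" "\<And>x. x \<in> opp (fst e) (snd e) \<Longrightarrow> \<bar>f x\<bar> \<le> B"
  shows "\<bar>eint e f\<bar> \<le> B * diameter (fst e)"
proof -
  obtain b d where t: "fst e \<in> \<T>" "nondeg (snd e) b d" "fst e = convex hull {snd e,b,d}" "opp (fst e) (snd e) = closed_segment b d" "closed_segment b d \<subseteq> frontier \<Omega>"
    using BE_tri[of "fst e" "snd e"] e by (metis prod.collapse)
  have cst: "eint e (\<lambda>x. r) = r * norm (d - b)" for r using eint_const[OF t(1-3,5), of r] by simp
  have B0: "B \<ge> 0" by (rule order_trans[OF abs_ge_zero f(2)[of b]]) (simp add: t(4))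
  have "eint e f \<le> eint e (\<lambda>x. B)" "eint e (\<lambda>x. - B) \<le> eint e f"
    by (rule eint_mono[OF e]; use f in \<open>force simp: abs_le_iff\<close>)+
  moreover have "B * norm (d - b) \<le> B * diameter (fst e)" using edge_len(2)[OF t(1-3)] B0 by (rule mult_left_mono)
  ultimately show ?thesis unfolding cst by linarith
qed

text \<open>An edge is no longer than the diameter of its triangle, which cancels the weight in the
  norm, so pointwise bounds suffice.\<close>

lemma Hn_le:
  assumes v: "v \<in> fe" and B: "\<And>e x. e \<in> BE \<Longrightarrow> x \<in> fst e \<Longrightarrow> (ep v (fst e) x)\<^sup>2 \<le> B e"
  shows "Hn v \<le> (\<Sum>e\<in>BE. B e)"
  unfolding Hn_def
proof (rule sum_mono)
  fix e assume e: "e \<in> BE"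
  have K: "fst e \<in> \<T>" using e by (auto simp: BE_def)
  have sub: "opp (fst e) (snd e) \<subseteq> fst e"
  proof -
    have "verts (fst e) - {snd e} \<subseteq> fst e" using tri_facts(6)[OF mesh_simplex[OF K]] by blast
    then show ?thesis unfolding opp_def using tri_facts(1)[OF mesh_simplex[OF K]] by (simp add: hull_minimal)
  qed
  have "\<bar>eint e (\<lambda>x. (ep v (fst e) x)\<^sup>2)\<bar> \<le> B e * diameter (fst e)"
    by (rule eint_bounds[OF e]) (use B[OF e] sub in \<open>auto intro!: continuous_intros ep_cont v e\<close>)
  then show "inverse (diameter (fst e)) * eint e (\<lambda>x. (ep v (fst e) x)\<^sup>2) \<le> B e"
    using diam_pos[OF K] by (simp add: field_simps)
qed

text \<open>Young's inequality, from |t \<nabla>v + \<nabla>w|^2 \<ge> 0; the free t serves to make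
  the share of w small.\<close>

lemma inner_lower:
  assumes v: "v \<in> fe" "w \<in> fe" and t: "t > 0" and K: "K \<in> \<T>"
  shows "- (t / 2 * E v K + E w K / (2 * t)) \<le> (LINT x|lebesgue_on K. dp v K x \<bullet> dp w K x)"
proof -
  have int: "integrable (lebesgue_on K) f" if "continuous_on UNIV f" for f :: "point \<Rightarrow> real"
    by (intro integrable_on_compact[OF tri_facts(2)[OF mesh_simplex[OF K]]] continuous_on_subset[OF that]) simp
  note cd = dp_cont[OF v(1) K] dp_cont[OF v(2) K]
  have "(LINT x|lebesgue_on K. (- (t / 2)) * (norm (dp v K x))\<^sup>2 + (- 1 / (2 * t)) * (norm (dp w K x))\<^sup>2) \<le> (LINT x|lebesgue_on K. dp v K x \<bullet> dp w K x)"
  proof (rule integral_mono[OF int int])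
    fix x
    have "0 \<le> (norm (t *\<^sub>R dp v K x + dp w K x))\<^sup>2" by simp
    also have "\<dots> = t\<^sup>2 * (norm (dp v K x))\<^sup>2 + 2 * t * (dp v K x \<bullet> dp w K x) + (norm (dp w K x))\<^sup>2"
      unfolding power2_norm_eq_inner by (simp add: inner_add_left inner_add_right inner_commute power2_eq_square algebra_simps)
    finally have "0 \<le> (t\<^sup>2 * (norm (dp v K x))\<^sup>2 + 2 * t * (dp v K x \<bullet> dp w K x) + (norm (dp w K x))\<^sup>2) / (2 * t)" using t by simp
    then show "(- (t / 2)) * (norm (dp v K x))\<^sup>2 + (- 1 / (2 * t)) * (norm (dp w K x))\<^sup>2 \<le> dp v K x \<bullet> dp w K x"
      using t by (simp add: add_divide_distrib power2_eq_square)
  qed (use t in \<open>auto intro!: continuous_intros cd\<close>)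
  also have "(LINT x|lebesgue_on K. (- (t / 2)) * (norm (dp v K x))\<^sup>2 + (- 1 / (2 * t)) * (norm (dp w K x))\<^sup>2) = (- (t / 2)) * E v K + (- 1 / (2 * t)) * E w K"
  proof -
    have i: "integrable (lebesgue_on K) (\<lambda>x. (norm (dp v K x))\<^sup>2)" "integrable (lebesgue_on K) (\<lambda>x. (norm (dp w K x))\<^sup>2)"
      by (intro int continuous_intros cd)+
    show ?thesis unfolding E_def using i by (subst Bochner_Integration.integral_add) (auto simp del: mult_minus_left)
  qed
  finally show ?thesis using t by (simp add: field_simps)
qed

lemma inner_lower_sum:
  assumes v: "v \<in> fe" "w \<in> fe" and t: "t > 0"
  shows "- (t / 2 * En v + En w / (2 * t)) \<le> (\<Sum>K\<in>\<T>. LINT x|lebesgue_on K. dp v K x \<bullet> dp w K x)"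
proof -
  have "- (t / 2 * En v + En w / (2 * t)) = (\<Sum>K\<in>\<T>. - (t / 2 * E v K + E w K / (2 * t)))"
    by (simp add: En_def sum_negf sum_subtractf sum.distrib sum_distrib_left sum_divide_distrib)
  also have "\<dots> \<le> (\<Sum>K\<in>\<T>. LINT x|lebesgue_on K. dp v K x \<bullet> dp w K x)" by (intro sum_mono inner_lower v t)
  finally show ?thesis .
qed

lemma gb_le: assumes "K \<in> \<T>" "z \<in> verts K" shows "norm (gb K z) \<le> c / diameter K"
proof -
  obtain b d where "nondeg z b d" "K = convex hull {z,b,d}" by (rule tri_at_vertex[OF mesh_simplex[OF assms(1)] assms(2)])
  then show ?thesis using glam_le[OF assms(1)] gb_eq by metis
qed

lemma dp_wI_sum: assumes "K \<in> \<T>" shows "dp (wI u) K x = (\<Sum>z\<in>verts K. u z *\<^sub>R gb K z)"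
proof -
  obtain a b d where t: "nondeg a b d" "K = convex hull {a,b,d}" using simplex2_nondeg[OF mesh_simplex[OF assms]] by metis
  have n: "nondeg b d a" "nondeg d a b" using t(1) by (simp_all add: nondeg_cyc nondeg_cyc2)
  have "gb K a = glam a b d" "gb K b = glam b d a" "gb K d = glam d a b"
    using gb_eq[OF t(1)] gb_eq[OF n(1)] gb_eq[OF n(2)] t(2) by (simp_all add: hull3_perm)
  moreover have "verts K = {a,b,d}" using verts_tri[OF t(1)] t(2) by simp
  ultimately show ?thesis using dp_wI[OF assms t] nondeg_imp[OF t(1)] by simp
qed

text \<open>The gradient on K combines three vectors of length at most c over the diameter, and the
  area is at most pi times the squared diameter. The factor 3 comes from Cauchy-Schwarz.\<close>

lemma E_wI: assumes "K \<in> \<T>" shows "E (wI u) K \<le> 3 * pi * c\<^sup>2 * (\<Sum>z\<in>verts K. (u z)\<^sup>2)"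
proof -
  note tf = tri_facts[OF mesh_simplex[OF assms]]
  have d0: "diameter K > 0" by (rule diam_pos[OF assms])
  define g where "g = (\<Sum>z\<in>verts K. u z *\<^sub>R gb K z)"
  have "norm g \<le> (\<Sum>z\<in>verts K. norm (u z *\<^sub>R gb K z))" unfolding g_def by (rule norm_sum)
  also have "\<dots> \<le> (\<Sum>z\<in>verts K. \<bar>u z\<bar> * (c / diameter K))"
  proof (rule sum_mono)
    fix z assume "z \<in> verts K"
    from mult_left_mono[OF gb_le[OF assms this] abs_ge_zero[of "u z"]]
    show "norm (u z *\<^sub>R gb K z) \<le> \<bar>u z\<bar> * (c / diameter K)" by (simp only: norm_scaleR)
  qed
  also have "\<dots> = (c / diameter K) * (\<Sum>z\<in>verts K. 1 * \<bar>u z\<bar>)" by (simp add: sum_distrib_left mult.commute)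
  finally have "(norm g)\<^sup>2 \<le> ((c / diameter K) * (\<Sum>z\<in>verts K. 1 * \<bar>u z\<bar>))\<^sup>2" by (intro power_mono) auto
  also have "\<dots> = (c / diameter K)\<^sup>2 * (\<Sum>z\<in>verts K. 1 * \<bar>u z\<bar>)\<^sup>2" by (simp add: power_mult_distrib power_divide)
  also have "\<dots> \<le> (c / diameter K)\<^sup>2 * ((\<Sum>z\<in>verts K. 1\<^sup>2) * (\<Sum>z\<in>verts K. \<bar>u z\<bar>\<^sup>2))" by (intro mult_left_mono Cauchy_Schwarz_ineq_sum) simp
  also have "\<dots> = (c / diameter K)\<^sup>2 * (3 * (\<Sum>z\<in>verts K. (u z)\<^sup>2))" using tf(5) by simp
  finally have g: "(norm g)\<^sup>2 \<le> (c / diameter K)\<^sup>2 * (3 * (\<Sum>z\<in>verts K. (u z)\<^sup>2))" .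
  have "E (wI u) K = (LINT x|lebesgue_on K. (norm g)\<^sup>2)" unfolding E_def dp_wI_sum[OF assms] g_def ..
  also have "\<dots> = measure lebesgue K * (norm g)\<^sup>2"
    using tri_lmeasurable[OF mesh_simplex[OF assms]] by (simp add: measure_restrict_space)
  also have "\<dots> \<le> (pi * (diameter K)\<^sup>2) * ((c / diameter K)\<^sup>2 * (3 * (\<Sum>z\<in>verts K. (u z)\<^sup>2)))"
    by (intro mult_mono area_upper[OF assms] g) auto
  also have "\<dots> = 3 * pi * c\<^sup>2 * (\<Sum>z\<in>verts K. (u z)\<^sup>2)" using d0 by (simp add: power_divide field_simps)
  finally show ?thesis .
qed

text \<open>A triangle occurs in at most three boundary edges.\<close>

lemma sum_fst_E:
  assumes "A \<subseteq> BE" shows "(\<Sum>e\<in>A. E v (fst e)) \<le> 3 * En v"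
proof -
  have "A \<subseteq> (SIGMA K:\<T>. verts K)" using assms by (auto simp: BE_def)
  then have "(\<Sum>e\<in>A. E v (fst e)) \<le> (\<Sum>e\<in>(SIGMA K:\<T>. verts K). E v (fst e))"
    using finite_mesh tri_facts(4)[OF mesh_simplex] E_ge0 by (intro sum_mono2) auto
  also have "\<dots> = (\<Sum>K\<in>\<T>. \<Sum>z\<in>verts K. E v K)"
    using finite_mesh tri_facts(4)[OF mesh_simplex] by (subst sum.Sigma) (auto simp: case_prod_beta)
  also have "\<dots> = 3 * En v" using tri_facts(5)[OF mesh_simplex] by (simp add: En_def sum_distrib_left)
  finally show ?thesis .
qed

text \<open>One set of constants serves both kinds of test functions. In \<open>be\<close> the first
  two summands come from \<open>testable_interior\<close>, the last two from
  \<open>testable_ear\<close>; \<open>ga\<close> has room for the norms of both; in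
  \<open>ka\<close> the factor of L stands for edges controlled through a link. \<open>al\<close> is
  half of the flux bound 1 / (2 c), the other half absorbing the energy of w.\<close>

definition al :: real where "al = 1 / (4 * c)"
definition be :: "real \<Rightarrow> real" where "be M = 3 * pi * c ^ 3 * (M + 1) + 3 * c * Co / 2 + c * (2 * c + 2)\<^sup>2 * Co + c ^ 3 * pi"
definition ga :: "real \<Rightarrow> real" where "ga M = 3 * pi * c\<^sup>2 * M + 3 * pi * c\<^sup>2 + 2"
definition ka :: "real \<Rightarrow> real \<Rightarrow> real" where "ka M L = 2 + 6 * Co + L * (2 + 18 * M * Co)"

text \<open>The hypotheses of \<open>inf_sup_from_test\<close>, with constants fixed by c, k, M and
  L. S will be a sum of squares of vertex values of v.\<close>

definition testable :: "real \<Rightarrow> real \<Rightarrow> (point \<Rightarrow> real) \<Rightarrow> bool" where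
  "testable M L v \<longleftrightarrow> (\<exists>w\<in>fe. \<exists>S\<ge>0. nitsche_form vs \<Omega> \<T> v w \<ge> al * S - be M * En v \<and> N2 w \<le> ga M * S \<and> Hn v \<le> ka M L * (S + En v))"

lemma BE_in: assumes "e \<in> BE" shows "fst e \<in> \<T>" "snd e \<in> fst e"
proof -
  show K: "fst e \<in> \<T>" using assms by (auto simp: BE_def)
  have "snd e \<in> verts (fst e)" using assms by (auto simp: BE_def)
  then show "snd e \<in> fst e" using tri_facts(6)[OF mesh_simplex[OF K]] by blast
qed

text \<open>w takes the values of - v at the vertices opposite to good edges and 0 at all others, so
  it vanishes on the boundary. Its outward flux through a good edge has the sign of v at the
  opposite vertex, and v on the edge differs from that value by the oscillation only. Good edges may
  be arbitrarily many; the remaining ones, at most L, are linked to good ones.\<close>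

lemma testable_interior:
  assumes v: "v \<in> fe" and M: "M \<ge> 0" "\<And>a. real (card {K \<in> \<T>. a \<in> K}) \<le> M" and L: "real (card (BE - GE)) \<le> L"
    and links: "\<And>e. e \<in> BE - GE \<Longrightarrow> \<exists>e'\<in>GE. \<exists>U. open U \<and> connected U \<and> U \<subseteq> \<Omega> \<and> fst e \<inter> U \<noteq> {} \<and> fst e' \<inter> U \<noteq> {} \<and>
        real (card {K \<in> \<T>. K \<inter> U \<noteq> {}}) \<le> M"
  shows "testable M L v"
proof -
  have finGE: "finite GE" "GE \<subseteq> BE" using finBE by (auto simp: GE_def)
  define nv where "nv a = ep v (elem_at \<T> a) a" for a
  define u where "u a = (if a \<in> snd ` GE then - nv a else 0)" for a
  \<comment> \<open>S counts a vertex once for every good edge opposite to it, so the squared nodal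
    values sum to at most S.\<close>
  define S where "S = (\<Sum>e\<in>GE. (nv (snd e))\<^sup>2)"
  have S0: "S \<ge> 0" unfolding S_def by (simp add: sum_nonneg)
  have nv: "ep v K a = nv a" if "a \<in> \<Omega>" "K \<in> \<T>" "a \<in> K" for a K
    unfolding nv_def using elem_at[of a] closure_subset[of \<Omega>] that by (intro vertex_continuous[OF v that(1,3) _ that(2)]) auto
  have u0: "u z = 0" if "z \<in> frontier \<Omega>" for z
    using domain_disjoint_frontier that by (auto simp: u_def GE_def)
  let ?w = "wI u"
  have w: "?w \<in> fe" by (rule wI_props(1))
  have tri: "\<exists>b d. fst e \<in> \<T> \<and> nondeg (snd e) b d \<and> fst e = convex hull {snd e,b,d} \<and> opp (fst e) (snd e) = closed_segment b d \<and> closed_segment b d \<subseteq> frontier \<Omega>"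
    if "e \<in> BE" for e using BE_tri[of "fst e" "snd e"] that by (metis prod.collapse)
  have w0: "ep ?w (fst e) x = 0" if e: "e \<in> BE" and x: "x \<in> opp (fst e) (snd e)" for e x
  proof -
    obtain b d where t: "fst e \<in> \<T>" "nondeg (snd e) b d" "fst e = convex hull {snd e,b,d}" "opp (fst e) (snd e) = closed_segment b d" "closed_segment b d \<subseteq> frontier \<Omega>"
      using tri[OF e] by blast
    have "u b = 0" "u d = 0" using t(5) u0 by (auto simp: subset_iff)
    moreover have "x \<in> closed_segment b d" using x t(4) by simp
    then obtain s where s: "x = (1 - s) *\<^sub>R b + s *\<^sub>R d" unfolding in_segment by blast
    ultimately have "interp u (convex hull {snd e,b,d}) x = 0" unfolding s interp_edge[OF t(2)] by simp
    then show ?thesis using wI_props(2)[OF t(1), of u] t(3) by simp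
  qed
  have z2: "eint e (\<lambda>x. (dp v (fst e) x \<bullet> nu e) * ep ?w (fst e) x) = 0" if e: "e \<in> BE" for e
  proof -
    have "eint e (\<lambda>x. (dp v (fst e) x \<bullet> nu e) * ep ?w (fst e) x) = eint e (\<lambda>x. 0 * 1)" by (rule eint_cong) (use w0[OF e] in simp)
    then show ?thesis unfolding eint_cmult by simp
  qed
  have t3: "(1 / (2 * c)) * (u (snd e))\<^sup>2 - (c * Co / 2) * (if e \<in> GE then E v (fst e) else 0) \<le> eint e (\<lambda>x. ep v (fst e) x * (dp ?w (fst e) x \<bullet> nu e))"
    if e: "e \<in> BE" for e
  proof -
    obtain b d where t: "fst e \<in> \<T>" "nondeg (snd e) b d" "fst e = convex hull {snd e,b,d}" "opp (fst e) (snd e) = closed_segment b d" "closed_segment b d \<subseteq> frontier \<Omega>"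
      using tri[OF e] by blast
    let ?K = "fst e" and ?a = "snd e" and ?g = "glam (snd e) b d"
    have ub: "u b = 0" "u d = 0" using t(5) u0 by (auto simp: subset_iff)
    have g0: "?g \<noteq> 0" using glam_inner[of ?a b d "?a - b"] t(2) by (auto simp: nondeg_def)
    have nu: "nu e = - (?g /\<^sub>R norm ?g)" unfolding nu_def using gb_eq[OF t(2)] t(3) by simp
    have dw: "dp ?w ?K x \<bullet> nu e = - (u ?a * norm ?g)" for x
      unfolding dp_wI[OF t(1-3)] nu using ub g0 by (simp add: power2_norm_eq_inner[symmetric] power2_eq_square)
    show ?thesis
    proof (cases "e \<in> GE")
      case False
      then have "?a \<notin> \<Omega>" using e by (simp add: GE_def)
      then have "u ?a = 0" by (auto simp: u_def GE_def)
      then show ?thesis unfolding dw using False eint_cmult[of e 0 "\<lambda>x. 1"] by simp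
    next
      case True
      then have aO: "?a \<in> \<Omega>" by (simp add: GE_def)
      have aK: "?a \<in> ?K" using e tri_facts(6)[OF mesh_simplex[OF t(1)]] by (auto simp: BE_def)
      have ua: "u ?a = - ep v ?K ?a" using True nv[OF aO t(1) aK] by (auto simp: u_def)
      have "(norm ?g * ((u ?a)\<^sup>2 / 2 - Co * E v ?K / 2)) * norm (d - b) = eint e (\<lambda>x. norm ?g * ((u ?a)\<^sup>2 / 2 - Co * E v ?K / 2))"
        using eint_const[OF t(1-3,5)] by simp
      also have "\<dots> \<le> eint e (\<lambda>x. ep v ?K x * (- (u ?a * norm ?g)))"
      proof (rule eint_mono[OF e])
        show "continuous_on UNIV (\<lambda>x. ep v ?K x * (- (u ?a * norm ?g)))" by (intro continuous_intros ep_cont v e)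
        fix x assume "x \<in> opp ?K ?a"
        then have xK: "x \<in> ?K" using t edge_iff[OF t(2)] by simp
        have "(ep v ?K ?a - ep v ?K x)\<^sup>2 \<le> Co * E v ?K" by (rule element_oscillation(1)[OF v t(1) aK xK])
        \<comment> \<open>From v(x) v(a) = (v(x)^2 + v(a)^2 - (v(a) - v(x))^2) / 2, dropping the
          first square.\<close>
        moreover have "(ep v ?K ?a)\<^sup>2 / 2 - (ep v ?K ?a - ep v ?K x)\<^sup>2 / 2 \<le> ep v ?K x * ep v ?K ?a"
          using zero_le_power2[of "ep v ?K x"] by (simp add: power2_diff field_simps)
        ultimately have "(u ?a)\<^sup>2 / 2 - Co * E v ?K / 2 \<le> ep v ?K x * ep v ?K ?a" unfolding ua by simp
        from mult_left_mono[OF this norm_ge_zero[of ?g]]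
        show "norm ?g * ((u ?a)\<^sup>2 / 2 - Co * E v ?K / 2) \<le> ep v ?K x * (- (u ?a * norm ?g))" unfolding ua by (simp add: mult_ac)
      qed simp
      finally have 1: "(norm (d - b) * norm ?g) * ((u ?a)\<^sup>2 / 2) - (norm (d - b) * norm ?g) * (Co * E v ?K / 2) \<le> eint e (\<lambda>x. ep v ?K x * (- (u ?a * norm ?g)))"
        by (simp add: algebra_simps)
      have "1 / c * ((u ?a)\<^sup>2 / 2) \<le> (norm (d - b) * norm ?g) * ((u ?a)\<^sup>2 / 2)" using edge_len(3)[OF t(1-3)] by (intro mult_right_mono) auto
      moreover have "(norm (d - b) * norm ?g) * (Co * E v ?K / 2) \<le> c * (Co * E v ?K / 2)"
        using edge_len(4)[OF t(1-3)] Co_pos E_ge0 by (intro mult_right_mono) auto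
      ultimately show ?thesis unfolding dw using 1 True by simp
    qed
  qed
  have "(\<Sum>e\<in>BE. (u (snd e))\<^sup>2) \<ge> S"
  proof -
    have "S = (\<Sum>e\<in>GE. (u (snd e))\<^sup>2)" unfolding S_def by (intro sum.cong refl) (auto simp: u_def)
    also have "\<dots> \<le> (\<Sum>e\<in>BE. (u (snd e))\<^sup>2)" using finBE finGE by (intro sum_mono2) auto
    finally show ?thesis .
  qed
  then have "(1 / (2 * c)) * S \<le> (1 / (2 * c)) * (\<Sum>e\<in>BE. (u (snd e))\<^sup>2)" using c_pos by (intro mult_left_mono) auto
  moreover have "(\<Sum>e\<in>BE. if e \<in> GE then E v (fst e) else 0) \<le> 3 * En v"
  proof -
    have "(\<Sum>e\<in>BE. if e \<in> GE then E v (fst e) else 0) = (\<Sum>e\<in>BE \<inter> GE. E v (fst e))" using finBE by (simp add: sum.inter_restrict)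
    then show ?thesis using sum_fst_E[of "BE \<inter> GE" v] by simp
  qed
  then have "(c * Co / 2) * (\<Sum>e\<in>BE. if e \<in> GE then E v (fst e) else 0) \<le> (c * Co / 2) * (3 * En v)" using c_pos Co_pos by (intro mult_left_mono) auto
  moreover have "(1 / (2 * c)) * (\<Sum>e\<in>BE. (u (snd e))\<^sup>2) - (c * Co / 2) * (\<Sum>e\<in>BE. if e \<in> GE then E v (fst e) else 0)
      \<le> (\<Sum>e\<in>BE. eint e (\<lambda>x. ep v (fst e) x * (dp ?w (fst e) x \<bullet> nu e)))"
    unfolding sum_distrib_left sum_subtractf[symmetric] by (intro sum_mono t3)
  ultimately have T3: "(1 / (2 * c)) * S - 3 * c * Co / 2 * En v \<le> (\<Sum>e\<in>BE. eint e (\<lambda>x. ep v (fst e) x * (dp ?w (fst e) x \<bullet> nu e)))"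
    by (simp add: mult_ac)
  have sumV: "(\<Sum>z\<in>V. (u z)\<^sup>2) \<le> S"
  proof -
    have "(\<Sum>z\<in>V. (u z)\<^sup>2) \<le> (\<Sum>z\<in>snd ` GE. (u z)\<^sup>2)"
    proof -
      have "(\<Sum>z\<in>V. (u z)\<^sup>2) = (\<Sum>z\<in>V \<inter> snd ` GE. (u z)\<^sup>2)" using finV by (intro sum.mono_neutral_right) (auto simp: u_def)
      also have "\<dots> \<le> (\<Sum>z\<in>snd ` GE. (u z)\<^sup>2)" using finGE by (intro sum_mono2) auto
      finally show ?thesis .
    qed
    also have "\<dots> \<le> (\<Sum>e\<in>GE. (u (snd e))\<^sup>2)" using sum_image_le[OF finGE(1), of "\<lambda>z. (u z)\<^sup>2" snd] by (simp add: o_def)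
    also have "\<dots> = S" unfolding S_def by (intro sum.cong refl) (auto simp: u_def)
    finally show ?thesis .
  qed
  have Enw: "En ?w \<le> 3 * pi * c\<^sup>2 * M * S"
  proof -
    have "En ?w \<le> (\<Sum>K\<in>\<T>. 3 * pi * c\<^sup>2 * (\<Sum>z\<in>verts K. (u z)\<^sup>2))" unfolding En_def by (intro sum_mono E_wI)
    also have "\<dots> = 3 * pi * c\<^sup>2 * (\<Sum>K\<in>\<T>. \<Sum>z\<in>V. if z \<in> verts K then (u z)\<^sup>2 else 0)"
    proof -
      have "(\<Sum>z\<in>verts K. (u z)\<^sup>2) = (\<Sum>z\<in>V. if z \<in> verts K then (u z)\<^sup>2 else 0)" if "K \<in> \<T>" for K
      proof -
        have "V \<inter> verts K = verts K" using that by blast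
        then show ?thesis using finV by (simp flip: sum.inter_restrict)
      qed
      then show ?thesis by (simp add: sum_distrib_left cong: sum.cong)
    qed
    also have "(\<Sum>K\<in>\<T>. \<Sum>z\<in>V. if z \<in> verts K then (u z)\<^sup>2 else 0) = (\<Sum>z\<in>V. \<Sum>K\<in>\<T>. if z \<in> verts K then (u z)\<^sup>2 else 0)" by (rule sum.swap)
    \<comment> \<open>After the exchange of sums a vertex is counted once for each of its at most M
      triangles.\<close>
    also have "\<dots> \<le> (\<Sum>z\<in>V. M * (u z)\<^sup>2)"
    proof (rule sum_mono)
      fix z
      have "(\<Sum>K\<in>\<T>. if z \<in> verts K then (u z)\<^sup>2 else 0) = real (card {K \<in> \<T>. z \<in> verts K}) * (u z)\<^sup>2"
        using finite_mesh by (simp add: sum.If_cases Int_def)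
      also have "\<dots> \<le> M * (u z)\<^sup>2"
      proof -
        have "card {K \<in> \<T>. z \<in> verts K} \<le> card {K \<in> \<T>. z \<in> K}" using finite_mesh tri_facts(6)[OF mesh_simplex] by (intro card_mono) auto
        then show ?thesis using M(2)[of z] by (intro mult_right_mono) auto
      qed
      finally show "(\<Sum>K\<in>\<T>. if z \<in> verts K then (u z)\<^sup>2 else 0) \<le> M * (u z)\<^sup>2" .
    qed
    also have "\<dots> \<le> M * S" using sumV M(1) by (simp add: mult_left_mono flip: sum_distrib_left)
    finally show ?thesis using c_pos by (simp add: mult_left_mono mult.assoc)
  qed
  have Hw: "Hn ?w = 0"
  proof -
    have "eint e (\<lambda>x. (ep ?w (fst e) x)\<^sup>2) = 0" if "e \<in> BE" for e
    proof -
      have "eint e (\<lambda>x. (ep ?w (fst e) x)\<^sup>2) = eint e (\<lambda>x. 0 * 1)" by (rule eint_cong) (use w0[OF that] in simp)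
      then show ?thesis unfolding eint_cmult by simp
    qed
    then show ?thesis by (simp add: Hn_def)
  qed
  \<comment> \<open>Chosen so that the energy of w costs at most \<open>al\<close> times S in
    Young's inequality, half of the flux term; the summand 1 keeps t positive when M = 0.\<close>
  define t where "t = 6 * pi * c ^ 3 * (M + 1)"
  have t: "t > 0" unfolding t_def using c_pos M(1) by (simp add: add_nonneg_pos)
  have "- (t / 2 * En v + En ?w / (2 * t)) \<le> (\<Sum>K\<in>\<T>. LINT x|lebesgue_on K. dp v K x \<bullet> dp ?w K x)" by (rule inner_lower_sum[OF v w t])
  moreover have "En ?w / (2 * t) \<le> al * S"
  proof -
    have "En ?w \<le> 3 * pi * c\<^sup>2 * (M + 1) * S"
    proof -
      have "3 * pi * c\<^sup>2 * M * S \<le> 3 * pi * c\<^sup>2 * (M + 1) * S" using S0 c_pos by (intro mult_right_mono mult_left_mono) auto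
      then show ?thesis using Enw by linarith
    qed
    then have "En ?w / (2 * t) \<le> 3 * pi * c\<^sup>2 * (M + 1) * S / (2 * t)" using t by (intro divide_right_mono) auto
    also have "\<dots> = al * S"
    proof -
      define X where "X = 3 * pi * c\<^sup>2 * (M + 1)"
      have "X \<noteq> 0" using c_pos M(1) by (simp add: X_def)
      moreover have "2 * t = X * (4 * c)" by (simp add: t_def X_def power2_eq_square power3_eq_cube)
      ultimately show ?thesis unfolding X_def[symmetric] al_def by simp
    qed
    finally show ?thesis .
  qed
  moreover have "nitsche_form vs \<Omega> \<T> v ?w = (\<Sum>K\<in>\<T>. LINT x|lebesgue_on K. dp v K x \<bullet> dp ?w K x)
     + (\<Sum>e\<in>BE. eint e (\<lambda>x. ep v (fst e) x * (dp ?w (fst e) x \<bullet> nu e)))"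
    unfolding nitsche_eq[OF v w] using z2 by simp
  ultimately have "nitsche_form vs \<Omega> \<T> v ?w \<ge> (1 / (2 * c)) * S - al * S - (3 * c * Co / 2 + t / 2) * En v"
    using T3 by (simp add: distrib_right)
  moreover have "(1 / (2 * c)) * S - al * S = al * S" by (simp add: al_def field_simps)
  ultimately have A: "nitsche_form vs \<Omega> \<T> v ?w \<ge> al * S - (3 * c * Co / 2 + t / 2) * En v" by linarith
  have "3 * c * Co / 2 + t / 2 \<le> be M"
  proof -
    have "0 \<le> c * (2 * c + 2)\<^sup>2 * Co + c ^ 3 * pi" using c_pos Co_pos by (intro add_nonneg_nonneg mult_nonneg_nonneg) auto
    then show ?thesis unfolding be_def t_def by simp
  qed
  then have "(3 * c * Co / 2 + t / 2) * En v \<le> be M * En v" using En_ge0 by (rule mult_right_mono)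
  then have B: "nitsche_form vs \<Omega> \<T> v ?w \<ge> al * S - be M * En v" using A by linarith
  have C: "N2 ?w \<le> ga M * S"
  proof -
    have "0 \<le> (3 * pi * c\<^sup>2 + 2) * S" using S0 by (intro mult_nonneg_nonneg) auto
    then show ?thesis using Enw Hw unfolding N2_def ga_def by (simp add: algebra_simps)
  qed
  have cE: "0 \<le> Co * E v K" for K using Co_pos E_ge0 by simp
  \<comment> \<open>A good edge uses the value at its own vertex; any other edge uses the vertex of
    a linked good edge, at the price of all of S.\<close>
  have "(ep v (fst e) x)\<^sup>2 \<le> (if e \<in> GE then 2 * (nv (snd e))\<^sup>2 + 2 * Co * E v (fst e) else 2 * S + 18 * M * Co * En v)"
    if e: "e \<in> BE" and x: "x \<in> fst e" for e x
  proof (cases "e \<in> GE")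
    case True
    then have aO: "snd e \<in> \<Omega>" by (simp add: GE_def)
    note K = BE_in[OF e]
    have "(ep v (fst e) x - ep v (fst e) (snd e))\<^sup>2 \<le> Co * E v (fst e)" by (rule element_oscillation(1)[OF v K(1) x K(2)])
    moreover have "(ep v (fst e) x)\<^sup>2 \<le> 2 * (ep v (fst e) (snd e))\<^sup>2 + 2 * (ep v (fst e) x - ep v (fst e) (snd e))\<^sup>2"
      using zero_le_power2[of "ep v (fst e) x - 2 * ep v (fst e) (snd e)"] by (simp add: power2_eq_square algebra_simps)
    ultimately show ?thesis using True nv[OF aO K] by simp
  next
    case False
    then have "e \<in> BE - GE" using e by simp
    from links[OF this] obtain e' where e': "e' \<in> GE" and "\<exists>U. open U \<and> connected U \<and> U \<subseteq> \<Omega> \<and> fst e \<inter> U \<noteq> {} \<and> fst e' \<inter> U \<noteq> {} \<and> real (card {K \<in> \<T>. K \<inter> U \<noteq> {}}) \<le> M" ..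
    from this(2) obtain U where U: "open U" "connected U" "U \<subseteq> \<Omega>" "fst e \<inter> U \<noteq> {}" "fst e' \<inter> U \<noteq> {}"
        "real (card {K \<in> \<T>. K \<inter> U \<noteq> {}}) \<le> M" by (elim exE conjE)
    have e'B: "e' \<in> BE" using e' finGE by blast
    have K: "fst e \<in> \<T>" "fst e' \<in> \<T>" "snd e' \<in> fst e'" "snd e' \<in> \<Omega>" using BE_in[OF e] BE_in[OF e'B] e' by (auto simp: GE_def)
    have "(ep v (fst e) x)\<^sup>2 \<le> 2 * (ep v (fst e') (snd e'))\<^sup>2 + 18 * M * Co * En v"
      by (rule linked_elements_square_bound[OF v U(1-3) K(1,2) U(4,5) x K(3) U(6)])
    moreover have "(nv (snd e'))\<^sup>2 \<le> S" unfolding S_def using e' finGE by (intro member_le_sum[where f="\<lambda>e. (nv (snd e))\<^sup>2"]) auto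
    ultimately show ?thesis using False nv[OF K(4,2,3)] by simp
  qed
  then have "Hn v \<le> (\<Sum>e\<in>BE. if e \<in> GE then 2 * (nv (snd e))\<^sup>2 + 2 * Co * E v (fst e) else 2 * S + 18 * M * Co * En v)"
    by (rule Hn_le[OF v])
  also have "\<dots> = (\<Sum>e\<in>GE. 2 * (nv (snd e))\<^sup>2 + 2 * Co * E v (fst e)) + (\<Sum>e\<in>BE - GE. 2 * S + 18 * M * Co * En v)"
  proof -
    have "BE \<inter> {e. e \<in> GE} = GE" "BE \<inter> - {e. e \<in> GE} = BE - GE" using finGE by auto
    then show ?thesis using finBE by (simp add: sum.If_cases)
  qed
  also have "\<dots> \<le> (2 * S + 2 * Co * (3 * En v)) + L * (2 * S + 18 * M * Co * En v)"
  proof (rule add_mono)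
    have "(\<Sum>e\<in>GE. 2 * (nv (snd e))\<^sup>2 + 2 * Co * E v (fst e)) = 2 * S + 2 * Co * (\<Sum>e\<in>GE. E v (fst e))"
      by (simp add: S_def sum.distrib sum_distrib_left)
    also have "\<dots> \<le> 2 * S + 2 * Co * (3 * En v)" using sum_fst_E[OF finGE(2), of v] Co_pos by (intro add_left_mono mult_left_mono) auto
    finally show "(\<Sum>e\<in>GE. 2 * (nv (snd e))\<^sup>2 + 2 * Co * E v (fst e)) \<le> 2 * S + 2 * Co * (3 * En v)" .
    have "0 \<le> 2 * S + 18 * M * Co * En v" using S0 M(1) Co_pos En_ge0 by (auto intro!: add_nonneg_nonneg mult_nonneg_nonneg)
    then show "(\<Sum>e\<in>BE - GE. 2 * S + 18 * M * Co * En v) \<le> L * (2 * S + 18 * M * Co * En v)"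
      using mult_right_mono[OF L] by simp
  qed
  finally have h: "Hn v \<le> 2 * S + 2 * Co * (3 * En v) + L * (2 * S + 18 * M * Co * En v)" .
  have D: "Hn v \<le> ka M L * (S + En v)"
  proof -
    have L0: "0 \<le> L" using L by (meson of_nat_0_le_iff order_trans)
    have "0 \<le> L * (18 * M * Co) * S" "0 \<le> 6 * Co * S" "0 \<le> (2 + L * 2) * En v"
      using L0 M(1) Co_pos S0 En_ge0 by (auto intro!: mult_nonneg_nonneg)
    then show ?thesis using h unfolding ka_def by (simp add: algebra_simps)
  qed
  show ?thesis unfolding testable_def using w S0 B C D by blast
qed

text \<open>If two of the three edges of \<open>K\<close> lie on the boundary, the outward fluxes of the hat function
  of their common vertex through them add up to minus its flux through the third edge.\<close>

lemma testable_ear: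
  assumes v: "v \<in> fe" and M: "M \<ge> 0" "real (card \<T>) \<le> M" and L: "real (card BE) \<le> L"
    and K: "K \<in> \<T>" "nondeg a b d" "K = convex hull {a,b,d}"
    and e: "closed_segment d a \<subseteq> frontier \<Omega>" "closed_segment a b \<subseteq> frontier \<Omega>" "\<not> closed_segment b d \<subseteq> frontier \<Omega>"
    and only: "\<And>K'. K' \<in> \<T> \<Longrightarrow> a \<in> K' \<Longrightarrow> K' = K"
  shows "testable M L v"
proof -
  define r where "r = ep v K a"
  define S where "S = r\<^sup>2"
  \<comment> \<open>The sign is opposite to that in \<open>testable_interior\<close>: the gradient
    of this hat function points, on balance, outwards through the two edges at a.\<close>
  define u where "u z = (if z = a then r else 0)" for z
  define o1 where "o1 = sqrt (Co * E v K)"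
  have cE: "0 \<le> Co * E v K" using Co_pos E_ge0 by simp
  have o0: "0 \<le> o1" "o1\<^sup>2 = Co * E v K" using cE by (simp_all add: o1_def)
  have S0: "S \<ge> 0" by (simp add: S_def)
  let ?w = "wI u" and ?D = "diameter K"
  have w: "?w \<in> fe" by (rule wI_props(1))
  have D0: "?D > 0" by (rule diam_pos[OF K(1)])
  have n: "nondeg b d a" "nondeg d a b" using K(2) by (simp_all add: nondeg_cyc nondeg_cyc2)
  have Kp: "K = convex hull {b,d,a}" "K = convex hull {d,a,b}" using K(3) by (simp_all add: hull3_perm)
  have ne: "a \<noteq> b" "b \<noteq> d" "a \<noteq> d" using nondeg_imp[OF K(2)] by auto
  let ?g = "glam a b d" and ?gb = "glam b d a" and ?gd = "glam d a b"
  have gs: "?gb + ?gd = - ?g" using glam_sum[OF K(2)] by (simp add: eq_neg_iff_add_eq_0 add_ac)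
  have BEb: "(K, b) \<in> BE" by (rule BE_I[OF K(1) n(1) Kp(1) e(1)])
  have BEd: "(K, d) \<in> BE" by (rule BE_I[OF K(1) n(2) Kp(2) e(2)])
  have BEO: "(K, a) \<notin> BE"
  proof
    assume "(K, a) \<in> BE"
    then have "opp K a \<subseteq> frontier \<Omega>" by (simp add: BE_def)
    then show False using opp_tri[OF K(2)] K(3) e(3) by simp
  qed
  have aK: "a \<in> K" unfolding K(3) by (auto intro: hull_inc)
  have dK: "dp ?w K x = r *\<^sub>R ?g" for x using dp_wI[OF K, of u] ne by (simp add: u_def)
  have other: "interp u K' = (\<lambda>x. 0)" "dp ?w K' x = 0" if K': "K' \<in> \<T>" "K' \<noteq> K" for K' x
  proof -
    have "a \<notin> verts K'" using only[OF K'(1)] K'(2) tri_facts(6)[OF mesh_simplex[OF K'(1)]] by blast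
    then have u0: "u z = 0" if "z \<in> verts K'" for z using that by (auto simp: u_def)
    then show i: "interp u K' = (\<lambda>x. 0)" by (auto simp: interp_def fun_eq_iff)
    show "dp ?w K' x = 0" unfolding dp_def wI_props(2)[OF K'(1)] i by (rule pgrad_eq[OF GDERIV_const])
  qed
  have epK: "ep ?w K x = r * lam a b d x" for x
    using wI_props(2)[OF K(1), of u] interp_tri[OF K(2), of u x] K(3) ne by (simp add: u_def)
  have lam01: "0 \<le> lam a b d x" "lam a b d x \<le> 1" if "x \<in> K" for x
    using in_tri_iff[OF K(2), of x] that K(3) lam_sum[OF K(2), of x] by auto
  have ewb: "\<bar>ep ?w K x\<bar> \<le> \<bar>r\<bar>" if "x \<in> K" for x
    unfolding epK abs_mult using lam01[OF that] by (intro mult_left_le) auto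
  have subK: "x \<in> K" if "x \<in> opp (fst ed) (snd ed)" "ed = (K, b) \<or> ed = (K, d)" for x ed
    using that opp_tri[OF n(1)] opp_tri[OF n(2)] Kp edge_iff[OF n(1), of x] edge_iff[OF n(2), of x] by auto
  \<comment> \<open>No other triangle contains a, so w lives on K alone and only its two boundary
    edges contribute.\<close>
  have split: "(\<Sum>ed\<in>BE. f ed) = f (K, b) + f (K, d)" if "\<And>ed. ed \<in> BE \<Longrightarrow> fst ed \<noteq> K \<Longrightarrow> f ed = 0" for f :: "_ \<Rightarrow> real"
  proof -
    have "f ed = 0" if ed: "ed \<in> BE - {(K, b), (K, d)}" for ed
    proof (cases "fst ed = K")
      case True
      then have "snd ed \<in> {a, b, d}" using ed verts_tri[OF K(2)] K(3) by (auto simp: BE_def)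
      then have "ed = (K, a) \<or> ed = (K, b) \<or> ed = (K, d)" using True by (cases ed) auto
      then show ?thesis using ed BEO by auto
    next
      case False
      then show ?thesis using ed \<open>\<And>ed. ed \<in> BE \<Longrightarrow> fst ed \<noteq> K \<Longrightarrow> f ed = 0\<close> by blast
    qed
    then have "(\<Sum>ed\<in>BE. f ed) = (\<Sum>ed\<in>{(K, b), (K, d)}. f ed)"
      using finBE BEb BEd by (intro sum.mono_neutral_right) auto
    then show ?thesis using ne by simp
  qed
  have inK: "fst ed \<in> \<T>" if "ed \<in> BE" for ed using that by (auto simp: BE_def)
  define F2 where "F2 ed = eint ed (\<lambda>x. (dp v (fst ed) x \<bullet> nu ed) * ep ?w (fst ed) x)" for ed
  define F3 where "F3 ed = eint ed (\<lambda>x. ep v (fst ed) x * (dp ?w (fst ed) x \<bullet> nu ed))" for ed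
  have z: "F2 ed = 0" "F3 ed = 0" if "ed \<in> BE" "fst ed \<noteq> K" for ed
    using eint_cmult[of ed 0 "\<lambda>x. 1"] other[OF inK[OF that(1)] that(2)] wI_props(2)[OF inK[OF that(1)], of u] by (simp_all add: F2_def F3_def)
  have nu1: "norm (nu ed) \<le> 1" for ed by (cases "gb (fst ed) (snd ed) = 0") (simp_all add: nu_def)
  \<comment> \<open>Since w does not vanish on the boundary, the consistency term survives; it is
    linear in |r| and in \<open>o1\<close>, so that Young's inequality can absorb it.\<close>
  have F2b: "\<bar>F2 ed\<bar> \<le> \<bar>r\<bar> * o1" if ed: "ed = (K, b) \<or> ed = (K, d)" for ed
  proof -
    have eB: "ed \<in> BE" and f: "fst ed = K" using ed BEb BEd by auto
    have "\<bar>F2 ed\<bar> \<le> (o1 / ?D * \<bar>r\<bar>) * diameter (fst ed)" unfolding F2_def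
    proof (rule eint_bounds[OF eB])
      show "continuous_on UNIV (\<lambda>x. (dp v (fst ed) x \<bullet> nu ed) * ep ?w (fst ed) x)"
        by (intro continuous_on_mult dpnu_cont ep_cont v w eB)
      fix x assume "x \<in> opp (fst ed) (snd ed)"
      then have xK: "x \<in> K" using subK ed by blast
      have "(?D * norm (dp v K x))\<^sup>2 \<le> o1\<^sup>2" using element_oscillation(2)[OF v K(1) xK xK] o0(2) by (simp add: power_mult_distrib)
      then have "?D * norm (dp v K x) \<le> o1" using o0(1) by (rule power2_le_imp_le)
      then have "norm (dp v K x) \<le> o1 / ?D" using D0 by (simp add: pos_le_divide_eq mult.commute)
      moreover have "\<bar>dp v K x \<bullet> nu ed\<bar> \<le> norm (dp v K x)"
        using Cauchy_Schwarz_ineq2[of "dp v K x" "nu ed"] mult_left_le[OF nu1[of ed] norm_ge_zero[of "dp v K x"]] by linarith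
      ultimately show "\<bar>(dp v (fst ed) x \<bullet> nu ed) * ep ?w (fst ed) x\<bar> \<le> o1 / ?D * \<bar>r\<bar>"
        unfolding abs_mult f using ewb[OF xK] o0 D0 by (intro mult_mono) auto
    qed
    then show ?thesis using D0 f by (simp add: mult.commute)
  qed
  \<comment> \<open>v is replaced by its value r at a, with an error of at most \<open>o1\<close>;
    the gradient of the hat function times the diameter is at most c.\<close>
  have F3b: "r\<^sup>2 * (len *\<^sub>R nu ed \<bullet> ?g) - c * \<bar>r\<bar> * o1 \<le> F3 ed"
    if ed: "ed = (K, b) \<or> ed = (K, d)" and len: "\<And>q. eint ed (\<lambda>x. q) = q * len" for ed len
  proof -
    have eB: "ed \<in> BE" and f: "fst ed = K" using ed BEb BEd by auto
    let ?k = "r * (?g \<bullet> nu ed)"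
    have "F3 ed = eint ed (\<lambda>x. ?k * r + ?k * (ep v K x - r))" unfolding F3_def f dK by (simp add: algebra_simps)
    also have "\<dots> = eint ed (\<lambda>x. ?k * r) + ?k * eint ed (\<lambda>x. ep v K x - r)"
      by (rule eint_lin[OF eB]) (use ep_cont[OF v eB] f in \<open>auto intro!: continuous_intros\<close>)
    finally have F: "F3 ed = ?k * r * len + ?k * eint ed (\<lambda>x. ep v K x - r)" by (simp add: len)
    have "\<bar>eint ed (\<lambda>x. ep v K x - r)\<bar> \<le> o1 * diameter (fst ed)"
    proof (rule eint_bounds[OF eB])
      show "continuous_on UNIV (\<lambda>x. ep v K x - r)" using ep_cont[OF v eB] f by (auto intro!: continuous_intros)
      fix x assume "x \<in> opp (fst ed) (snd ed)"
      then have xK: "x \<in> K" using subK ed by blast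
      show "\<bar>ep v K x - r\<bar> \<le> o1" unfolding r_def o1_def using element_oscillation(1)[OF v K(1) xK aK] by (metis real_sqrt_abs real_sqrt_le_iff)
    qed
    moreover have "\<bar>?k\<bar> \<le> \<bar>r\<bar> * (c / ?D)"
    proof -
      have "\<bar>?g \<bullet> nu ed\<bar> \<le> norm ?g"
        using Cauchy_Schwarz_ineq2[of ?g "nu ed"] mult_left_le[OF nu1[of ed] norm_ge_zero[of ?g]] by linarith
      then show ?thesis unfolding abs_mult using glam_le[OF K] by (intro mult_left_mono) auto
    qed
    ultimately have "\<bar>?k\<bar> * \<bar>eint ed (\<lambda>x. ep v K x - r)\<bar> \<le> (\<bar>r\<bar> * (c / ?D)) * (o1 * ?D)"
      unfolding f using c_pos D0 by (intro mult_mono) auto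
    also have "\<dots> = c * \<bar>r\<bar> * o1" using D0 by simp
    finally have "\<bar>?k * eint ed (\<lambda>x. ep v K x - r)\<bar> \<le> c * \<bar>r\<bar> * o1" by (simp only: abs_mult)
    moreover have "?k * r * len = r\<^sup>2 * (len *\<^sub>R nu ed \<bullet> ?g)" by (simp add: power2_eq_square inner_commute)
    ultimately show ?thesis unfolding F by linarith
  qed
  \<comment> \<open>Twice the area of K. Edge length times outward normal is - A times the gradient
    of the opposite coordinate, so by \<open>glam_sum\<close> the two edges add up to A times the
    gradient of the coordinate of a.\<close>
  define A where "A = \<bar>cr (a - b) (d - b)\<bar>"
  have Acyc: "\<bar>cr (b - d) (a - d)\<bar> = A" "\<bar>cr (d - a) (b - a)\<bar> = A"
    unfolding A_def using cr_cyc[of b d a] cr_cyc[of d a b] by simp_all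
  have scal: "norm (q - p) *\<^sub>R nu (K, z) = - (A *\<^sub>R glam z p q)"
    if "nondeg z p q" "K = convex hull {z,p,q}" "\<bar>cr (z - p) (q - p)\<bar> = A" for z p q
  proof -
    have g0: "glam z p q \<noteq> 0" using glam_inner[of z p q "z - p"] that(1) by (auto simp: nondeg_def)
    have "nu (K, z) = - (glam z p q /\<^sub>R norm (glam z p q))" unfolding nu_def using gb_eq[OF that(1)] that(2) by simp
    then show ?thesis using edge_len(5)[OF K(1) that(1,2)] that(3) g0 by simp
  qed
  have "r\<^sup>2 * ((norm (a - d) *\<^sub>R nu (K, b)) \<bullet> ?g) - c * \<bar>r\<bar> * o1 \<le> F3 (K, b)"
    by (rule F3b) (use eint_const[OF K(1) n(1) Kp(1) e(1)] in auto)
  moreover have "r\<^sup>2 * ((norm (b - a) *\<^sub>R nu (K, d)) \<bullet> ?g) - c * \<bar>r\<bar> * o1 \<le> F3 (K, d)"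
    by (rule F3b) (use eint_const[OF K(1) n(2) Kp(2) e(2)] in auto)
  moreover have "(norm (a - d) *\<^sub>R nu (K, b)) \<bullet> ?g + (norm (b - a) *\<^sub>R nu (K, d)) \<bullet> ?g = A * (norm ?g)\<^sup>2"
  proof -
    have "norm (a - d) *\<^sub>R nu (K, b) + norm (b - a) *\<^sub>R nu (K, d) = - (A *\<^sub>R (?gb + ?gd))"
      using scal[OF n(1) Kp(1) Acyc(1)] scal[OF n(2) Kp(2) Acyc(2)] by (simp add: scaleR_add_right)
    also have "\<dots> = A *\<^sub>R ?g" unfolding gs by simp
    finally have "(norm (a - d) *\<^sub>R nu (K, b) + norm (b - a) *\<^sub>R nu (K, d)) \<bullet> ?g = A * (norm ?g)\<^sup>2"
      by (simp only: inner_scaleR_left power2_norm_eq_inner)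
    then show ?thesis by (simp only: inner_add_left)
  qed
  then have "r\<^sup>2 * ((norm (a - d) *\<^sub>R nu (K, b)) \<bullet> ?g) + r\<^sup>2 * ((norm (b - a) *\<^sub>R nu (K, d)) \<bullet> ?g) = r\<^sup>2 * (A * (norm ?g)\<^sup>2)"
    by (simp only: distrib_left[symmetric])
  ultimately have F3sum: "r\<^sup>2 * (A * (norm ?g)\<^sup>2) - 2 * c * \<bar>r\<bar> * o1 \<le> F3 (K, b) + F3 (K, d)"
    by linarith
  have Ag: "1 / c \<le> A * (norm ?g)\<^sup>2"
    using edge_len(3)[OF K] edge_len(5)[OF K] unfolding A_def by (simp add: power2_eq_square mult.assoc)
  have EwK: "E ?w K \<le> pi * c\<^sup>2 * S"
  proof -
    have "E ?w K = measure lebesgue K * (norm (r *\<^sub>R ?g))\<^sup>2"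
      unfolding E_def dK using tri_lmeasurable[OF mesh_simplex[OF K(1)]] by (simp add: measure_restrict_space)
    also have "\<dots> \<le> (pi * ?D\<^sup>2) * (\<bar>r\<bar> * (c / ?D))\<^sup>2"
      unfolding norm_scaleR using glam_le[OF K] by (intro mult_mono area_upper[OF K(1)] power_mono mult_left_mono) auto
    also have "\<dots> = pi * c\<^sup>2 * S" using D0 by (simp add: S_def power_mult_distrib power_divide)
    finally show ?thesis .
  qed
  have Ew0: "E ?w K' = 0" if "K' \<in> \<T>" "K' \<noteq> K" for K' using other(2)[OF that] by (simp add: E_def)
  have Ts: "(\<Sum>K\<in>\<T>. f K) = f K" if "\<And>K'. K' \<in> \<T> \<Longrightarrow> K' \<noteq> K \<Longrightarrow> f K' = 0" for f :: "_ \<Rightarrow> real"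
  proof -
    have "(\<Sum>K\<in>\<T>. f K) = (\<Sum>K\<in>{K}. f K)" using finite_mesh K(1) that by (intro sum.mono_neutral_right) auto
    then show ?thesis by simp
  qed
  have Enw: "En ?w = E ?w K" unfolding En_def by (rule Ts) (rule Ew0)
  define t where "t = 2 * c ^ 3 * pi"
  have t: "t > 0" unfolding t_def using c_pos by simp
  have "- (t / 2 * En v + En ?w / (2 * t)) \<le> (\<Sum>K\<in>\<T>. LINT x|lebesgue_on K. dp v K x \<bullet> dp ?w K x)" by (rule inner_lower_sum[OF v w t])
  moreover have "En ?w / (2 * t) \<le> al * S"
  proof -
    have "En ?w / (2 * t) \<le> pi * c\<^sup>2 * S / (2 * t)" using EwK t unfolding Enw by (intro divide_right_mono) auto
    also have "\<dots> = al * S" unfolding t_def al_def using c_pos by (simp add: field_simps power2_eq_square power3_eq_cube)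
    finally show ?thesis .
  qed
  ultimately have T1: "- (c ^ 3 * pi * En v) - al * S \<le> (\<Sum>K\<in>\<T>. LINT x|lebesgue_on K. dp v K x \<bullet> dp ?w K x)"
    unfolding t_def by (simp add: mult_ac)
  have form: "nitsche_form vs \<Omega> \<T> v ?w = (\<Sum>K\<in>\<T>. LINT x|lebesgue_on K. dp v K x \<bullet> dp ?w K x) - (F2 (K, b) + F2 (K, d)) + (F3 (K, b) + F3 (K, d))"
    unfolding nitsche_eq[OF v w] F2_def[symmetric] F3_def[symmetric] using split[of F2] split[of F3] z by simp
  \<comment> \<open>Young's inequality: 2 c collects the two errors of replacing v by r, and 2 the
    two consistency terms.\<close>
  have "(2 * c + 2) * (\<bar>r\<bar> * o1) \<le> al * S + c * (2 * c + 2)\<^sup>2 * Co * En v"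
  proof -
    have "0 \<le> (\<bar>r\<bar> / (2 * c) - (2 * c + 2) * o1)\<^sup>2" by simp
    then have "2 * (\<bar>r\<bar> / (2 * c)) * ((2 * c + 2) * o1) \<le> (\<bar>r\<bar> / (2 * c))\<^sup>2 + ((2 * c + 2) * o1)\<^sup>2" by (simp add: power2_diff)
    then have "c * (2 * (\<bar>r\<bar> / (2 * c)) * ((2 * c + 2) * o1)) \<le> c * ((\<bar>r\<bar> / (2 * c))\<^sup>2 + ((2 * c + 2) * o1)\<^sup>2)"
      using c_pos by (intro mult_left_mono) auto
    moreover have "c * (2 * (\<bar>r\<bar> / (2 * c)) * ((2 * c + 2) * o1)) = (2 * c + 2) * (\<bar>r\<bar> * o1)" using c_pos by simp
    moreover have "c * (\<bar>r\<bar> / (2 * c))\<^sup>2 = al * S" using c_pos by (simp add: al_def S_def power_divide power2_eq_square)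
    moreover have "c * ((2 * c + 2) * o1)\<^sup>2 \<le> c * (2 * c + 2)\<^sup>2 * Co * En v"
    proof -
      have "c * ((2 * c + 2) * o1)\<^sup>2 = (c * (2 * c + 2)\<^sup>2 * Co) * E v K" by (simp add: power_mult_distrib o0(2))
      also have "\<dots> \<le> (c * (2 * c + 2)\<^sup>2 * Co) * En v" using c_pos Co_pos E_le[OF K(1)] by (intro mult_left_mono) auto
      finally show ?thesis .
    qed
    ultimately show ?thesis by (simp add: distrib_left)
  qed
  moreover have "1 / c * S \<le> r\<^sup>2 * (A * (norm ?g)\<^sup>2)" using mult_left_mono[OF Ag, of "r\<^sup>2"] by (simp add: S_def mult.commute)
  \<comment> \<open>Of these four shares one absorbs the energy of w and one the mixed terms; one of
    the remaining two is kept.\<close>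
  moreover have "1 / c * S = 4 * (al * S)" by (simp add: al_def)
  moreover have "F2 (K, b) + F2 (K, d) \<le> 2 * (\<bar>r\<bar> * o1)" using F2b[of "(K, b)"] F2b[of "(K, d)"] by simp
  ultimately have "nitsche_form vs \<Omega> \<T> v ?w \<ge> 2 * (al * S) - (c * (2 * c + 2)\<^sup>2 * Co + c ^ 3 * pi) * En v"
    using T1 F3sum unfolding form by (simp add: algebra_simps)
  moreover have "0 \<le> al * S" using c_pos S0 by (simp add: al_def)
  moreover have "(c * (2 * c + 2)\<^sup>2 * Co + c ^ 3 * pi) * En v \<le> be M * En v"
  proof (intro mult_right_mono En_ge0)
    have "0 \<le> 3 * pi * c ^ 3 * (M + 1) + 3 * c * Co / 2" using c_pos Co_pos M(1) by (intro add_nonneg_nonneg mult_nonneg_nonneg) auto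
    then show "c * (2 * c + 2)\<^sup>2 * Co + c ^ 3 * pi \<le> be M" unfolding be_def by simp
  qed
  ultimately have B: "nitsche_form vs \<Omega> \<T> v ?w \<ge> al * S - be M * En v" by linarith
  have "Hn ?w \<le> 2 * S"
  proof -
    define f where "f ed = inverse (diameter (fst ed)) * eint ed (\<lambda>x. (ep ?w (fst ed) x)\<^sup>2)" for ed
    have fz: "f ed = 0" if "ed \<in> BE" "fst ed \<noteq> K" for ed
      using eint_cmult[of ed 0 "\<lambda>x. 1"] other(1)[OF inK[OF that(1)] that(2)] wI_props(2)[OF inK[OF that(1)], of u] by (simp add: f_def)
    have fb: "f ed \<le> S" if ed: "ed = (K, b) \<or> ed = (K, d)" for ed
    proof -
      have eB: "ed \<in> BE" and fK: "fst ed = K" using ed BEb BEd by auto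
      have "\<bar>eint ed (\<lambda>x. (ep ?w (fst ed) x)\<^sup>2)\<bar> \<le> S * diameter (fst ed)"
      proof (rule eint_bounds[OF eB])
        show "continuous_on UNIV (\<lambda>x. (ep ?w (fst ed) x)\<^sup>2)" by (intro continuous_intros ep_cont w eB)
        fix x assume "x \<in> opp (fst ed) (snd ed)"
        then have "x \<in> K" using subK ed by blast
        then show "\<bar>(ep ?w (fst ed) x)\<^sup>2\<bar> \<le> S" using power_mono[OF ewb, of x 2] by (simp add: S_def fK)
      qed
      then show ?thesis using D0 by (simp add: f_def fK field_simps)
    qed
    have "Hn ?w = f (K, b) + f (K, d)" unfolding Hn_def f_def[symmetric] by (rule split) (rule fz)
    then show ?thesis using fb[of "(K, b)"] fb[of "(K, d)"] by simp
  qed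
  moreover have "En ?w \<le> 3 * pi * c\<^sup>2 * S"
  proof -
    have "0 \<le> pi * c\<^sup>2 * S" using S0 by simp
    then have "pi * c\<^sup>2 * S \<le> 3 * (pi * c\<^sup>2 * S)" by linarith
    then show ?thesis using EwK unfolding Enw by (simp only: mult.assoc)
  qed
  moreover have "0 \<le> 3 * pi * c\<^sup>2 * M * S" using S0 M(1) by simp
  ultimately have C: "N2 ?w \<le> ga M * S" unfolding N2_def ga_def by (simp add: algebra_simps)
  have "(ep v (fst e') x)\<^sup>2 \<le> 2 * S + 18 * M * Co * En v" if e': "e' \<in> BE" and x: "x \<in> fst e'" for e' x
  proof -
    have meets: "K' \<inter> \<Omega> \<noteq> {}" if "K' \<in> \<T>" for K' using interior_in_domain[OF that] interior_tri_ne[OF mesh_simplex[OF that]] interior_subset by blast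
    \<comment> \<open>\<Omega> itself is the linking set, since M bounds the number of all
      triangles.\<close>
    have "{K \<in> \<T>. K \<inter> \<Omega> \<noteq> {}} = \<T>" using meets by blast
    then have "real (card {K \<in> \<T>. K \<inter> \<Omega> \<noteq> {}}) \<le> M" using M(2) by simp
    from linked_elements_square_bound[OF v domain_props(1,2) order_refl inK[OF e'] K(1) meets[OF inK[OF e']] meets[OF K(1)] x aK this]
    show ?thesis by (simp add: S_def r_def)
  qed
  then have "Hn v \<le> (\<Sum>e\<in>BE. 2 * S + 18 * M * Co * En v)" by (rule Hn_le[OF v])
  also have "\<dots> \<le> L * (2 * S + 18 * M * Co * En v)"
    using L S0 M(1) Co_pos En_ge0 by (simp add: mult_right_mono)
  finally have D: "Hn v \<le> ka M L * (S + En v)"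
  proof -
    assume h: "Hn v \<le> L * (2 * S + 18 * M * Co * En v)"
    have L0: "0 \<le> L" using L by (meson of_nat_0_le_iff order_trans)
    have "0 \<le> L * (18 * M * Co) * S" "0 \<le> (2 + 6 * Co) * (S + En v)" "0 \<le> (L * 2) * En v"
      using L0 M(1) Co_pos S0 En_ge0 by (auto intro!: mult_nonneg_nonneg)
    then show ?thesis using h unfolding ka_def by (simp add: algebra_simps)
  qed
  show ?thesis unfolding testable_def using w S0 B C D by blast
qed

end

section \<open>Ears\<close>

lemma separated_parts_swap: "separated_parts \<Omega> p q D1 D2 c1 c2 \<Longrightarrow> separated_parts \<Omega> p q D2 D1 c2 c1"
  unfolding separated_parts_def by (simp add: Un_commute Int_commute)

lemma connected_in_part:
  assumes "open D1" "open D2" "D1 \<inter> D2 = {}" "connected S" "S \<subseteq> D1 \<union> D2"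
  shows "S \<subseteq> D1 \<or> S \<subseteq> D2"
proof (rule ccontr)
  assume "\<not> ?thesis"
  then have "D1 \<inter> S \<noteq> {}" "D2 \<inter> S \<noteq> {}" using assms(5) by auto
  moreover have "D1 \<inter> D2 \<inter> S = {}" using assms(3) by blast
  ultimately show False using connectedD[OF assms(4,1,2) _ assms(5)] by blast
qed

context mesh begin

text \<open>Being an edge of the mesh, a chord meets no interior of a triangle, so the triangles are
  distributed over the two parts that it separates.\<close>

definition chord :: "point \<Rightarrow> point \<Rightarrow> bool" where
  "chord p q \<longleftrightarrow> p \<in> frontier \<Omega> \<and> q \<in> frontier \<Omega> \<and> open_segment p q \<subseteq> \<Omega> \<and>
     (\<exists>K\<in>\<T>. \<exists>a. nondeg a p q \<and> K = convex hull {a,p,q})"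

lemma chord_parts:
  assumes "chord p q" obtains D1 D2 c1 c2 where "separated_parts \<Omega> p q D1 D2 c1 c2"
proof -
  obtain a where "nondeg a p q" using assms by (auto simp: chord_def)
  then have "p \<noteq> q" by (rule nondeg_imp(2))
  then have "\<exists>D1 D2 c1 c2. separated_parts \<Omega> p q D1 D2 c1 c2"
    using assms polygonal_domain_regular(2)[OF pd, of p q] by (simp add: chord_def)
  then show ?thesis using that by blast
qed

lemma chord_disjoint_interior:
  assumes "chord p q" "K \<in> \<T>" shows "interior K \<inter> closed_segment p q = {}"
proof -
  obtain K0 a where K0: "K0 \<in> \<T>" "nondeg a p q" "K0 = convex hull {a,p,q}" using assms(1) by (auto simp: chord_def)
  have sub: "closed_segment p q \<subseteq> K0" using edge_iff[OF K0(2)] K0(3) by auto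
  show ?thesis
  proof (cases "K = K0")
    case True
    then show ?thesis using interior_tri[OF K0(2)] edge_iff[OF K0(2)] K0(3) by auto
  next
    case False
    then show ?thesis using interior_disjoint[OF assms(2) K0(1) False] sub by blast
  qed
qed

lemma interior_in_part:
  assumes g: "chord p q" and s: "separated_parts \<Omega> p q D1 D2 c1 c2" and K: "K \<in> \<T>"
  shows "interior K \<subseteq> D1 \<or> interior K \<subseteq> D2"
proof -
  have "interior K \<subseteq> \<Omega> - open_segment p q"
    using interior_in_domain[OF K] chord_disjoint_interior[OF g K] segment_open_subset_closed[of p q] by blast
  then show ?thesis using s tri_facts(8)[OF mesh_simplex[OF K]] by (intro connected_in_part) (auto simp: separated_parts_def)
qed

lemma sub_closure_part:
  assumes "K \<in> \<T>" "interior K \<subseteq> D" shows "K \<subseteq> closure D"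
  using closure_mono[OF assms(2)] tri_facts(7)[OF mesh_simplex[OF assms(1)]] by simp

text \<open>The part of K in \<Omega> is then just the interior of K, which is therefore open and
  closed in the connected set \<Omega> and fills it, leaving no room for a second triangle.\<close>

lemma all_boundary_edges_single:
  assumes K: "K \<in> \<T>" "nondeg a b d" "K = convex hull {a,b,d}"
    and e: "closed_segment a b \<subseteq> frontier \<Omega>" "closed_segment b d \<subseteq> frontier \<Omega>" "closed_segment d a \<subseteq> frontier \<Omega>"
  shows "\<T> = {K}"
proof -
  have n: "nondeg b d a" "nondeg d a b" using K(2) by (simp_all add: nondeg_cyc nondeg_cyc2)
  have Kp: "K = convex hull {b,d,a}" "K = convex hull {d,a,b}" using K(3) by (simp_all add: hull3_perm)
  have *: "y \<in> interior K" if y: "y \<in> K" "y \<in> \<Omega>" for y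
  proof -
    have "lam a b d y \<noteq> 0" "lam b d a y \<noteq> 0" "lam d a b y \<noteq> 0"
      using edge_iff[OF K(2), of y] edge_iff[OF n(1), of y] edge_iff[OF n(2), of y] y e domain_disjoint_frontier K(3) Kp by auto
    then show ?thesis using y(1) in_tri_iff[OF K(2), of y] interior_tri[OF K(2)] K(3) by auto
  qed
  have "\<Omega> \<subseteq> interior K \<or> \<Omega> \<subseteq> - K"
    by (rule connected_in_part) (use * domain_props interior_subset[of K] tri_facts(3)[OF mesh_simplex[OF K(1)]] in auto)
  moreover have "\<not> \<Omega> \<subseteq> - K" using interior_in_domain[OF K(1)] interior_tri_ne[OF mesh_simplex[OF K(1)]] interior_subset[of K] by blast
  ultimately have O: "\<Omega> \<subseteq> interior K" by blast
  have "K' = K" if K': "K' \<in> \<T>" for K'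
  proof (rule ccontr)
    assume "K' \<noteq> K"
    then have "interior K \<inter> K' = {}" using interior_disjoint[OF K(1) K'] by simp
    then show False using interior_in_domain[OF K'] O interior_tri_ne[OF mesh_simplex[OF K']] interior_subset[of K'] by blast
  qed
  then show ?thesis using K(1) by blast
qed

text \<open>A triangle has three facets. Against five faces on a side this excludes a mesh that
  consists of one triangle.\<close>

lemma single_few_faces:
  assumes "\<T> = {K}" shows "card (element_faces_in \<T> S) \<le> 3"
proof -
  have K: "K \<in> \<T>" using assms by simp
  obtain a b d where t: "nondeg a b d" "K = convex hull {a,b,d}" by (rule simplex2_nondeg[OF mesh_simplex[OF K]])
  have "element_faces_in \<T> S \<subseteq> (\<lambda>u. convex hull ({a,b,d} - {u})) ` {a,b,d}"
  proof
    fix F assume "F \<in> element_faces_in \<T> S"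
    then have "F facet_of convex hull {a,b,d}" using assms t(2) by (auto simp: element_faces_in_def)
    then show "F \<in> (\<lambda>u. convex hull ({a,b,d} - {u})) ` {a,b,d}"
      unfolding facet_of_convex_hull_affine_independent[OF nondeg_imp(4)[OF t(1)]] by blast
  qed
  then have "card (element_faces_in \<T> S) \<le> card {a,b,d}" by (rule surj_card_le[rotated]) simp
  also have "\<dots> \<le> 3" by (simp add: card_insert_if)
  finally show ?thesis .
qed

text \<open>The part cut off by [b, d] that contains the interior of K is exactly that interior. A
  second triangle at a would lie in the other part and put a into both boundary arcs; but these
  share only b and d.\<close>

lemma ear_isolated:
  assumes K: "K \<in> \<T>" "nondeg a b d" "K = convex hull {a,b,d}"
    and e: "closed_segment d a \<subseteq> frontier \<Omega>" "closed_segment a b \<subseteq> frontier \<Omega>" "\<not> closed_segment b d \<subseteq> frontier \<Omega>"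
    and K': "K' \<in> \<T>" "a \<in> K'"
  shows "K' = K"
proof (rule ccontr)
  assume ne: "K' \<noteq> K"
  have n: "nondeg b d a" "nondeg d a b" using K(2) by (simp_all add: nondeg_cyc nondeg_cyc2)
  have Kp: "K = convex hull {b,d,a}" "K = convex hull {d,a,b}" using K(3) by (simp_all add: hull3_perm)
  have g: "chord b d" unfolding chord_def using K e edge_cases[OF K] by (auto simp: subset_eq)
  have afr: "a \<in> frontier \<Omega>" using e(2) by auto
  obtain E1 E2 s1 s2 where E: "separated_parts \<Omega> b d E1 E2 s1 s2" by (rule chord_parts[OF g])
  obtain D1 D2 c1 c2 where s: "separated_parts \<Omega> b d D1 D2 c1 c2" and KD: "interior K \<subseteq> D1"
    using interior_in_part[OF g E K(1)] E separated_parts_swap[OF E] by blast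
  note S = s[unfolded separated_parts_def]
  have *: "y \<in> interior K" if y: "y \<in> K" "y \<in> D1" for y
  proof -
    have yO: "y \<in> \<Omega>" "y \<notin> open_segment b d" using S y(2) by auto
    have "y \<noteq> b" "y \<noteq> d" using e domain_disjoint_frontier yO by auto
    then have "y \<notin> closed_segment b d" using yO by (simp add: open_segment_def)
    then have "lam a b d y \<noteq> 0" "lam b d a y \<noteq> 0" "lam d a b y \<noteq> 0"
      using edge_iff[OF K(2), of y] edge_iff[OF n(1), of y] edge_iff[OF n(2), of y] y(1) yO e(1,2) domain_disjoint_frontier K(3) Kp by auto
    then show ?thesis using y(1) in_tri_iff[OF K(2), of y] interior_tri[OF K(2)] K(3) by auto
  qed
  have "D1 \<subseteq> interior K \<or> D1 \<subseteq> - K"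
    by (rule connected_in_part) (use * S interior_subset[of K] tri_facts(3)[OF mesh_simplex[OF K(1)]] in auto)
  moreover have "\<not> D1 \<subseteq> - K" using KD interior_tri_ne[OF mesh_simplex[OF K(1)]] interior_subset[of K] by blast
  ultimately have D1: "D1 \<subseteq> interior K" by blast
  have "interior K' \<inter> D1 = {}" using interior_disjoint[OF K(1) K'(1)] ne D1 interior_subset[of K'] by blast
  then have "\<not> interior K' \<subseteq> D1" using interior_tri_ne[OF mesh_simplex[OF K'(1)]] by blast
  then have "interior K' \<subseteq> D2" using interior_in_part[OF g s K'(1)] by blast
  then have "a \<in> closure D2" using sub_closure_part[OF K'(1)] K'(2) by blast
  moreover have "a \<in> closure D1" using sub_closure_part[OF K(1) KD] K(3) hull_inc[of a "{a,b,d}"] by auto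
  moreover have "a \<notin> closed_segment b d" using edge_iff[OF K(2), of a] lam_vertex(1)[OF K(2)] by simp
  moreover have "a \<notin> D1" "a \<notin> D2" using afr domain_disjoint_frontier S by auto
  ultimately have "a \<in> c1 \<inter> c2" using S by auto
  then have "a \<in> {b, d}" using S by simp
  then show False using nondeg_imp[OF K(2)] by auto
qed

text \<open>If \<open>K\<close> had two chords, the chord \<open>[p, q]\<close> would lie beyond only one of them, and the part beyond
  the other one would be strictly smaller than \<open>D\<close>.\<close>

lemma no_two_chords:
  assumes K: "K \<in> \<T>" "nondeg a b d" "K = convex hull {a,b,d}" and g: "chord a b" "chord a d"
    and pq: "chord p q" "separated_parts \<Omega> p q D D' c c'" "interior K \<subseteq> D"
    and min: "\<And>p q D1 D2 c1 c2. chord p q \<Longrightarrow> separated_parts \<Omega> p q D1 D2 c1 c2 \<Longrightarrow>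
       card {K\<in>\<T>. interior K \<subseteq> D} \<le> card {K\<in>\<T>. interior K \<subseteq> D1}"
  shows False
proof -
  note SD = pq(2)[unfolded separated_parts_def]
  have Kne: "interior K \<noteq> {}" by (rule interior_tri_ne[OF mesh_simplex[OF K(1)]])
  \<comment> \<open>An open set disjoint from Y misses the closure of Y, hence all of K and not only
    its interior.\<close>
  have apart: "X \<inter> K = {}" if "open X" "X \<inter> Y = {}" "interior K \<subseteq> Y" for X Y
    proof -
    have "X \<inter> closure Y = {}" using open_Int_closure_eq_empty[OF that(1), of Y] that(2) by simp
    then show ?thesis using sub_closure_part[OF K(1) that(3)] by blast
  qed
  have seg: "closed_segment a b \<subseteq> K" "closed_segment a d \<subseteq> K"
    unfolding K(3) segment_convex_hull by (auto intro!: hull_mono)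
  have oseg: "open_segment a b \<subseteq> K" "open_segment a d \<subseteq> K" using seg segment_open_subset_closed by blast+
  \<comment> \<open>By minimality, the part beyond [a, z] as seen from K contains D': otherwise all
    its triangles would lie in D, and K would be missing among them.\<close>
  have beyond: "\<exists>X Y s t. separated_parts \<Omega> a z X Y s t \<and> interior K \<subseteq> Y \<and> D' \<subseteq> X"
    if z: "chord a z" "open_segment a z \<subseteq> K" for z
  proof -
    obtain E1 E2 s1 s2 where E: "separated_parts \<Omega> a z E1 E2 s1 s2" by (rule chord_parts[OF z(1)])
    obtain X Y s t where XY: "separated_parts \<Omega> a z X Y s t" and KY: "interior K \<subseteq> Y"
      using interior_in_part[OF z(1) E K(1)] E separated_parts_swap[OF E] by blast
    note S = XY[unfolded separated_parts_def]
    have "D' \<inter> K = {}" by (rule apart[OF _ _ pq(3)]) (use SD in auto)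
    moreover have XYu: "X \<union> Y = \<Omega> - open_segment a z" using S by simp
    moreover have "D' \<subseteq> \<Omega>" using SD by auto
    ultimately have "D' \<subseteq> X \<union> Y" using z(2) unfolding XYu by blast
    moreover have "open X" "open Y" "X \<inter> Y = {}" "connected D'" using S SD by simp_all
    ultimately have "D' \<subseteq> X \<or> D' \<subseteq> Y" by (intro connected_in_part)
    moreover have "\<not> D' \<subseteq> Y"
    proof
      assume DY: "D' \<subseteq> Y"
      have "{K\<in>\<T>. interior K \<subseteq> X} \<subset> {K\<in>\<T>. interior K \<subseteq> D}"
      proof
        show "{K\<in>\<T>. interior K \<subseteq> X} \<subseteq> {K\<in>\<T>. interior K \<subseteq> D}"
        proof clarify
          fix K' x assume K': "K' \<in> \<T>" "interior K' \<subseteq> X" and x: "x \<in> interior K'"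
          have "\<not> interior K' \<subseteq> D'" using K'(2) x DY S by blast
          then show "x \<in> D" using interior_in_part[OF pq(1,2) K'(1)] x by blast
        qed
        have "\<not> interior K \<subseteq> X" using KY S Kne by blast
        then show "{K\<in>\<T>. interior K \<subseteq> X} \<noteq> {K\<in>\<T>. interior K \<subseteq> D}" using K(1) pq(3) by blast
      qed
      then have "card {K\<in>\<T>. interior K \<subseteq> X} < card {K\<in>\<T>. interior K \<subseteq> D}" using finite_mesh by (intro psubset_card_mono) auto
      then show False using min[OF z(1) XY] by simp
    qed
    ultimately show ?thesis using XY KY by blast
  qed
  obtain X Y s t where X: "separated_parts \<Omega> a b X Y s t" "interior K \<subseteq> Y" "D' \<subseteq> X" using beyond[OF g(1) oseg(1)] by blast
  obtain X' Y' s' t' where X': "separated_parts \<Omega> a d X' Y' s' t'" "interior K \<subseteq> Y'" "D' \<subseteq> X'" using beyond[OF g(2) oseg(2)] by blast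
  note S = X(1)[unfolded separated_parts_def] and S' = X'(1)[unfolded separated_parts_def]
  have "p \<in> closure D'" using SD by simp
  then have D'ne: "D' \<noteq> {}" by auto
  have "X' \<inter> K = {}" by (rule apart[OF _ _ X'(2)]) (use S' in auto)
  moreover have u: "X \<union> Y = \<Omega> - open_segment a b" using S by simp
  moreover have "X' \<subseteq> \<Omega>" using S' by auto
  ultimately have "X' \<subseteq> X \<union> Y" using oseg(1) unfolding u by blast
  moreover have "open X" "open Y" "X \<inter> Y = {}" "connected X'" using S S' by simp_all
  ultimately have 1: "X' \<subseteq> X \<or> X' \<subseteq> Y" by (intro connected_in_part)
  have "X \<inter> K = {}" by (rule apart[OF _ _ X(2)]) (use S in auto)
  moreover have u: "X' \<union> Y' = \<Omega> - open_segment a d" using S' by simp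
  moreover have "X \<subseteq> \<Omega>" using S by auto
  ultimately have "X \<subseteq> X' \<union> Y'" using oseg(2) unfolding u by blast
  moreover have "open X'" "open Y'" "X' \<inter> Y' = {}" "connected X" using S S' by simp_all
  ultimately have 2: "X \<subseteq> X' \<or> X \<subseteq> Y'" by (intro connected_in_part)
  have "X \<inter> Y = {}" "X' \<inter> Y' = {}" using S S' by simp_all
  \<comment> \<open>Each of the two connected parts lies on one side of the other chord, and both
    contain the nonempty D', so they coincide.\<close>
  then have "X = X'" using 1 2 D'ne X(3) X'(3) by blast
  \<comment> \<open>The midpoint of [a, b] borders X, but it is neither on [a, d] nor on the
    boundary of \<Omega>, so it cannot border X'.\<close>
  define m where "m = midpoint a b"
  have ab: "a \<noteq> b" using nondeg_imp[OF K(2)] by simp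
  have m: "m \<in> open_segment a b" using ab by (simp add: m_def)
  have mO: "m \<in> \<Omega>" using m g(1) by (auto simp: chord_def)
  have n: "nondeg d a b" "nondeg b d a" using K(2) by (simp_all add: nondeg_cyc nondeg_cyc2)
  have "m \<notin> closed_segment a d"
    using open_edge_iff[OF n(1), of m] m edge_iff[OF n(2), of m] by (auto simp: closed_segment_commute)
  moreover have "m \<in> closure X'" using S m segment_open_subset_closed[of a b] \<open>X = X'\<close> by auto
  ultimately have "m \<in> X' \<or> m \<in> s'" using S' by auto
  moreover have "m \<notin> X'" using \<open>X = X'\<close> S m by auto
  moreover have "m \<notin> s'" using S' mO domain_disjoint_frontier by blast
  ultimately show False by blast
qed

text \<open>Take a chord and a side of it with the fewest triangles, and there a triangle at a
  boundary point off the chord. All its vertices are on the boundary, so its edges are boundary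
  edges or chords. Three boundary edges are excluded by the five faces, two chords by minimality;
  what remains is an ear.\<close>

lemma ear_exists:
  assumes H: "\<And>K a. (K, a) \<in> BE \<Longrightarrow> a \<notin> \<Omega>" and five: "card (element_faces_in \<T> S) \<ge> 5"
    and inf: "infinite (frontier \<Omega>)"
  obtains K a b d where "K \<in> \<T>" "nondeg a b d" "K = convex hull {a,b,d}"
    "closed_segment d a \<subseteq> frontier \<Omega>" "closed_segment a b \<subseteq> frontier \<Omega>" "\<not> closed_segment b d \<subseteq> frontier \<Omega>"
    "\<And>K'. K' \<in> \<T> \<Longrightarrow> a \<in> K' \<Longrightarrow> K' = K"
proof -
  have no3: "\<not> (closed_segment a b \<subseteq> frontier \<Omega> \<and> closed_segment b d \<subseteq> frontier \<Omega> \<and> closed_segment d a \<subseteq> frontier \<Omega>)"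
    if "K \<in> \<T>" "nondeg a b d" "K = convex hull {a,b,d}" for K a b d
    using all_boundary_edges_single[OF that] single_few_faces[of K S] five by auto
  have bd: "\<exists>a b d. nondeg a b d \<and> K = convex hull {a,b,d} \<and> closed_segment b d \<subseteq> frontier \<Omega> \<and> a \<in> frontier \<Omega>"
    if y: "y \<in> frontier \<Omega>" "y \<notin> V" "K \<in> \<T>" "y \<in> K" for y K
  proof -
    obtain a b d where t: "nondeg a b d" "K = convex hull {a,b,d}" "y \<in> open_segment b d" "closed_segment b d \<subseteq> frontier \<Omega>"
      by (rule boundary_edge[OF y])
    have "a \<notin> \<Omega>" by (rule H[OF BE_I[OF y(3) t(1,2,4)]])
    moreover have "a \<in> closure \<Omega>" using triangle_in_closure[OF y(3)] t(2) hull_inc[of a "{a,b,d}"] by auto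
    ultimately have "a \<in> frontier \<Omega>" using closure_domain by blast
    then show ?thesis using t by blast
  qed
  have ch: "closed_segment x z \<subseteq> frontier \<Omega> \<or> chord x z" if "K \<in> \<T>" "nondeg w x z" "K = convex hull {w,x,z}" "x \<in> frontier \<Omega>" "z \<in> frontier \<Omega>" for K w x z
    using edge_cases[OF that(1-3)] that unfolding chord_def by blast
  define P where "P n \<longleftrightarrow> (\<exists>p q D1 D2 c1 c2. chord p q \<and> separated_parts \<Omega> p q D1 D2 c1 c2 \<and> card {K\<in>\<T>. interior K \<subseteq> D1} = n)" for n
  \<comment> \<open>Some chord exists, because any boundary triangle has all its vertices, but not
    all its edges, on the boundary.\<close>
  have ex: "\<exists>n. P n"
  proof -
    have "\<exists>y. y \<in> frontier \<Omega> - V" using Diff_infinite_finite[OF finV inf] by (metis finite.emptyI equals0I)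
    then obtain y where y: "y \<in> frontier \<Omega>" "y \<notin> V" by blast
    then obtain K where K: "K \<in> \<T>" "y \<in> K" using cover closure_domain by blast
    obtain a b d where t: "nondeg a b d" "K = convex hull {a,b,d}" "closed_segment b d \<subseteq> frontier \<Omega>" "a \<in> frontier \<Omega>"
      using bd[OF y K] by blast
    have fr: "b \<in> frontier \<Omega>" "d \<in> frontier \<Omega>" using t(3) by auto
    have n: "nondeg d a b" "nondeg b d a" using t(1) by (simp_all add: nondeg_cyc nondeg_cyc2)
    have Kp: "K = convex hull {d,a,b}" "K = convex hull {b,d,a}" using t(2) by (simp_all add: hull3_perm)
    have "chord a b \<or> chord d a"
      using ch[OF K(1) n(1) Kp(1) t(4) fr(1)] ch[OF K(1) n(2) Kp(2) fr(2) t(4)] no3[OF K(1) t(1,2)] t(3) by blast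
    then obtain p q where pq: "chord p q" by blast
    then show ?thesis unfolding P_def using chord_parts[OF pq] by metis
  qed
  define N where "N = (LEAST n. P n)"
  have "P N" unfolding N_def using ex by (rule LeastI_ex)
  then obtain p q D D' c c' where pq: "chord p q" "separated_parts \<Omega> p q D D' c c'" "card {K\<in>\<T>. interior K \<subseteq> D} = N"
    unfolding P_def by blast
  have min: "card {K\<in>\<T>. interior K \<subseteq> D} \<le> card {K\<in>\<T>. interior K \<subseteq> D1}"
    if "chord p q" "separated_parts \<Omega> p q D1 D2 c1 c2" for p q D1 D2 c1 c2
    unfolding pq(3) N_def by (rule Least_le) (unfold P_def, intro exI conjI, rule that(1), rule that(2), rule refl)
  note SD = pq(2)[unfolded separated_parts_def]
  have "infinite (c - (V \<union> {p, q}))" using SD finV by (intro Diff_infinite_finite) auto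
  then have "c - (V \<union> {p, q}) \<noteq> {}" by (rule infinite_imp_nonempty)
  then obtain y where y: "y \<in> c" "y \<notin> V" "y \<noteq> p" "y \<noteq> q" by auto
  have "c \<union> c' = frontier \<Omega>" using SD by simp
  then have yf: "y \<in> frontier \<Omega>" using y(1) by blast
  then obtain K where K: "K \<in> \<T>" "y \<in> K" using cover closure_domain by blast
  \<comment> \<open>Otherwise y would lie on both arcs, whose only common points are p and
    q.\<close>
  have "\<not> interior K \<subseteq> D'"
  proof
    assume "interior K \<subseteq> D'"
    then have "y \<in> closure D'" using sub_closure_part[OF K(1)] K(2) by blast
    moreover have "y \<notin> D'" using yf SD domain_disjoint_frontier by blast
    moreover have "y \<notin> closed_segment p q" using pq(1) yf domain_disjoint_frontier y unfolding chord_def open_segment_def by blast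
    ultimately have "y \<in> c \<inter> c'" using SD y by auto
    then show False using SD y by simp
  qed
  then have KD: "interior K \<subseteq> D" using interior_in_part[OF pq(1,2) K(1)] by blast
  obtain a b d where t: "nondeg a b d" "K = convex hull {a,b,d}" "closed_segment b d \<subseteq> frontier \<Omega>" "a \<in> frontier \<Omega>"
    using bd[OF yf y(2) K] by blast
  have fr: "b \<in> frontier \<Omega>" "d \<in> frontier \<Omega>" using t(3) by auto
  have n: "nondeg d a b" "nondeg b d a" "nondeg b a d" using t(1) nondeg_swap[of b a d] by (simp_all add: nondeg_cyc nondeg_cyc2)
  have Kp: "K = convex hull {d,a,b}" "K = convex hull {b,d,a}" "K = convex hull {b,a,d}" using t(2) by (simp_all add: hull3_perm insert_commute)
  consider "closed_segment a b \<subseteq> frontier \<Omega>" "\<not> closed_segment d a \<subseteq> frontier \<Omega>"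
    | "closed_segment d a \<subseteq> frontier \<Omega>" "\<not> closed_segment a b \<subseteq> frontier \<Omega>" | "chord a b" "chord a d"
    using ch[OF K(1) n(1) Kp(1) t(4) fr(1)] ch[OF K(1) n(3) Kp(3) t(4) fr(2)] no3[OF K(1) t(1,2)] t(3)
    by (auto simp: closed_segment_commute)
  then show ?thesis
  proof cases
    case 1
    show ?thesis by (rule that[OF K(1) n(2) Kp(2) 1(1) t(3) 1(2)]) (rule ear_isolated[OF K(1) n(2) Kp(2) 1(1) t(3) 1(2)])
  next
    case 2
    show ?thesis by (rule that[OF K(1) n(1) Kp(1) t(3) 2(1) 2(2)]) (rule ear_isolated[OF K(1) n(1) Kp(1) t(3) 2(1) 2(2)])
  next
    case 3
    have False by (rule no_two_chords[OF K(1) t(1,2) 3 pq(1,2) KD]) (rule min)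
    then show ?thesis ..
  qed
qed

end

section \<open>Fine and coarse meshes\<close>

text \<open>By homogeneity: the point at the larger fraction of its segment is blown up to the end m
  or s, which has a positive distance from the other segment.\<close>

lemma ray_separation:
  fixes p m s :: "'a::euclidean_space"
  assumes d: "closed_segment p m \<inter> closed_segment p s \<subseteq> {p}" and ne: "p \<noteq> m" "p \<noteq> s"
  obtains c where "c > 0" "\<And>y z. y \<in> closed_segment p m \<Longrightarrow> z \<in> closed_segment p s \<Longrightarrow> c * dist y p \<le> dist y z"
proof -
  have "m \<notin> closed_segment p s" "s \<notin> closed_segment p m" using d ne by auto
  then obtain d1 d2 where d1: "d1 > 0" "\<And>z. z \<in> closed_segment p s \<Longrightarrow> d1 \<le> dist m z"
      and d2: "d2 > 0" "\<And>z. z \<in> closed_segment p m \<Longrightarrow> d2 \<le> dist s z"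
    using separate_point_closed[OF closed_segment] by metis
  define c where "c = min d1 d2 / dist p m"
  have pm: "dist p m > 0" using ne by simp
  have "c * dist y p \<le> dist y z" if y: "y \<in> closed_segment p m" and z: "z \<in> closed_segment p s" for y z
  proof -
    obtain t where t: "y = p + t *\<^sub>R (m - p)" "0 \<le> t" "t \<le> 1" using y by (auto simp: in_segment algebra_simps)
    obtain u where u: "z = p + u *\<^sub>R (s - p)" "0 \<le> u" "u \<le> 1" using z by (auto simp: in_segment algebra_simps)
    have "dist y p = t * dist p m" using t by (simp add: dist_norm norm_minus_commute)
    then have cy: "c * dist y p = t * min d1 d2" using pm by (simp add: c_def)
    consider "t = 0" | "u \<le> t" "t > 0" | "t < u" using t(2) by fastforce
    then show ?thesis
    proof cases
      case 1
      then show ?thesis using t(1) by simp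
    next
      case 2
      define z' where "z' = p + (u / t) *\<^sub>R (s - p)"
      have "z' \<in> closed_segment p s" unfolding in_segment z'_def using 2 u(2)
        by (intro exI[of _ "u / t"]) (simp add: algebra_simps)
      then have "t * d1 \<le> t * dist m z'" using d1(2) t(2) by (intro mult_left_mono)
      also have "t * dist m z' = norm (t *\<^sub>R (m - z'))" using t(2) by (simp add: dist_norm)
      also have "t *\<^sub>R (m - z') = y - z" using 2 by (simp add: z'_def t(1) u(1) algebra_simps)
      finally have "t * d1 \<le> dist y z" by (simp add: dist_norm)
      moreover have "t * min d1 d2 \<le> t * d1" using t(2) by (intro mult_left_mono) auto
      ultimately show ?thesis using cy by linarith
    next
      case 3
      define y' where "y' = p + (t / u) *\<^sub>R (m - p)"
      have "y' \<in> closed_segment p m" unfolding in_segment y'_def using 3 t(2)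
        by (intro exI[of _ "t / u"]) (simp add: algebra_simps)
      then have "u * d2 \<le> u * dist s y'" using d2(2) u(2) by (intro mult_left_mono)
      also have "u * dist s y' = norm (u *\<^sub>R (s - y'))" using u(2) by (simp add: dist_norm)
      also have "u *\<^sub>R (s - y') = z - y" using 3 t(2) by (simp add: y'_def t(1) u(1) algebra_simps)
      finally have "u * d2 \<le> dist y z" by (simp add: dist_norm norm_minus_commute)
      moreover have "t * min d1 d2 \<le> u * d2" using 3 t(2) d1(1) d2(1) by (intro mult_mono) auto
      ultimately show ?thesis using cy by linarith
    qed
  qed
  moreover have "c > 0" using d1 d2 pm by (simp add: c_def)
  ultimately show ?thesis using that by blast
qed

lemma half_segment_separation:
  fixes p m r s :: "'a::euclidean_space"
  assumes d: "closed_segment p m \<inter> closed_segment r s \<subseteq> {p} \<inter> {r, s}" and ne: "p \<noteq> m" "r \<noteq> s"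
  obtains c where "c > 0" "\<And>y z. y \<in> closed_segment p m \<Longrightarrow> z \<in> closed_segment r s \<Longrightarrow> c * dist y p \<le> dist y z"
proof -
  consider "p = r" | "p = s" | "closed_segment p m \<inter> closed_segment r s = {}" using d by blast
  then show ?thesis
  proof cases
    case 1
    show ?thesis by (rule ray_separation[of p m s]) (use d ne 1 that in auto)
  next
    case 2
    show ?thesis by (rule ray_separation[of p m r]) (use d ne 2 that in \<open>auto simp: closed_segment_commute\<close>)
  next
    case 3
    obtain e where e: "e > 0" "\<And>y z. y \<in> closed_segment p m \<Longrightarrow> z \<in> closed_segment r s \<Longrightarrow> e \<le> dist y z"
      using separate_compact_closed[OF compact_segment closed_segment 3] by metis
    have pm: "dist p m > 0" using ne by simp
    have "e / dist p m * dist y p \<le> dist y z" if yz: "y \<in> closed_segment p m" "z \<in> closed_segment r s" for y z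
    proof -
      have "dist y p \<le> dist p m" using dist_in_closed_segment(1)[OF yz(1)] by (simp add: dist_commute)
      then have "e / dist p m * dist y p \<le> e / dist p m * dist p m" using e(1) pm by (intro mult_left_mono) auto
      also have "\<dots> = e" using pm by simp
      finally show ?thesis using e(2)[OF yz] by linarith
    qed
    then show ?thesis using that[of "e / dist p m"] e pm by simp
  qed
qed

text \<open>Cut at the midpoint, each half can touch the other segment at one end only, and the
  estimate for half segments applies.\<close>

lemma segment_separation:
  fixes p q r s :: "'a::euclidean_space"
  assumes d: "closed_segment p q \<inter> closed_segment r s \<subseteq> {p, q} \<inter> {r, s}" and ne: "p \<noteq> q" "r \<noteq> s"
  obtains c where "c > 0" "\<And>y z. y \<in> closed_segment p q \<Longrightarrow> z \<in> closed_segment r s \<Longrightarrow> c * min (dist y p) (dist y q) \<le> dist y z"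
proof -
  define m where "m = midpoint p q"
  have m: "m \<in> closed_segment p q" "p \<noteq> m" "q \<noteq> m" using ne by (auto simp: m_def midpoint_eq_endpoint dest: sym)
  have U: "closed_segment p q = closed_segment p m \<union> closed_segment q m"
    using Un_closed_segment[OF m(1)] by (simp add: closed_segment_commute)
  have "q \<notin> closed_segment p m" "p \<notin> closed_segment q m"
    using dist_in_closed_segment(1)[of q p m] dist_in_closed_segment(1)[of p q m] ne by (auto simp: m_def dist_midpoint dist_commute)
  then have h: "closed_segment p m \<inter> closed_segment r s \<subseteq> {p} \<inter> {r, s}" "closed_segment q m \<inter> closed_segment r s \<subseteq> {q} \<inter> {r, s}"
    using d U by auto
  obtain c1 where c1: "c1 > 0" "\<And>y z. y \<in> closed_segment p m \<Longrightarrow> z \<in> closed_segment r s \<Longrightarrow> c1 * dist y p \<le> dist y z"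
    using half_segment_separation[OF h(1) m(2) ne(2)] by metis
  obtain c2 where c2: "c2 > 0" "\<And>y z. y \<in> closed_segment q m \<Longrightarrow> z \<in> closed_segment r s \<Longrightarrow> c2 * dist y q \<le> dist y z"
    using half_segment_separation[OF h(2) m(3) ne(2)] by metis
  have "min c1 c2 * min (dist y p) (dist y q) \<le> dist y z" if y: "y \<in> closed_segment p q" and z: "z \<in> closed_segment r s" for y z
  proof -
    have "min c1 c2 * min (dist y p) (dist y q) \<le> c1 * dist y p" "min c1 c2 * min (dist y p) (dist y q) \<le> c2 * dist y q"
      using c1(1) c2(1) by (intro mult_mono; simp)+
    moreover have "c1 * dist y p \<le> dist y z \<or> c2 * dist y q \<le> dist y z" using y U c1(2) c2(2) z by blast
    ultimately show ?thesis by linarith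
  qed
  then show ?thesis using that[of "min c1 c2"] c1 c2 by simp
qed

text \<open>A quantitative form of simplicity: a point can be close to another side only if it is
  proportionally close to an end of its own side.\<close>

definition sides_separated :: "point list \<Rightarrow> real \<Rightarrow> bool" where
  "sides_separated vs c \<longleftrightarrow> (\<forall>i<length vs. \<forall>j<length vs. i \<noteq> j \<longrightarrow> (\<forall>y\<in>side vs i. \<forall>z\<in>side vs j.
     c * min (dist y (vs ! i)) (dist y (vs ! (Suc i mod length vs))) \<le> dist y z))"

lemma polygon_sides_separated:
  assumes sp: "simple_polygon vs" obtains c where "0 < c" "c \<le> 1" "sides_separated vs c"
proof -
  let ?e = "\<lambda>i. vs ! (Suc i mod length vs)"
  define Q where "Q ij c \<longleftrightarrow> (\<forall>y\<in>side vs (fst ij). \<forall>z\<in>side vs (snd ij). c * min (dist y (vs ! fst ij)) (dist y (?e (fst ij))) \<le> dist y z)"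
    for ij and c :: real
  define P where "P = {ij \<in> {..<length vs} \<times> {..<length vs}. fst ij \<noteq> snd ij}"
  have "finite P" by (simp add: P_def)
  have "\<forall>ij\<in>P. \<exists>c>0. Q ij c"
  proof
    fix ij assume ij: "ij \<in> P"
    define i j where "i = fst ij" and "j = snd ij"
    have b: "i < length vs" "j < length vs" "i \<noteq> j" using ij by (auto simp: P_def i_def j_def)
    have "closed_segment (vs ! i) (?e i) \<inter> closed_segment (vs ! j) (?e j) \<subseteq> {vs ! i, ?e i} \<inter> {vs ! j, ?e j}"
      using sp b unfolding simple_polygon_def side_def side_ends_def by blast
    from segment_separation[OF this polygon_sides_distinct_ends[OF sp b(1)] polygon_sides_distinct_ends[OF sp b(2)]]
    show "\<exists>c>0. Q ij c" unfolding Q_def side_def i_def j_def by metis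
  qed
  then obtain f where f: "\<And>ij. ij \<in> P \<Longrightarrow> f ij > 0" "\<And>ij. ij \<in> P \<Longrightarrow> Q ij (f ij)" by metis
  \<comment> \<open>The inserted 1 gives c \<le> 1 and makes the set nonempty.\<close>
  define c where "c = Min (insert 1 (f ` P))"
  have c: "0 < c" "c \<le> 1" using f(1) \<open>finite P\<close> by (auto simp: c_def)
  have "Q ij c" if ij: "ij \<in> P" for ij
    unfolding Q_def
  proof (intro ballI)
    fix y z assume yz: "y \<in> side vs (fst ij)" "z \<in> side vs (snd ij)"
    have "c \<le> f ij" using ij \<open>finite P\<close> by (auto simp: c_def)
    then have "c * min (dist y (vs ! fst ij)) (dist y (?e (fst ij))) \<le> f ij * min (dist y (vs ! fst ij)) (dist y (?e (fst ij)))"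
      by (rule mult_right_mono) simp
    also have "\<dots> \<le> dist y z" using f(2)[OF ij] yz by (simp add: Q_def)
    finally show "c * min (dist y (vs ! fst ij)) (dist y (?e (fst ij))) \<le> dist y z" .
  qed
  then have "sides_separated vs c" by (auto simp: sides_separated_def P_def Q_def)
  then show ?thesis using that c by blast
qed

lemma lam_midpoint: "lam a b c (midpoint x y) = (lam a b c x + lam a b c y) / 2"
  by (simp add: lam_eq midpoint_def inner_diff_right inner_add_right field_simps)

text \<open>Otherwise the segment from x to a would run in the boundary, while its midpoint is
  interior to K.\<close>

lemma (in mesh) opposite_vertex_not_on_side:
  assumes K: "K \<in> \<T>" "nondeg a b d" "K = convex hull {a,b,d}" and x: "x \<in> open_segment b d"
    and i: "i < length vs" "x \<in> side vs i"
  shows "a \<notin> side vs i"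
proof
  assume a: "a \<in> side vs i"
  have n: "nondeg b d a" "nondeg d a b" using K(2) by (simp_all add: nondeg_cyc nondeg_cyc2)
  have "midpoint x a \<in> closed_segment x a" by simp
  also have "\<dots> \<subseteq> side vs i" using i a unfolding side_def by (intro closed_segment_subset) auto
  finally have "midpoint x a \<in> frontier \<Omega>" using sides(3)[OF i(1)] by blast
  moreover have "midpoint x a \<in> interior K"
    unfolding K(3) interior_tri[OF K(2)]
    using x open_edge_iff[OF K(2)] lam_vertex[OF K(2)] lam_vertex[OF n(1)] lam_vertex[OF n(2)] by (simp add: lam_midpoint)
  ultimately show False using interior_in_domain[OF K(1)] domain_disjoint_frontier by blast
qed

lemma open_segment_not_end: "x \<in> open_segment a b \<Longrightarrow> y \<in> open_segment a b \<Longrightarrow> a \<notin> closed_segment x y"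
  for a b :: "'a::real_normed_vector"
proof
  assume xy: "x \<in> open_segment a b" "y \<in> open_segment a b" and a: "a \<in> closed_segment x y"
  have "convex (open_segment a b)" by simp
  then have "closed_segment x y \<subseteq> open_segment a b" using xy by (simp add: closed_segment_subset)
  then show False using a by (auto simp: open_segment_def)
qed

text \<open>A second edge point near x is on the boundary but too close to x for the other sides, so
  it is on side i. The affine function then vanishes at two points of the line of the side, hence on
  the line.\<close>

lemma (in mesh) lam_zero_on_side:
  assumes K: "K \<in> \<T>" "nondeg a b d" "K = convex hull {a,b,d}" and e: "closed_segment b d \<subseteq> frontier \<Omega>"
    and x: "x \<in> open_segment b d" and i: "i < length vs" "x \<in> side vs i"
    and r: "r > 0" "\<And>j z. j < length vs \<Longrightarrow> j \<noteq> i \<Longrightarrow> z \<in> side vs j \<Longrightarrow> r \<le> dist x z"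
    and u: "u \<in> side vs i"
  shows "lam a b d u = 0"
proof -
  let ?p = "vs ! i" and ?q = "vs ! (Suc i mod length vs)"
  \<comment> \<open>Makes the distance from x to x' smaller than r.\<close>
  define s where "s = min 1 (r / (2 * dist x d))"
  have xd: "x \<noteq> d" using x by (simp add: open_segment_def)
  have s: "0 < s" "s \<le> 1" "s * dist x d < r"
  proof -
    show "0 < s" "s \<le> 1" using r(1) xd by (simp_all add: s_def)
    have "s * dist x d \<le> r / (2 * dist x d) * dist x d" by (intro mult_right_mono) (simp_all add: s_def)
    also have "\<dots> < r" using r(1) xd by simp
    finally show "s * dist x d < r" .
  qed
  define x' where "x' = x + s *\<^sub>R (d - x)"
  have "x' \<in> closed_segment x d" unfolding in_segment x'_def using s by (intro exI[of _ s]) (simp add: algebra_simps)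
  also have "\<dots> \<subseteq> closed_segment b d" using x segment_open_subset_closed[of b d] by (intro closed_segment_subset) auto
  finally have x': "x' \<in> closed_segment b d" .
  have dx: "dist x x' < r" using s by (simp add: x'_def dist_norm norm_minus_commute)
  have ne: "x' \<noteq> x" using s(1) xd by (simp add: x'_def)
  obtain j where j: "j < length vs" "x' \<in> side vs j" using x' e domain_props(4) by blast
  have "j = i" using r(2)[OF j(1) _ j(2)] dx by linarith
  then have x'i: "x' \<in> side vs i" using j by simp
  have l0: "lam a b d x = 0" "lam a b d x' = 0" using open_edge_iff[OF K(2)] x edge_iff[OF K(2)] x' by auto
  have par: "\<exists>t. y = ?p + t *\<^sub>R (?q - ?p)" if "y \<in> side vs i" for y
    using that unfolding side_def in_segment by (auto simp: algebra_simps)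
  obtain t1 t2 t where t: "x = ?p + t1 *\<^sub>R (?q - ?p)" "x' = ?p + t2 *\<^sub>R (?q - ?p)" "u = ?p + t *\<^sub>R (?q - ?p)"
    using par[OF i(2)] par[OF x'i] par[OF u] by blast
  define \<beta> where "\<beta> = glam a b d \<bullet> (?q - ?p)"
  have l: "lam a b d (?p + w *\<^sub>R (?q - ?p)) = lam a b d ?p + w * \<beta>" for w
    using lam_diff[of a b d "?p + w *\<^sub>R (?q - ?p)" ?p] by (simp add: \<beta>_def)
  have "t1 * \<beta> = t2 * \<beta>" using l0 unfolding t(1,2) l by linarith
  moreover have "t1 \<noteq> t2" using ne t by auto
  ultimately have "\<beta> = 0" by simp
  then show ?thesis using l0(1) unfolding t(1,3) l by simp
qed

section \<open>Area counting and links between boundary edges\<close>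

context sr_mesh begin

abbreviation h :: real where "h \<equiv> mesh_size \<T>"

lemma mesh_size_bounds: "K \<in> \<T> \<Longrightarrow> diameter K \<le> h" "h > 0"
proof -
  show *: "diameter K \<le> h" if "K \<in> \<T>" for K unfolding mesh_size_def using finite_mesh that by (intro Max_ge) auto
  show "h > 0" using mesh_nonempty * diam_pos by (meson less_le_trans)
qed

text \<open>The triangles overlap in null sets, and shape regularity and quasi-uniformity give each
  an area of at least pi h^2 / (4 c^2 q^2); comparison with the area of the disc bounds their
  number.\<close>

lemma elements_in_ball:
  assumes q: "quasi_uniform q \<T>" and X: "X \<subseteq> \<T>" "\<And>K. K \<in> X \<Longrightarrow> K \<subseteq> cball z r" and r: "r \<ge> 0"
  shows "real (card X) * h\<^sup>2 \<le> 4 * c\<^sup>2 * q\<^sup>2 * r\<^sup>2"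
proof -
  have fX: "finite X" using X(1) finite_mesh by (rule finite_subset)
  have one: "h\<^sup>2 * (pi / (4 * c\<^sup>2)) \<le> q\<^sup>2 * measure lebesgue K" if "K \<in> X" for K
  proof -
    have K: "K \<in> \<T>" using that X(1) by blast
    have "h \<le> q * diameter K" using q K by (simp add: quasi_uniform_def)
    then have "h\<^sup>2 \<le> (q * diameter K)\<^sup>2" using mesh_size_bounds(2) by (intro power_mono) auto
    then have "h\<^sup>2 * (pi / (4 * c\<^sup>2)) \<le> (q * diameter K)\<^sup>2 * (pi / (4 * c\<^sup>2))" by (rule mult_right_mono) simp
    also have "\<dots> = q\<^sup>2 * (pi / (4 * c\<^sup>2) * (diameter K)\<^sup>2)" by (simp add: power_mult_distrib mult_ac)
    also have "\<dots> \<le> q\<^sup>2 * measure lebesgue K" using area_lower[OF K] by (intro mult_left_mono) auto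
    finally show ?thesis .
  qed
  have lm: "K \<in> lmeasurable" if "K \<in> X" for K using that X(1) by (intro tri_lmeasurable mesh_simplex) auto
  have "real (card X) * (h\<^sup>2 * (pi / (4 * c\<^sup>2))) = (\<Sum>K\<in>X. h\<^sup>2 * (pi / (4 * c\<^sup>2)))" by simp
  also have "\<dots> \<le> (\<Sum>K\<in>X. q\<^sup>2 * measure lebesgue K)" using one by (rule sum_mono)
  also have "\<dots> = q\<^sup>2 * (\<Sum>K\<in>X. measure lebesgue K)" by (simp add: sum_distrib_left)
  also have "(\<Sum>K\<in>X. measure lebesgue K) = measure lebesgue (\<Union>X)"
  proof (rule measure_negligible_finite_Union[symmetric])
    show "pairwise (\<lambda>S T. negligible (S \<inter> T)) X"
    proof (rule pairwiseI)
      fix K K' assume K: "K \<in> X" "K' \<in> X" "K \<noteq> K'"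
      then have T: "K \<in> \<T>" "K' \<in> \<T>" using X(1) by auto
      have "K \<inter> K' \<subseteq> frontier K"
        using interior_disjoint[OF T K(3)] tri_facts(3)[OF mesh_simplex[OF T(1)]] by (auto simp: frontier_def)
      then show "negligible (K \<inter> K')"
        using negligible_convex_frontier[OF tri_facts(1)[OF mesh_simplex[OF T(1)]]] negligible_subset by blast
    qed
  qed (use fX lm in auto)
  also have "measure lebesgue (\<Union>X) \<le> measure lebesgue (cball z r)"
    using X(2) fX lm by (intro measure_mono_fmeasurable) auto
  also have "measure lebesgue (cball z r) = pi * r\<^sup>2" using r by (simp add: content_cball unit_ball_vol_2)
  finally have "real (card X) * (h\<^sup>2 * (pi / (4 * c\<^sup>2))) \<le> q\<^sup>2 * (pi * r\<^sup>2)" by (simp add: mult_left_mono)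
  then have "(real (card X) * h\<^sup>2) * (pi / (4 * c\<^sup>2)) \<le> q\<^sup>2 * (pi * r\<^sup>2)" by (simp only: mult.assoc)
  then have "real (card X) * h\<^sup>2 \<le> q\<^sup>2 * (pi * r\<^sup>2) / (pi / (4 * c\<^sup>2))"
    using c_pos by (subst pos_le_divide_eq) auto
  also have "\<dots> = 4 * c\<^sup>2 * q\<^sup>2 * r\<^sup>2"
  proof -
    have "q2 * (p * r2) / (p / (4 * c2)) = 4 * c2 * q2 * r2" if "p \<noteq> 0" for p q2 r2 c2 :: real using that by (simp add: field_simps)
    from this[OF pi_neq_zero] show ?thesis .
  qed
  finally show ?thesis .
qed

lemma elements_near:
  assumes q: "quasi_uniform q \<T>" and X: "X \<subseteq> \<T>" "\<And>K. K \<in> X \<Longrightarrow> K \<subseteq> cball z (R * h)" and R: "R \<ge> 0"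
  shows "real (card X) \<le> 4 * c\<^sup>2 * q\<^sup>2 * R\<^sup>2"
proof -
  have "real (card X) * h\<^sup>2 \<le> 4 * c\<^sup>2 * q\<^sup>2 * (R * h)\<^sup>2"
    by (rule elements_in_ball[OF q X]) (use R mesh_size_bounds(2) in simp_all)
  then have "real (card X) * h\<^sup>2 \<le> 4 * c\<^sup>2 * q\<^sup>2 * R\<^sup>2 * h\<^sup>2" unfolding power_mult_distrib mult.assoc .
  then show ?thesis by (rule mult_right_le_imp_le) (use mesh_size_bounds(2) in simp)
qed

lemma element_near: "K \<in> \<T> \<Longrightarrow> x \<in> K \<Longrightarrow> dist p x \<le> r \<Longrightarrow> K \<subseteq> cball p (r + h)"
proof
  fix y assume K: "K \<in> \<T>" "x \<in> K" and r: "dist p x \<le> r" and y: "y \<in> K"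
  have "dist x y \<le> h" using vert_dist[OF K y] mesh_size_bounds(1)[OF K(1)] by (simp add: dist_norm)
  then show "y \<in> cball p (r + h)" using r dist_triangle[of p y x] by simp
qed

text \<open>Near a corner \<open>p\<close> the vertex opposite to a boundary edge may lie on the boundary. The neighbouring
  good edge lies on the same side at distance between \<open>h / c0\<close> and \<open>2 h / c0\<close> from \<open>p\<close>, where the other
  sides are too far away to be reached by its triangle; \<open>U\<close> is a thin strip along that side.\<close>

lemma link_fine:
  assumes c0: "0 < c0" "c0 \<le> 1" "sides_separated vs c0"
    and len: "\<And>i. i < length vs \<Longrightarrow> 4 * h \<le> c0 * dist (vs ! i) (vs ! (Suc i mod length vs))"
    and e: "e \<in> BE - GE"
  obtains p e' U where "p \<in> set vs" "fst e \<subseteq> cball p ((1 / c0 + 1) * h)" "e' \<in> GE" "open U" "connected U" "U \<subseteq> \<Omega>"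
    "fst e \<inter> U \<noteq> {}" "fst e' \<inter> U \<noteq> {}" "\<And>K. K \<in> \<T> \<Longrightarrow> K \<inter> U \<noteq> {} \<Longrightarrow> K \<subseteq> cball p ((2 / c0 + 2) * h)"
proof -
  obtain K a where Ka: "e = (K, a)" by fastforce
  have KB: "(K, a) \<in> BE" using e Ka by simp
  obtain b d where K: "K \<in> \<T>" "nondeg a b d" "K = convex hull {a,b,d}" and bd: "closed_segment b d \<subseteq> frontier \<Omega>"
    using BE_tri[OF KB] by metis
  have sp: "simple_polygon vs" using pd by (simp add: polygonal_domain_def)
  have aK: "a \<in> K" unfolding K(3) by (rule hull_inc) simp
  have "a \<notin> \<Omega>" using e Ka by (auto simp: GE_def)
  then have af: "a \<in> frontier \<Omega>" using aK triangle_in_closure[OF K(1)] closure_domain by blast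
  have bne: "b \<noteq> d" by (rule nondeg_imp(2)[OF K(2)])
  \<comment> \<open>x is kept off the corners, so that it is a relative interior point of its
    side.\<close>
  then have "infinite (open_segment b d - set vs)" by (intro Diff_infinite_finite) auto
  then have "open_segment b d - set vs \<noteq> {}" by (rule infinite_imp_nonempty)
  then obtain x where x: "x \<in> open_segment b d" "x \<notin> set vs" by blast
  have xf: "x \<in> frontier \<Omega>" using x(1) bd segment_open_subset_closed[of b d] by blast
  obtain i where i: "i < length vs" "x \<in> side vs i" using xf domain_props(4) by blast
  have xK: "x \<in> K" using x(1) open_edge_iff[OF K(2), of x] in_tri_iff[OF K(2), of x] K(3) by simp
  let ?p = "vs ! i" and ?q = "vs ! (Suc i mod length vs)"
  have pq: "?p \<noteq> ?q" "?p \<in> set vs" "?q \<in> set vs" using sides(1)[OF i(1)] i(1) by (auto intro!: nth_mem mod_less_divisor)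
  \<comment> \<open>An opposite vertex on the boundary lies on a different side and within distance
    h; by the separation of sides, y is then within h / c0 of an end of its own side.\<close>
  have far: "c0 * min (dist y ?p) (dist y ?q) \<le> h"
    if y: "K' \<in> \<T>" "nondeg a' b' d'" "K' = convex hull {a',b',d'}" "y \<in> open_segment b' d'" "y \<in> side vs i" "a' \<in> frontier \<Omega>" for y K' a' b' d'
  proof -
    have ni: "a' \<notin> side vs i" by (rule opposite_vertex_not_on_side[OF y(1-4) i(1) y(5)])
    obtain j where j: "j < length vs" "a' \<in> side vs j" using y(6) domain_props(4) by blast
    have "c0 * min (dist y ?p) (dist y ?q) \<le> dist y a'"
      using c0(3) i(1) j y(5) ni unfolding sides_separated_def by metis
    also have "\<dots> \<le> diameter K'"
    proof -
      have "y \<in> K'" "a' \<in> K'" using y(4) open_edge_iff[OF y(2), of y] in_tri_iff[OF y(2), of y] hull_inc[of a' "{a',b',d'}"] y(3) by simp_all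
      then show ?thesis using vert_dist[OF y(1)] by (simp add: dist_norm)
    qed
    also have "\<dots> \<le> h" by (rule mesh_size_bounds(1)[OF y(1)])
    finally show ?thesis .
  qed
  have "c0 * min (dist x ?p) (dist x ?q) \<le> h" by (rule far[OF K x(1) i(2) af])
  then have "c0 * dist x ?p \<le> h \<or> c0 * dist x ?q \<le> h" by (simp add: min_def split: if_splits)
  \<comment> \<open>p is the corner near the edge e, q the other end of the side.\<close>
  then obtain p q where p: "c0 * dist x p \<le> h" "p = ?p \<and> q = ?q \<or> p = ?q \<and> q = ?p" by blast
  have sd: "side vs i = closed_segment p q" using p(2) by (auto simp: side_def closed_segment_commute)
  have pne: "p \<noteq> q" "p \<in> set vs" "q \<in> set vs" using p(2) pq by auto
  define l where "l = dist p q"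
  have l: "4 * h \<le> c0 * l" "l > 0" using len[OF i(1)] p(2) pne(1) by (auto simp: l_def dist_commute)
  \<comment> \<open>The parameter at distance h / c0 from p. The side is so long that parameters up
    to 2 \<tau> stay more than h / c0 away from q as well.\<close>
  define \<tau> where "\<tau> = h / (c0 * l)"
  have cl0: "c0 * l > 0" using c0 l by simp
  have \<tau>: "\<tau> > 0" "4 * \<tau> \<le> 1" "\<tau> * l = h / c0" using mesh_size_bounds(2) cl0 l c0 by (simp_all add: \<tau>_def field_simps)
  have "infinite (linepath p q ` {\<tau><..<2 * \<tau>})"
  proof -
    have "inj_on (linepath p q) {\<tau><..<2 * \<tau>}"
      by (rule inj_on_subset[OF inj_on_linepath[OF pne(1)]]) (use \<tau> in auto)
    then show ?thesis using \<tau>(1) by (simp add: finite_image_iff)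
  qed
  then have "linepath p q ` {\<tau><..<2 * \<tau>} - V \<noteq> {}" using finV by (intro infinite_imp_nonempty Diff_infinite_finite) auto
  then obtain y0 where "y0 \<in> linepath p q ` {\<tau><..<2 * \<tau>}" "y0 \<notin> V" by blast
  then obtain t where t: "\<tau> < t" "t < 2 * \<tau>" "linepath p q t \<notin> V" by force
  define y where "y = linepath p q t"
  have y0: "y = p + t *\<^sub>R (q - p)" by (simp add: y_def linepath_def algebra_simps)
  have "dist y p = t * l" using t(1) \<tau>(1) by (simp add: y0 dist_norm l_def norm_minus_commute)
  moreover have "dist y q = (1 - t) * l"
  proof -
    have "y - q = (1 - t) *\<^sub>R (p - q)" by (simp add: y0 algebra_simps)
    then show ?thesis using t(2) \<tau>(2) by (simp add: dist_norm l_def)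
  qed
  ultimately have yd: "h / c0 < dist y p" "dist y p \<le> 2 * h / c0" "h / c0 < dist y q"
  proof -
    assume d: "dist y p = t * l" "dist y q = (1 - t) * l"
    have "\<tau> * l < t * l" "t * l \<le> 2 * \<tau> * l" "\<tau> * l < (1 - t) * l" using t l(2) \<tau>(1,2) by simp_all
    then show "h / c0 < dist y p" "dist y p \<le> 2 * h / c0" "h / c0 < dist y q" using d \<tau>(3) by simp_all
  qed
  have yo: "y \<in> open_segment p q" unfolding in_segment using pne(1) t \<tau>
    by (intro conjI exI[of _ t]) (auto simp: y0 algebra_simps)
  have ys: "y \<in> side vs i" using yo segment_open_subset_closed[of p q] sd by blast
  have yf: "y \<in> frontier \<Omega>" using ys sides(3)[OF i(1)] by blast
  have yV: "y \<notin> V" using t(3) by (simp add: y_def)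
  obtain K' where K': "K' \<in> \<T>" "y \<in> K'" using yf in_some_triangle closure_domain by blast
  obtain a' b' d' where t': "nondeg a' b' d'" "K' = convex hull {a',b',d'}" "y \<in> open_segment b' d'" "closed_segment b' d' \<subseteq> frontier \<Omega>"
    by (rule boundary_edge[OF yf yV K'])
  \<comment> \<open>At y, more than h / c0 away from both ends, \<open>far\<close> excludes an
    opposite vertex on the boundary.\<close>
  have "a' \<notin> frontier \<Omega>"
  proof
    assume "a' \<in> frontier \<Omega>"
    then have "c0 * min (dist y ?p) (dist y ?q) \<le> h" by (rule far[OF K'(1) t'(1-3) ys])
    then have "c0 * min (dist y p) (dist y q) \<le> h" using p(2) by (auto simp: min.commute)
    moreover have "h < c0 * min (dist y p) (dist y q)" using yd c0(1) by (simp add: min_def pos_divide_less_eq mult.commute)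
    ultimately show False by simp
  qed
  moreover have "a' \<in> closure \<Omega>" using triangle_in_closure[OF K'(1)] t'(2) hull_inc[of a' "{a',b',d'}"] by auto
  ultimately have "a' \<in> \<Omega>" using closure_domain by blast
  then have G: "(K', a') \<in> GE" using BE_I[OF K'(1) t'(1,2,4)] by (simp add: GE_def)
  have xo: "x \<in> open_segment p q" using i(2) sd x(2) pne by (auto simp: open_segment_def)
  let ?S = "closed_segment x y"
  have Sside: "?S \<subseteq> side vs i" unfolding sd
    using xo yo segment_open_subset_closed[of p q] by (intro closed_segment_subset) auto
  have Sends: "p \<notin> ?S" "q \<notin> ?S"
    using open_segment_not_end[OF xo yo] open_segment_not_end[of x q p y] xo yo by (auto simp: open_segment_commute)
  \<comment> \<open>The other sides; the segment from x to y avoids the ends of its side and thus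
    keeps a positive distance from them.\<close>
  define Z where "Z = (\<Union>j\<in>{..<length vs} - {i}. side vs j)"
  have "closed Z" unfolding Z_def by (intro closed_UN) (auto simp: side_def)
  moreover have "?S \<inter> Z = {}"
  proof -
    have "False" if u: "u \<in> ?S" "j < length vs" "j \<noteq> i" "u \<in> side vs j" for u j
    proof -
      have "u \<in> side_ends vs i" using sp i(1) u Sside unfolding simple_polygon_def by blast
      then show False using Sends u(1) p(2) by (auto simp: side_ends_def)
    qed
    then show ?thesis by (auto simp: Z_def)
  qed
  ultimately obtain \<delta>0 where d0: "\<delta>0 > 0" "\<And>u z. u \<in> ?S \<Longrightarrow> z \<in> Z \<Longrightarrow> \<delta>0 \<le> dist u z"
    using separate_compact_closed[OF compact_segment] by metis
  \<comment> \<open>At most \<delta>0 so that the strip misses the other sides, at most h so that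
    its triangles stay near p.\<close>
  define \<delta> where "\<delta> = min \<delta>0 h"
  have \<delta>: "\<delta> > 0" "\<delta> \<le> \<delta>0" "\<delta> \<le> h" using d0(1) mesh_size_bounds(2) by (auto simp: \<delta>_def)
  let ?g = "glam a b d"
  have lz: "lam a b d u = 0" if "u \<in> side vs i" for u
  proof (rule lam_zero_on_side[OF K bd x(1) i d0(1) _ that])
    fix j z assume "j < length vs" "j \<noteq> i" "z \<in> side vs j"
    then show "\<delta>0 \<le> dist x z" using d0(2)[of x z] by (auto simp: Z_def)
  qed
  have gne: "?g \<noteq> 0" using lam_vertex(1)[OF K(2)] by (auto simp: lam_eq)
  define H where "H = {z. ?g \<bullet> z > ?g \<bullet> b}"
  have H: "z \<in> H \<longleftrightarrow> 0 < lam a b d z" for z by (simp add: H_def lam_eq inner_diff_right)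
  \<comment> \<open>The sum of the segment and a small disc, cut by the half plane on the side of K;
    an intersection of convex sets.\<close>
  define U where "U = (\<Union>u\<in>?S. \<Union>w\<in>ball 0 \<delta>. {u + w}) \<inter> H"
  have oU: "open U" unfolding U_def H_def by (intro open_Int open_sums open_halfspace_gt disjI2) simp
  have cU: "connected U" unfolding U_def H_def
    by (intro convex_connected convex_Int convex_sums convex_halfspace_gt convex_closed_segment convex_ball)
  have UI: "u + w \<in> U" if "u \<in> ?S" "norm w < \<delta>" "0 < lam a b d (u + w)" for u w
  proof -
    have "u + w \<in> (\<Union>u\<in>?S. \<Union>w\<in>ball 0 \<delta>. {u + w})"
      by (rule UN_I[OF that(1)], rule UN_I[of w]) (use that(2) in auto)
    then show ?thesis using that(3) H by (simp add: U_def)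
  qed
  have UE: "\<exists>u w. z = u + w \<and> u \<in> ?S \<and> norm w < \<delta>" "0 < lam a b d z" if "z \<in> U" for z
  proof -
    have "z \<in> (\<Union>u\<in>?S. \<Union>w\<in>ball 0 \<delta>. {u + w})" using that by (simp add: U_def)
    then obtain u where u: "u \<in> ?S" "z \<in> (\<Union>w\<in>ball 0 \<delta>. {u + w})" by (rule UN_E)
    from u(2) obtain w where "w \<in> ball 0 \<delta>" "z \<in> {u + w}" by (rule UN_E)
    then show "\<exists>u w. z = u + w \<and> u \<in> ?S \<and> norm w < \<delta>" using u(1) by (intro exI conjI) auto
    show "0 < lam a b d z" using that H by (simp add: U_def)
  qed
  have step: "\<exists>w. norm w < r \<and> norm w < \<delta> \<and> u + w \<in> U" if u: "u \<in> ?S" and r: "r > 0" for u r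
  proof -
    define s where "s = min r \<delta> / (2 * norm ?g)"
    have s: "s > 0" using r \<delta>(1) gne by (simp add: s_def)
    have "norm (s *\<^sub>R ?g) = min r \<delta> / 2" using gne r \<delta>(1) by (simp add: s_def)
    moreover have "min r \<delta> > 0" using r \<delta>(1) by simp
    ultimately have n: "norm (s *\<^sub>R ?g) < r" "norm (s *\<^sub>R ?g) < \<delta>" by linarith+
    have "lam a b d (u + s *\<^sub>R ?g) = s * (?g \<bullet> ?g)" using lam_diff[of a b d "u + s *\<^sub>R ?g" u] lz u Sside by auto
    then have "0 < lam a b d (u + s *\<^sub>R ?g)" using s gne by simp
    then show ?thesis using UI[OF u n(2)] n by blast
  qed
  \<comment> \<open>Side i is excluded because \<open>lam\<close> vanishes on it, the other sides by
    their distance. So U avoids the boundary and, meeting \<Omega>, lies in it.\<close>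
  have "U \<inter> frontier \<Omega> = {}"
  proof -
    have False if z: "z \<in> U" "z \<in> frontier \<Omega>" for z
    proof -
      obtain j where j: "j < length vs" "z \<in> side vs j" using z(2) domain_props(4) by blast
      have "j \<noteq> i" using lz[of z] UE(2)[OF z(1)] j by auto
      then have "z \<in> Z" using j by (auto simp: Z_def)
      obtain u w where u: "z = u + w" "u \<in> ?S" "norm w < \<delta>" using UE(1)[OF z(1)] by blast
      have "\<delta>0 \<le> dist u z" by (rule d0(2)[OF u(2) \<open>z \<in> Z\<close>])
      then show False using u(1,3) \<delta>(2) by (simp add: dist_norm)
    qed
    then show ?thesis by blast
  qed
  obtain e1 where e1: "e1 > 0" "\<And>z. z \<in> ball x e1 \<Longrightarrow> z \<in> \<Omega> \<longleftrightarrow> 0 < lam a b d z" "\<And>z. z \<in> ball x e1 \<Longrightarrow> z \<in> \<Omega> \<Longrightarrow> z \<in> interior K"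
    using boundary_local[OF K x(1) xf] by metis
  obtain e2 where e2: "e2 > 0" "\<And>z. z \<in> ball y e2 \<Longrightarrow> z \<in> \<Omega> \<Longrightarrow> z \<in> interior K'"
    using boundary_local[OF K'(1) t'(1-3) yf] by metis
  obtain w1 where w1: "norm w1 < e1" "x + w1 \<in> U" using step[OF _ e1(1), of x] by auto
  obtain w2 where w2: "norm w2 < e2" "y + w2 \<in> U" using step[OF _ e2(1), of y] by auto
  have b1: "x + w1 \<in> ball x e1" "y + w2 \<in> ball y e2" using w1(1) w2(1) by (simp_all add: dist_norm)
  have x1: "x + w1 \<in> \<Omega>" using e1(2)[OF b1(1)] UE(2)[OF w1(2)] by simp
  have UO: "U \<subseteq> \<Omega>"
  proof (rule ccontr)
    assume "\<not> U \<subseteq> \<Omega>"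
    then have "U - \<Omega> \<noteq> {}" by blast
    moreover have "U \<inter> \<Omega> \<noteq> {}" using w1(2) x1 by blast
    ultimately show False using connected_Int_frontier[OF cU] \<open>U \<inter> frontier \<Omega> = {}\<close> by blast
  qed
  have KU: "fst e \<inter> U \<noteq> {}" using e1(3)[OF b1(1) x1] interior_subset[of K] w1(2) Ka by auto
  have "y + w2 \<in> interior K'" by (rule e2(2)[OF b1(2)]) (use w2(2) UO in blast)
  then have KU': "fst (K', a') \<inter> U \<noteq> {}" using interior_subset[of K'] w2(2) by auto
  have xd: "dist p x \<le> h / c0" using p(1) c0(1) by (simp add: pos_le_divide_eq dist_commute mult.commute)
  have hc: "h / c0 > 0" using mesh_size_bounds(2) c0(1) by simp
  have near: "fst e \<subseteq> cball p ((1 / c0 + 1) * h)"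
    using element_near[OF K(1) xK xd] by (simp add: Ka distrib_right)
  have all: "K0 \<subseteq> cball p ((2 / c0 + 2) * h)" if K0: "K0 \<in> \<T>" "K0 \<inter> U \<noteq> {}" for K0
  proof -
    obtain z where z: "z \<in> K0" "z \<in> U" using K0(2) by blast
    obtain u w where u: "z = u + w" "u \<in> ?S" "norm w < \<delta>" using UE(1)[OF z(2)] by blast
    have "?S \<subseteq> cball p (2 * h / c0)" using xd yd(2) hc by (intro closed_segment_subset) (auto simp: dist_commute)
    then have "dist p u \<le> 2 * h / c0" using u(2) by auto
    moreover have "dist u z \<le> h" using u(1,3) \<delta>(3) by (simp add: dist_norm)
    ultimately have "dist p z \<le> 2 * h / c0 + h" using dist_triangle[of p z u] by linarith
    from element_near[OF K0(1) z(1) this] show ?thesis by (simp add: distrib_right add_ac)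
  qed
  show ?thesis by (rule that[OF pne(2) near G oU cU UO KU KU']) (rule all)
qed

text \<open>The triangles of edges that are not good lie within a fixed multiple of h of a corner,
  so area counting bounds their number independently of h; the same holds for triangles at one
  vertex and for those that meet a strip.\<close>

lemma testable_fine:
  assumes v: "v \<in> fe" and q: "quasi_uniform q \<T>" and c0: "0 < c0" "c0 \<le> 1" "sides_separated vs c0"
    and len: "\<And>i. i < length vs \<Longrightarrow> 4 * h \<le> c0 * dist (vs ! i) (vs ! (Suc i mod length vs))"
    and M: "4 * c\<^sup>2 * q\<^sup>2 * (2 / c0 + 2)\<^sup>2 \<le> M" and L: "3 * (real (length vs) * M) \<le> L"
  shows "testable M L v"
proof -
  have M0: "0 \<le> M" using M by (rule order_trans[rotated]) simp
  have cnt: "real (card X) \<le> M" if X: "X \<subseteq> \<T>" "\<And>K. K \<in> X \<Longrightarrow> K \<subseteq> cball z (R * h)" and R: "0 \<le> R" "R \<le> 2 / c0 + 2" for X z R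
  proof -
    have "real (card X) \<le> 4 * c\<^sup>2 * q\<^sup>2 * R\<^sup>2" by (rule elements_near[OF q X R(1)])
    also have "\<dots> \<le> 4 * c\<^sup>2 * q\<^sup>2 * (2 / c0 + 2)\<^sup>2" using R by (intro mult_left_mono power_mono) auto
    finally show ?thesis using M by linarith
  qed
  have R: "0 \<le> 1 / c0 + 1" "1 / c0 + 1 \<le> 2 / c0 + 2" "0 \<le> 2 / c0 + 2" "1 \<le> 2 / c0 + 2" using c0(1) by (simp_all add: field_simps)
  show ?thesis
  proof (rule testable_interior[OF v M0])
    fix a
    show "real (card {K \<in> \<T>. a \<in> K}) \<le> M"
    proof (rule cnt[of _ a 1])
      show "K \<subseteq> cball a (1 * h)" if "K \<in> {K \<in> \<T>. a \<in> K}" for K using element_near[of K a a 0] that by simp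
    qed (use R in auto)
  next
    define Y where "Y p = {K \<in> \<T>. K \<subseteq> cball p ((1 / c0 + 1) * h)}" for p
    have fY: "finite (Y p)" for p using finite_mesh by (simp add: Y_def)
    have Yc: "real (card (Y p)) \<le> M" for p by (rule cnt[OF _ _ R(1,2)]) (auto simp: Y_def)
    \<comment> \<open>At most M triangles near each corner, each with three vertices to name an
      edge.\<close>
    have "BE - GE \<subseteq> (SIGMA K:(\<Union>p\<in>set vs. Y p). verts K)"
    proof
      fix e assume e: "e \<in> BE - GE"
      obtain p where "p \<in> set vs" "fst e \<subseteq> cball p ((1 / c0 + 1) * h)"
        using link_fine[OF c0 len e] by metis
      moreover have "fst e \<in> \<T>" "snd e \<in> verts (fst e)" using e by (auto simp: BE_def)
      ultimately show "e \<in> (SIGMA K:(\<Union>p\<in>set vs. Y p). verts K)" by (cases e) (auto simp: Y_def)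
    qed
    then have "card (BE - GE) \<le> card (SIGMA K:(\<Union>p\<in>set vs. Y p). verts K)"
      using fY tri_facts(4)[OF mesh_simplex] by (intro card_mono finite_SigmaI) (auto simp: Y_def)
    also have "\<dots> = (\<Sum>K\<in>(\<Union>p\<in>set vs. Y p). card (verts K))"
      using fY tri_facts(4)[OF mesh_simplex] by (intro card_SigmaI) (auto simp: Y_def)
    also have "\<dots> = (\<Sum>K\<in>(\<Union>p\<in>set vs. Y p). 3)"
      by (rule sum.cong) (auto simp: Y_def tri_facts(5)[OF mesh_simplex])
    also have "\<dots> = 3 * card (\<Union>p\<in>set vs. Y p)" by simp
    finally have "real (card (BE - GE)) \<le> 3 * real (card (\<Union>p\<in>set vs. Y p))" by linarith
    also have "real (card (\<Union>p\<in>set vs. Y p)) \<le> (\<Sum>p\<in>set vs. real (card (Y p)))"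
      using card_UN_le[of "set vs" Y] by (simp flip: of_nat_sum)
    also have "\<dots> \<le> (\<Sum>p\<in>set vs. M)" by (rule sum_mono) (rule Yc)
    also have "\<dots> \<le> real (length vs) * M" using M0 card_length[of vs] by (simp add: mult_right_mono)
    finally show "real (card (BE - GE)) \<le> L" using L by (simp add: mult_left_mono)
  next
    fix e assume e: "e \<in> BE - GE"
    obtain p e' U where U: "e' \<in> GE" "open U" "connected U" "U \<subseteq> \<Omega>" "fst e \<inter> U \<noteq> {}" "fst e' \<inter> U \<noteq> {}"
      "\<And>K. K \<in> \<T> \<Longrightarrow> K \<inter> U \<noteq> {} \<Longrightarrow> K \<subseteq> cball p ((2 / c0 + 2) * h)"
      using link_fine[OF c0 len e] by metis
    have "real (card {K \<in> \<T>. K \<inter> U \<noteq> {}}) \<le> M" by (rule cnt[OF _ _ R(3) order_refl]) (use U(7) in auto)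
    then show "\<exists>e'\<in>GE. \<exists>U. open U \<and> connected U \<and> U \<subseteq> \<Omega> \<and> fst e \<inter> U \<noteq> {} \<and> fst e' \<inter> U \<noteq> {} \<and>
        real (card {K \<in> \<T>. K \<inter> U \<noteq> {}}) \<le> M"
      by (intro bexI[OF _ U(1)] exI[of _ U] conjI U(2-6))
  qed
qed

lemma infinite_frontier: "infinite (frontier \<Omega>)"
proof -
  have n: "length vs \<ge> 3" using pd by (simp add: polygonal_domain_def simple_polygon_def)
  then have 0: "0 < length vs" by linarith
  have "infinite (side vs 0)" using sides(1)[OF 0] by (simp add: side_def)
  then show ?thesis using sides(3)[OF 0] finite_subset by blast
qed

text \<open>With h bounded below, area counting in a disc around \<Omega> bounds the number of all
  triangles, and \<Omega> itself can be the linking set.\<close>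

lemma testable_coarse:
  assumes v: "v \<in> fe" and q: "quasi_uniform q \<T>" and h0: "0 < h0" "h0 \<le> h" and B: "0 \<le> B" "\<Omega> \<subseteq> cball 0 B"
    and five: "card (element_faces_in \<T> S) \<ge> 5"
    and M: "4 * c\<^sup>2 * q\<^sup>2 * B\<^sup>2 / h0\<^sup>2 \<le> M" and L: "3 * M \<le> L"
  shows "testable M L v"
proof -
  have sub: "K \<subseteq> cball 0 B" if "K \<in> \<T>" for K using triangle_in_closure[OF that] closure_minimal[OF B(2) closed_cball] by blast
  have "real (card \<T>) * h0\<^sup>2 \<le> real (card \<T>) * h\<^sup>2" using h0 by (intro mult_left_mono power_mono) auto
  also have "\<dots> \<le> 4 * c\<^sup>2 * q\<^sup>2 * B\<^sup>2" by (rule elements_in_ball[OF q order_refl sub B(1)])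
  finally have "real (card \<T>) \<le> 4 * c\<^sup>2 * q\<^sup>2 * B\<^sup>2 / h0\<^sup>2" using h0(1) by (simp add: pos_le_divide_eq)
  then have N: "real (card \<T>) \<le> M" using M by linarith
  then have M0: "0 \<le> M" by (rule order_trans[rotated]) simp
  have cnt: "real (card X) \<le> M" if "X \<subseteq> \<T>" for X using card_mono[OF finite_mesh that] N by linarith
  have "card BE \<le> card (SIGMA K:\<T>. verts K)"
    using finite_mesh tri_facts(4)[OF mesh_simplex] by (intro card_mono finite_SigmaI) (auto simp: BE_def)
  also have "\<dots> = (\<Sum>K\<in>\<T>. card (verts K))" using finite_mesh tri_facts(4)[OF mesh_simplex] by (intro card_SigmaI) auto
  also have "\<dots> = (\<Sum>K\<in>\<T>. 3)" by (rule sum.cong) (auto simp: tri_facts(5)[OF mesh_simplex])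
  finally have "real (card BE) \<le> 3 * real (card \<T>)" by simp
  then have BL: "real (card BE) \<le> L" using N L by linarith
  show ?thesis
  proof (cases "GE = {}")
    case True
    then have H: "a \<notin> \<Omega>" if "(K, a) \<in> BE" for K a using that by (auto simp: GE_def)
    show ?thesis
    proof (rule ear_exists[OF _ five infinite_frontier])
      show "a \<notin> \<Omega>" if "(K, a) \<in> BE" for K a using that by (rule H)
      fix K a b d
      assume K: "K \<in> \<T>" "nondeg a b d" "K = convex hull {a,b,d}"
        and e: "closed_segment d a \<subseteq> frontier \<Omega>" "closed_segment a b \<subseteq> frontier \<Omega>" "\<not> closed_segment b d \<subseteq> frontier \<Omega>"
        and only: "\<And>K'. K' \<in> \<T> \<Longrightarrow> a \<in> K' \<Longrightarrow> K' = K"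
      show "testable M L v" by (rule testable_ear[OF v M0 N BL K e]) (rule only)
    qed
  next
    case False
    then obtain e' where e': "e' \<in> GE" by blast
    show ?thesis
    proof (rule testable_interior[OF v M0])
      show "real (card {K \<in> \<T>. a \<in> K}) \<le> M" for a by (rule cnt) auto
      have "card (BE - GE) \<le> card BE" using finBE by (intro card_mono) auto
      then show "real (card (BE - GE)) \<le> L" using BL by linarith
      have meet: "fst e \<inter> \<Omega> \<noteq> {}" if "e \<in> BE" for e
      proof -
        have K: "fst e \<in> \<T>" by (rule BE_in(1)[OF that])
        show ?thesis using interior_in_domain[OF K] interior_tri_ne[OF mesh_simplex[OF K]] interior_subset[of "fst e"] by blast
      qed
      have c: "real (card {K \<in> \<T>. K \<inter> \<Omega> \<noteq> {}}) \<le> M" by (rule cnt) auto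
      have e'B: "e' \<in> BE" using e' by (simp add: GE_def)
      show "\<exists>e'\<in>GE. \<exists>U. open U \<and> connected U \<and> U \<subseteq> \<Omega> \<and> fst e \<inter> U \<noteq> {} \<and> fst e' \<inter> U \<noteq> {} \<and>
        real (card {K \<in> \<T>. K \<inter> U \<noteq> {}}) \<le> M" if "e \<in> BE - GE" for e
        using that by (intro bexI[OF _ e'] exI[of _ \<Omega>] conjI domain_props(1,2) order_refl meet e'B c) auto
    qed
  qed
qed

text \<open>The constant of \<open>inf_sup_from_test\<close>. Its ingredients depend on the locale
  only through k and c, so all meshes of the family share it.\<close>

definition cs :: "real \<Rightarrow> real \<Rightarrow> real" where
  "cs M L = min (1/2) (al / (2 * (2 * be M + 1))) / (sqrt (2 * (1 + ka M L) + 2 * ga M) * sqrt (1 + ka M L))"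

lemma constants_nonneg:
  assumes "0 \<le> M" "0 \<le> L" shows "0 < al" "0 \<le> be M" "0 \<le> ga M" "0 \<le> ka M L"
  using assms c_pos Co_pos by (auto simp: al_def be_def ga_def ka_def intro!: add_nonneg_nonneg mult_nonneg_nonneg)

lemma cs_pos: assumes "0 \<le> M" "0 \<le> L" shows "0 < cs M L"
  using constants_nonneg[OF assms] unfolding cs_def
  by (intro divide_pos_pos mult_pos_pos) (simp_all add: add_nonneg_pos add_pos_nonneg)

lemma inf_sup_of_testable:
  assumes v: "v \<in> fe" and nn: "0 \<le> M" "0 \<le> L" and t: "testable M L v"
  shows "ereal (cs M L * norm_1h vs \<Omega> \<T> v) \<le> (SUP w\<in>{w \<in> fe. nonzero_on \<Omega> w}. ereal (nitsche_form vs \<Omega> \<T> v w / norm_1h vs \<Omega> \<T> w))"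
proof -
  obtain w S where w: "w \<in> fe" "S \<ge> 0" "nitsche_form vs \<Omega> \<T> v w \<ge> al * S - be M * En v" "N2 w \<le> ga M * S" "Hn v \<le> ka M L * (S + En v)"
    using t unfolding testable_def by blast
  show ?thesis unfolding cs_def by (rule inf_sup_from_test[OF v w(1,2) constants_nonneg[OF nn] w(3-5)])
qed

end

theorem theorem4p2:
  fixes vs :: "point list" and \<Omega> :: "point set" and k :: nat
    and family :: "point set set set" and c_rho c_qu :: real
  assumes "polygonal_domain vs \<Omega>"
    and "k \<ge> 1"
    and "\<And>\<T>. \<T> \<in> family \<Longrightarrow> fitted_triangulation \<Omega> \<T>"
    and "\<And>\<T>. \<T> \<in> family \<Longrightarrow> shape_regular c_rho \<T>"
    and "\<And>\<T>. \<T> \<in> family \<Longrightarrow> quasi_uniform c_qu \<T>"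
    and "\<And>\<T> i. \<T> \<in> family \<Longrightarrow> i < length vs \<Longrightarrow> card (element_faces_in \<T> (side vs i)) \<ge> 5"
  shows "\<exists>c_s>0. \<forall>\<T>\<in>family. \<forall>v\<in>fe_space \<Omega> \<T> k.
           ereal (c_s * norm_1h vs \<Omega> \<T> v) \<le>
             (SUP w\<in>{w \<in> fe_space \<Omega> \<T> k. nonzero_on \<Omega> w}.
                ereal (nitsche_form vs \<Omega> \<T> v w / norm_1h vs \<Omega> \<T> w))"
proof (cases "family = {}")
  case True
  \<comment> \<open>The empty family is treated apart because positivity of c_rho is deduced from
    the existence of a triangle.\<close>
  then show ?thesis by (intro exI[of _ 1]) simp
next
  case False
  have sr: "sr_mesh vs \<Omega> \<T> k c_rho" if "\<T> \<in> family" for \<T>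
    by unfold_locales (use assms(1-4) that in auto)
  have sp: "simple_polygon vs" and "bounded \<Omega>" using assms(1) by (auto simp: polygonal_domain_def)
  then have n: "length vs > 0" by (auto simp: simple_polygon_def)
  obtain c0 where c0: "0 < c0" "c0 \<le> 1" "sides_separated vs c0" by (rule polygon_sides_separated[OF sp])
  obtain B where "0 < B" "\<Omega> \<subseteq> cball 0 B"
    using \<open>bounded \<Omega>\<close> unfolding bounded_pos subset_eq by (auto simp: dist_norm)
  then have B: "0 \<le> B" "\<Omega> \<subseteq> cball 0 B" by auto
  define len where "len i = dist (vs ! i) (vs ! (Suc i mod length vs))" for i
  define l where "l = Min (len ` {..<length vs})"
  have l: "l \<le> len i" if "i < length vs" for i using that unfolding l_def by (intro Min_le) auto
  have "l \<in> len ` {..<length vs}" unfolding l_def using n by (intro Min_in) auto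
  then have "l > 0" using polygon_sides_distinct_ends[OF sp] by (auto simp: len_def)
  \<comment> \<open>The threshold between fine and coarse meshes: below it every side is longer than
    4 h / c0.\<close>
  define h0 where "h0 = c0 * l / 4"
  have h0: "h0 > 0" using c0 \<open>l > 0\<close> by (simp add: h0_def)
  \<comment> \<open>The first bound counts triangles near a corner of a fine mesh, the second all
    triangles of a coarse one.\<close>
  define M where "M = max (4 * c_rho\<^sup>2 * c_qu\<^sup>2 * (2 / c0 + 2)\<^sup>2) (4 * c_rho\<^sup>2 * c_qu\<^sup>2 * B\<^sup>2 / h0\<^sup>2)"
  define L where "L = max (3 * (real (length vs) * M)) (3 * M)"
  have M: "4 * c_rho\<^sup>2 * c_qu\<^sup>2 * (2 / c0 + 2)\<^sup>2 \<le> M" "4 * c_rho\<^sup>2 * c_qu\<^sup>2 * B\<^sup>2 / h0\<^sup>2 \<le> M" by (simp_all add: M_def)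
  have "0 \<le> 4 * c_rho\<^sup>2 * c_qu\<^sup>2 * (2 / c0 + 2)\<^sup>2" by simp
  then have M0: "0 \<le> M" using M(1) by linarith
  have L: "3 * (real (length vs) * M) \<le> L" "3 * M \<le> L" by (simp_all add: L_def)
  then have L0: "0 \<le> L" using M0 by linarith
  \<comment> \<open>Outside the locale the constant takes k, c_rho, M and L but no mesh, so any
    member of the family may be used to see that it is positive.\<close>
  have "0 < sr_mesh.cs k c_rho M L"
  proof -
    from False obtain \<T> where "\<T> \<in> family" by blast
    then interpret sr_mesh vs \<Omega> \<T> k c_rho by (rule sr)
    show ?thesis by (rule cs_pos[OF M0 L0])
  qed
  moreover have "ereal (sr_mesh.cs k c_rho M L * norm_1h vs \<Omega> \<T> v) \<le>
             (SUP w\<in>{w \<in> fe_space \<Omega> \<T> k. nonzero_on \<Omega> w}. ereal (nitsche_form vs \<Omega> \<T> v w / norm_1h vs \<Omega> \<T> w))"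
    if T: "\<T> \<in> family" and v: "v \<in> fe_space \<Omega> \<T> k" for \<T> v
  proof -
    interpret sr_mesh vs \<Omega> \<T> k c_rho by (rule sr[OF T])
    have "testable M L v"
    proof (cases "mesh_size \<T> < h0")
      case True
      show ?thesis
      proof (rule testable_fine[OF v assms(5)[OF T] c0 _ M(1) L(1)])
        fix i assume "i < length vs"
        then have "c0 * l \<le> c0 * len i" using l c0(1) by (intro mult_left_mono) auto
        then show "4 * mesh_size \<T> \<le> c0 * dist (vs ! i) (vs ! (Suc i mod length vs))"
          using True unfolding h0_def len_def by linarith
      qed
    next
      case False
      then have "h0 \<le> mesh_size \<T>" by simp
      then show ?thesis by (rule testable_coarse[OF v assms(5)[OF T] h0 _ B assms(6)[OF T n] M(2) L(2)])
    qed
    then show ?thesis by (rule inf_sup_of_testable[OF v M0 L0])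
  qed
  ultimately show ?thesis by blast
qed

end
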